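(* Let $k\ge1$, let $M$ be a manifold, let $L:\mathrm{T}^kM\to\mathbb{R}$ be a Lagrangian function with action $S_L(\mathbf{t}^k\gamma)=\int_{t_0}^{t_1}L(\mathbf{t}^k\gamma(t))\,dt$, let $\gamma:[t_0,t_1]\to M$ be a curve, and let $\delta\mathbf{t}^k\gamma=\kappa_k(\mathbf{t}^k\delta\gamma)$ be the admissible variation of $\mathbf{t}^k\gamma$ generated by a vector field $\delta\gamma(t)\in\mathrm{T}_{\gamma(t)}M$ along $\gamma$. Define the force $\mathrm{F}_{L,\gamma}(t)\in\mathrm{T}^*M$ and the momentum $\mathrm{M}_{L,\gamma}(t)\in\mathrm{T}^{k-1}\mathrm{T}^*M$ along $\gamma$ by $$\mathrm{F}_{L,\gamma}(t)=\Upsilon_{k,\tau^*}\left(\mathbf{t}^k\Lambda_L(\mathbf{t}^k\gamma(t))\right),\qquad \mathrm{M}_{L,\gamma}(t)=\upsilon_{k-1,\tau^*}\left(\mathbf{t}^{k-1}\lambda_L(\mathbf{t}^k\gamma(t))\right),$$ where $\Lambda_L:=\varepsilon_k\circ dL:\mathrm{T}^kM\to\mathrm{T}^k\mathrm{T}^*M$ and $\lambda_L:=\tau^k_{k-1,\mathrm{T}^*M}\circ\Lambda_L:\mathrm{T}^kM\to\mathrm{T}^{k-1}\mathrm{T}^*M$. Then the differential of the action $S_L$ in the direction of the variation $\delta\mathbf{t}^k\gamma$ equals $$\langle dS_L(\mathbf{t}^k\gamma),\delta\mathbf{t}^k\gamma\rangle=\int_{t_0}^{t_1}\langle\mathrm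{F}_{L,\gamma}(t),\delta\gamma(t)\rangle_\tau\,dt+\langle\mathrm{M}_{L,\gamma}(t),\mathbf{t}^{k-1}\delta\gamma(t)\rangle_{\mathrm{T}^{k-1}\tau}\Big|_{t_0}^{t_1}.$$
   Context: All manifolds and maps are smooth. $\mathrm{T}^kN$ is the bundle of $k$-velocities ($k$-jets) of curves in $N$ ($\mathrm{T}^0N=N$). $\mathbf{t}^k\gamma(t)=\mathbf{t}^k_t\gamma(t)\in\mathrm{T}^kN$ is the $k$-velocity at $t$ of a curve $\gamma$ in $N$. $\tau^k_{s}:\mathrm{T}^kN\to\mathrm{T}^sN$ are the jet projections, and a subscript $N$ as in $\tau^k_{k-1,\mathrm{T}^*M}$ indicates the manifold. $\tau:\mathrm{T}M\to M$ and $\tau^*:\mathrm{T}^*M\to M$ are the tangent and cotangent projections. $\mathrm{T}^{(k)}N=\mathrm{T}\cdots\mathrm{T}N$ ($k$ times). Elements of $\mathrm{T}^m\mathrm{T}^nN$ are $\mathbf{t}^m_s\mathbf{t}^n_t\phi(s,t)$. Canonical inclusions are $\mathrm{T}^{m+n}N\subset\mathrm{T}^m\mathrm{T}^nN$, $\mathbf{t}^{m+n}_{t=0}\gamma(t)\mapsto\mathbf{t}^m_{s=0}\mathbf{t}^n_{t=0}\gamma(s+t)$, and, by iteration, $\mathrm{T}^m\mathrm{T}^nN\subset\mathrm{T}^{(m+n)}N$. For a vector bundle $\sigma:E\to M$ with dual $E^*$: $\langle\cdot,\cdot\rangle_{\mathrm{T}^{(k)}\sigma}$ is the pairing of $\mathrm{T}^{(k)}E^*$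 and $\mathrm{T}^{(k)}E$ over $\mathrm{T}^{(k)}M$ obtained from the natural pairing $\langle\cdot,\cdot\rangle_\sigma$ by taking $k$ times the tangent lift ($f\mapsto f^{(1)}$, $f^{(1)}(\mathbf{t}^1_0\gamma)=\frac{d}{dt}|_0f(\gamma(t))$). $\langle\cdot,\cdot\rangle_{\mathrm{T}^k\sigma}$ is its restriction to $\mathrm{T}^kE^*\times_{\mathrm{T}^kM}\mathrm{T}^kE$. Both are non-degenerate, and equivalently $\langle\mathbf{t}^k_0\xi,\mathbf{t}^k_0y\rangle_{\mathrm{T}^k\sigma}=\frac{d^k}{dt^k}|_0\langle\xi(t),y(t)\rangle_\sigma$. The order of arguments is immaterial. The canonical flip is $\kappa_k:\mathrm{T}^k\mathrm{T}M\to\mathrm{T}\mathrm{T}^kM$, $\mathbf{t}^k_{t=0}\mathbf{t}^1_{s=0}\gamma(t,s)\mapsto\mathbf{t}^1_{s=0}\mathbf{t}^k_{t=0}\gamma(t,s)$. Its dual isomorphism $\varepsilon_k:\mathrm{T}^*\mathrm{T}^kM\to\mathrm{T}^k\mathrm{T}^*M$ (over $\mathrm{id}_{\mathrm{T}^kM}$) is defined by $\langle\Psi,\kappa_k(V)\rangle_{\tau_{\mathrm{T}^kM}}=\langle\varepsilon_k(\Psi),V\rangle_{\mathrm{T}^k\tau}$ for $\Psi\in\mathrm{T}^*\mathrm{T}^kM$ and $V\in\mathrm{T}^k\mathrm{T}M$ over the same point of $\mathrm{T}^kM$. Semi-holonomic vectors: $\widetilde{\mathrm{T}}^{k,k}E=\{X\in\mathrm{T}^k\mathrm{T}^kE:\mathrm{T}^k\mathrm{T}^k\sigma(X)\in\mathrm{T}^{2k}M\}$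 and $\widetilde{\mathrm{T}}^{(k)}E=\{X\in\mathrm{T}^{(k)}E:\mathrm{T}^{(k)}\sigma(X)\in\mathrm{T}^kM\}$. For $\Phi\in\widetilde{\mathrm{T}}^{k,k}E$, $\Phi^{(m,n)}\in\mathrm{T}^m\mathrm{T}^nE$ is its truncation ($\mathbf{t}^k_s\mathbf{t}^k_t\phi\mapsto\mathbf{t}^m_s\mathbf{t}^n_t\phi$). The $\Phi^{(m,n)}$ with $m+n$ fixed lie in one fibre of $\mathrm{T}^{(m+n)}\sigma$ and may be added there. $\Upsilon_{k,\sigma}:\widetilde{\mathrm{T}}^{k,k}E\to E$ is the vector bundle morphism over $\mathrm{T}^{2k}M\to M$ given by $\langle\Upsilon_{k,\sigma}(\Phi),\xi\rangle_\sigma=\big\langle\sum_{j=0}^k(-1)^j\binom kj\Phi^{(j,k-j)},\mathbf{t}^k\xi\big\rangle_{\mathrm{T}^{(k)}\sigma}$, where $\mathbf{t}^k\xi\in\mathrm{T}^kE^*$ is any element over $\xi\in E^*$ lying over the same $k$-velocity in $\mathrm{T}^kM$ as the sum (the value is independent of this choice). In lifted coordinates $y^{i,(\beta,\gamma)}(\mathbf{t}^k_s\mathbf{t}^k_t\phi)=\partial_s^\beta\partial_t^\gamma|_0y^i(\phi(s,t))$, the fibre coordinates of $\Upsilon_{k,\sigma}(\Phi)$ are $\sum_{\alpha=0}^k(-1)^\alpha\binom k\alpha y^{i,(\alpha,k-\alpha)}$. $\mathrm{P}_k:\widetilde{\mathrm{T}}^{(k)}E\to\mathrm{T}^kE$ is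 defined by $\langle\mathrm{P}_k(X),\Psi\rangle_{\mathrm{T}^k\sigma}=\langle X,\Psi\rangle_{\mathrm{T}^{(k)}\sigma}$ for all $\Psi\in\mathrm{T}^kE^*$ over the same point of $\mathrm{T}^kM$ as $X$. $\upsilon_{k,\sigma}:\widetilde{\mathrm{T}}^{k,k}E\to\mathrm{T}^kE$ is $\upsilon_{k,\sigma}(\Phi)=\mathrm{P}_k\big[\sum_{i=0}^k(-1)^i\binom{k+1}{i+1}\Phi^{(i,k-i)}\big]$. Here these maps are used with $\sigma=\tau^*$, $E=\mathrm{T}^*M$, $E^*=\mathrm{T}M$. $\mathbf{t}^k\Lambda_L(\mathbf{t}^k\gamma(t))$ is the $k$-velocity at $t$ of the curve $t\mapsto\Lambda_L(\mathbf{t}^k\gamma(t))$ in $\mathrm{T}^k\mathrm{T}^*M$ (it is semi-holonomic), and similarly for $\mathbf{t}^{k-1}\lambda_L(\mathbf{t}^k\gamma(t))$. The differential of the action is $\langle dS_L(\mathbf{t}^k\gamma),\delta\mathbf{t}^k\gamma\rangle:=\int_{t_0}^{t_1}\langle dL(\mathbf{t}^k\gamma(t)),\delta\mathbf{t}^k\gamma(t)\rangle_{\tau_{\mathrm{T}^kM}}\,dt$, where $\delta\mathbf{t}^k\gamma(t)\in\mathrm{T}_{\mathbf{t}^k\gamma(t)}\mathrm{T}^kM$. *)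

theory Defs
  imports "HOL-Analysis.Analysis"
begin

section \<open>Smooth manifolds\<close>

definition partial :: "nat \<Rightarrow> ((nat \<Rightarrow> real) \<Rightarrow> real) \<Rightarrow> (nat \<Rightarrow> real) \<Rightarrow> real" where
  "partial i f x = deriv (\<lambda>h. f (x(i := h))) (x i)"

abbreviation partials :: "nat list \<Rightarrow> ((nat \<Rightarrow> real) \<Rightarrow> real) \<Rightarrow> (nat \<Rightarrow> real) \<Rightarrow> real" where
  "partials is f \<equiv> foldr partial is f"

abbreviation origin :: "nat \<Rightarrow> real" where
  "origin \<equiv> (\<lambda>_. 0)"

text \<open>All iterated partial derivatives exist and are continuous on the (open) set \<open>V\<close> of
  \<open>Euclidean_space n\<close>.\<close>

definition smooth_on_Rn :: "nat \<Rightarrow> (nat \<Rightarrow> real) set \<Rightarrow> ((nat \<Rightarrow> real) \<Rightarrow> real) \<Rightarrow> bool" where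
  "smooth_on_Rn n V f \<longleftrightarrow>
     (\<forall>is. set is \<subseteq> {..<n} \<longrightarrow>
        continuous_map (subtopology (Euclidean_space n) V) euclideanreal (partials is f) \<and>
        (\<forall>x\<in>V. \<forall>i<n. (\<lambda>h. partials is f (x(i := h))) differentiable (at (x i))))"

text \<open>A smooth structure is given by a dimension and charts (domain, coordinate map), the coordinates
  taking values in \<open>Euclidean_space\<close>. Dimensions are numbers and not types because that of
  the bundle of \<open>k\<close>-velocities depends on \<open>k\<close>.\<close>

record 'a atlas =
  dimension :: nat
  charts :: "('a set \<times> ('a \<Rightarrow> nat \<Rightarrow> real)) set"

definition points :: "'a atlas \<Rightarrow> 'a set" where
  "points N = (\<Union>(U, \<phi>)\<in>charts N. U)"

definition smooth_manifold :: "'a topology \<Rightarrow> 'a atlas \<Rightarrow> bool" where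
  "smooth_manifold X N \<longleftrightarrow>
     Hausdorff_space X \<and> second_countable X \<and> topspace X = points N \<and>
     (\<forall>(U, \<phi>)\<in>charts N.
        openin X U \<and> openin (Euclidean_space (dimension N)) (\<phi> ` U) \<and>
        homeomorphic_map (subtopology X U)
          (subtopology (Euclidean_space (dimension N)) (\<phi> ` U)) \<phi>) \<and>
     (\<forall>(U, \<phi>)\<in>charts N. \<forall>(V, \<psi>)\<in>charts N. \<forall>i<dimension N.
        smooth_on_Rn (dimension N) (\<phi> ` (U \<inter> V)) (\<lambda>x. \<psi> (inv_into U \<phi> x) i))"

definition smooth_function :: "'a atlas \<Rightarrow> ('a \<Rightarrow> real) \<Rightarrow> bool" where
  "smooth_function N f \<longleftrightarrow>
     (\<forall>(U, \<phi>)\<in>charts N. smooth_on_Rn (dimension N) (\<phi> ` U) (\<lambda>x. f (inv_into U \<phi> x)))"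

definition smooth_curve :: "'a atlas \<Rightarrow> real set \<Rightarrow> (real \<Rightarrow> 'a) \<Rightarrow> bool" where
  "smooth_curve N I c \<longleftrightarrow>
     c ` I \<subseteq> points N \<and>
     (\<forall>(U, \<phi>)\<in>charts N. open {t \<in> I. c t \<in> U} \<and>
        (\<forall>t\<in>I. c t \<in> U \<longrightarrow> (\<forall>i<dimension N. \<forall>\<alpha>.
           ((deriv ^^ \<alpha>) (\<lambda>t. \<phi> (c t) i)) differentiable (at t))))"

definition smooth_curve_near_0 :: "'a atlas \<Rightarrow> (real \<Rightarrow> 'a) \<Rightarrow> bool" where
  "smooth_curve_near_0 N c \<longleftrightarrow> (\<exists>I. open I \<and> 0 \<in> I \<and> smooth_curve N I c)"

text \<open>Germs at the origin of smooth \<open>p\<close>-parameter families of points of \<open>N\<close>.\<close>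

definition smooth_family :: "nat \<Rightarrow> 'a atlas \<Rightarrow> ((nat \<Rightarrow> real) \<Rightarrow> 'a) \<Rightarrow> bool" where
  "smooth_family p N f \<longleftrightarrow>
     (\<exists>W. openin (Euclidean_space p) W \<and> origin \<in> W \<and> f ` W \<subseteq> points N \<and>
        (\<forall>(U, \<phi>)\<in>charts N. openin (Euclidean_space p) {s \<in> W. f s \<in> U} \<and>
           (\<forall>i<dimension N. smooth_on_Rn p {s \<in> W. f s \<in> U} (\<lambda>s. \<phi> (f s) i))))"

abbreviation smooth_family2 :: "'a atlas \<Rightarrow> (real \<Rightarrow> real \<Rightarrow> 'a) \<Rightarrow> bool" where
  "smooth_family2 N g \<equiv> smooth_family 2 N (\<lambda>x. g (x 0) (x 1))"


section \<open>Velocities\<close>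

text \<open>The \<open>k\<close>-velocity of \<open>c\<close> at \<open>t\<close>, as the class of all curves that have at \<open>0\<close> the same
  derivatives up to order \<open>k\<close> in charts.\<close>

type_synonym 'a jet = "(real \<Rightarrow> 'a) set"

definition velocity :: "'a atlas \<Rightarrow> nat \<Rightarrow> (real \<Rightarrow> 'a) \<Rightarrow> real \<Rightarrow> 'a jet" where
  "velocity N k c t =
     {b. smooth_curve_near_0 N b \<and> b 0 = c t \<and>
         (\<forall>(U, \<phi>)\<in>charts N. c t \<in> U \<longrightarrow> (\<forall>i<dimension N. \<forall>\<alpha>\<le>k.
            (deriv ^^ \<alpha>) (\<lambda>u. \<phi> (b u) i) 0 = (deriv ^^ \<alpha>) (\<lambda>u. \<phi> (c u) i) t))}"

definition rep :: "'b set \<Rightarrow> 'b" where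
  "rep v = (SOME c. c \<in> v)"

definition base_point :: "'a jet \<Rightarrow> 'a" where
  "base_point v = rep v 0"

text \<open>The bundle of \<open>k\<close>-velocities of \<open>N\<close>. In the chart lifted from \<open>(U, \<phi>)\<close> the coordinate
  of index \<open>\<alpha> * n + i\<close> (where \<open>\<alpha> \<le> k\<close>, \<open>i < n\<close> and \<open>n\<close> is the dimension of \<open>N\<close>) is the derivative
  of order \<open>\<alpha>\<close> of the coordinate \<open>i\<close>. The case \<open>k = 1\<close> is the tangent bundle.\<close>

definition jet_bundle :: "nat \<Rightarrow> 'a atlas \<Rightarrow> 'a jet atlas" where
  "jet_bundle k N =
     \<lparr>dimension = (k + 1) * dimension N,
      charts = (\<lambda>(U, \<phi>).
        ({v. \<exists>c. smooth_curve_near_0 N c \<and> c 0 \<in> U \<and> v = velocity N k c 0},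
         \<lambda>v j. if j < (k + 1) * dimension N
               then (deriv ^^ (j div dimension N)) (\<lambda>t. \<phi> (rep v t) (j mod dimension N)) 0
               else 0)) ` charts N\<rparr>"

abbreviation tangent :: "'a atlas \<Rightarrow> 'a jet atlas" where
  "tangent N \<equiv> jet_bundle 1 N"

text \<open>The jet projection to \<open>s\<close>-velocities, and the map of \<open>k\<close>-velocities induced by \<open>f\<close>, a map
  into the manifold \<open>N'\<close>.\<close>

definition jet_proj :: "'a atlas \<Rightarrow> nat \<Rightarrow> 'a jet \<Rightarrow> 'a jet" where
  "jet_proj N s v = velocity N s (rep v) 0"

definition jet_map :: "'b atlas \<Rightarrow> nat \<Rightarrow> ('a \<Rightarrow> 'b) \<Rightarrow> 'a jet \<Rightarrow> 'b jet" where
  "jet_map N' k f v = velocity N' k (f \<circ> rep v) 0"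

text \<open>The element of the \<open>m\<close>-velocities (in \<open>s\<close>) of \<open>n\<close>-velocities (in \<open>t\<close>) represented by \<open>g s t\<close>.\<close>

definition velocity2 :: "'a atlas \<Rightarrow> nat \<Rightarrow> nat \<Rightarrow> (real \<Rightarrow> real \<Rightarrow> 'a) \<Rightarrow> 'a jet jet" where
  "velocity2 N m n g = velocity (jet_bundle n N) m (\<lambda>s. velocity N n (g s) 0) 0"

text \<open>The truncation to an \<open>m\<close>-velocity of \<open>n\<close>-velocities (\<open>m, n \<le> k\<close>).\<close>

definition truncation :: "'a atlas \<Rightarrow> nat \<Rightarrow> nat \<Rightarrow> nat \<Rightarrow> 'a jet jet \<Rightarrow> 'a jet jet" where
  "truncation N k m n \<Phi> =
     (THE Y. \<exists>g. smooth_family2 N g \<and> \<Phi> = velocity2 N k k g \<and> Y = velocity2 N m n g)"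


section \<open>The iterated tangent bundle\<close>

text \<open>The types of the \<open>k\<close> times iterated tangent bundles depend on \<open>k\<close>. An element of the \<open>k\<close> times
  iterated tangent bundle is obtained from a \<open>k\<close>-parameter family by differentiating once in each
  parameter in turn, the first parameter belonging to the outermost tangent bundle; its lifted
  coordinates are the partial derivatives of the family at the origin by subsets of the parameters.
  The element is therefore encoded as the class of families that share these derivatives.\<close>

type_synonym 'a itan = "((nat \<Rightarrow> real) \<Rightarrow> 'a) set"

definition itangent :: "'a atlas \<Rightarrow> nat \<Rightarrow> ((nat \<Rightarrow> real) \<Rightarrow> 'a) \<Rightarrow> 'a itan" where
  "itangent N k f =
     {g. smooth_family k N g \<and> g origin = f origin \<and>
         (\<forall>(U, \<phi>)\<in>charts N. f origin \<in> U \<longrightarrow>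
            (\<forall>i<dimension N. \<forall>is. distinct is \<and> set is \<subseteq> {..<k} \<longrightarrow>
               partials is (\<lambda>s. \<phi> (g s) i) origin = partials is (\<lambda>s. \<phi> (f s) i) origin))}"

definition itangent_map :: "'b atlas \<Rightarrow> nat \<Rightarrow> ('a \<Rightarrow> 'b) \<Rightarrow> 'a itan \<Rightarrow> 'b itan" where
  "itangent_map N' k f X = itangent N' k (f \<circ> rep X)"

text \<open>The canonical inclusions of the \<open>k\<close>-velocities, and of the \<open>m\<close>-velocities of \<open>n\<close>-velocities,
  into the iterated tangent bundle.\<close>

definition incl :: "'a atlas \<Rightarrow> nat \<Rightarrow> 'a jet \<Rightarrow> 'a itan" where
  "incl N k v = itangent N k (\<lambda>s. rep v (\<Sum>i<k. s i))"

definition incl2 :: "'a atlas \<Rightarrow> nat \<Rightarrow> nat \<Rightarrow> 'a jet jet \<Rightarrow> 'a itan" where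
  "incl2 N m n Y =
     (THE Z. \<exists>g. smooth_family2 N g \<and> Y = velocity2 N m n g \<and>
        Z = itangent N (m + n) (\<lambda>s. g (\<Sum>i<m. s i) (\<Sum>i=m..<m + n. s i)))"


section \<open>The cotangent bundle\<close>

text \<open>Covectors at \<open>x\<close> are pairs \<open>(x, l)\<close> with \<open>l\<close> linear on the tangent space at \<open>x\<close>, whose linear
  structure is that of the coordinates of tangent vectors in charts. Off the tangent space \<open>l\<close> is
  set to \<open>0\<close>, so that covectors are equal iff they agree on tangent vectors.\<close>

type_synonym 'a cov = "'a \<times> ('a jet \<Rightarrow> real)"

definition tangent_space :: "'a atlas \<Rightarrow> 'a \<Rightarrow> 'a jet set" where
  "tangent_space N x = {v \<in> points (tangent N). base_point v = x}"

definition linear_on_tangent_space :: "'a atlas \<Rightarrow> 'a \<Rightarrow> ('a jet \<Rightarrow> real) \<Rightarrow> bool" where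
  "linear_on_tangent_space N x l \<longleftrightarrow>
     (\<forall>(U, \<phi>)\<in>charts N. x \<in> U \<longrightarrow>
        (let d = (\<lambda>v i. deriv (\<lambda>t. \<phi> (rep v t) i) 0) in
         \<forall>u\<in>tangent_space N x. \<forall>v\<in>tangent_space N x. \<forall>w\<in>tangent_space N x. \<forall>a b.
           (\<forall>i<dimension N. d u i = a * d v i + b * d w i) \<longrightarrow> l u = a * l v + b * l w))"

definition covectors :: "'a atlas \<Rightarrow> 'a cov set" where
  "covectors N = {(x, l). x \<in> points N \<and> linear_on_tangent_space N x l \<and>
                          (\<forall>v. v \<notin> tangent_space N x \<longrightarrow> l v = 0)}"

definition coord_vector :: "'a atlas \<Rightarrow> 'a set \<times> ('a \<Rightarrow> nat \<Rightarrow> real) \<Rightarrow> 'a \<Rightarrow> nat \<Rightarrow> 'a jet" where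
  "coord_vector N = (\<lambda>(U, \<phi>) x i.
     velocity N 1 (\<lambda>t. inv_into U \<phi> ((\<phi> x)(i := \<phi> x i + t))) 0)"

definition cotangent :: "'a atlas \<Rightarrow> 'a cov atlas" where
  "cotangent N =
     \<lparr>dimension = 2 * dimension N,
      charts = (\<lambda>(U, \<phi>).
        ({p \<in> covectors N. fst p \<in> U},
         \<lambda>p j. if j < dimension N then \<phi> (fst p) j
               else if j < 2 * dimension N
               then snd p (coord_vector N (U, \<phi>) (fst p) (j - dimension N))
               else 0)) ` charts N\<rparr>"

definition differential :: "'a atlas \<Rightarrow> ('a \<Rightarrow> real) \<Rightarrow> 'a \<Rightarrow> 'a cov" where
  "differential N f x =
     (x, \<lambda>v. if v \<in> tangent_space N x then deriv (\<lambda>t. f (rep v t)) 0 else 0)"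

definition pairing :: "'a cov \<Rightarrow> 'a jet \<Rightarrow> real" where
  "pairing p v = snd p v"


section \<open>Lifted pairings, the canonical flip and its dual\<close>

text \<open>Below, \<open>M\<close> is the manifold; the vector bundle \<open>E\<close> is its cotangent bundle, with projection
  \<open>fst\<close>, and the dual bundle is its tangent bundle, with projection \<open>base_point\<close>.

  The \<open>k\<close>-fold tangent lift of a function takes the element represented by a \<open>k\<close>-parameter family
  to the derivative of the function along the family, once in each of the parameters. An element of
  the iterated tangent bundle of the fibre product is represented by two families over the same
  family of points of \<open>M\<close>.\<close>

definition itangent_pairing :: "nat \<Rightarrow> 'a cov itan \<Rightarrow> 'a jet itan \<Rightarrow> real" where
  "itangent_pairing k X Y =
     (THE r. \<exists>x\<in>X. \<exists>y\<in>Y.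
        eventually (\<lambda>s. fst (x s) = base_point (y s)) (nhdsin (Euclidean_space k) origin) \<and>
        r = partials [0..<k] (\<lambda>s. pairing (x s) (y s)) origin)"

definition jet_pairing :: "'a atlas \<Rightarrow> nat \<Rightarrow> 'a cov jet \<Rightarrow> 'a jet jet \<Rightarrow> real" where
  "jet_pairing M k X Y =
     itangent_pairing k (incl (cotangent M) k X) (incl (tangent M) k Y)"

definition flip :: "'a atlas \<Rightarrow> nat \<Rightarrow> 'a jet jet \<Rightarrow> 'a jet jet" where
  "flip M k V =
     (THE W. \<exists>g. smooth_family2 M g \<and> V = velocity2 M k 1 g \<and> W = velocity2 M 1 k (\<lambda>s t. g t s))"

definition dual_flip :: "'a atlas \<Rightarrow> nat \<Rightarrow> 'a jet cov \<Rightarrow> 'a cov jet" where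
  "dual_flip M k \<Psi> =
     (THE Y. Y \<in> points (jet_bundle k (cotangent M)) \<and> jet_map M k fst Y = fst \<Psi> \<and>
        (\<forall>V\<in>points (jet_bundle k (tangent M)). jet_map M k base_point V = fst \<Psi> \<longrightarrow>
           pairing \<Psi> (flip M k V) = jet_pairing M k Y V))"


section \<open>Force and momentum\<close>

text \<open>The linear combination \<open>\<Sum>j\<le>k. a j * Y j\<close> of elements of one fibre of the \<open>k\<close> times iterated
  tangent bundle of the cotangent bundle over that of \<open>M\<close>. Its operations are the tangent lifts of
  the fibrewise ones, so they act on families over the same family of points of \<open>M\<close>.\<close>

definition itangent_lincomb ::
  "'a atlas \<Rightarrow> nat \<Rightarrow> (nat \<Rightarrow> real) \<Rightarrow> (nat \<Rightarrow> 'a cov itan) \<Rightarrow> 'a cov itan" where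
  "itangent_lincomb M k a Y =
     (THE Z. \<exists>y. (\<forall>j\<le>k. y j \<in> Y j \<and>
           eventually (\<lambda>s. fst (y j s) = fst (y 0 s)) (nhdsin (Euclidean_space k) origin)) \<and>
        Z = itangent (cotangent M) k
              (\<lambda>s. (fst (y 0 s), \<lambda>v. \<Sum>j\<le>k. a j * snd (y j s) v)))"

definition truncations_lincomb ::
  "'a atlas \<Rightarrow> nat \<Rightarrow> (nat \<Rightarrow> real) \<Rightarrow> 'a cov jet jet \<Rightarrow> 'a cov itan" where
  "truncations_lincomb M k a \<Phi> =
     itangent_lincomb M k a
       (\<lambda>j. incl2 (cotangent M) j (k - j) (truncation (cotangent M) k j (k - j) \<Phi>))"

text \<open>\<open>Upsilon\<close> and \<open>upsilon\<close> are meant for semi-holonomic \<open>\<Phi>\<close>, and \<open>P_map\<close> for semi-holonomic \<open>X\<close>, i.e.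
  for \<open>X\<close> that lies over an element of the iterated tangent bundle of \<open>M\<close> included from the
  \<open>k\<close>-velocities. In \<open>Upsilon\<close>, \<open>\<Xi>\<close> is any element over the tangent vector \<open>\<xi>\<close> which lies over the
  same \<open>k\<close>-velocity in \<open>M\<close> as the sum.\<close>

definition Upsilon :: "'a atlas \<Rightarrow> nat \<Rightarrow> 'a cov jet jet \<Rightarrow> 'a cov" where
  "Upsilon M k \<Phi> =
     (let S = truncations_lincomb M k (\<lambda>j. (- 1) ^ j * real (k choose j)) \<Phi> in
      THE e. e \<in> covectors M \<and> fst e = fst (rep S origin) \<and>
        (\<forall>\<xi>\<in>tangent_space M (fst e). \<forall>\<Xi>\<in>points (jet_bundle k (tangent M)).
           base_point \<Xi> = \<xi> \<and> incl M k (jet_map M k base_point \<Xi>) = itangent_map M k fst S \<longrightarrow>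
           pairing e \<xi> = itangent_pairing k S (incl (tangent M) k \<Xi>)))"

definition P_map :: "'a atlas \<Rightarrow> nat \<Rightarrow> 'a cov itan \<Rightarrow> 'a cov jet" where
  "P_map M k X =
     (THE Y. Y \<in> points (jet_bundle k (cotangent M)) \<and>
        incl M k (jet_map M k fst Y) = itangent_map M k fst X \<and>
        (\<forall>\<Psi>\<in>points (jet_bundle k (tangent M)).
           incl M k (jet_map M k base_point \<Psi>) = itangent_map M k fst X \<longrightarrow>
           jet_pairing M k Y \<Psi> = itangent_pairing k X (incl (tangent M) k \<Psi>)))"

definition upsilon :: "'a atlas \<Rightarrow> nat \<Rightarrow> 'a cov jet jet \<Rightarrow> 'a cov jet" where
  "upsilon M k \<Phi> =
     P_map M k (truncations_lincomb M k (\<lambda>i. (- 1) ^ i * real ((k + 1) choose (i + 1))) \<Phi>)"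

definition Lambda_map :: "'a atlas \<Rightarrow> nat \<Rightarrow> ('a jet \<Rightarrow> real) \<Rightarrow> 'a jet \<Rightarrow> 'a cov jet" where
  "Lambda_map M k L = dual_flip M k \<circ> differential (jet_bundle k M) L"

definition lambda_map :: "'a atlas \<Rightarrow> nat \<Rightarrow> ('a jet \<Rightarrow> real) \<Rightarrow> 'a jet \<Rightarrow> 'a cov jet" where
  "lambda_map M k L = jet_proj (cotangent M) (k - 1) \<circ> Lambda_map M k L"

definition force_along :: "'a atlas \<Rightarrow> nat \<Rightarrow> ('a jet \<Rightarrow> real) \<Rightarrow> (real \<Rightarrow> 'a) \<Rightarrow> real \<Rightarrow> 'a cov" where
  "force_along M k L \<gamma> t =
     Upsilon M k (velocity (jet_bundle k (cotangent M)) k (\<lambda>t. Lambda_map M k L (velocity M k \<gamma> t)) t)"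

definition momentum_along ::
  "'a atlas \<Rightarrow> nat \<Rightarrow> ('a jet \<Rightarrow> real) \<Rightarrow> (real \<Rightarrow> 'a) \<Rightarrow> real \<Rightarrow> 'a cov jet" where
  "momentum_along M k L \<gamma> t =
     upsilon M (k - 1)
       (velocity (jet_bundle (k - 1) (cotangent M)) (k - 1)
          (\<lambda>t. lambda_map M k L (velocity M k \<gamma> t)) t)"

text \<open>The admissible variation of the \<open>k\<close>-velocity of a curve generated by the vector field
  \<open>\<delta>\<close> along the curve, and the differential of the action of \<open>L\<close> at the curve \<open>\<gamma>\<close> in the direction of a
  variation \<open>V\<close> of its \<open>k\<close>-velocity.\<close>

definition admissible_variation :: "'a atlas \<Rightarrow> nat \<Rightarrow> (real \<Rightarrow> 'a jet) \<Rightarrow> real \<Rightarrow> 'a jet jet" where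
  "admissible_variation M k \<delta> t = flip M k (velocity (tangent M) k \<delta> t)"

definition action_differential ::
  "'a atlas \<Rightarrow> nat \<Rightarrow> ('a jet \<Rightarrow> real) \<Rightarrow> real \<Rightarrow> real \<Rightarrow> (real \<Rightarrow> 'a) \<Rightarrow>
   (real \<Rightarrow> 'a jet jet) \<Rightarrow> real" where
  "action_differential M k L t\<^sub>0 t\<^sub>1 \<gamma> V =
     integral {t\<^sub>0..t\<^sub>1} (\<lambda>t. pairing (differential (jet_bundle k M) L (velocity M k \<gamma> t)) (V t))"

end

theory Submission
  imports Defs "HOL-Library.Sublist"
begin

text \<open>In a chart around \<open>\<gamma> s\<close> let \<open>h s t = (\<Sum>i. p\<^sub>i s t * v\<^sub>i (s + t))\<close>, where \<open>p\<^sub>i s\<close> is the polynomial in \<open>t\<close>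
  with the derivatives prescribed by the \<open>i\<close>-th fibre coordinates of \<open>\<Lambda>\<^sub>L\<close> at the \<open>k\<close>-velocity of \<open>\<gamma>\<close> at \<open>s\<close>,
  and \<open>v\<^sub>i\<close> are the fibre coordinates of the variation. Write \<open>D\<close> and \<open>T\<close> for the derivatives in \<open>s\<close> and
  \<open>t\<close>. The pairings of iterated bundles being tangent lifts, at \<open>t = 0\<close> the integrand of the
  differential of the action is \<open>T^k h\<close>, the force pairs with the variation to \<open>(T - D)^k h\<close>, and the momentum
  with its velocity to \<open>Q h\<close> for \<open>Q = (\<Sum>j<k. (-1)^j (k choose (j+1)) D^j T^(k-1-j))\<close>. The theorem is
  the identity \<open>D Q = T^k - (T - D)^k\<close> integrated over time. As \<open>T - D\<close> annihilates \<open>v\<^sub>i (s + t)\<close>, the value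
  of \<open>(T - D)^k h\<close> depends on the variation only through \<open>v\<^sub>i s\<close>, which is why the force is well defined.

  Jets and iterated tangent vectors are classes of curves and families compared in all charts at once.
  By the chain rule the derivatives in one chart determine them, and this is how the choices made in the
  definitions are evaluated.\<close>

section \<open>Germs of smooth functions\<close>

text \<open>The polynomials \<open>p_i\<close> come from the Leibniz rule: the pairing of two
  \<open>k\<close>-velocities is the \<open>k\<close>-th derivative of the sum of
  \<open>p_i v_i\<close>, in which the derivative of order k - \<alpha> of \<open>p_i\<close> meets
  that of order \<alpha> of \<open>v_i\<close> with the factor (k choose \<alpha>). Matching this
  with the differential of \<open>L\<close> forces the derivative of order \<beta> of
  \<open>p_i\<close> to be the derivative of \<open>L\<close> by the jet coordinate of order k -
  \<beta>, divided by (k choose \<beta>). The coefficients of \<open>Q\<close> arise by division: in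
  T^k - (T - D)^k the term without \<open>D\<close> cancels, and one factor \<open>D\<close> splits
  off from the rest, shifting the index by one. The obstacle is that most notions are definite
  descriptions over representatives. Pairings and sums accept only representatives over literally
  the same family of points of \<open>M\<close>, while given ones merely share finitely many
  derivatives there. Semi-holonomy supplies a common base: all truncations at time \<open>s\<close>
  lie over \<gamma> at \<open>s\<close> plus the sum of all parameters. Only the last integration is
  global; all else is an identity between germs in one chart.\<close>

definition coord_space :: "nat \<Rightarrow> (nat \<Rightarrow> real) set" where
  "coord_space n = {x. \<forall>i\<ge>n. x i = 0}"

abbreviation nbhds :: "nat \<Rightarrow> (nat \<Rightarrow> real) \<Rightarrow> (nat \<Rightarrow> real) filter" where
  "nbhds n a \<equiv> nhdsin (Euclidean_space n) a"

lemma Euclidean_space_coord_space: "Euclidean_space n = top_of_set (coord_space n)"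
  by (simp add: Euclidean_space_def coord_space_def euclidean_product_topology)

lemma topspace_Euclidean_coord_space [simp]: "topspace (Euclidean_space n) = coord_space n"
  by (simp add: Euclidean_space_coord_space)

lemma openin_Euclidean_subset: "openin (Euclidean_space n) V \<Longrightarrow> V \<subseteq> coord_space n"
  using openin_subset by fastforce

lemma origin_coord_space [simp]: "origin \<in> coord_space n"
  by (simp add: coord_space_def)

lemma coord_space_upd: "x \<in> coord_space n \<Longrightarrow> i < n \<Longrightarrow> x(i := h) \<in> coord_space n"
  by (auto simp: coord_space_def)

lemma coord_space_eq_iff:
  "x \<in> coord_space n \<Longrightarrow> y \<in> coord_space n \<Longrightarrow> x = y \<longleftrightarrow> (\<forall>i<n. x i = y i)"
  by (auto simp: coord_space_def fun_eq_iff) (metis not_le)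

lemma openin_box:
  "openin (Euclidean_space n) {x \<in> coord_space n. \<forall>i<n. \<bar>x i - a i\<bar> < e}"
proof -
  have "{x \<in> coord_space n. \<forall>i<n. \<bar>x i - a i\<bar> < e} =
     coord_space n \<inter> (\<Inter>i\<in>{..<n}. {x. \<bar>x i - a i\<bar> < e})" by auto
  moreover have "open (\<Inter>i\<in>{..<n}. {x::nat\<Rightarrow>real. \<bar>x i - a i\<bar> < e})"
    by (intro open_INT finite_lessThan ballI open_Collect_less continuous_intros continuous_on_product_coordinates)
  ultimately show ?thesis
    by (auto simp: Euclidean_space_coord_space)
qed

text \<open>The ambient topology is the product over all indices, but points of
  \<open>coord_space n\<close> agree from index \<open>n\<close> on, so only finitely many of the
  radii obtained from a basic open set enter the minimum.\<close>

lemma box_in_open: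
  assumes "openin (Euclidean_space n) V" "a \<in> V"
  shows "\<exists>e>0. \<forall>x\<in>coord_space n. (\<forall>i<n. \<bar>x i - a i\<bar> < e) \<longrightarrow> x \<in> V"
proof -
  obtain T where T: "open T" "V = coord_space n \<inter> T"
    using assms(1) by (auto simp: Euclidean_space_coord_space openin_open)
  have "openin (powertop_real UNIV) T"
    using T by (simp add: euclidean_product_topology)
  from product_topology_open_contains_basis[OF this, of a] assms(2) T(2)
  obtain X where X: "a \<in> (\<Pi>\<^sub>E i\<in>UNIV. X i)" "\<And>i. open (X i)" "(\<Pi>\<^sub>E i\<in>UNIV. X i) \<subseteq> T"
    by auto
  have "\<forall>i. \<exists>e>0. \<forall>y. \<bar>y - a i\<bar> < e \<longrightarrow> y \<in> X i"
  proof
    fix i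
    have "a i \<in> X i" using X(1) by auto
    then obtain e where "e > 0" "ball (a i) e \<subseteq> X i"
      using X(2) openE by blast
    then show "\<exists>e>0. \<forall>y. \<bar>y - a i\<bar> < e \<longrightarrow> y \<in> X i"
      by (intro exI[of _ e]) (auto simp: ball_def dist_real_def abs_minus_commute)
  qed
  then obtain e where e: "\<And>i. e i > 0" "\<And>i y. \<bar>y - a i\<bar> < e i \<Longrightarrow> y \<in> X i"
    by metis
  \<comment> \<open>The 1 keeps the set nonempty when \<open>n = 0\<close>.\<close>
  define d where "d = Min (insert 1 (e ` {..<n}))"
  have "d > 0" using e(1) by (auto simp: d_def)
  have dle: "d \<le> e i" if "i < n" for i
    using that by (auto simp: d_def)
  show ?thesis
  proof (intro exI[of _ d] conjI ballI impI \<open>d > 0\<close>)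
    fix x assume x: "x \<in> coord_space n" "\<forall>i<n. \<bar>x i - a i\<bar> < d"
    have "x i \<in> X i" for i
    proof (cases "i < n")
      case True
      then show ?thesis using x dle[OF True] by (intro e(2)) force
    next
      case False
      then have "x i = a i"
        using x(1) assms(2) T(2) by (auto simp: coord_space_def)
      then show ?thesis using e(1)[of i] by (intro e(2)) auto
    qed
    then show "x \<in> V" using X(3) T(2) x(1) by auto
  qed
qed

lemma eventually_nbhds:
  assumes "a \<in> coord_space n"
  shows "eventually P (nbhds n a) \<longleftrightarrow>
    (\<exists>e>0. \<forall>x\<in>coord_space n. (\<forall>i<n. \<bar>x i - a i\<bar> < e) \<longrightarrow> P x)"
proof
  assume "eventually P (nbhds n a)"
  then obtain S where S: "openin (Euclidean_space n) S" "a \<in> S" "\<forall>x\<in>S. P x"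
    using assms by (auto simp: eventually_nhdsin)
  then show "\<exists>e>0. \<forall>x\<in>coord_space n. (\<forall>i<n. \<bar>x i - a i\<bar> < e) \<longrightarrow> P x"
    using box_in_open[OF S(1,2)] by blast
next
  assume "\<exists>e>0. \<forall>x\<in>coord_space n. (\<forall>i<n. \<bar>x i - a i\<bar> < e) \<longrightarrow> P x"
  then obtain e where e: "e > 0" "\<forall>x\<in>coord_space n. (\<forall>i<n. \<bar>x i - a i\<bar> < e) \<longrightarrow> P x"
    by blast
  show "eventually P (nbhds n a)"
    unfolding eventually_nhdsin using openin_box[of n a e] e assms by auto
qed

lemma eventually_nbhds_open:
  "openin (Euclidean_space n) V \<Longrightarrow> a \<in> V \<Longrightarrow> eventually (\<lambda>x. x \<in> V) (nbhds n a)"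
  by (auto simp: eventually_nhdsin)

lemma eventually_nbhds_E:
  assumes "eventually P (nbhds n a)" "a \<in> coord_space n"
  obtains V where "openin (Euclidean_space n) V" "a \<in> V" "\<And>x. x \<in> V \<Longrightarrow> P x"
  using assms by (auto simp: eventually_nhdsin)

lemma eventually_nbhds_self: "eventually P (nbhds n a) \<Longrightarrow> a \<in> coord_space n \<Longrightarrow> P a"
  by (auto simp: eventually_nhdsin)

lemma eventually_coord_space: "eventually (\<lambda>x. x \<in> coord_space n) (nbhds n a)"
  by (auto simp: eventually_nhdsin intro: exI[of _ "coord_space n"]
      openin_topspace[of "Euclidean_space n", simplified])

lemma eventually_eventually_nbhds:
  "eventually P (nbhds n a) \<Longrightarrow> eventually (\<lambda>x. eventually P (nbhds n x)) (nbhds n a)"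
  by (force simp: eventually_nhdsin)

lemma openin_Euclidean_iff:
  "openin (Euclidean_space n) V \<longleftrightarrow>
     V \<subseteq> coord_space n \<and> (\<forall>a\<in>V. eventually (\<lambda>x. x \<in> V) (nbhds n a))"
proof
  assume V: "V \<subseteq> coord_space n \<and> (\<forall>a\<in>V. eventually (\<lambda>x. x \<in> V) (nbhds n a))"
  have "\<exists>S. openin (Euclidean_space n) S \<and> a \<in> S \<and> S \<subseteq> V" if "a \<in> V" for a
    using V that eventually_nhdsin[of "\<lambda>x. x \<in> V" "Euclidean_space n" a] by auto
  then show "openin (Euclidean_space n) V" using openin_subopen[of _ V] by blast
next
  assume "openin (Euclidean_space n) V"
  then show "V \<subseteq> coord_space n \<and> (\<forall>a\<in>V. eventually (\<lambda>x. x \<in> V) (nbhds n a))"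
    using eventually_nbhds_open[of n V] openin_Euclidean_subset[of n V] by blast
qed

text \<open>\<open>partial\<close> sees a function along coordinate lines only; this carries
  information about germs to such a line.\<close>

lemma eventually_nbhds_line:
  assumes "eventually P (nbhds n x)" "x \<in> coord_space n" "i < n"
  shows "eventually (\<lambda>h. P (x(i := h))) (nhds (x i))"
proof -
  obtain e where e: "e > 0" "\<forall>y\<in>coord_space n. (\<forall>i<n. \<bar>y i - x i\<bar> < e) \<longrightarrow> P y"
    using assms(1) unfolding eventually_nbhds[OF assms(2)] by blast
  have "eventually (\<lambda>h. dist h (x i) < e) (nhds (x i))"
    unfolding eventually_nhds_metric using e(1) by auto
  then show ?thesis
    by eventually_elim (use e assms coord_space_upd in \<open>auto simp: dist_real_def\<close>)
qed

section \<open>Continuity and smoothness at a point and near it\<close>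

definition contat :: "nat \<Rightarrow> ((nat \<Rightarrow> real) \<Rightarrow> real) \<Rightarrow> (nat \<Rightarrow> real) \<Rightarrow> bool" where
  "contat n f a \<longleftrightarrow> (f \<longlongrightarrow> f a) (nbhds n a)"

lemma contat_cong:
  assumes "eventually (\<lambda>x. f x = g x) (nbhds n a)" "a \<in> coord_space n" "contat n f a"
  shows "contat n g a"
  using assms eventually_nbhds_self[OF assms(1,2)] unfolding contat_def
  by (metis (mono_tags, lifting) tendsto_cong)

lemma continuous_map_contat:
  assumes "openin (Euclidean_space n) V"
  shows "continuous_map (subtopology (Euclidean_space n) V) euclideanreal f \<longleftrightarrow> (\<forall>a\<in>V. contat n f a)"
proof -
  have V: "V \<subseteq> coord_space n" using assms openin_Euclidean_subset by blast
  have "(f \<longlongrightarrow> f a) (nbhds n a) \<longleftrightarrow> (f \<longlongrightarrow> f a) (at a within V)" if "a \<in> V" for a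
  proof -
    have "a \<in> coord_space n" using V that by auto
    have *: "eventually P (nbhds n a) \<longleftrightarrow> eventually P (inf (nhds a) (principal V))" for P
    proof
      assume "eventually P (nbhds n a)"
      then obtain W where "openin (Euclidean_space n) W" "a \<in> W" "\<forall>x\<in>W. P x"
        using \<open>a \<in> coord_space n\<close> by (auto simp: eventually_nhdsin)
      then show "eventually P (inf (nhds a) (principal V))"
        unfolding eventually_inf_principal eventually_nhds Euclidean_space_coord_space openin_open
        using V by blast
    next
      assume "eventually P (inf (nhds a) (principal V))"
      then obtain S where S: "open S" "a \<in> S" "\<forall>x\<in>S. x \<in> V \<longrightarrow> P x"
        unfolding eventually_inf_principal eventually_nhds by blast
      have "openin (Euclidean_space n) (S \<inter> V)"
        using assms S(1) unfolding Euclidean_space_coord_space by (metis openin_Int_open inf_commute)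
      then show "eventually P (nbhds n a)"
        using S that by (auto simp: eventually_nhdsin intro!: exI[of _ "S \<inter> V"])
    qed
    then have "nbhds n a = inf (nhds a) (principal V)"
      by (simp add: filter_eq_iff)
    then show ?thesis
      by (simp add: tendsto_at_within_iff_tendsto_nhds)
  qed
  then show ?thesis
    using V unfolding Euclidean_space_coord_space contat_def
    by (simp add: subtopology_subtopology inf.absorb2 continuous_on)
qed

definition smooth_at_point :: "nat \<Rightarrow> ((nat \<Rightarrow> real) \<Rightarrow> real) \<Rightarrow> (nat \<Rightarrow> real) \<Rightarrow> bool" where
  "smooth_at_point n f x \<longleftrightarrow> (\<forall>is. set is \<subseteq> {..<n} \<longrightarrow> contat n (partials is f) x \<and>
      (\<forall>i<n. (\<lambda>h. partials is f (x(i := h))) differentiable (at (x i))))"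

text \<open>Nearby points are included because mean value arguments use derivatives around the point
  and because inductions on derivative lists differentiate equations that hold near it. Membership
  in \<open>coord_space\<close> excludes points where the filter is trivial.\<close>

definition smooth_germ :: "nat \<Rightarrow> ((nat \<Rightarrow> real) \<Rightarrow> real) \<Rightarrow> (nat \<Rightarrow> real) \<Rightarrow> bool" where
  "smooth_germ n f a \<longleftrightarrow> a \<in> coord_space n \<and> eventually (smooth_at_point n f) (nbhds n a)"

lemma smooth_on_Rn_at_point:
  assumes "openin (Euclidean_space n) V"
  shows "smooth_on_Rn n V f \<longleftrightarrow> (\<forall>x\<in>V. smooth_at_point n f x)"
  unfolding smooth_on_Rn_def smooth_at_point_def continuous_map_contat[OF assms] by blast

lemma smooth_on_Rn_germ:
  assumes "openin (Euclidean_space n) V"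
  shows "smooth_on_Rn n V f \<longleftrightarrow> (\<forall>x\<in>V. smooth_germ n f x)"
  unfolding smooth_on_Rn_at_point[OF assms] smooth_germ_def
  using openin_Euclidean_subset[OF assms] assms
  by (force simp: eventually_nhdsin)

lemma smooth_germ_E:
  assumes "smooth_germ n f a"
  obtains V where "openin (Euclidean_space n) V" "a \<in> V" "\<And>x. x \<in> V \<Longrightarrow> smooth_at_point n f x"
  using assms unfolding smooth_germ_def using eventually_nbhds_E by blast

lemma smooth_germ_coord_space: "smooth_germ n f a \<Longrightarrow> a \<in> coord_space n"
  by (simp add: smooth_germ_def)

lemma smooth_germ_eventually:
  "smooth_germ n f a \<Longrightarrow> eventually (smooth_germ n f) (nbhds n a)"
  unfolding smooth_germ_def
  using eventually_conj[OF eventually_coord_space eventually_eventually_nbhds] by blast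

lemma smooth_germ_at_point: "smooth_germ n f a \<Longrightarrow> smooth_at_point n f a"
  unfolding smooth_germ_def using eventually_nbhds_self by blast

lemma smooth_at_point_contat: "smooth_at_point n f x \<Longrightarrow> contat n f x"
  unfolding smooth_at_point_def by (drule spec[of _ "[]"]) simp

lemma smooth_at_point_differentiable:
  "smooth_at_point n f x \<Longrightarrow> i < n \<Longrightarrow> (\<lambda>h. f (x(i := h))) differentiable (at (x i))"
  unfolding smooth_at_point_def by (drule spec[of _ "[]"]) simp

lemma smooth_germ_contat: "smooth_germ n f a \<Longrightarrow> contat n f a"
  using smooth_germ_at_point smooth_at_point_contat by blast

lemma smooth_germ_differentiable:
  "smooth_germ n f a \<Longrightarrow> i < n \<Longrightarrow> (\<lambda>h. f (a(i := h))) differentiable (at (a i))"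
  using smooth_germ_at_point smooth_at_point_differentiable by blast

lemma smooth_germ_partial_deriv:
  assumes "smooth_germ n f a" "i < n"
  shows "((\<lambda>h. f (a(i := h))) has_real_derivative partial i f a) (at (a i))"
  using smooth_germ_differentiable[OF assms] unfolding partial_def
  by (metis DERIV_deriv_iff_real_differentiable)

lemma smooth_at_point_partial: "smooth_at_point n f x \<Longrightarrow> i < n \<Longrightarrow> smooth_at_point n (partial i f) x"
  unfolding smooth_at_point_def
proof (intro allI impI)
  fix "is" assume h: "\<forall>is. set is \<subseteq> {..<n} \<longrightarrow> contat n (partials is f) x \<and>
      (\<forall>i<n. (\<lambda>h. partials is f (x(i := h))) differentiable (at (x i)))" "i < n" "set is \<subseteq> {..<n}"
  show "contat n (partials is (partial i f)) x \<and>
      (\<forall>j<n. (\<lambda>h. partials is (partial i f) (x(j := h))) differentiable (at (x j)))"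
    using h(1)[rule_format, of "is @ [i]"] h(2,3) by simp
qed

lemma smooth_germ_partial: "smooth_germ n f a \<Longrightarrow> i < n \<Longrightarrow> smooth_germ n (partial i f) a"
  unfolding smooth_germ_def using smooth_at_point_partial by (metis (mono_tags, lifting) eventually_mono)

lemma smooth_germ_partials: "smooth_germ n f a \<Longrightarrow> set is \<subseteq> {..<n} \<Longrightarrow> smooth_germ n (partials is f) a"
  by (induction "is") (auto intro: smooth_germ_partial)

text \<open>Class C^r by recursion on the innermost derivative. The product and chain rules express
  a derivative through products of functions of the class one lower, so closure properties follow by
  induction on \<open>r\<close>, a recursion that the quantification over all lists hides.\<close>

primrec Cr :: "nat \<Rightarrow> nat \<Rightarrow> (nat \<Rightarrow> real) set \<Rightarrow> ((nat \<Rightarrow> real) \<Rightarrow> real) \<Rightarrow> bool" where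
  "Cr n 0 V f \<longleftrightarrow> (\<forall>x\<in>V. contat n f x)"
| "Cr n (Suc r) V f \<longleftrightarrow> (\<forall>x\<in>V. contat n f x) \<and>
     (\<forall>i<n. (\<forall>x\<in>V. (\<lambda>h. f (x(i := h))) differentiable (at (x i))) \<and> Cr n r V (partial i f))"

lemma Cr_contat: "Cr n r V f \<Longrightarrow> x \<in> V \<Longrightarrow> contat n f x"
  by (cases r) auto

lemma Cr_pred: "Cr n (Suc r) V f \<Longrightarrow> Cr n r V f"
  by (induction r arbitrary: f) auto

text \<open>In \<open>partials (is @ [i]) f\<close> the index \<open>i\<close> is differentiated
  first, which matches the recursion of \<open>Cr\<close>; hence the induction from the end of the
  list.\<close>

lemma smooth_at_point_Cr: "(\<forall>x\<in>V. smooth_at_point n f x) \<longleftrightarrow> (\<forall>r. Cr n r V f)"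
proof
  assume "\<forall>x\<in>V. smooth_at_point n f x"
  moreover have "(\<forall>x\<in>V. smooth_at_point n f x) \<longrightarrow> Cr n r V f" for r
    by (induction r arbitrary: f)
      (auto simp: smooth_at_point_contat smooth_at_point_differentiable smooth_at_point_partial)
  ultimately show "\<forall>r. Cr n r V f" by blast
next
  assume "\<forall>r. Cr n r V f"
  moreover have "set is \<subseteq> {..<n} \<Longrightarrow> \<forall>r. Cr n r V f \<Longrightarrow> x \<in> V \<Longrightarrow> contat n (partials is f) x \<and>
      (\<forall>i<n. (\<lambda>h. partials is f (x(i := h))) differentiable (at (x i)))" for "is" x
  proof (induction "is" arbitrary: f rule: rev_induct)
    case Nil
    then have "Cr n (Suc 0) V f" by blast
    then show ?case using Nil.prems(3) by (simp add: fun_upd_def)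
  next
    case (snoc i "is")
    have "\<forall>r. Cr n r V (partial i f)"
      using snoc.prems by (metis Cr.simps(2) insert_subset lessThan_iff list.simps(15) set_append Un_subset_iff list.set(1))
    then show ?case using snoc.IH[of "partial i f"] snoc.prems by simp
  qed
  ultimately show "\<forall>x\<in>V. smooth_at_point n f x"
    by (simp add: smooth_at_point_def)
qed

section \<open>Locality of derivatives; sums and products of functions of class C^r\<close>

lemma partial_cong:
  assumes "eventually (\<lambda>x. f x = g x) (nbhds n a)" "a \<in> coord_space n" "i < n"
  shows "partial i f a = partial i g a"
proof -
  have "eventually (\<lambda>h. f (a(i := h)) = g (a(i := h))) (nhds (a i))"
    using eventually_nbhds_line[OF assms] .
  then show ?thesis unfolding partial_def by (rule deriv_cong_ev) simp
qed

lemma eventually_partial_cong: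
  assumes "eventually (\<lambda>x. f x = g x) (nbhds n a)" "i < n"
  shows "eventually (\<lambda>x. partial i f x = partial i g x) (nbhds n a)"
  using eventually_conj[OF eventually_coord_space eventually_eventually_nbhds[OF assms(1)]]
  by eventually_elim (use partial_cong assms in blast)

lemma eventually_partials_cong:
  assumes "eventually (\<lambda>x. f x = g x) (nbhds n a)" "set is \<subseteq> {..<n}"
  shows "eventually (\<lambda>x. partials is f x = partials is g x) (nbhds n a)"
  using assms(2) by (induction "is") (auto intro: assms(1) eventually_partial_cong)

lemma partials_cong:
  assumes "eventually (\<lambda>x. f x = g x) (nbhds n a)" "set is \<subseteq> {..<n}" "a \<in> coord_space n"
  shows "partials is f a = partials is g a"
  using eventually_nbhds_self[OF eventually_partials_cong] assms by blast

lemma differentiable_cong_line: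
  fixes f g :: "(nat \<Rightarrow> real) \<Rightarrow> real"
  assumes "eventually (\<lambda>x. f x = g x) (nbhds n x)" "x \<in> coord_space n" "i < n"
    "(\<lambda>h. f (x(i := h))) differentiable (at (x i))"
  shows "(\<lambda>h. g (x(i := h))) differentiable (at (x i))"
proof -
  have "eventually (\<lambda>h. f (x(i := h)) = g (x(i := h))) (nhds (x i))"
    using eventually_nbhds_line[OF assms(1-3)] .
  moreover obtain D where "((\<lambda>h. f (x(i := h))) has_real_derivative D) (at (x i))"
    using assms(4) real_differentiable_def by blast
  ultimately have "((\<lambda>h. g (x(i := h))) has_real_derivative D) (at (x i))"
    by (subst DERIV_cong_ev[OF refl _ refl, symmetric])
  then show ?thesis using real_differentiable_def by blast
qed

lemma smooth_germ_cong:
  assumes "smooth_germ n f a" "eventually (\<lambda>x. f x = g x) (nbhds n a)"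
  shows "smooth_germ n g a"
proof -
  have "eventually (\<lambda>x. smooth_at_point n g x) (nbhds n a)"
    using eventually_conj[OF eventually_conj[OF eventually_coord_space
          eventually_eventually_nbhds[OF assms(2)]] assms(1)[unfolded smooth_germ_def, THEN conjunct2]]
  proof eventually_elim
    case (elim x)
    then show ?case unfolding smooth_at_point_def
      using eventually_partials_cong contat_cong differentiable_cong_line by blast
  qed
  then show ?thesis using assms(1) by (simp add: smooth_germ_def)
qed

lemma Cr_cong:
  assumes "openin (Euclidean_space n) V"
  shows "Cr n r V f \<Longrightarrow> (\<And>x. x \<in> V \<Longrightarrow> f x = g x) \<Longrightarrow> Cr n r V g"
proof (induction r arbitrary: f g)
  case 0
  have "contat n g x" if "x \<in> V" for x
  proof (rule contat_cong[of f g])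
    show "eventually (\<lambda>x. f x = g x) (nbhds n x)"
      using eventually_nbhds_open[OF assms that] by (rule eventually_mono) (use 0 in auto)
  qed (use 0 that openin_Euclidean_subset[OF assms] in auto)
  then show ?case by simp
next
  case (Suc r)
  have ev: "eventually (\<lambda>y. f y = g y) (nbhds n x)" and x: "x \<in> coord_space n" if "x \<in> V" for x
    using eventually_mono[OF eventually_nbhds_open[OF assms that], of "\<lambda>y. f y = g y"]
      Suc.prems that openin_Euclidean_subset[OF assms] by auto
  show ?case
    unfolding Cr.simps
  proof (intro conjI ballI allI impI)
    fix x assume "x \<in> V"
    then show "contat n g x" using contat_cong[OF ev x] Suc.prems by auto
    fix i assume "i < n"
    then show "(\<lambda>h. g (x(i := h))) differentiable (at (x i))"
      using differentiable_cong_line[OF ev x] \<open>x \<in> V\<close> Suc.prems by auto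
  next
    fix i assume "i < n"
    then show "Cr n r V (partial i g)"
      using Suc.IH[of "partial i f" "partial i g"] Suc.prems partial_cong[OF ev x] by auto
  qed
qed

lemma Cr_const: "Cr n r V (\<lambda>_. c)"
proof -
  have "partial i (\<lambda>_. c) = (\<lambda>_. 0)" for i c by (simp add: partial_def fun_eq_iff)
  then show ?thesis by (induction r arbitrary: c) (auto simp: contat_def)
qed

lemma partial_coord: "partial j (\<lambda>x. x i) = (\<lambda>_. if i = j then 1 else 0)"
  by (auto simp: partial_def fun_eq_iff)

lemma contat_coord:
  assumes "i < n" "a \<in> coord_space n" shows "contat n (\<lambda>x. x i) a"
  unfolding contat_def tendsto_iff
proof (intro allI impI)
  fix e :: real assume "e > 0"
  then show "\<forall>\<^sub>F x in nbhds n a. dist (x i) (a i) < e"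
    unfolding eventually_nbhds[OF assms(2)] using assms(1) by (auto simp: dist_real_def)
qed

lemma Cr_coord:
  assumes "i < n" "V \<subseteq> coord_space n" shows "Cr n r V (\<lambda>x. x i)"
proof -
  have "(\<lambda>h. (x(j := h)) i) differentiable (at (x j))" for x :: "nat \<Rightarrow> real" and j
    by (cases "i = j") auto
  then show ?thesis
    using assms contat_coord by (cases r) (auto simp: partial_coord Cr_const)
qed

lemma partial_add:
  assumes "(\<lambda>h. f (x(i := h))) differentiable (at (x i))" "(\<lambda>h. g (x(i := h))) differentiable (at (x i))"
  shows "partial i (\<lambda>x. f x + g x) x = partial i f x + partial i g x"
  unfolding partial_def using assms
  by (intro DERIV_imp_deriv DERIV_add) (metis DERIV_deriv_iff_real_differentiable)+

lemma partial_mult: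
  assumes "(\<lambda>h. f (x(i := h))) differentiable (at (x i))" "(\<lambda>h. g (x(i := h))) differentiable (at (x i))"
  shows "partial i (\<lambda>x. f x * g x) x = partial i f x * g x + f x * partial i g x"
  unfolding partial_def
  using DERIV_mult[OF assms[folded DERIV_deriv_iff_real_differentiable]]
  by (auto intro!: DERIV_imp_deriv simp: algebra_simps)

lemma contat_arith:
  assumes "contat n f x" "contat n g x"
  shows "contat n (\<lambda>x. f x + g x) x" "contat n (\<lambda>x. f x * g x) x"
  using assms by (auto simp: contat_def tendsto_add tendsto_mult)

lemma Cr_add:
  assumes V: "openin (Euclidean_space n) V"
  shows "Cr n r V f \<Longrightarrow> Cr n r V g \<Longrightarrow> Cr n r V (\<lambda>x. f x + g x)"
proof (induction r arbitrary: f g)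
  case 0
  then show ?case by (simp add: contat_arith)
next
  case (Suc r)
  have "Cr n r V (partial i (\<lambda>x. f x + g x))" if "i < n" for i
    by (rule Cr_cong[OF V Suc.IH[of "partial i f" "partial i g"]]) (use Suc.prems that partial_add in auto)
  then show ?case using Suc.prems by (simp add: contat_arith)
qed

lemma Cr_mult:
  assumes V: "openin (Euclidean_space n) V"
  shows "Cr n r V f \<Longrightarrow> Cr n r V g \<Longrightarrow> Cr n r V (\<lambda>x. f x * g x)"
proof (induction r arbitrary: f g)
  case 0
  then show ?case by (simp add: contat_arith)
next
  case (Suc r)
  have "Cr n r V (partial i (\<lambda>x. f x * g x))" if "i < n" for i
  proof (rule Cr_cong[OF V Cr_add[OF V]])
    show "Cr n r V (\<lambda>x. partial i f x * g x)" "Cr n r V (\<lambda>x. f x * partial i g x)"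
      using Suc.prems that Cr_pred[OF Suc.prems(1)] Cr_pred[OF Suc.prems(2)]
      by (auto intro!: Suc.IH simp del: Cr.simps(1))
  qed (use Suc.prems that partial_mult in auto)
  then show ?case using Suc.prems by (simp add: contat_arith)
qed

lemma Cr_sum:
  assumes V: "openin (Euclidean_space n) V"
  shows "(\<And>j. j \<in> A \<Longrightarrow> Cr n r V (f j)) \<Longrightarrow> Cr n r V (\<lambda>x. \<Sum>j\<in>A. f j x)"
  by (induction A rule: infinite_finite_induct) (auto intro!: Cr_add[OF V] Cr_const)

section \<open>Mean value theorem, chain rule and composites of class C^r\<close>

lemma mvt_symmetric:
  fixes f :: "real \<Rightarrow> real"
  assumes "\<And>z. \<bar>z - a\<bar> \<le> \<bar>b - a\<bar> \<Longrightarrow> (f has_real_derivative f' z) (at z)"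
  shows "\<exists>z. \<bar>z - a\<bar> \<le> \<bar>b - a\<bar> \<and> f b - f a = f' z * (b - a)"
proof (cases a b rule: linorder_cases)
  case less
  then obtain z where "a < z" "z < b" "f b - f a = (b - a) * f' z"
    using MVT2[of a b f f'] assms by force
  then show ?thesis by (intro exI[of _ z]) (auto simp: mult.commute)
next
  case greater
  then obtain z where "b < z" "z < a" "f a - f b = (a - b) * f' z"
    using MVT2[of b a f f'] assms by force
  then show ?thesis by (intro exI[of _ z]) (auto simp: algebra_simps)
qed auto

lemma filterlim_nbhds:
  assumes "eventually (\<lambda>x. G x \<in> coord_space n) F" "\<And>i. i < n \<Longrightarrow> ((\<lambda>x. G x i) \<longlongrightarrow> b i) F"
    "b \<in> coord_space n"
  shows "filterlim G (nbhds n b) F"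
  unfolding filterlim_iff
proof (intro allI impI)
  fix P assume "eventually P (nbhds n b)"
  then obtain e where e: "e > 0" "\<forall>x\<in>coord_space n. (\<forall>i<n. \<bar>x i - b i\<bar> < e) \<longrightarrow> P x"
    unfolding eventually_nbhds[OF assms(3)] by blast
  have "eventually (\<lambda>x. \<forall>i\<in>{..<n}. dist (G x i) (b i) < e) F"
    by (rule eventually_ball_finite) (use assms(2) e(1) tendsto_iff in \<open>auto simp: tendsto_iff\<close>)
  with assms(1) show "eventually (\<lambda>x. P (G x)) F"
    by eventually_elim (use e in \<open>auto simp: dist_real_def\<close>)
qed

text \<open>The increment from \<open>g t0\<close> to \<open>g t\<close> is split into
  \<open>n\<close> steps, one coordinate each. The mean value theorem turns step \<open>m\<close>
  into \<open>partial m f w\<close> times the increment of coordinate \<open>m\<close>, where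
  \<open>w\<close> tends to \<open>g t0\<close>; continuity of the partial derivatives at this one
  point then gives the limit of each quotient.\<close>

lemma chain_rule:
  assumes dg: "\<And>i. i < n \<Longrightarrow> ((\<lambda>t. g t i) has_real_derivative d i) (at t0)"
    and gE: "eventually (\<lambda>t. g t \<in> coord_space n) (nhds t0)"
    and df: "\<And>i. i < n \<Longrightarrow> eventually (\<lambda>x. (\<lambda>h. f (x(i := h))) differentiable (at (x i))) (nbhds n (g t0))"
    and cf: "\<And>i. i < n \<Longrightarrow> contat n (partial i f) (g t0)"
  shows "((\<lambda>t. f (g t)) has_real_derivative (\<Sum>i<n. partial i f (g t0) * d i)) (at t0)"
proof -
  have gt0: "g t0 \<in> coord_space n" using gE eventually_nhds_x_imp_x by blast
  \<comment> \<open>In \<open>z m t\<close> the first \<open>m\<close> coordinates have been moved;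
    \<open>z 0 t\<close> is \<open>g t0\<close>, and \<open>z n t\<close> is \<open>g t\<close> for
    \<open>t\<close> near \<open>t0\<close>.\<close>
  define z where "z m t = (\<lambda>i. if i < m then g t i else g t0 i)" for m t
  have lim: "((\<lambda>t. (f (z (Suc m) t) - f (z m t)) / (t - t0)) \<longlongrightarrow> partial m f (g t0) * d m) (at t0)"
    if m: "m < n" for m
  proof -
    obtain e where e: "e > 0" "\<forall>x\<in>coord_space n. (\<forall>i<n. \<bar>x i - g t0 i\<bar> < e) \<longrightarrow>
        (\<lambda>h. f (x(m := h))) differentiable (at (x m))"
      using df[OF m] unfolding eventually_nbhds[OF gt0] by blast
    have tend: "((\<lambda>t. g t i) \<longlongrightarrow> g t0 i) (at t0)" if "i < n" for i
      using DERIV_isCont[OF dg[OF that]] by (simp add: isCont_def)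
    have "eventually (\<lambda>t. \<forall>i\<in>{..<n}. dist (g t i) (g t0 i) < e) (at t0)"
      by (rule eventually_ball_finite) (use tend e(1) in \<open>auto simp: tendsto_iff\<close>)
    moreover have gEa: "eventually (\<lambda>t. g t \<in> coord_space n) (at t0)"
      using gE by (simp add: eventually_nhds_conv_at)
    ultimately have "eventually (\<lambda>t. \<exists>w. w \<in> coord_space n \<and> (\<forall>i<n. \<bar>w i - g t0 i\<bar> \<le> \<bar>g t i - g t0 i\<bar>) \<and>
        f (z (Suc m) t) - f (z m t) = partial m f w * (g t m - g t0 m)) (at t0)"
    proof eventually_elim
      case (elim t)
      have zE: "z m t \<in> coord_space n" using gt0 elim(2) by (auto simp: z_def coord_space_def)
      have zs: "z (Suc m) t = (z m t)(m := g t m)" "z m t = (z m t)(m := g t0 m)"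
        by (auto simp: z_def fun_eq_iff less_Suc_eq)
      have D: "((\<lambda>h. f ((z m t)(m := h))) has_real_derivative partial m f ((z m t)(m := w))) (at w)"
        if "\<bar>w - g t0 m\<bar> \<le> \<bar>g t m - g t0 m\<bar>" for w
      proof -
        have "(\<lambda>h. f (((z m t)(m := w))(m := h))) differentiable (at (((z m t)(m := w)) m))"
        proof (rule e(2)[rule_format])
          show "(z m t)(m := w) \<in> coord_space n" by (rule coord_space_upd[OF zE m])
          fix i assume i: "i < n"
          have "\<bar>g t i - g t0 i\<bar> < e" "\<bar>g t m - g t0 m\<bar> < e"
            using elim(1) i m by (auto simp: dist_real_def)
          then show "\<bar>((z m t)(m := w)) i - g t0 i\<bar> < e"
            using that e(1) by (auto simp: z_def)
        qed
        then show ?thesis by (simp add: partial_def DERIV_deriv_iff_real_differentiable)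
      qed
      from mvt_symmetric[OF D] obtain w where w: "\<bar>w - g t0 m\<bar> \<le> \<bar>g t m - g t0 m\<bar>"
        "f ((z m t)(m := g t m)) - f ((z m t)(m := g t0 m)) = partial m f ((z m t)(m := w)) * (g t m - g t0 m)"
        by blast
      show ?case
        by (intro exI[of _ "(z m t)(m := w)"] conjI coord_space_upd[OF zE m])
          (use w zs in \<open>auto simp: z_def\<close>)
    qed
    then obtain w where w: "eventually (\<lambda>t. w t \<in> coord_space n \<and> (\<forall>i<n. \<bar>w t i - g t0 i\<bar> \<le> \<bar>g t i - g t0 i\<bar>) \<and>
        f (z (Suc m) t) - f (z m t) = partial m f (w t) * (g t m - g t0 m)) (at t0)"
      unfolding eventually_ex by blast
    have "filterlim w (nbhds n (g t0)) (at t0)"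
    proof (rule filterlim_nbhds[OF _ _ gt0])
      show "eventually (\<lambda>t. w t \<in> coord_space n) (at t0)" using w by (rule eventually_mono) auto
      fix i assume i: "i < n"
      have "((\<lambda>t. \<bar>g t i - g t0 i\<bar>) \<longlongrightarrow> 0) (at t0)"
        using tend[OF i] by (simp add: tendsto_rabs_zero_iff LIM_zero_iff)
      then have "((\<lambda>t. w t i - g t0 i) \<longlongrightarrow> 0) (at t0)"
        by (rule Lim_null_comparison[rotated]) (use w i in \<open>auto elim: eventually_mono\<close>)
      then show "((\<lambda>t. w t i) \<longlongrightarrow> g t0 i) (at t0)" by (simp add: LIM_zero_iff)
    qed
    then have "((\<lambda>t. partial m f (w t)) \<longlongrightarrow> partial m f (g t0)) (at t0)"
      using cf[OF m] unfolding contat_def by (rule filterlim_compose[rotated])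
    moreover have "((\<lambda>t. (g t m - g t0 m) / (t - t0)) \<longlongrightarrow> d m) (at t0)"
      using dg[OF m] by (simp add: has_field_derivative_iff)
    ultimately have "((\<lambda>t. partial m f (w t) * ((g t m - g t0 m) / (t - t0))) \<longlongrightarrow> partial m f (g t0) * d m) (at t0)"
      by (rule tendsto_mult)
    then show ?thesis
      by (rule Lim_transform_eventually) (use w in \<open>auto elim: eventually_mono\<close>)
  qed
  have "((\<lambda>t. \<Sum>m<n. (f (z (Suc m) t) - f (z m t)) / (t - t0)) \<longlongrightarrow> (\<Sum>m<n. partial m f (g t0) * d m)) (at t0)"
    by (intro tendsto_sum lim) auto
  moreover have "eventually (\<lambda>t. (\<Sum>m<n. (f (z (Suc m) t) - f (z m t)) / (t - t0)) = (f (g t) - f (g t0)) / (t - t0)) (at t0)"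
  proof -
    have "eventually (\<lambda>t. g t \<in> coord_space n) (at t0)" using gE by (simp add: eventually_nhds_conv_at)
    then show ?thesis
    proof eventually_elim
      case (elim t)
      have "z n t = g t" using elim gt0 by (auto simp: z_def coord_space_def fun_eq_iff)
      moreover have "z 0 t = g t0" by (auto simp: z_def)
      ultimately show ?case
        by (simp add: sum_divide_distrib[symmetric] sum_lessThan_telescope[of "\<lambda>m. f (z m t)" n])
    qed
  qed
  ultimately show ?thesis
    unfolding has_field_derivative_iff by (rule Lim_transform_eventually)
qed

text \<open>Induction on \<open>r\<close>: a partial derivative of the composite is a sum of
  products of some \<open>partial i f\<close> after \<open>G\<close>, covered by the induction
  hypothesis with the order of \<open>G\<close> lowered by one, and a derivative of
  \<open>G\<close>.\<close>

lemma Cr_comp: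
  assumes V: "openin (Euclidean_space n) V" and W: "openin (Euclidean_space p) W"
    and G: "\<And>x. x \<in> W \<Longrightarrow> G x \<in> V"
  shows "(\<And>i. i < n \<Longrightarrow> Cr p r W (\<lambda>x. G x i)) \<Longrightarrow> Cr n r V f \<Longrightarrow> Cr p r W (\<lambda>x. f (G x))"
proof (induction r arbitrary: f)
  have cont: "contat p (\<lambda>x. f (G x)) x"
    if x: "x \<in> W" and c: "\<And>i. i < n \<Longrightarrow> contat p (\<lambda>x. G x i) x" and f: "contat n f (G x)" for f x
  proof -
    have "filterlim G (nbhds n (G x)) (nbhds p x)"
    proof (rule filterlim_nbhds)
      show "eventually (\<lambda>x. G x \<in> coord_space n) (nbhds p x)"
        using eventually_nbhds_open[OF W x]
        by (rule eventually_mono) (use G openin_Euclidean_subset[OF V] in auto)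
    qed (use c G[OF x] openin_Euclidean_subset[OF V] in \<open>auto simp: contat_def\<close>)
    then show ?thesis using f unfolding contat_def by (rule filterlim_compose[rotated])
  qed
  {
    case 0
    then show ?case using cont G by simp
  next
    case (Suc r)
    have c: "contat p (\<lambda>x. f (G x)) x" if "x \<in> W" for x
      by (rule cont) (use Suc.prems G that in auto)
    have chain: "((\<lambda>h. f (G (x(j := h)))) has_real_derivative
        (\<Sum>i<n. partial i f (G x) * partial j (\<lambda>y. G y i) x)) (at (x j))"
      if x: "x \<in> W" and j: "j < p" for x j
    proof -
      have xE: "x \<in> coord_space p" using x openin_Euclidean_subset[OF W] by auto
      have "((\<lambda>h. f (G (x(j := h)))) has_real_derivative
        (\<Sum>i<n. partial i f (G (x(j := x j))) * partial j (\<lambda>y. G y i) x)) (at (x j))"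
      proof (rule chain_rule)
        fix i assume i: "i < n"
        show "((\<lambda>t. G (x(j := t)) i) has_real_derivative partial j (\<lambda>y. G y i) x) (at (x j))"
          using Suc.prems(1)[OF i] x j unfolding partial_def
          by (simp add: DERIV_deriv_iff_real_differentiable)
        show "\<forall>\<^sub>F y in nbhds n (G (x(j := x j))). (\<lambda>h. f (y(i := h))) differentiable at (y i)"
          using eventually_nbhds_open[OF V G[OF x]] Suc.prems(2) i
          by (auto elim!: eventually_mono)
        show "contat n (partial i f) (G (x(j := x j)))"
          using Suc.prems(2) i G[OF x] Cr_contat by auto
      next
        show "\<forall>\<^sub>F t in nhds (x j). G (x(j := t)) \<in> coord_space n"
          using eventually_nbhds_line[OF eventually_nbhds_open[OF W x] xE j]
          by (rule eventually_mono) (use G openin_Euclidean_subset[OF V] in auto)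
      qed
      then show ?thesis by simp
    qed
    have "Cr p r W (partial j (\<lambda>x. f (G x)))" if j: "j < p" for j
    proof (rule Cr_cong[OF W])
      show "Cr p r W (\<lambda>x. \<Sum>i<n. partial i f (G x) * partial j (\<lambda>y. G y i) x)"
      proof (intro Cr_sum[OF W] Cr_mult[OF W])
        fix i assume i: "i \<in> {..<n}"
        show "Cr p r W (\<lambda>x. partial i f (G x))"
          by (rule Suc.IH) (use Suc.prems(2) i Cr_pred[OF Suc.prems(1)] in auto)
        show "Cr p r W (partial j (\<lambda>y. G y i))" using Suc.prems(1) i j by auto
      qed
    next
      fix x assume "x \<in> W"
      then show "(\<Sum>i<n. partial i f (G x) * partial j (\<lambda>y. G y i) x) = partial j (\<lambda>x. f (G x)) x"
        using DERIV_imp_deriv[OF chain[OF _ j]] unfolding partial_def[of j "\<lambda>x. f (G x)"] by simp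
    qed
    then show ?case
      using c chain unfolding Cr.simps real_differentiable_def by blast
  }
qed

text \<open>Brings closure rules for C^r classes on open sets down to germs. \<open>P\<close>
  collects what is known near \<open>a\<close> about the ingredients of \<open>f\<close>.\<close>

lemma smooth_germ_Cr:
  assumes "a \<in> coord_space n" "eventually P (nbhds n a)"
    and "\<And>V r. openin (Euclidean_space n) V \<Longrightarrow> (\<And>x. x \<in> V \<Longrightarrow> P x) \<Longrightarrow> Cr n r V f"
  shows "smooth_germ n f a"
proof -
  obtain V where V: "openin (Euclidean_space n) V" "a \<in> V" "\<And>x. x \<in> V \<Longrightarrow> P x"
    using eventually_nbhds_E[OF assms(2,1)] by blast
  then have "\<forall>x\<in>V. smooth_at_point n f x"
    unfolding smooth_at_point_Cr using assms(3) by blast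
  then show ?thesis
    unfolding smooth_germ_def using assms(1) V(1,2) by (auto simp: eventually_nhdsin)
qed

lemma smooth_at_point_imp_Cr: "(\<And>x. x \<in> V \<Longrightarrow> smooth_at_point n f x) \<Longrightarrow> Cr n r V f"
  using smooth_at_point_Cr by blast

section \<open>Closure rules for smooth germs\<close>

lemma smooth_germ_const [simp]: "a \<in> coord_space n \<Longrightarrow> smooth_germ n (\<lambda>_. c) a"
  by (rule smooth_germ_Cr[where P = "\<lambda>_. True"]) (auto simp: Cr_const)

lemma smooth_germ_coord: "a \<in> coord_space n \<Longrightarrow> i < n \<Longrightarrow> smooth_germ n (\<lambda>x. x i) a"
  by (rule smooth_germ_Cr[where P = "\<lambda>x. x \<in> coord_space n"])
    (auto intro!: Cr_coord eventually_coord_space)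

lemma smooth_germ_add:
  assumes "smooth_germ n f a" "smooth_germ n g a"
  shows "smooth_germ n (\<lambda>x. f x + g x) a"
  by (rule smooth_germ_Cr[where P = "\<lambda>x. smooth_at_point n f x \<and> smooth_at_point n g x"])
    (use assms smooth_at_point_imp_Cr in \<open>auto simp: smooth_germ_def eventually_conj intro!: Cr_add\<close>)

lemma smooth_germ_mult:
  assumes "smooth_germ n f a" "smooth_germ n g a"
  shows "smooth_germ n (\<lambda>x. f x * g x) a"
  by (rule smooth_germ_Cr[where P = "\<lambda>x. smooth_at_point n f x \<and> smooth_at_point n g x"])
    (use assms smooth_at_point_imp_Cr in \<open>auto simp: smooth_germ_def eventually_conj intro!: Cr_mult\<close>)

lemma smooth_germ_sum:
  assumes "a \<in> coord_space n" "\<And>j. j \<in> A \<Longrightarrow> smooth_germ n (f j) a"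
  shows "smooth_germ n (\<lambda>x. \<Sum>j\<in>A. f j x) a"
  using assms(2)
  by (induction A rule: infinite_finite_induct) (auto intro!: smooth_germ_add simp: assms(1))

lemma smooth_germ_filterlim:
  assumes "\<And>i. i < n \<Longrightarrow> smooth_germ p (\<lambda>x. G x i) a"
    and "eventually (\<lambda>x. G x \<in> coord_space n) (nbhds p a)" "a \<in> coord_space p"
  shows "filterlim G (nbhds n (G a)) (nbhds p a)"
  by (rule filterlim_nbhds)
    (use assms smooth_germ_contat eventually_nbhds_self[OF assms(2,3)] in \<open>auto simp: contat_def\<close>)

lemma smooth_germ_comp:
  assumes f: "smooth_germ n f (G a)" and G: "\<And>i. i < n \<Longrightarrow> smooth_germ p (\<lambda>x. G x i) a"
    and GE: "eventually (\<lambda>x. G x \<in> coord_space n) (nbhds p a)" and a: "a \<in> coord_space p"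
  shows "smooth_germ p (\<lambda>x. f (G x)) a"
proof -
  obtain V where V: "openin (Euclidean_space n) V" "G a \<in> V" "\<And>x. x \<in> V \<Longrightarrow> smooth_at_point n f x"
    using smooth_germ_E[OF f] by blast
  have lim: "filterlim G (nbhds n (G a)) (nbhds p a)"
    using smooth_germ_filterlim[OF G GE a] .
  have ev: "eventually (\<lambda>x. G x \<in> V \<and> (\<forall>i\<in>{..<n}. smooth_at_point p (\<lambda>x. G x i) x)) (nbhds p a)"
    using G lim eventually_nbhds_open[OF V(1,2)]
    by (intro eventually_conj eventually_ball_finite) (auto simp: smooth_germ_def filterlim_iff)
  show ?thesis
  proof (rule smooth_germ_Cr[OF a ev])
    fix W r assume "openin (Euclidean_space p) W"
      "\<And>x. x \<in> W \<Longrightarrow> G x \<in> V \<and> (\<forall>i\<in>{..<n}. smooth_at_point p (\<lambda>x. G x i) x)"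
    then show "Cr p r W (\<lambda>x. f (G x))"
      by - (rule Cr_comp[OF V(1)], auto simp: V(3) smooth_at_point_imp_Cr)
  qed
qed

lemma partial_comp:
  assumes f: "smooth_germ n f (G a)" and G: "\<And>i. i < n \<Longrightarrow> smooth_germ p (\<lambda>x. G x i) a"
    and GE: "eventually (\<lambda>x. G x \<in> coord_space n) (nbhds p a)" and a: "a \<in> coord_space p" and j: "j < p"
  shows "partial j (\<lambda>x. f (G x)) a = (\<Sum>i<n. partial i f (G a) * partial j (\<lambda>x. G x i) a)"
proof -
  have "((\<lambda>h. f (G (a(j := h)))) has_real_derivative
      (\<Sum>i<n. partial i f (G (a(j := a j))) * partial j (\<lambda>y. G y i) a)) (at (a j))"
  proof (rule chain_rule)
    fix i assume i: "i < n"
    show "((\<lambda>t. G (a(j := t)) i) has_real_derivative partial j (\<lambda>y. G y i) a) (at (a j))"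
      using smooth_germ_partial_deriv[OF G[OF i] j] .
    show "\<forall>\<^sub>F y in nbhds n (G (a(j := a j))). (\<lambda>h. f (y(i := h))) differentiable at (y i)"
      using f i smooth_at_point_differentiable by (auto simp: smooth_germ_def elim!: eventually_mono)
    show "contat n (partial i f) (G (a(j := a j)))"
      using smooth_germ_contat[OF smooth_germ_partial[OF f i]] by simp
  next
    show "\<forall>\<^sub>F t in nhds (a j). G (a(j := t)) \<in> coord_space n"
      by (rule eventually_nbhds_line[OF GE a j])
  qed
  then show ?thesis unfolding partial_def[of j "\<lambda>x. f (G x)"] by (simp add: DERIV_imp_deriv)
qed

lemma eventually_partial_comp:
  assumes f: "smooth_germ n f (G a)" and G: "\<And>i. i < n \<Longrightarrow> smooth_germ p (\<lambda>x. G x i) a"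
    and GE: "eventually (\<lambda>x. G x \<in> coord_space n) (nbhds p a)" and a: "a \<in> coord_space p" and j: "j < p"
  shows "eventually (\<lambda>x. partial j (\<lambda>x. f (G x)) x =
    (\<Sum>i<n. partial i f (G x) * partial j (\<lambda>x. G x i) x)) (nbhds p a)"
proof -
  have "eventually (\<lambda>x. smooth_germ n f (G x)) (nbhds p a)"
    using smooth_germ_filterlim[OF G GE a] smooth_germ_eventually[OF f] by (auto simp: filterlim_iff)
  moreover have "eventually (\<lambda>x. \<forall>i\<in>{..<n}. smooth_germ p (\<lambda>x. G x i) x) (nbhds p a)"
    by (rule eventually_ball_finite) (use G smooth_germ_eventually in auto)
  moreover note eventually_coord_space[of p a] eventually_eventually_nbhds[OF GE]
  ultimately show ?thesis
    by eventually_elim (intro partial_comp, use j in auto)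
qed

lemma eventually_partial_add:
  assumes "smooth_germ n f a" "smooth_germ n g a" "i < n"
  shows "eventually (\<lambda>x. partial i (\<lambda>x. f x + g x) x = partial i f x + partial i g x) (nbhds n a)"
  using smooth_germ_eventually[OF assms(1)] smooth_germ_eventually[OF assms(2)]
  by eventually_elim (use assms(3) in \<open>auto intro!: partial_add smooth_germ_differentiable\<close>)

lemma eventually_partial_mult:
  assumes "smooth_germ n f a" "smooth_germ n g a" "i < n"
  shows "eventually (\<lambda>x. partial i (\<lambda>x. f x * g x) x = partial i f x * g x + f x * partial i g x) (nbhds n a)"
  using smooth_germ_eventually[OF assms(1)] smooth_germ_eventually[OF assms(2)]
  by eventually_elim (use assms(3) in \<open>auto intro!: partial_mult smooth_germ_differentiable\<close>)

lemma partial_sum: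
  assumes "\<And>j. j \<in> A \<Longrightarrow> smooth_germ n (f j) a" "i < n"
  shows "partial i (\<lambda>x. \<Sum>j\<in>A. f j x) a = (\<Sum>j\<in>A. partial i (f j) a)"
  using smooth_germ_partial_deriv[OF assms(1,2)]
  by (simp add: partial_def[of i "\<lambda>x. \<Sum>j\<in>A. f j x"] DERIV_imp_deriv DERIV_sum)

text \<open>Shown as an equation near \<open>a\<close>, not only at \<open>a\<close>, since each
  induction step differentiates the previous equation. The same device serves for scaling and for
  permuted indices below.\<close>

lemma partials_sum:
  assumes "\<And>j. j \<in> A \<Longrightarrow> smooth_germ n (f j) a" "set is \<subseteq> {..<n}" "a \<in> coord_space n" "finite A"
  shows "partials is (\<lambda>x. \<Sum>j\<in>A. f j x) a = (\<Sum>j\<in>A. partials is (f j) a)"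
proof -
  have "eventually (\<lambda>x. partials is (\<lambda>x. \<Sum>j\<in>A. f j x) x = (\<Sum>j\<in>A. partials is (f j) x)) (nbhds n a)"
    using assms(2)
  proof (induction "is")
    case (Cons i "is")
    have "eventually (\<lambda>x. \<forall>j\<in>A. smooth_germ n (partials is (f j)) x) (nbhds n a)"
      by (rule eventually_ball_finite)
        (use Cons.prems assms(1,4) in \<open>auto intro!: smooth_germ_eventually smooth_germ_partials\<close>)
    moreover have "eventually (\<lambda>x. partial i (partials is (\<lambda>x. \<Sum>j\<in>A. f j x)) x =
        partial i (\<lambda>x. \<Sum>j\<in>A. partials is (f j) x) x) (nbhds n a)"
      using Cons by (intro eventually_partial_cong) auto
    ultimately show ?case
      by eventually_elim (use Cons.prems in \<open>simp add: partial_sum[where n = n]\<close>)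
  qed simp
  then show ?thesis using eventually_nbhds_self assms(3) by blast
qed

lemma partial_scale: "smooth_germ n f a \<Longrightarrow> i < n \<Longrightarrow> partial i (\<lambda>x. c * f x) a = c * partial i f a"
  using DERIV_imp_deriv[OF DERIV_cmult[OF smooth_germ_partial_deriv, of n f a i c]]
  by (simp add: partial_def[of i "\<lambda>x. c * f x"])

lemma partials_scale:
  assumes "smooth_germ n f a" "set is \<subseteq> {..<n}"
  shows "partials is (\<lambda>x. c * f x) a = c * partials is f a"
proof -
  have "eventually (\<lambda>x. partials is (\<lambda>x. c * f x) x = c * partials is f x) (nbhds n a)"
    using assms(2)
  proof (induction "is")
    case (Cons i "is")
    have "eventually (\<lambda>x. partial i (partials is (\<lambda>x. c * f x)) x =
        partial i (\<lambda>x. c * partials is f x) x) (nbhds n a)"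
      using Cons by (intro eventually_partial_cong) auto
    moreover have "eventually (smooth_germ n (partials is f)) (nbhds n a)"
      using Cons.prems assms(1) by (auto intro!: smooth_germ_eventually smooth_germ_partials)
    ultimately show ?case by eventually_elim (use Cons.prems partial_scale in auto)
  qed simp
  then show ?thesis using eventually_nbhds_self assms(1) smooth_germ_coord_space by blast
qed

text \<open>The second difference is a difference in direction \<open>j\<close> of increments in
  direction \<open>i\<close>; one mean value in each direction turns it into a mixed derivative at a
  point within \<open>h\<close> of \<open>a\<close> in every coordinate.\<close>

lemma second_difference:
  assumes sm: "\<And>x. x \<in> coord_space n \<Longrightarrow> (\<And>l. l < n \<Longrightarrow> \<bar>x l - a l\<bar> < e) \<Longrightarrow> smooth_germ n f x"
    and a: "a \<in> coord_space n" and ij: "i < n" "j < n" "i \<noteq> j" and h: "0 < h" "h < e"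
  shows "\<exists>w\<in>coord_space n. (\<forall>l<n. \<bar>w l - a l\<bar> \<le> h) \<and>
    f (a(i := a i + h, j := a j + h)) - f (a(j := a j + h)) - f (a(i := a i + h)) + f a =
    h * h * partial i (partial j f) w"
proof -
  let ?q = "\<lambda>u. f (a(i := a i + h, j := u)) - f (a(j := u))"
  let ?z = "\<lambda>u v. a(i := u, j := v)"
  have box: "?z u v \<in> coord_space n \<and> (\<forall>l<n. \<bar>?z u v l - a l\<bar> \<le> h)"
    if "\<bar>u - a i\<bar> \<le> h" "\<bar>v - a j\<bar> \<le> h" for u v
    using that a ij h coord_space_upd by auto
  have smz: "smooth_germ n f (?z u v)" if "\<bar>u - a i\<bar> \<le> h" "\<bar>v - a j\<bar> \<le> h" for u v
    using box[OF that] h(2) by (intro sm) (auto intro: le_less_trans)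
  have Dj: "((\<lambda>v. f (?z u v)) has_real_derivative partial j f (?z u v)) (at v)"
    if "\<bar>u - a i\<bar> \<le> h" "\<bar>v - a j\<bar> \<le> h" for u v
    using smooth_germ_partial_deriv[OF smz[OF that] ij(2)] by simp
  have Di: "((\<lambda>u. partial j f (?z u v)) has_real_derivative partial i (partial j f) (?z u v)) (at u)"
    if "\<bar>u - a i\<bar> \<le> h" "\<bar>v - a j\<bar> \<le> h" for u v
    using smooth_germ_partial_deriv[OF smooth_germ_partial[OF smz[OF that] ij(2)] ij(1)] ij(3)
    by (simp add: fun_upd_twist)
  have "\<exists>v. \<bar>v - a j\<bar> \<le> \<bar>(a j + h) - a j\<bar> \<and> ?q (a j + h) - ?q (a j) =
      (partial j f (?z (a i + h) v) - partial j f (?z (a i) v)) * ((a j + h) - a j)"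
  proof (rule mvt_symmetric)
    fix v assume "\<bar>v - a j\<bar> \<le> \<bar>a j + h - a j\<bar>"
    then show "(?q has_real_derivative (partial j f (?z (a i + h) v) - partial j f (?z (a i) v))) (at v)"
      using Dj[of "a i + h" v] Dj[of "a i" v] h by (intro DERIV_diff) auto
  qed
  then obtain v where v: "\<bar>v - a j\<bar> \<le> h" "?q (a j + h) - ?q (a j) =
      (partial j f (?z (a i + h) v) - partial j f (?z (a i) v)) * h"
    using h by auto
  have "\<exists>u. \<bar>u - a i\<bar> \<le> \<bar>(a i + h) - a i\<bar> \<and> partial j f (?z (a i + h) v) - partial j f (?z (a i) v) =
      partial i (partial j f) (?z u v) * ((a i + h) - a i)"
    using v(1) h by (intro mvt_symmetric Di) auto
  then obtain u where u: "\<bar>u - a i\<bar> \<le> h" "partial j f (?z (a i + h) v) - partial j f (?z (a i) v) =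
      partial i (partial j f) (?z u v) * h"
    using h by auto
  have "f (a(i := a i + h, j := a j)) = f (a(i := a i + h))"
    using ij(3) by (simp add: fun_upd_idem)
  then show ?thesis
    using box[OF u(1) v(1)] u(2) v(2)
    by (intro bexI[of _ "?z u v"]) (auto simp: algebra_simps)
qed

text \<open>The second difference is symmetric in \<open>i\<close> and \<open>j\<close>. Dividing by
  \<open>h * h\<close> equates the two mixed derivatives at two points close to \<open>a\<close>,
  and continuity moves both points to \<open>a\<close>.\<close>

lemma partial_commute:
  assumes "smooth_germ n f a" "i < n" "j < n"
  shows "partial i (partial j f) a = partial j (partial i f) a"
proof (cases "i = j")
  case False
  have a: "a \<in> coord_space n" using assms(1) smooth_germ_coord_space by blast
  obtain e where e: "e > 0" "\<And>x. x \<in> coord_space n \<Longrightarrow> (\<And>l. l < n \<Longrightarrow> \<bar>x l - a l\<bar> < e) \<Longrightarrow> smooth_germ n f x"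
    using smooth_germ_eventually[OF assms(1)] unfolding eventually_nbhds[OF a] by blast
  have "\<bar>partial i (partial j f) a - partial j (partial i f) a\<bar> \<le> d" if "d > 0" for d
  proof -
    have "eventually (\<lambda>x. dist (partial i (partial j f) x) (partial i (partial j f) a) < d / 2 \<and>
        dist (partial j (partial i f) x) (partial j (partial i f) a) < d / 2) (nbhds n a)"
      using smooth_germ_contat[OF smooth_germ_partial[OF smooth_germ_partial[OF assms(1)]]] assms(2,3) that
      unfolding contat_def tendsto_iff by (intro eventually_conj) (meson half_gt_zero)+
    then obtain b where b: "b > 0" "\<And>x. x \<in> coord_space n \<Longrightarrow> (\<And>l. l < n \<Longrightarrow> \<bar>x l - a l\<bar> < b) \<Longrightarrow>
        dist (partial i (partial j f) x) (partial i (partial j f) a) < d / 2 \<and>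
        dist (partial j (partial i f) x) (partial j (partial i f) a) < d / 2"
      unfolding eventually_nbhds[OF a] by blast
    \<comment> \<open>Small enough for smoothness on the box and for both mixed derivatives to be
      within \<open>d / 2\<close> of their values at \<open>a\<close>.\<close>
    define h where "h = min e b / 2"
    have h: "0 < h" "h < e" "h < b" using e(1) b(1) by (auto simp: h_def)
    obtain w where w: "w \<in> coord_space n" "\<forall>l<n. \<bar>w l - a l\<bar> \<le> h"
      "f (a(i := a i + h, j := a j + h)) - f (a(j := a j + h)) - f (a(i := a i + h)) + f a =
        h * h * partial i (partial j f) w"
      using second_difference[OF e(2) a assms(2,3) False h(1,2)] by blast
    obtain w' where w': "w' \<in> coord_space n" "\<forall>l<n. \<bar>w' l - a l\<bar> \<le> h"
      "f (a(j := a j + h, i := a i + h)) - f (a(i := a i + h)) - f (a(j := a j + h)) + f a =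
        h * h * partial j (partial i f) w'"
      using second_difference[OF e(2) a assms(3,2) False[symmetric] h(1,2)] by blast
    have "h * h * partial i (partial j f) w = h * h * partial j (partial i f) w'"
      using w(3) w'(3) unfolding fun_upd_twist[OF False, of a "a i + h" "a j + h"] by linarith
    then have "partial i (partial j f) w = partial j (partial i f) w'" using h(1) by simp
    moreover have "dist (partial i (partial j f) w) (partial i (partial j f) a) < d / 2"
      "dist (partial j (partial i f) w') (partial j (partial i f) a) < d / 2"
      using b(2)[OF w(1)] b(2)[OF w'(1)] w(2) w'(2) h(3) le_less_trans by blast+
    ultimately show ?thesis unfolding dist_real_def by linarith
  qed
  then show ?thesis by (metis abs_le_zero_iff dense_ge eq_iff_diff_eq_0)
qed simp

lemma partial_partials_commute:
  assumes "smooth_germ n f a" "i < n" "set is \<subseteq> {..<n}"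
  shows "partial i (partials is f) a = partials is (partial i f) a"
proof -
  have "eventually (\<lambda>x. partial i (partials is f) x = partials is (partial i f) x) (nbhds n a)"
    using assms(3)
  proof (induction "is")
    case (Cons j "is")
    have "eventually (\<lambda>x. partial j (partial i (partials is f)) x =
        partial j (partials is (partial i f)) x) (nbhds n a)"
      using Cons by (intro eventually_partial_cong) auto
    moreover have "eventually (smooth_germ n (partials is f)) (nbhds n a)"
      using Cons.prems assms(1) by (auto intro!: smooth_germ_eventually smooth_germ_partials)
    ultimately show ?case
      by eventually_elim (use Cons.prems partial_commute assms(2) in auto)
  qed simp
  then show ?thesis using eventually_nbhds_self assms(1) smooth_germ_coord_space by blast
qed

text \<open>The head of one list is moved to its place in the other by
  \<open>partial_partials_commute\<close>, and the tails are compared by induction. As a consequence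
  every derivative in two parameters can be brought into the form \<open>mixed\<close>.\<close>

lemma partials_permute:
  assumes "smooth_germ n f a" "set is \<subseteq> {..<n}" "mset is = mset js"
  shows "partials is f a = partials js f a"
proof -
  have "eventually (\<lambda>x. partials is f x = partials js f x) (nbhds n a)"
    using assms(2,3)
  proof (induction "is" arbitrary: js)
    case (Cons i "is")
    then have "i \<in> set js" by (metis list.set_intros(1) mset_eq_setD)
    then obtain xs ys where js: "js = xs @ i # ys" by (meson split_list)
    have set_js: "set js \<subseteq> {..<n}" using Cons.prems by (metis mset_eq_setD)
    have "eventually (\<lambda>x. partials is f x = partials (xs @ ys) f x) (nbhds n a)"
      using Cons js by (intro Cons.IH) auto
    then have "eventually (\<lambda>x. partial i (partials is f) x = partial i (partials (xs @ ys) f) x) (nbhds n a)"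
      using Cons.prems by (intro eventually_partial_cong) auto
    moreover have "eventually (smooth_germ n (partials ys f)) (nbhds n a)"
      using set_js js assms(1) by (auto intro!: smooth_germ_eventually smooth_germ_partials)
    ultimately show ?case
      by eventually_elim (use set_js js partial_partials_commute in auto)
  qed simp
  then show ?thesis using eventually_nbhds_self assms(1) smooth_germ_coord_space by blast
qed

section \<open>Derivatives along sublists\<close>

text \<open>Jets and iterated tangent vectors are both described by derivatives along families of lists that
  are closed under sublists; quantifying over sublists makes the following relation compatible with
  products and compositions.\<close>

definition agree :: "(nat \<Rightarrow> real) \<Rightarrow> nat list \<Rightarrow> ((nat \<Rightarrow> real) \<Rightarrow> real) \<Rightarrow> ((nat \<Rightarrow> real) \<Rightarrow> real) \<Rightarrow> bool" where
  "agree a is u v \<longleftrightarrow> (\<forall>js. subseq js is \<longrightarrow> partials js u a = partials js v a)"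

lemma subseq_snoc_iff: "subseq js (is @ [j]) \<longleftrightarrow> subseq js is \<or> (\<exists>js'. js = js' @ [j] \<and> subseq js' is)"
proof
  assume "subseq js (is @ [j])"
  then obtain xs ys where "js = xs @ ys" "subseq xs is" "subseq ys [j]"
    using subseq_appendE by blast
  then show "subseq js is \<or> (\<exists>js'. js = js' @ [j] \<and> subseq js' is)"
    by (cases ys) (auto simp: subseq_Cons2_iff split: if_splits)
qed (auto intro: list_emb_append2 list_emb_append_mono)

text \<open>The last index is the innermost derivative, so agreement along a longer list reduces to
  agreement of the functions and of their derivatives along the shorter one. With this recursion the
  product and chain rules are applied once per step, and formulas for their iterates are
  avoided.\<close>

lemma agree_snoc: "agree a (is @ [j]) u v \<longleftrightarrow> agree a is u v \<and> agree a is (partial j u) (partial j v)"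
  unfolding agree_def subseq_snoc_iff by (auto simp: all_conj_distrib imp_conjR)

lemma agree_Nil: "agree a [] u v \<longleftrightarrow> u a = v a"
  by (auto simp: agree_def dest!: list_emb_Nil2)

lemma agree_D: "agree a is u v \<Longrightarrow> partials is u a = partials is v a"
  by (simp add: agree_def)

lemma agree_point: "agree a is u v \<Longrightarrow> u a = v a"
  unfolding agree_def by (metis foldr.simps(1) id_apply list_emb_Nil)

lemma eventually_eq_sym: "eventually (\<lambda>x. f x = g x) F \<Longrightarrow> eventually (\<lambda>x. g x = f x) F"
  by (erule eventually_mono) simp

lemma agree_cong:
  assumes "agree a is u v" "set is \<subseteq> {..<p}" "a \<in> coord_space p"
    "eventually (\<lambda>x. u x = u' x) (nbhds p a)" "eventually (\<lambda>x. v x = v' x) (nbhds p a)"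
  shows "agree a is u' v'"
  unfolding agree_def
proof (intro allI impI)
  fix js assume js: "subseq js is"
  then have "set js \<subseteq> {..<p}" using assms(2) list_emb_set[OF js] by blast
  then have "partials js u a = partials js u' a" "partials js v a = partials js v' a"
    using assms(3-5) partials_cong by blast+
  then show "partials js u' a = partials js v' a" using assms(1) js by (simp add: agree_def)
qed

lemma agree_add:
  assumes "smooth_germ p u a" "smooth_germ p v a" "smooth_germ p u' a" "smooth_germ p v' a"
    and "set is \<subseteq> {..<p}" "agree a is u u'" "agree a is v v'"
  shows "agree a is (\<lambda>x. u x + v x) (\<lambda>x. u' x + v' x)"
  using assms
proof (induction "is" arbitrary: u v u' v' rule: rev_induct)
  case Nil
  then show ?case by (simp add: agree_Nil)
next
  case (snoc j "is")
  have j: "j < p" "set is \<subseteq> {..<p}" using snoc.prems by auto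
  have "agree a is (partial j (\<lambda>x. u x + v x)) (partial j (\<lambda>x. u' x + v' x))"
  proof (rule agree_cong[OF _ j(2) smooth_germ_coord_space[OF snoc.prems(1)]])
    show "agree a is (\<lambda>x. partial j u x + partial j v x) (\<lambda>x. partial j u' x + partial j v' x)"
      by (rule snoc.IH) (use snoc.prems j agree_snoc smooth_germ_partial in auto)
  qed (rule eventually_eq_sym[OF eventually_partial_add[OF snoc.prems(1,2) j(1)]],
      rule eventually_eq_sym[OF eventually_partial_add[OF snoc.prems(3,4) j(1)]])
  moreover have "agree a is (\<lambda>x. u x + v x) (\<lambda>x. u' x + v' x)"
    by (rule snoc.IH) (use snoc.prems j agree_snoc in auto)
  ultimately show ?case by (simp add: agree_snoc)
qed

lemma agree_mult:
  assumes "smooth_germ p u a" "smooth_germ p v a" "smooth_germ p u' a" "smooth_germ p v' a"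
    and "set is \<subseteq> {..<p}" "agree a is u u'" "agree a is v v'"
  shows "agree a is (\<lambda>x. u x * v x) (\<lambda>x. u' x * v' x)"
  using assms
proof (induction "is" arbitrary: u v u' v' rule: rev_induct)
  case Nil
  then show ?case by (simp add: agree_Nil)
next
  case (snoc j "is")
  have j: "j < p" "set is \<subseteq> {..<p}" using snoc.prems by auto
  have "agree a is (partial j (\<lambda>x. u x * v x)) (partial j (\<lambda>x. u' x * v' x))"
  proof (rule agree_cong[OF _ j(2) smooth_germ_coord_space[OF snoc.prems(1)]])
    show "agree a is (\<lambda>x. partial j u x * v x + u x * partial j v x)
        (\<lambda>x. partial j u' x * v' x + u' x * partial j v' x)"
    proof (rule agree_add[where p = p])
      show "agree a is (\<lambda>x. partial j u x * v x) (\<lambda>x. partial j u' x * v' x)"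
        "agree a is (\<lambda>x. u x * partial j v x) (\<lambda>x. u' x * partial j v' x)"
        by (rule snoc.IH; use snoc.prems j agree_snoc smooth_germ_partial in auto)+
    qed (use snoc.prems j smooth_germ_partial in \<open>auto intro!: smooth_germ_mult\<close>)
  qed (rule eventually_eq_sym[OF eventually_partial_mult[OF snoc.prems(1,2) j(1)]],
      rule eventually_eq_sym[OF eventually_partial_mult[OF snoc.prems(3,4) j(1)]])
  moreover have "agree a is (\<lambda>x. u x * v x) (\<lambda>x. u' x * v' x)"
    by (rule snoc.IH) (use snoc.prems j agree_snoc in auto)
  ultimately show ?case by (simp add: agree_snoc)
qed

lemma agree_refl: "agree a is u u"
  by (simp add: agree_def)

lemma agree_sum:
  assumes "a \<in> coord_space p" "set is \<subseteq> {..<p}"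
    and "\<And>i. i \<in> A \<Longrightarrow> smooth_germ p (u i) a" "\<And>i. i \<in> A \<Longrightarrow> smooth_germ p (v i) a"
    and "\<And>i. i \<in> A \<Longrightarrow> agree a is (u i) (v i)"
  shows "agree a is (\<lambda>x. \<Sum>i\<in>A. u i x) (\<lambda>x. \<Sum>i\<in>A. v i x)"
  using assms(3-)
proof (induction A rule: infinite_finite_induct)
  case (insert i A)
  have "agree a is (\<lambda>x. u i x + (\<Sum>i\<in>A. u i x)) (\<lambda>x. v i x + (\<Sum>i\<in>A. v i x))"
    by (rule agree_add[where p = p]) (use insert assms(1,2) in \<open>auto intro!: smooth_germ_sum\<close>)
  then show ?case using insert by simp
qed (auto simp: agree_refl)

text \<open>The reason why derivatives in one chart determine those in another. One differentiation
  of \<open>f\<close> after \<open>G\<close> leaves sums of products of \<open>partial i f\<close>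
  after \<open>G\<close> with derivatives of \<open>G\<close>, so the induction runs over all
  \<open>f\<close> at once.\<close>

lemma agree_comp:
  assumes "smooth_germ n f (G a)" "a \<in> coord_space p" "set is \<subseteq> {..<p}"
    and "\<And>i. i < n \<Longrightarrow> smooth_germ p (\<lambda>x. G x i) a" "eventually (\<lambda>x. G x \<in> coord_space n) (nbhds p a)"
    and "\<And>i. i < n \<Longrightarrow> smooth_germ p (\<lambda>x. H x i) a" "eventually (\<lambda>x. H x \<in> coord_space n) (nbhds p a)"
    and "\<And>i. i < n \<Longrightarrow> agree a is (\<lambda>x. G x i) (\<lambda>x. H x i)"
  shows "agree a is (\<lambda>x. f (G x)) (\<lambda>x. f (H x))"
proof -
  have "G a \<in> coord_space n" "H a \<in> coord_space n"
    using assms(2,5,7) eventually_nbhds_self by blast+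
  \<comment> \<open>Agreement includes the empty sublist, so the two maps have the same value at
    \<open>a\<close>, and smoothness of \<open>f\<close> at \<open>G a\<close> serves both.\<close>
  then have GH: "G a = H a"
    using coord_space_eq_iff assms(8) agree_point by blast
  show ?thesis
    using assms(1,3,8)
  proof (induction "is" arbitrary: f rule: rev_induct)
    case Nil
    then show ?case using GH by (simp add: agree_Nil)
  next
    case (snoc j "is")
    have j: "j < p" "set is \<subseteq> {..<p}" using snoc.prems by auto
    have sm: "smooth_germ n f (H a)" using snoc.prems(1) GH by simp
    have "agree a is (partial j (\<lambda>x. f (G x))) (partial j (\<lambda>x. f (H x)))"
    proof (rule agree_cong[OF _ j(2) assms(2)])
      show "agree a is (\<lambda>x. \<Sum>i<n. partial i f (G x) * partial j (\<lambda>x. G x i) x)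
        (\<lambda>x. \<Sum>i<n. partial i f (H x) * partial j (\<lambda>x. H x i) x)"
      proof (rule agree_sum[OF assms(2) j(2)])
        fix i assume "i \<in> {..<n}"
        then have i: "i < n" by simp
        have 1: "smooth_germ p (\<lambda>x. partial i f (G x)) a"
          by (rule smooth_germ_comp[OF smooth_germ_partial[OF snoc.prems(1) i] assms(4,5,2)])
        have 2: "smooth_germ p (\<lambda>x. partial i f (H x)) a"
          by (rule smooth_germ_comp[OF smooth_germ_partial[OF sm i] assms(6,7,2)])
        have 3: "smooth_germ p (partial j (\<lambda>x. G x i)) a" "smooth_germ p (partial j (\<lambda>x. H x i)) a"
          using smooth_germ_partial[OF assms(4)[OF i] j(1)] smooth_germ_partial[OF assms(6)[OF i] j(1)] by auto
        show "smooth_germ p (\<lambda>x. partial i f (G x) * partial j (\<lambda>x. G x i) x) a"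
          "smooth_germ p (\<lambda>x. partial i f (H x) * partial j (\<lambda>x. H x i) x) a"
          by (rule smooth_germ_mult[OF 1 3(1)], rule smooth_germ_mult[OF 2 3(2)])
        show "agree a is (\<lambda>x. partial i f (G x) * partial j (\<lambda>x. G x i) x)
            (\<lambda>x. partial i f (H x) * partial j (\<lambda>x. H x i) x)"
        proof (rule agree_mult[OF 1 3(1) 2 3(2) j(2)])
          show "agree a is (\<lambda>x. partial i f (G x)) (\<lambda>x. partial i f (H x))"
            by (rule snoc.IH[OF smooth_germ_partial[OF snoc.prems(1) i] j(2)])
              (use snoc.prems(3) agree_snoc in blast)
          show "agree a is (partial j (\<lambda>x. G x i)) (partial j (\<lambda>x. H x i))"
            using snoc.prems(3)[OF i] agree_snoc by blast
        qed
      qed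
      show "\<forall>\<^sub>F x in nbhds p a. (\<Sum>i<n. partial i f (G x) * partial j (\<lambda>x. G x i) x) = partial j (\<lambda>x. f (G x)) x"
        by (rule eventually_eq_sym[OF eventually_partial_comp[OF snoc.prems(1) assms(4,5,2) j(1)]])
      show "\<forall>\<^sub>F x in nbhds p a. (\<Sum>i<n. partial i f (H x) * partial j (\<lambda>x. H x i) x) = partial j (\<lambda>x. f (H x)) x"
        by (rule eventually_eq_sym[OF eventually_partial_comp[OF sm assms(6,7,2) j(1)]])
    qed
    moreover have "agree a is (\<lambda>x. f (G x)) (\<lambda>x. f (H x))"
      by (rule snoc.IH[OF snoc.prems(1) j(2)]) (use snoc.prems(3) agree_snoc in blast)
    ultimately show ?case by (simp add: agree_snoc)
  qed
qed


section \<open>Functions of one and two parameters\<close>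

abbreviation point1 :: "real \<Rightarrow> nat \<Rightarrow> real" where
  "point1 t \<equiv> (\<lambda>i. if i = 0 then t else 0)"

definition point2 :: "real \<Rightarrow> real \<Rightarrow> nat \<Rightarrow> real" where
  "point2 s t = (\<lambda>i. if i = 0 then s else if i = 1 then t else 0)"

lemma point_coord_space [simp]: "point1 t \<in> coord_space (Suc 0)" "point2 s t \<in> coord_space 2"
  by (auto simp: coord_space_def point2_def)

lemma point2_simps [simp]: "point2 s t 0 = s" "point2 s t (Suc 0) = t" "point2 0 0 = origin"
  "(point2 s t)(0 := u) = point2 u t" "(point2 s t)(Suc 0 := u) = point2 s u"
  by (auto simp: point2_def fun_eq_iff)

lemma point2_coord: "x \<in> coord_space 2 \<Longrightarrow> point2 (x 0) (x (Suc 0)) = x"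
  by (auto simp: point2_def coord_space_def fun_eq_iff not_less_eq_eq numeral_2_eq_2)

lemma eventually_nbhds1: "eventually (\<lambda>x. P (x 0)) (nbhds (Suc 0) (point1 t)) \<longleftrightarrow> eventually P (nhds t)"
proof -
  have "(\<forall>x\<in>coord_space (Suc 0). \<bar>x 0 - t\<bar> < e \<longrightarrow> P (x 0)) \<longleftrightarrow> (\<forall>y. \<bar>y - t\<bar> < e \<longrightarrow> P y)" for e
  proof (intro iffI allI impI)
    fix y assume h: "\<forall>x\<in>coord_space (Suc 0). \<bar>x 0 - t\<bar> < e \<longrightarrow> P (x 0)" "\<bar>y - t\<bar> < e"
    show "P y" using h(1)[rule_format, OF point_coord_space(1)[of y]] h(2) by simp
  qed simp
  then show ?thesis
    unfolding eventually_nbhds[OF point_coord_space(1)] eventually_nhds_metric by (simp add: dist_real_def)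
qed

section \<open>One parameter: iterated \<open>deriv\<close> as partial derivatives\<close>

lemma partials_replicate: "partials (replicate \<alpha> 0) (\<lambda>x. f (x 0)) = (\<lambda>x. (deriv ^^ \<alpha>) f (x 0))"
  by (induction \<alpha>) (auto simp: partial_def fun_eq_iff)

lemma list_in_1: "set is \<subseteq> {..<Suc 0} \<Longrightarrow> is = replicate (length is) 0"
  by (induction "is") auto

definition smooth1 :: "(real \<Rightarrow> real) \<Rightarrow> real \<Rightarrow> bool" where
  "smooth1 f t \<longleftrightarrow> eventually (\<lambda>u. \<forall>\<alpha>. (deriv ^^ \<alpha>) f differentiable (at u)) (nhds t)"

lemma smooth1_eventually: "smooth1 f t \<Longrightarrow> eventually (smooth1 f) (nhds t)"
  unfolding smooth1_def by (simp add: eventually_eventually)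

lemma smooth1_differentiable: "smooth1 f t \<Longrightarrow> (deriv ^^ \<alpha>) f differentiable (at t)"
  unfolding smooth1_def using eventually_nhds_x_imp_x by blast

text \<open>In one variable a differentiable derivative is continuous, so existence of all
  derivatives near \<open>t\<close> amounts to smoothness of the germ. What is proved for germs
  thereby becomes available for curves, whose definition speaks of iterated
  \<open>deriv\<close>.\<close>

lemma smooth1_germ: "smooth1 f t \<longleftrightarrow> smooth_germ (Suc 0) (\<lambda>x. f (x 0)) (point1 t)"
proof -
  have "smooth_at_point (Suc 0) (\<lambda>x. f (x 0)) x \<longleftrightarrow> (\<forall>\<alpha>. (deriv ^^ \<alpha>) f differentiable (at (x 0)))"
    if x: "x \<in> coord_space (Suc 0)" for x
  proof
    assume h: "\<forall>\<alpha>. (deriv ^^ \<alpha>) f differentiable (at (x 0))"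
    show "smooth_at_point (Suc 0) (\<lambda>x. f (x 0)) x"
      unfolding smooth_at_point_def
    proof (intro allI impI)
      fix "is" :: "nat list" assume "set is \<subseteq> {..<Suc 0}"
      then have p: "partials is (\<lambda>x. f (x 0)) = (\<lambda>x. (deriv ^^ length is) f (x 0))"
        using list_in_1 partials_replicate by metis
      have "isCont ((deriv ^^ length is) f) (x 0)"
        using h differentiable_imp_continuous_within by blast
      then have "contat (Suc 0) (\<lambda>x. (deriv ^^ length is) f (x 0)) x"
        unfolding contat_def using contat_coord[of 0 "Suc 0" x] x
        by (auto simp: contat_def intro: isCont_tendsto_compose)
      then show "contat (Suc 0) (partials is (\<lambda>x. f (x 0))) x \<and>
          (\<forall>i<Suc 0. (\<lambda>h. partials is (\<lambda>x. f (x 0)) (x(i := h))) differentiable (at (x i)))"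
        using h by (simp add: p)
    qed
  next
    assume h: "smooth_at_point (Suc 0) (\<lambda>x. f (x 0)) x"
    show "\<forall>\<alpha>. (deriv ^^ \<alpha>) f differentiable (at (x 0))"
    proof
      fix \<alpha>
      have "(\<lambda>h. partials (replicate \<alpha> 0) (\<lambda>x. f (x 0)) (x(0 := h))) differentiable (at (x 0))"
        using h[unfolded smooth_at_point_def, THEN spec[of _ "replicate \<alpha> 0"]] by (auto simp: set_replicate_conv_if simp del: foldr_replicate)
      then show "(deriv ^^ \<alpha>) f differentiable (at (x 0))" unfolding partials_replicate by simp
    qed
  qed
  then have "eventually (smooth_at_point (Suc 0) (\<lambda>x. f (x 0))) (nbhds (Suc 0) (point1 t)) \<longleftrightarrow>
      eventually (\<lambda>x. \<forall>\<alpha>. (deriv ^^ \<alpha>) f differentiable (at (x 0))) (nbhds (Suc 0) (point1 t))"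
    by (intro eventually_cong[OF eventually_coord_space]) auto
  then show ?thesis
    using eventually_nbhds1[of "\<lambda>u. \<forall>\<alpha>. (deriv ^^ \<alpha>) f differentiable (at u)" t]
    by (simp add: smooth1_def smooth_germ_def)
qed

lemma smooth1_cong: "smooth1 f t \<Longrightarrow> eventually (\<lambda>u. f u = g u) (nhds t) \<Longrightarrow> smooth1 g t"
  unfolding smooth1_germ
  by (erule smooth_germ_cong) (simp add: eventually_nbhds1[of "\<lambda>u. f u = g u"])

lemma higher_deriv_cong: "eventually (\<lambda>u. f u = g u) (nhds (t::real)) \<Longrightarrow> (deriv ^^ \<alpha>) f t = (deriv ^^ \<alpha>) g t"
proof (induction \<alpha> arbitrary: f g)
  case (Suc \<alpha>)
  have "eventually (\<lambda>u. deriv f u = deriv g u) (nhds t)"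
    using Suc.prems unfolding eventually_eventually[of "\<lambda>u. f u = g u" t, symmetric]
    by (rule eventually_mono) (auto intro: deriv_cong_ev)
  then show ?case using Suc.IH[of "deriv f" "deriv g"] by (simp only: funpow_Suc_right o_apply)
qed (auto dest: eventually_nhds_x_imp_x)

lemma smooth1_comp:
  assumes "smooth_germ n f (G t)" "\<And>i. i < n \<Longrightarrow> smooth1 (\<lambda>u. G u i) t"
    and "eventually (\<lambda>u. G u \<in> coord_space n) (nhds t)"
  shows "smooth1 (\<lambda>u. f (G u)) t"
  unfolding smooth1_germ
  by (rule smooth_germ_comp[of n f "\<lambda>x. G (x 0)"])
    (use assms in \<open>auto simp: smooth1_germ eventually_nbhds1[of "\<lambda>u. G u \<in> coord_space n"]\<close>)

lemma smooth_germ_comp1: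
  assumes "smooth1 f (G a)" "smooth_germ p G a"
  shows "smooth_germ p (\<lambda>x. f (G x)) a"
proof -
  have "smooth_germ p (\<lambda>x. f (point1 (G x) 0)) a"
    by (rule smooth_germ_comp[of "Suc 0" "\<lambda>x. f (x 0)" "\<lambda>x. point1 (G x)"])
      (use assms smooth_germ_coord_space in \<open>auto simp: smooth1_germ\<close>)
  then show ?thesis by simp
qed

lemma smooth1_const: "smooth1 (\<lambda>_. c) t"
  by (simp add: smooth1_germ)

lemma smooth1_ident: "smooth1 (\<lambda>u. u) t"
  by (simp add: smooth1_germ smooth_germ_coord)

lemma smooth1_add: "smooth1 f t \<Longrightarrow> smooth1 g t \<Longrightarrow> smooth1 (\<lambda>u. f u + g u) t"
  unfolding smooth1_germ by (rule smooth_germ_add)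

lemma smooth1_mult: "smooth1 f t \<Longrightarrow> smooth1 g t \<Longrightarrow> smooth1 (\<lambda>u. f u * g u) t"
  unfolding smooth1_germ by (rule smooth_germ_mult)

lemma smooth1_sum: "(\<And>j. j \<in> A \<Longrightarrow> smooth1 (f j) t) \<Longrightarrow> smooth1 (\<lambda>u. \<Sum>j\<in>A. f j u) t"
  unfolding smooth1_germ by (rule smooth_germ_sum) auto

lemma smooth1_power: "smooth1 f t \<Longrightarrow> smooth1 (\<lambda>u. f u ^ n) t"
  by (induction n) (auto intro: smooth1_const smooth1_mult)

lemma smooth1_higher_deriv: "smooth1 f t \<Longrightarrow> smooth1 ((deriv ^^ \<alpha>) f) t"
  unfolding smooth1_def
  by (erule eventually_mono) (metis funpow_add o_apply)

lemma smooth1_comp1: "smooth1 f (g t) \<Longrightarrow> smooth1 g t \<Longrightarrow> smooth1 (\<lambda>u. f (g u)) t"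
  unfolding smooth1_germ[of _ t] using smooth_germ_comp1[of f "\<lambda>x. g (x 0)" "point1 t"] by auto

lemma deriv_shift: "deriv (\<lambda>u. f (u + c)) x = deriv f (x + c)" for f :: "real \<Rightarrow> real"
  unfolding deriv_def by (simp add: DERIV_shift)

lemma higher_deriv_shift: "(deriv ^^ \<alpha>) (\<lambda>u. f (c + u)) x = (deriv ^^ \<alpha>) f (c + x)" for f :: "real \<Rightarrow> real"
proof -
  have "(deriv ^^ \<alpha>) (\<lambda>u. f (u + c)) = (\<lambda>u. (deriv ^^ \<alpha>) f (u + c))"
    by (induction \<alpha>) (simp_all add: deriv_shift)
  then show ?thesis by (simp add: add.commute)
qed

lemma smooth1_shift: "smooth1 f (c + t) \<Longrightarrow> smooth1 (\<lambda>u. f (c + u)) t"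
  by (rule smooth1_comp1) (auto intro: smooth1_add smooth1_const smooth1_ident)

text \<open>This is D^a T^b, with \<open>s\<close> as parameter 0 and \<open>t\<close> as parameter
  1. The \<open>t\<close>-derivatives are innermost, as in velocities of velocities, where the inner
  bundle belongs to \<open>t\<close>.\<close>

abbreviation mixed :: "nat \<Rightarrow> nat \<Rightarrow> ((nat \<Rightarrow> real) \<Rightarrow> real) \<Rightarrow> (nat \<Rightarrow> real) \<Rightarrow> real" where
  "mixed a b \<equiv> partials (replicate a 0 @ replicate b (Suc 0))"

lemma set_mixed: "set (replicate a 0 @ replicate b (Suc 0)) \<subseteq> {..<2}"
  by (auto simp: set_replicate_conv_if)

lemma partials_replicate_1: "partials (replicate b (Suc 0)) (\<lambda>x. h (x 0) (x (Suc 0))) = (\<lambda>x. (deriv ^^ b) (h (x 0)) (x (Suc 0)))"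
  by (induction b) (auto simp: partial_def fun_eq_iff)

lemma partials_replicate_0: "partials (replicate a 0) (\<lambda>x. h (x 0) (x (Suc 0))) = (\<lambda>x. (deriv ^^ a) (\<lambda>s. h s (x (Suc 0))) (x 0))"
  by (induction a) (auto simp: partial_def fun_eq_iff)

lemma mixed_eq: "mixed a b (\<lambda>x. h (x 0) (x (Suc 0))) (point2 s t) = (deriv ^^ a) (\<lambda>s. (deriv ^^ b) (h s) t) s"
  unfolding foldr_append o_apply partials_replicate_1
  using fun_cong[OF partials_replicate_0[of a "\<lambda>s. (deriv ^^ b) (h s)"], of "point2 s t"] by simp

text \<open>Elements of velocity bundles at time \<open>s\<close> are represented by families around
  the origin; this translates their derivatives back to derivatives at \<open>s\<close>.\<close>

lemma mixed_shift: "mixed a b (\<lambda>x. f (point2 (s + x 0) (x (Suc 0)))) (point2 u t) = mixed a b f (point2 (s + u) t)"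
proof -
  have "mixed a b (\<lambda>x. f (point2 (s + x 0) (x (Suc 0)))) (point2 u t) =
      (deriv ^^ a) (\<lambda>u. (deriv ^^ b) (\<lambda>t. f (point2 (s + u) t)) t) u"
    by (rule mixed_eq)
  also have "\<dots> = (deriv ^^ a) (\<lambda>s. (deriv ^^ b) (\<lambda>t. f (point2 s t)) t) (s + u)"
    by (rule higher_deriv_shift)
  also have "\<dots> = mixed a b (\<lambda>x. f (point2 (x 0) (x (Suc 0)))) (point2 (s + u) t)"
    by (rule mixed_eq[symmetric])
  also have "\<dots> = mixed a b f (point2 (s + u) t)"
    by (rule partials_cong[OF _ set_mixed])
      (auto intro: eventually_mono[OF eventually_coord_space] simp: point2_coord)
  finally show ?thesis .
qed

lemma partial_1_mixed:
  assumes "smooth_germ 2 f x" shows "partial (Suc 0) (mixed a b f) x = mixed a (Suc b) f x"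
proof -
  have "partials (Suc 0 # replicate a 0 @ replicate b (Suc 0)) f x = mixed a (Suc b) f x"
    by (rule partials_permute[OF assms]) (auto simp: set_replicate_conv_if)
  then show ?thesis by simp
qed

lemma partials_mixed:
  assumes "smooth_germ 2 f x" "set is \<subseteq> {..<2}"
  shows "partials is f x = mixed (count_list is 0) (count_list is (Suc 0)) f x"
proof (rule partials_permute[OF assms])
  have "count_list is i = 0" if "i \<noteq> 0" "i \<noteq> Suc 0" for i
    using assms(2) that by (subst count_list_0_iff) (auto simp: subset_iff numeral_2_eq_2 less_Suc_eq)
  then show "mset is = mset (replicate (count_list is 0) 0 @ replicate (count_list is (Suc 0)) (Suc 0))"
    by (intro multiset_eqI) (auto simp: count_mset)
qed

text \<open>On a function of the sum, a derivative in any one parameter acts as the ordinary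
  derivative. This describes the inclusion of \<open>k\<close>-velocities into the iterated tangent
  bundle: the coordinate belonging to a set of parameters depends only on its size.\<close>

lemma partials_sum_of_coords:
  assumes "set is \<subseteq> {..<k}"
  shows "partials is (\<lambda>s. f (\<Sum>i<k. s i)) = (\<lambda>s. (deriv ^^ length is) f (\<Sum>i<k. s i))"
  using assms
proof (induction "is")
  case (Cons j "is")
  have "(\<Sum>i<k. (s(j := u)) i) = u + (\<Sum>i\<in>{..<k} - {j}. s i)" for s :: "nat \<Rightarrow> real" and u
    using Cons.prems by (subst sum.remove[of _ j]) auto
  moreover have "(\<Sum>i<k. s i) = s j + (\<Sum>i\<in>{..<k} - {j}. s i)" for s :: "nat \<Rightarrow> real"
    using Cons.prems by (subst sum.remove[of _ j]) auto
  ultimately show ?case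
    using Cons by (auto simp: partial_def deriv_shift)
qed simp

text \<open>Parameters below \<open>m\<close> act as \<open>D\<close> and the others as
  \<open>T\<close>, which the index map on the list records. This describes the inclusion of
  velocities of velocities into the iterated tangent bundle.\<close>

lemma partials_two_sums:
  assumes "set is \<subseteq> {..<m + n}"
  shows "partials is (\<lambda>s. f (point2 (\<Sum>i<m. s i) (\<Sum>i=m..<m + n. s i))) =
    (\<lambda>s. partials (map (\<lambda>i. if i < m then 0 else Suc 0) is) f (point2 (\<Sum>i<m. s i) (\<Sum>i=m..<m + n. s i)))"
  using assms
proof (induction "is")
  case (Cons j "is")
  let ?F = "partials (map (\<lambda>i. if i < m then 0 else Suc 0) is) f"
  have P: "partial 0 F (point2 a b) = deriv (\<lambda>u. F (point2 u b)) a"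
    "partial (Suc 0) F (point2 a b) = deriv (\<lambda>u. F (point2 a u)) b" for F a b
    by (simp_all add: partial_def)
  have "partial j (\<lambda>s. ?F (point2 (\<Sum>i<m. s i) (\<Sum>i=m..<m + n. s i))) s =
      partial (if j < m then 0 else Suc 0) ?F (point2 (\<Sum>i<m. s i) (\<Sum>i=m..<m + n. s i))" for s
  proof (cases "j < m")
    case True
    have "(\<Sum>i<m. (s(j := u)) i) = u + (\<Sum>i\<in>{..<m} - {j}. s i)" for u
      using True by (subst sum.remove[of _ j]) auto
    moreover have "(\<Sum>i<m. s i) = s j + (\<Sum>i\<in>{..<m} - {j}. s i)"
      using True by (subst sum.remove[of _ j]) auto
    moreover have "(\<Sum>i=m..<m + n. (s(j := u)) i) = (\<Sum>i=m..<m + n. s i)" for u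
      using True by (intro sum.cong) auto
    ultimately show ?thesis
      using True by (simp add: P) (simp add: partial_def deriv_shift[of "\<lambda>u. ?F (point2 u _)"])
  next
    case False
    have j: "j \<in> {m..<m + n}" using False Cons.prems by auto
    have "(\<Sum>i=m..<m + n. (s(j := u)) i) = u + (\<Sum>i\<in>{m..<m + n} - {j}. s i)" for u
      using j by (subst sum.remove[of _ j]) auto
    moreover have "(\<Sum>i=m..<m + n. s i) = s j + (\<Sum>i\<in>{m..<m + n} - {j}. s i)"
      using j by (subst sum.remove[of _ j]) auto
    moreover have "(\<Sum>i<m. (s(j := u)) i) = (\<Sum>i<m. s i)" for u
      using False by (intro sum.cong) auto
    ultimately show ?thesis
      using False by (simp add: P) (simp add: partial_def deriv_shift[of "\<lambda>u. ?F (point2 _ u)"])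
  qed
  moreover have "partials is (\<lambda>s. f (point2 (\<Sum>i<m. s i) (\<Sum>i=m..<m + n. s i))) =
      (\<lambda>s. ?F (point2 (\<Sum>i<m. s i) (\<Sum>i=m..<m + n. s i)))"
    using Cons by simp
  ultimately show ?case unfolding list.map foldr.simps o_apply by auto
qed simp

lemma partials_two_sums_upt:
  "partials [0..<m + n] (\<lambda>s. f (point2 (\<Sum>i<m. s i) (\<Sum>i=m..<m + n. s i))) origin = mixed m n f origin"
proof -
  have "map (\<lambda>i. if i < m then 0 else Suc 0) [0..<m + n] = replicate m 0 @ replicate n (Suc 0)"
    by (rule nth_equalityI) (auto simp: nth_append)
  then show ?thesis
    by (subst partials_two_sums) auto
qed

section \<open>Higher derivatives of sums and products, and powers of T - D\<close>

lemma higher_deriv_sum: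
  assumes "finite A" "\<And>j. j \<in> A \<Longrightarrow> smooth1 (f j) t"
  shows "(deriv ^^ \<alpha>) (\<lambda>u. \<Sum>j\<in>A. f j u) t = (\<Sum>j\<in>A. (deriv ^^ \<alpha>) (f j) t)"
proof -
  have "partials (replicate \<alpha> 0) (\<lambda>x. \<Sum>j\<in>A. f j (x 0)) (point1 t) =
      (\<Sum>j\<in>A. partials (replicate \<alpha> 0) (\<lambda>x. f j (x 0)) (point1 t))"
    by (rule partials_sum[where n = "Suc 0"])
      (use assms in \<open>auto simp: smooth1_germ set_replicate_conv_if\<close>)
  then show ?thesis
    unfolding partials_replicate[of \<alpha> "\<lambda>u. \<Sum>j\<in>A. f j u"] partials_replicate by simp
qed

lemma higher_deriv_scale: "smooth1 f t \<Longrightarrow> (deriv ^^ \<alpha>) (\<lambda>u. c * f u) t = c * (deriv ^^ \<alpha>) f t"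
  using partials_scale[of "Suc 0" "\<lambda>x. f (x 0)" "point1 t" "replicate \<alpha> 0" c]
  unfolding smooth1_germ partials_replicate[of \<alpha> f] partials_replicate[of \<alpha> "\<lambda>u. c * f u"]
  by (auto simp: set_replicate_conv_if)

lemma smooth1_DERIV: "smooth1 f t \<Longrightarrow> ((deriv ^^ \<alpha>) f has_real_derivative (deriv ^^ Suc \<alpha>) f t) (at t)"
  using smooth1_differentiable DERIV_deriv_iff_real_differentiable by force

text \<open>Pascal's rule, in the form in which both the Leibniz rule and the expansion of (T - D)^n
  pass from \<open>n\<close> to \<open>n + 1\<close>.\<close>

lemma binomial_convolution_step:
  fixes A :: "nat \<Rightarrow> nat \<Rightarrow> real"
  shows "(\<Sum>j\<le>n. real (n choose j) * (A (Suc (n - j)) j + A (n - j) (Suc j))) =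
    (\<Sum>j\<le>Suc n. real (Suc n choose j) * A (Suc n - j) j)"
proof -
  have "(\<Sum>j\<le>Suc n. real (Suc n choose j) * A (Suc n - j) j) =
      A (Suc n) 0 + (\<Sum>j\<le>n. real (Suc n choose Suc j) * A (n - j) (Suc j))"
    by (subst sum.atMost_Suc_shift) simp
  also have "\<dots> = A (Suc n) 0 + (\<Sum>j\<le>n. real (n choose Suc j) * A (n - j) (Suc j)) +
      (\<Sum>j\<le>n. real (n choose j) * A (n - j) (Suc j))"
    by (simp add: algebra_simps sum.distrib)
  also have "A (Suc n) 0 + (\<Sum>j\<le>n. real (n choose Suc j) * A (n - j) (Suc j)) =
      (\<Sum>j\<le>Suc n. real (n choose j) * A (Suc n - j) j)"
    by (subst sum.atMost_Suc_shift) simp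
  also have "\<dots> = (\<Sum>j\<le>n. real (n choose j) * A (Suc (n - j)) j)"
    by (simp add: Suc_diff_le)
  finally show ?thesis by (simp add: algebra_simps sum.distrib)
qed

lemma higher_deriv_mult:
  assumes "smooth1 f t" "smooth1 g t"
  shows "(deriv ^^ n) (\<lambda>u. f u * g u) t =
    (\<Sum>j\<le>n. real (n choose j) * ((deriv ^^ (n - j)) f t * (deriv ^^ j) g t))"
proof -
  have "eventually (\<lambda>t. (deriv ^^ n) (\<lambda>u. f u * g u) t =
    (\<Sum>j\<le>n. real (n choose j) * ((deriv ^^ (n - j)) f t * (deriv ^^ j) g t))) (nhds t)"
  proof (induction n)
    case (Suc n)
    from iffD2[OF eventually_eventually Suc] smooth1_eventually[OF assms(1)] smooth1_eventually[OF assms(2)]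
    show ?case
    proof eventually_elim
      case (elim t)
      have "deriv ((deriv ^^ n) (\<lambda>u. f u * g u)) t =
          deriv (\<lambda>t. \<Sum>j\<le>n. real (n choose j) * ((deriv ^^ (n - j)) f t * (deriv ^^ j) g t)) t"
        by (rule deriv_cong_ev[OF elim(1) refl])
      also have "\<dots> = (\<Sum>j\<le>n. real (n choose j) * ((deriv ^^ Suc (n - j)) f t * (deriv ^^ j) g t +
          (deriv ^^ Suc j) g t * (deriv ^^ (n - j)) f t))"
        by (rule DERIV_imp_deriv[OF DERIV_sum[OF
                DERIV_cmult[OF DERIV_mult[OF smooth1_DERIV[OF elim(2)] smooth1_DERIV[OF elim(3)]]]]])
      also have "\<dots> = (\<Sum>j\<le>Suc n. real (Suc n choose j) * ((deriv ^^ (Suc n - j)) f t * (deriv ^^ j) g t))"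
        using binomial_convolution_step[of n "\<lambda>a b. (deriv ^^ a) f t * (deriv ^^ b) g t"]
        by (simp add: mult.commute)
      finally show ?case by simp
    qed
  qed simp
  then show ?thesis using eventually_nhds_x_imp_x by blast
qed

text \<open>Along the line (s - r, t + r) differentiation by \<open>r\<close> is T - D. The right
  side is the binomial expansion of its \<open>n\<close>-th power, legitimate because
  \<open>D\<close> and \<open>T\<close> commute on smooth germs.\<close>

lemma higher_deriv_antidiagonal:
  assumes "smooth_germ 2 f (point2 s t)"
  shows "(deriv ^^ n) (\<lambda>r. f (point2 (s - r) (t + r))) 0 =
    (\<Sum>j\<le>n. (- 1) ^ j * real (n choose j) * mixed j (n - j) f (point2 s t))"
proof -
  let ?p = "\<lambda>r. point2 (s - r) (t + r)"

  \<comment> \<open>The expansion has to hold for all \<open>r\<close> near 0 in order to be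
    differentiated, so smoothness is first spread along the line.\<close>
  have ev: "eventually (\<lambda>r. smooth_germ 2 f (?p r)) (nhds 0)"
  proof -
    have "filterlim ?p (nbhds 2 (?p 0)) (nhds 0)"
    proof (rule filterlim_nbhds)
      fix i
      have "((\<lambda>r. s - r) \<longlongrightarrow> s - 0) (nhds 0)" "((\<lambda>r. t + r) \<longlongrightarrow> t + 0) (nhds 0)"
        by (intro tendsto_intros filterlim_ident)+
      then show "((\<lambda>r. ?p r i) \<longlongrightarrow> ?p 0 i) (nhds 0)"
        by (cases "i = 0"; cases "i = 1") (auto simp: point2_def)
    qed simp_all
    then show ?thesis using smooth_germ_eventually[OF assms] by (simp add: filterlim_iff)
  qed
  have D: "((\<lambda>r. F (?p r)) has_real_derivative (partial (Suc 0) F (?p r) - partial 0 F (?p r))) (at r)"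
    if "smooth_germ 2 F (?p r)" for F r
  proof -
    have "((\<lambda>r. F (?p r)) has_real_derivative
        (\<Sum>i<2. partial i F (?p r) * (if i = 0 then - 1 else 1))) (at r)"
    proof (rule chain_rule)
      show "((\<lambda>r. ?p r i) has_real_derivative (if i = 0 then - 1 else 1)) (at r)" if "i < 2" for i
        using that by (auto simp: point2_def intro!: derivative_eq_intros)
      show "\<forall>\<^sub>F x in nbhds 2 (?p r). (\<lambda>h. F (x(i := h))) differentiable at (x i)" if "i < 2" for i
        using smooth_germ_eventually[OF \<open>smooth_germ 2 F (?p r)\<close>]
        by (rule eventually_mono) (use that smooth_germ_differentiable in blast)
      show "contat 2 (partial i F) (?p r)" if "i < 2" for i
        using \<open>smooth_germ 2 F (?p r)\<close> that smooth_germ_partial smooth_germ_contat by blast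
    qed simp
    then show ?thesis by (simp add: numeral_2_eq_2)
  qed
  have "eventually (\<lambda>r. (deriv ^^ n) (\<lambda>r. f (?p r)) r =
    (\<Sum>j\<le>n. (- 1) ^ j * real (n choose j) * mixed j (n - j) f (?p r))) (nhds 0)"
  proof (induction n)
    case (Suc n)
    from iffD2[OF eventually_eventually Suc] ev
    show ?case
    proof eventually_elim
      case (elim r)
      have "deriv ((deriv ^^ n) (\<lambda>r. f (?p r))) r =
          deriv (\<lambda>r. \<Sum>j\<le>n. (- 1) ^ j * real (n choose j) * mixed j (n - j) f (?p r)) r"
        by (rule deriv_cong_ev[OF elim(1) refl])
      also have "\<dots> = (\<Sum>j\<le>n. (- 1) ^ j * real (n choose j) *
          (partial (Suc 0) (mixed j (n - j) f) (?p r) - partial 0 (mixed j (n - j) f) (?p r)))"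
        by (rule DERIV_imp_deriv[OF DERIV_sum[OF
                DERIV_cmult[OF D[OF smooth_germ_partials[OF elim(2) set_mixed]]]]])
      also have "\<dots> = (\<Sum>j\<le>n. real (n choose j) * ((- 1) ^ j * mixed j (Suc (n - j)) f (?p r) +
          (- 1) ^ Suc j * mixed (Suc j) (n - j) f (?p r)))"
        using partial_1_mixed[OF elim(2)] by (intro sum.cong refl) (simp add: algebra_simps)
      also have "\<dots> = (\<Sum>j\<le>Suc n. real (Suc n choose j) * ((- 1) ^ j * mixed j (Suc n - j) f (?p r)))"
        by (rule binomial_convolution_step[of n "\<lambda>a b. (- 1) ^ b * mixed b a f (?p r)"])
      finally show ?case by (simp add: algebra_simps del: foldr_append)
    qed
  qed simp
  from eventually_nhds_x_imp_x[OF this] show ?thesis by simp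
qed

text \<open>Bookkeeping for the derivative of a sum of \<open>c \<alpha>\<close> times a derivative
  of order \<alpha>: a term either keeps its order, with \<open>p\<close> the derivative of its
  coefficient, or moves up by one order. The conditionals treat the two ends of the range.\<close>

lemma sum_shift_coefficients:
  fixes p c W :: "nat \<Rightarrow> real"
  shows "(\<Sum>\<alpha>\<le>n. p \<alpha> * W \<alpha> + c \<alpha> * W (Suc \<alpha>)) =
    (\<Sum>\<alpha>\<le>Suc n. ((if \<alpha> \<le> n then p \<alpha> else 0) + (if \<alpha> = 0 then 0 else c (\<alpha> - Suc 0))) * W \<alpha>)"
proof -
  have "(\<Sum>\<alpha>\<le>Suc n. (if \<alpha> \<le> n then p \<alpha> else 0) * W \<alpha>) = (\<Sum>\<alpha>\<le>n. p \<alpha> * W \<alpha>)"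
    by (simp add: sum.atMost_Suc)
  moreover have "(\<Sum>\<alpha>\<le>Suc n. (if \<alpha> = 0 then 0 else c (\<alpha> - Suc 0)) * W \<alpha>) = (\<Sum>\<alpha>\<le>n. c \<alpha> * W (Suc \<alpha>))"
    by (subst sum.atMost_Suc_shift) simp
  ultimately show ?thesis by (simp only: distrib_right sum.distrib)
qed

text \<open>The coefficients \<open>c\<close> do not depend on \<open>w\<close>: this is what makes a pairing with a sum of truncations
  a linear function of the velocity of the second argument.\<close>

lemma partials_mult_translate:
  assumes p: "smooth_germ 2 p a" and "set is \<subseteq> {..<2}"
  shows "\<exists>c. (\<forall>\<alpha>. smooth_germ 2 (c \<alpha>) a) \<and> (\<forall>w. smooth1 w (a 0 + a (Suc 0)) \<longrightarrow>
    eventually (\<lambda>x. partials is (\<lambda>x. p x * w (x 0 + x (Suc 0))) x =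
      (\<Sum>\<alpha>\<le>length is. c \<alpha> x * (deriv ^^ \<alpha>) w (x 0 + x (Suc 0)))) (nbhds 2 a))"
  using assms(2)
proof (induction "is")
  case Nil
  show ?case by (intro exI[of _ "\<lambda>_. p"]) (use p in auto)
next
  case (Cons i "is")
  have a: "a \<in> coord_space 2" using p smooth_germ_coord_space by blast
  obtain c where c: "\<And>\<alpha>. smooth_germ 2 (c \<alpha>) a"
    "\<And>w. smooth1 w (a 0 + a (Suc 0)) \<Longrightarrow>
      eventually (\<lambda>x. partials is (\<lambda>x. p x * w (x 0 + x (Suc 0))) x =
      (\<Sum>\<alpha>\<le>length is. c \<alpha> x * (deriv ^^ \<alpha>) w (x 0 + x (Suc 0)))) (nbhds 2 a)"
    using Cons by auto
  have i: "i < 2" using Cons.prems by simp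
  \<comment> \<open>As \<open>w\<close> is evaluated at the sum of the parameters, a derivative in
    either of them raises its order by one. The new coefficient of order \<alpha> collects the
    derivative of the old one and the old one of order \<alpha> - 1; \<open>w\<close> does not
    enter.\<close>
  define d where "d \<alpha> = (\<lambda>x. (if \<alpha> \<le> length is then partial i (c \<alpha>) x else 0) +
    (if \<alpha> = 0 then 0 else c (\<alpha> - 1) x))" for \<alpha>
  have sm: "smooth_germ 2 (\<lambda>x. (deriv ^^ \<alpha>) w (x 0 + x (Suc 0))) a" if "smooth1 w (a 0 + a (Suc 0))" for w \<alpha>
    by (rule smooth_germ_comp1[of "(deriv ^^ \<alpha>) w" "\<lambda>x. x 0 + x (Suc 0)"])
      (use that a in \<open>auto intro!: smooth1_higher_deriv smooth_germ_add smooth_germ_coord\<close>)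
  have "eventually (\<lambda>x. partials (i # is) (\<lambda>x. p x * w (x 0 + x (Suc 0))) x =
      (\<Sum>\<alpha>\<le>length (i # is). d \<alpha> x * (deriv ^^ \<alpha>) w (x 0 + x (Suc 0)))) (nbhds 2 a)"
    if w: "smooth1 w (a 0 + a (Suc 0))" for w
  proof -
    let ?W = "\<lambda>\<alpha> x. (deriv ^^ \<alpha>) w (x 0 + x (Suc 0))"
    have smc: "eventually (\<lambda>x. \<forall>\<alpha>\<in>{..length is}. smooth_germ 2 (c \<alpha>) x) (nbhds 2 a)"
      by (rule eventually_ball_finite) (use smooth_germ_eventually[OF c(1)] in auto)
    have smW: "eventually (\<lambda>x. \<forall>\<alpha>\<in>{..length is}. smooth_germ 2 (?W \<alpha>) x) (nbhds 2 a)"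
      by (rule eventually_ball_finite) (use smooth_germ_eventually[OF sm[OF w]] in auto)
    have "((\<lambda>x. x 0 + x (Suc 0)) \<longlongrightarrow> a 0 + a (Suc 0)) (nbhds 2 a)"
      using smooth_germ_contat[OF smooth_germ_add[OF smooth_germ_coord[OF a] smooth_germ_coord[OF a]], of 0 "Suc 0"]
      by (simp add: contat_def)
    then have sw: "eventually (\<lambda>x. smooth1 w (x 0 + x (Suc 0))) (nbhds 2 a)"
      using smooth1_eventually[OF w] by (simp add: filterlim_iff)
    from smc smW sw eventually_partial_cong[OF c(2)[OF w] i]
    show ?thesis
    proof eventually_elim
      case (elim x)
      have W: "partial i (?W \<alpha>) x = ?W (Suc \<alpha>) x" for \<alpha>
      proof -
        have "((\<lambda>h. (deriv ^^ \<alpha>) w ((x(i := h)) 0 + (x(i := h)) (Suc 0))) has_real_derivative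
            (deriv ^^ Suc \<alpha>) w (x 0 + x (Suc 0)) * 1) (at (x i))"
        proof (rule DERIV_chain2[where g = "\<lambda>h. (x(i := h)) 0 + (x(i := h)) (Suc 0)"])
          show "((deriv ^^ \<alpha>) w has_real_derivative (deriv ^^ Suc \<alpha>) w (x 0 + x (Suc 0)))
            (at ((x(i := x i)) 0 + (x(i := x i)) (Suc 0)))"
            using smooth1_DERIV[OF elim(3)] by simp
          show "((\<lambda>h. (x(i := h)) 0 + (x(i := h)) (Suc 0)) has_real_derivative 1) (at (x i))"
            using i by (cases "i = 0") (auto simp: less_Suc_eq numeral_2_eq_2 intro!: derivative_eq_intros)
        qed
        then show ?thesis unfolding partial_def[of i "?W \<alpha>"] by (simp add: DERIV_imp_deriv)
      qed
      have "partial i (partials is (\<lambda>x. p x * w (x 0 + x (Suc 0)))) x =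
          partial i (\<lambda>x. \<Sum>\<alpha>\<le>length is. c \<alpha> x * ?W \<alpha> x) x"
        using elim(4) .
      also have "\<dots> = (\<Sum>\<alpha>\<le>length is. partial i (\<lambda>x. c \<alpha> x * ?W \<alpha> x) x)"
        by (rule partial_sum[where n = 2]) (use elim i in \<open>auto intro!: smooth_germ_mult\<close>)
      also have "\<dots> = (\<Sum>\<alpha>\<le>length is. partial i (c \<alpha>) x * ?W \<alpha> x + c \<alpha> x * ?W (Suc \<alpha>) x)"
      proof (intro sum.cong refl)
        fix \<alpha> assume "\<alpha> \<in> {..length is}"
        then have "smooth_germ 2 (c \<alpha>) x" "smooth_germ 2 (?W \<alpha>) x" using elim(1,2) by auto
        from partial_mult[OF smooth_germ_differentiable[OF this(1) i] smooth_germ_differentiable[OF this(2) i]]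
        show "partial i (\<lambda>x. c \<alpha> x * ?W \<alpha> x) x = partial i (c \<alpha>) x * ?W \<alpha> x + c \<alpha> x * ?W (Suc \<alpha>) x"
          unfolding W .
      qed
      also have "\<dots> = (\<Sum>\<alpha>\<le>length (i # is). d \<alpha> x * ?W \<alpha> x)"
        unfolding d_def list.size(4) add_0_right add_Suc_right One_nat_def by (rule sum_shift_coefficients)
      finally show ?case by simp
    qed
  qed
  moreover have "smooth_germ 2 (d \<alpha>) a" for \<alpha>
    unfolding d_def using c(1) a i
    by (cases "\<alpha> \<le> length is"; cases "\<alpha> = 0") (auto intro!: smooth_germ_add smooth_germ_partial)
  ultimately show ?case by blast
qed

section \<open>Curves and families in an atlas\<close>

text \<open>The part of the manifold structure that charts alone express. The bundles are given as
  atlases without a topology, so this is the notion that passes from \<open>M\<close> to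
  them.\<close>

definition smooth_atlas :: "'a atlas \<Rightarrow> bool" where
  "smooth_atlas N \<longleftrightarrow> (\<forall>(U, \<phi>)\<in>charts N. inj_on \<phi> U) \<and>
     (\<forall>(U, \<phi>)\<in>charts N. \<forall>(V, \<psi>)\<in>charts N.
        openin (Euclidean_space (dimension N)) (\<phi> ` (U \<inter> V)) \<and>
        (\<forall>i<dimension N. smooth_on_Rn (dimension N) (\<phi> ` (U \<inter> V)) (\<lambda>x. \<psi> (inv_into U \<phi> x) i)))"

lemma smooth_manifold_atlas:
  assumes "smooth_manifold X M" shows "smooth_atlas M"
proof -
  have hm: "openin X U" "homeomorphic_map (subtopology X U)
      (subtopology (Euclidean_space (dimension M)) (\<phi> ` U)) \<phi>" "U \<subseteq> topspace X"
      "openin (Euclidean_space (dimension M)) (\<phi> ` U)"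
    if "(U, \<phi>) \<in> charts M" for U \<phi>
    using assms that openin_subset unfolding smooth_manifold_def by fastforce+
  have "inj_on \<phi> U" if "(U, \<phi>) \<in> charts M" for U \<phi>
    using homeomorphic_imp_injective_map[OF hm(2)[OF that]] hm(3)[OF that] by (simp add: Int_absorb1)
  \<comment> \<open>A chart is a homeomorphism onto an open image, so the image of an overlap is
    open there and hence in the whole space.\<close>
  moreover have "openin (Euclidean_space (dimension M)) (\<phi> ` (U \<inter> V))"
    if "(U, \<phi>) \<in> charts M" "(V, \<psi>) \<in> charts M" for U \<phi> V \<psi>
  proof -
    have "openin (subtopology X U) (U \<inter> V)"
      using hm(1)[OF that(2)] by (metis inf_commute openin_subtopology_Int2)
    then have "openin (subtopology (Euclidean_space (dimension M)) (\<phi> ` U)) (\<phi> ` (U \<inter> V))"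
      using homeomorphic_imp_open_map[OF hm(2)[OF that(1)]] by (simp add: open_map_def)
    then show ?thesis using hm(4)[OF that(1)] openin_trans_full by blast
  qed
  ultimately show ?thesis
    using assms unfolding smooth_atlas_def smooth_manifold_def by (auto split: prod.splits)
qed

section \<open>Curves and velocities at one point\<close>

definition curve_at :: "'a atlas \<Rightarrow> (real \<Rightarrow> 'a) \<Rightarrow> real \<Rightarrow> bool" where
  "curve_at N c t \<longleftrightarrow> (\<exists>I. open I \<and> t \<in> I \<and> smooth_curve N I c)"

lemma smooth_curve_near_0_curve_at: "smooth_curve_near_0 N c \<longleftrightarrow> curve_at N c 0"
  by (auto simp: smooth_curve_near_0_def curve_at_def)

lemma curve_at_in_points: "curve_at N c t \<Longrightarrow> c t \<in> points N"
  by (auto simp: curve_at_def smooth_curve_def)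

lemma curve_at_eventually: "curve_at N c t \<Longrightarrow> eventually (curve_at N c) (nhds t)"
  unfolding curve_at_def eventually_nhds by blast

lemma in_points_iff: "x \<in> points N \<longleftrightarrow> (\<exists>U \<phi>. (U, \<phi>) \<in> charts N \<and> x \<in> U)"
  by (auto simp: points_def)

lemma velocity_iff:
  "b \<in> velocity N k c t \<longleftrightarrow> curve_at N b 0 \<and> b 0 = c t \<and>
    (\<forall>U \<phi> i \<alpha>. (U, \<phi>) \<in> charts N \<longrightarrow> c t \<in> U \<longrightarrow> i < dimension N \<longrightarrow> \<alpha> \<le> k \<longrightarrow>
      (deriv ^^ \<alpha>) (\<lambda>u. \<phi> (b u) i) 0 = (deriv ^^ \<alpha>) (\<lambda>u. \<phi> (c u) i) t)"
  unfolding velocity_def smooth_curve_near_0_curve_at by auto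

lemma velocity_shift: "velocity N k c t = velocity N k (\<lambda>u. c (t + u)) 0"
proof -
  have "(deriv ^^ \<alpha>) (\<lambda>u. \<phi> (c (t + u)) i) 0 = (deriv ^^ \<alpha>) (\<lambda>u. \<phi> (c u) i) t"
    for \<alpha> i and \<phi> :: "'a \<Rightarrow> nat \<Rightarrow> real"
    using higher_deriv_shift[of \<alpha> "\<lambda>u. \<phi> (c u) i" t 0] by simp
  then show ?thesis by (intro set_eqI) (simp add: velocity_iff)
qed

text \<open>A member shares with \<open>c\<close> all derivatives to which the class refers, in
  every chart around the point, and therefore defines the same class.\<close>

lemma velocity_mem:
  "b \<in> velocity N k c t \<Longrightarrow> velocity N k b 0 = velocity N k c t"
  by (intro set_eqI) (auto simp: velocity_iff)

lemma velocity_self: "curve_at N c 0 \<Longrightarrow> c \<in> velocity N k c 0"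
  by (simp add: velocity_iff)

lemma velocity_cong:
  assumes "eventually (\<lambda>u. c u = c' u) (nhds t)"
  shows "velocity N k c t = velocity N k c' t"
proof -
  have "eventually (\<lambda>u. \<phi> (c u) i = \<phi> (c' u) i) (nhds t)" for \<phi> :: "'a \<Rightarrow> nat \<Rightarrow> real" and i
    using assms by (rule eventually_mono) simp
  then have "(deriv ^^ \<alpha>) (\<lambda>u. \<phi> (c u) i) t = (deriv ^^ \<alpha>) (\<lambda>u. \<phi> (c' u) i) t"
    for \<phi> :: "'a \<Rightarrow> nat \<Rightarrow> real" and i \<alpha>
    by (rule higher_deriv_cong)
  then show ?thesis
    using eventually_nhds_x_imp_x[OF assms] by (intro set_eqI) (simp add: velocity_iff)
qed

section \<open>Smoothness and equality of velocities tested in one chart\<close>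

context
  fixes N :: "'a atlas"
  assumes N: "smooth_atlas N"
begin

abbreviation (input) "dm \<equiv> dimension N"

lemma chart_inj: "(U, \<phi>) \<in> charts N \<Longrightarrow> inj_on \<phi> U"
  using N unfolding smooth_atlas_def by auto

lemma chart_inv [simp]: "(U, \<phi>) \<in> charts N \<Longrightarrow> x \<in> U \<Longrightarrow> inv_into U \<phi> (\<phi> x) = x"
  using chart_inj by (simp add: inv_into_f_f)

lemma overlap_open:
  "(U, \<phi>) \<in> charts N \<Longrightarrow> (V, \<psi>) \<in> charts N \<Longrightarrow> openin (Euclidean_space dm) (\<phi> ` (U \<inter> V))"
  using N unfolding smooth_atlas_def by auto

lemma chart_open: "(U, \<phi>) \<in> charts N \<Longrightarrow> openin (Euclidean_space dm) (\<phi> ` U)"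
  using overlap_open[of U \<phi> U \<phi>] by simp

lemma chart_coord_space: "(U, \<phi>) \<in> charts N \<Longrightarrow> x \<in> U \<Longrightarrow> \<phi> x \<in> coord_space dm"
  using chart_open openin_Euclidean_subset by blast

lemma chart_eqI:
  "(U, \<phi>) \<in> charts N \<Longrightarrow> x \<in> U \<Longrightarrow> y \<in> U \<Longrightarrow> (\<And>i. i < dm \<Longrightarrow> \<phi> x i = \<phi> y i) \<Longrightarrow> x = y"
  by (metis chart_coord_space chart_inv coord_space_eq_iff)

lemma transition_germ:
  assumes "(U, \<phi>) \<in> charts N" "(V, \<psi>) \<in> charts N" "x \<in> U" "x \<in> V" "i < dm"
  shows "smooth_germ dm (\<lambda>y. \<psi> (inv_into U \<phi> y) i) (\<phi> x)"
proof -
  have "smooth_on_Rn dm (\<phi> ` (U \<inter> V)) (\<lambda>x. \<psi> (inv_into U \<phi> x) i)"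
    using N assms unfolding smooth_atlas_def by fastforce
  then show ?thesis
    using smooth_on_Rn_germ[OF overlap_open[OF assms(1,2)]] assms(3,4) by auto
qed

lemma in_overlap:
  assumes "(U, \<phi>) \<in> charts N" "x \<in> U" "\<phi> x \<in> \<phi> ` (U \<inter> V)" shows "x \<in> V"
  using assms chart_inj[OF assms(1)] by (auto dest: inj_onD)

text \<open>The definition asks about all charts. Smooth transition maps transfer smoothness from
  the chart at hand, and open overlaps make the preimages of the other chart domains open.\<close>

lemma smooth_family_iff:
  assumes C: "(U, \<phi>) \<in> charts N" and f0: "f origin \<in> U"
  shows "smooth_family p N f \<longleftrightarrow> eventually (\<lambda>s. f s \<in> U) (nbhds p origin) \<and>
    (\<forall>i<dm. smooth_germ p (\<lambda>s. \<phi> (f s) i) origin)"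
proof
  assume "smooth_family p N f"
  then obtain W where W: "openin (Euclidean_space p) W" "origin \<in> W"
    "openin (Euclidean_space p) {s \<in> W. f s \<in> U}"
    "\<forall>i<dm. smooth_on_Rn p {s \<in> W. f s \<in> U} (\<lambda>s. \<phi> (f s) i)"
    using C unfolding smooth_family_def by fastforce
  have 0: "origin \<in> {s \<in> W. f s \<in> U}" using W(2) f0 by simp
  have "eventually (\<lambda>s. f s \<in> U) (nbhds p origin)"
    by (rule eventually_mono[OF eventually_nbhds_open[OF W(3) 0]]) simp
  moreover have "smooth_germ p (\<lambda>s. \<phi> (f s) i) origin" if "i < dm" for i
    using W(4) that smooth_on_Rn_germ[OF W(3)] 0 by blast
  ultimately show "eventually (\<lambda>s. f s \<in> U) (nbhds p origin) \<and>
    (\<forall>i<dm. smooth_germ p (\<lambda>s. \<phi> (f s) i) origin)" by blast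
next
  assume h: "eventually (\<lambda>s. f s \<in> U) (nbhds p origin) \<and>
    (\<forall>i<dm. smooth_germ p (\<lambda>s. \<phi> (f s) i) origin)"
  then have "eventually (\<lambda>s. f s \<in> U \<and> (\<forall>i\<in>{..<dm}. smooth_germ p (\<lambda>s. \<phi> (f s) i) s)) (nbhds p origin)"
    by (intro eventually_conj eventually_ball_finite) (auto dest: smooth_germ_eventually)
  then obtain W where W: "openin (Euclidean_space p) W" "origin \<in> W" "\<And>s. s \<in> W \<Longrightarrow> f s \<in> U"
    "\<And>s i. s \<in> W \<Longrightarrow> i < dm \<Longrightarrow> smooth_germ p (\<lambda>s. \<phi> (f s) i) s"
    by (rule eventually_nbhds_E[OF _ origin_coord_space]) blast
  have ev: "eventually (\<lambda>s. s \<in> W) (nbhds p s)" if "s \<in> W" for s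
    using eventually_nbhds_open[OF W(1) that] .
  have sW: "s \<in> coord_space p" if "s \<in> W" for s
    using openin_Euclidean_subset[OF W(1)] that by auto
  have evc: "eventually (\<lambda>s. \<phi> (f s) \<in> coord_space dm) (nbhds p s)" if "s \<in> W" for s
    using ev[OF that] by (rule eventually_mono) (use W(3) chart_coord_space[OF C] in auto)
  have "openin (Euclidean_space p) {s \<in> W. f s \<in> V} \<and>
      (\<forall>i<dm. smooth_on_Rn p {s \<in> W. f s \<in> V} (\<lambda>s. \<psi> (f s) i))" if D: "(V, \<psi>) \<in> charts N" for V \<psi>
  proof -
    have op: "openin (Euclidean_space p) {s \<in> W. f s \<in> V}"
      unfolding openin_Euclidean_iff
    proof (intro conjI ballI)
      show "{s \<in> W. f s \<in> V} \<subseteq> coord_space p" using sW by auto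
      fix s assume s: "s \<in> {s \<in> W. f s \<in> V}"
      have "filterlim (\<lambda>s. \<phi> (f s)) (nbhds dm (\<phi> (f s))) (nbhds p s)"
        by (rule smooth_germ_filterlim) (use s W(4) evc sW in auto)
      moreover have "eventually (\<lambda>y. y \<in> \<phi> ` (U \<inter> V)) (nbhds dm (\<phi> (f s)))"
        by (rule eventually_nbhds_open[OF overlap_open[OF C D]]) (use s W(3) in auto)
      ultimately have "eventually (\<lambda>s. \<phi> (f s) \<in> \<phi> ` (U \<inter> V)) (nbhds p s)"
        unfolding filterlim_iff by blast
      moreover have "eventually (\<lambda>s. s \<in> W) (nbhds p s)" using ev s by auto
      ultimately show "eventually (\<lambda>s. s \<in> {s \<in> W. f s \<in> V}) (nbhds p s)"
        by eventually_elim (use in_overlap[OF C W(3)] in blast)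
    qed
    have "smooth_germ p (\<lambda>s. \<psi> (f s) i) s" if i: "i < dm" and s: "s \<in> {s \<in> W. f s \<in> V}" for i s
    proof (rule smooth_germ_cong)
      show "smooth_germ p (\<lambda>s. \<psi> (inv_into U \<phi> (\<phi> (f s))) i) s"
        by (rule smooth_germ_comp[where G = "\<lambda>s. \<phi> (f s)", OF transition_germ[OF C D _ _ i]])
          (use s W(3,4) evc sW in auto)
      show "\<forall>\<^sub>F s in nbhds p s. \<psi> (inv_into U \<phi> (\<phi> (f s))) i = \<psi> (f s) i"
        by (rule eventually_mono[OF ev[of s]]) (use s W(3) C in auto)
    qed
    then show ?thesis using op smooth_on_Rn_germ[OF op] by blast
  qed
  then show "smooth_family p N f"
    unfolding smooth_family_def using W(1-3) C by (intro exI[of _ W]) (auto simp: points_def)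
qed

lemma smooth_family_in_points: "smooth_family p N f \<Longrightarrow> f origin \<in> points N"
  unfolding smooth_family_def by auto

lemma smooth_family_cong:
  assumes "smooth_family p N f" "eventually (\<lambda>s. f s = g s) (nbhds p origin)"
  shows "smooth_family p N g"
proof -
  have eq: "f origin = g origin" using assms(2) eventually_nbhds_self origin_coord_space by blast
  obtain U \<phi> where C: "(U, \<phi>) \<in> charts N" "f origin \<in> U"
    using smooth_family_in_points[OF assms(1)] by (auto simp: points_def)
  have "eventually (\<lambda>s. g s \<in> U) (nbhds p origin)"
    using conjunct1[OF iffD1[OF smooth_family_iff[of U \<phi> f, OF C] assms(1)]] assms(2)
    by eventually_elim simp
  moreover have "smooth_germ p (\<lambda>s. \<phi> (g s) i) origin" if "i < dm" for i
    by (rule smooth_germ_cong[of p "\<lambda>s. \<phi> (f s) i"])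
      (use assms(1) smooth_family_iff[of U \<phi> f, OF C] that eventually_mono[OF assms(2)] in auto)
  ultimately show ?thesis using smooth_family_iff[of U \<phi> g p] C eq by auto
qed

text \<open>The analogue of \<open>smooth_family_iff\<close>, stated separately because smoothness
  of curves is defined by iterated \<open>deriv\<close> on an open set of times.\<close>

lemma curve_at_iff:
  assumes C: "(U, \<phi>) \<in> charts N" and ct: "c t \<in> U"
  shows "curve_at N c t \<longleftrightarrow> eventually (\<lambda>u. c u \<in> U) (nhds t) \<and> (\<forall>i<dm. smooth1 (\<lambda>u. \<phi> (c u) i) t)"
proof
  assume "curve_at N c t"
  then obtain I where I: "open I" "t \<in> I" "smooth_curve N I c" by (auto simp: curve_at_def)
  then have J: "open {u \<in> I. c u \<in> U}" "\<And>u i \<alpha>. u \<in> I \<Longrightarrow> c u \<in> U \<Longrightarrow> i < dm \<Longrightarrow>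
      ((deriv ^^ \<alpha>) (\<lambda>u. \<phi> (c u) i)) differentiable (at u)"
    using C unfolding smooth_curve_def by (auto split: prod.splits)
  have ev: "eventually (\<lambda>u. u \<in> {u \<in> I. c u \<in> U}) (nhds t)"
    using J(1) ct I(2) by (intro eventually_nhds_in_open) auto
  have "smooth1 (\<lambda>u. \<phi> (c u) i) t" if "i < dm" for i
    unfolding smooth1_def using ev by (rule eventually_mono) (use J(2) that in auto)
  then show "eventually (\<lambda>u. c u \<in> U) (nhds t) \<and> (\<forall>i<dm. smooth1 (\<lambda>u. \<phi> (c u) i) t)"
    using eventually_mono[OF ev, of "\<lambda>u. c u \<in> U"] by auto
next
  assume h: "eventually (\<lambda>u. c u \<in> U) (nhds t) \<and> (\<forall>i<dm. smooth1 (\<lambda>u. \<phi> (c u) i) t)"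
  then have "eventually (\<lambda>u. c u \<in> U \<and> (\<forall>i\<in>{..<dm}. smooth1 (\<lambda>u. \<phi> (c u) i) u)) (nhds t)"
    by (intro eventually_conj eventually_ball_finite) (auto dest: smooth1_eventually)
  then obtain J where J: "open J" "t \<in> J" "\<And>u. u \<in> J \<Longrightarrow> c u \<in> U"
    "\<And>u i. u \<in> J \<Longrightarrow> i < dm \<Longrightarrow> smooth1 (\<lambda>u. \<phi> (c u) i) u"
    unfolding eventually_nhds by auto
  have ev: "eventually (\<lambda>u. u \<in> J) (nhds u)" if "u \<in> J" for u
    using J(1) that by (rule eventually_nhds_in_open)
  have evc: "eventually (\<lambda>u. \<phi> (c u) \<in> coord_space dm) (nhds u)" if "u \<in> J" for u
    using ev[OF that] by (rule eventually_mono) (use J(3) chart_coord_space[OF C] in auto)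
  have "open {u \<in> J. c u \<in> V} \<and>
      (\<forall>u\<in>J. c u \<in> V \<longrightarrow> (\<forall>i<dm. \<forall>\<alpha>. ((deriv ^^ \<alpha>) (\<lambda>u. \<psi> (c u) i)) differentiable (at u)))"
    if D: "(V, \<psi>) \<in> charts N" for V \<psi>
  proof (intro conjI ballI impI allI)
    have "eventually (\<lambda>u. u \<in> {u \<in> J. c u \<in> V}) (nhds u)" if u: "u \<in> {u \<in> J. c u \<in> V}" for u
    proof -
      have "filterlim (\<lambda>u. \<phi> (c u)) (nbhds dm (\<phi> (c u))) (nhds u)"
      proof (rule filterlim_nbhds)
        fix i assume "i < dm"
        then have "isCont (\<lambda>u. \<phi> (c u) i) u"
          using J(4)[of u i] u smooth1_differentiable[of _ u 0] differentiable_imp_continuous_within by force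
        then show "((\<lambda>u. \<phi> (c u) i) \<longlongrightarrow> \<phi> (c u) i) (nhds u)"
          using tendsto_at_iff_tendsto_nhds[of "\<lambda>u. \<phi> (c u) i" u] by (simp add: continuous_at)
      qed (use evc u J(3) chart_coord_space[OF C] in auto)
      moreover have "eventually (\<lambda>y. y \<in> \<phi> ` (U \<inter> V)) (nbhds dm (\<phi> (c u)))"
        by (rule eventually_nbhds_open[OF overlap_open[OF C D]]) (use u J(3) in auto)
      ultimately have "eventually (\<lambda>u. \<phi> (c u) \<in> \<phi> ` (U \<inter> V)) (nhds u)"
        unfolding filterlim_iff by blast
      moreover have "eventually (\<lambda>u. u \<in> J) (nhds u)" using ev u by auto
      ultimately show ?thesis
        by eventually_elim (use in_overlap[OF C J(3)] in blast)
    qed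
    note evV = this
    show "open {u \<in> J. c u \<in> V}"
    proof (rule Topological_Spaces.openI)
      fix u assume "u \<in> {u \<in> J. c u \<in> V}"
      from evV[OF this] show "\<exists>T. open T \<and> u \<in> T \<and> T \<subseteq> {u \<in> J. c u \<in> V}"
        unfolding eventually_nhds subset_eq by blast
    qed
  next
    fix u i \<alpha> assume u: "u \<in> J" "c u \<in> V" "i < dm"
    have "smooth1 (\<lambda>u. \<psi> (inv_into U \<phi> (\<phi> (c u))) i) u"
      by (rule smooth1_comp[where G = "\<lambda>u. \<phi> (c u)", OF transition_germ[OF C D _ _ u(3)]])
        (use u J(3,4) evc in auto)
    then have "smooth1 (\<lambda>u. \<psi> (c u) i) u"
      by (rule smooth1_cong) (rule eventually_mono[OF ev[OF u(1)]], use J(3) C in auto)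
    then show "((deriv ^^ \<alpha>) (\<lambda>u. \<psi> (c u) i)) differentiable (at u)"
      by (rule smooth1_differentiable)
  qed
  then show "curve_at N c t"
    unfolding curve_at_def smooth_curve_def using J(1-3) C
    by (intro exI[of _ J]) (auto simp: points_def)
qed

lemma curve_at_coords:
  assumes "(U, \<phi>) \<in> charts N" "curve_at N c t" "c t \<in> U"
  shows "eventually (\<lambda>u. c u \<in> U) (nhds t)" "i < dm \<Longrightarrow> smooth1 (\<lambda>u. \<phi> (c u) i) t"
  using curve_at_iff[of U \<phi> c t] assms by auto

lemma curve_at_shift:
  assumes "curve_at N c (t + s)" shows "curve_at N (\<lambda>u. c (t + u)) s"
proof -
  obtain U \<phi> where C: "(U, \<phi>) \<in> charts N" "c (t + s) \<in> U"
    using curve_at_in_points[OF assms] by (auto simp: in_points_iff)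
  have "filterlim (\<lambda>u. t + u) (nhds (t + s)) (nhds s)" by (intro tendsto_intros filterlim_ident)
  then have "eventually (\<lambda>u. c (t + u) \<in> U) (nhds s)"
    using curve_at_coords(1)[OF C(1) assms C(2)] unfolding filterlim_iff by blast
  moreover have "smooth1 (\<lambda>u. \<phi> (c (t + u)) i) s" if "i < dm" for i
    using smooth1_shift[of "\<lambda>u. \<phi> (c u) i", OF curve_at_coords(2)[OF C(1) assms C(2) that]] .
  ultimately show ?thesis using curve_at_iff[of U \<phi> "\<lambda>u. c (t + u)" s] C by auto
qed

lemma velocity_at_self: "curve_at N c t \<Longrightarrow> (\<lambda>u. c (t + u)) \<in> velocity N k c t"
  using velocity_self[of N "\<lambda>u. c (t + u)" k] curve_at_shift[of c t 0] velocity_shift[of N k c t] by simp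

text \<open>Coordinates on velocity bundles are computed from a chosen representative. The class is
  nonempty and its members share the relevant derivatives, so any curve defining the velocity may be
  used instead.\<close>

lemma rep_velocity:
  assumes "curve_at N c t"
  shows "rep (velocity N k c t) \<in> velocity N k c t" "curve_at N (rep (velocity N k c t)) 0"
    "rep (velocity N k c t) 0 = c t"
    "(U, \<phi>) \<in> charts N \<Longrightarrow> c t \<in> U \<Longrightarrow> i < dm \<Longrightarrow> \<alpha> \<le> k \<Longrightarrow>
      (deriv ^^ \<alpha>) (\<lambda>u. \<phi> (rep (velocity N k c t) u) i) 0 = (deriv ^^ \<alpha>) (\<lambda>u. \<phi> (c u) i) t"
proof -
  show *: "rep (velocity N k c t) \<in> velocity N k c t"
    unfolding rep_def by (rule someI[of "\<lambda>b. b \<in> velocity N k c t", OF velocity_at_self[OF assms]])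
  show "curve_at N (rep (velocity N k c t)) 0" "rep (velocity N k c t) 0 = c t"
    "(U, \<phi>) \<in> charts N \<Longrightarrow> c t \<in> U \<Longrightarrow> i < dm \<Longrightarrow> \<alpha> \<le> k \<Longrightarrow>
      (deriv ^^ \<alpha>) (\<lambda>u. \<phi> (rep (velocity N k c t) u) i) 0 = (deriv ^^ \<alpha>) (\<lambda>u. \<phi> (c u) i) t"
    using iffD1[OF velocity_iff *] by blast+
qed

lemma base_point_velocity: "curve_at N c t \<Longrightarrow> base_point (velocity N k c t) = c t"
  by (simp add: base_point_def rep_velocity)

text \<open>\<open>agree_comp\<close> for one parameter, applied to the transition map along a list
  of \<alpha> zeros, whose sublists are again lists of at most \<alpha> zeros.\<close>

lemma jets_agree_chart:
  assumes C: "(U, \<phi>) \<in> charts N" and D: "(V, \<psi>) \<in> charts N"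
    and b: "curve_at N b 0" "b 0 \<in> U" "b 0 \<in> V" and c: "curve_at N c 0" "c 0 \<in> U"
    and eq: "\<And>i \<alpha>. i < dm \<Longrightarrow> \<alpha> \<le> k \<Longrightarrow> (deriv ^^ \<alpha>) (\<lambda>u. \<phi> (b u) i) 0 = (deriv ^^ \<alpha>) (\<lambda>u. \<phi> (c u) i) 0"
    and i: "i < dm" and \<alpha>: "\<alpha> \<le> k"
  shows "(deriv ^^ \<alpha>) (\<lambda>u. \<psi> (b u) i) 0 = (deriv ^^ \<alpha>) (\<lambda>u. \<psi> (c u) i) 0"
proof -
  have p0: "point1 0 = origin" by auto
  have bc: "b 0 = c 0"
    by (rule chart_eqI[OF C b(2) c(2)]) (use eq[of _ 0] in auto)
  have ev: "eventually (\<lambda>x. d (x 0) \<in> U) (nbhds (Suc 0) origin)"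
    "eventually (\<lambda>x. \<phi> (d (x 0)) \<in> coord_space dm) (nbhds (Suc 0) origin)"
    if "curve_at N d 0" "d 0 \<in> U" for d
    using curve_at_coords(1)[OF C that] eventually_nbhds1[of "\<lambda>u. d u \<in> U" 0]
      eventually_mono[of "\<lambda>x. d (x 0) \<in> U" _ "\<lambda>x. \<phi> (d (x 0)) \<in> coord_space dm"]
      chart_coord_space[OF C] by (auto simp: p0)
  have sm: "smooth_germ (Suc 0) (\<lambda>x. \<phi> (d (x 0)) i) origin" if "curve_at N d 0" "d 0 \<in> U" "i < dm" for d i
    using curve_at_coords(2)[OF C that] unfolding smooth1_germ p0 .
  have "agree origin (replicate \<alpha> 0) (\<lambda>x. \<psi> (inv_into U \<phi> (\<phi> (b (x 0)))) i)
      (\<lambda>x. \<psi> (inv_into U \<phi> (\<phi> (c (x 0)))) i)"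
  proof (rule agree_comp[of dm _ "\<lambda>x. \<phi> (b (x 0))" origin "Suc 0" _ "\<lambda>x. \<phi> (c (x 0))"])
    show "smooth_germ dm (\<lambda>y. \<psi> (inv_into U \<phi> y) i) (\<phi> (b (origin 0)))"
      using transition_germ[OF C D b(2,3) i] by simp
    show "set (replicate \<alpha> 0) \<subseteq> {..<Suc 0}" by (auto simp: set_replicate_conv_if)
    fix j assume j: "j < dm"
    show "agree origin (replicate \<alpha> 0) (\<lambda>x. \<phi> (b (x 0)) j) (\<lambda>x. \<phi> (c (x 0)) j)"
      unfolding agree_def
    proof (intro allI impI)
      fix js :: "nat list" assume js: "subseq js (replicate \<alpha> 0)"
      then have "set js \<subseteq> {..<Suc 0}" using list_emb_set[OF js] by auto
      then obtain l where l: "js = replicate l 0" using list_in_1 by blast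
      then have "l \<le> k" using list_emb_length[OF js] \<alpha> by simp
      show "partials js (\<lambda>x. \<phi> (b (x 0)) j) origin = partials js (\<lambda>x. \<phi> (c (x 0)) j) origin"
        unfolding l partials_replicate[of l "\<lambda>u. \<phi> (b u) j"] partials_replicate[of l "\<lambda>u. \<phi> (c u) j"]
        using eq[OF j \<open>l \<le> k\<close>] .
    qed
  qed (use sm ev b c in auto)
  then have "agree origin (replicate \<alpha> 0) (\<lambda>x. \<psi> (b (x 0)) i) (\<lambda>x. \<psi> (c (x 0)) i)"
  proof (rule agree_cong[of _ _ _ _ "Suc 0"])
    show "eventually (\<lambda>x. \<psi> (inv_into U \<phi> (\<phi> (b (x 0)))) i = \<psi> (b (x 0)) i) (nbhds (Suc 0) origin)"
      by (rule eventually_mono[OF ev(1)[OF b(1,2)]]) (simp add: C)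
    show "eventually (\<lambda>x. \<psi> (inv_into U \<phi> (\<phi> (c (x 0)))) i = \<psi> (c (x 0)) i) (nbhds (Suc 0) origin)"
      by (rule eventually_mono[OF ev(1)[OF c]]) (simp add: C)
  qed (auto simp: set_replicate_conv_if)
  from agree_D[OF this] show ?thesis
    unfolding partials_replicate[of \<alpha> "\<lambda>u. \<psi> (b u) i"] partials_replicate[of \<alpha> "\<lambda>u. \<psi> (c u) i"] .
qed

lemma velocity_eq_iff_0:
  assumes C: "(U, \<phi>) \<in> charts N" and b: "curve_at N b 0" "b 0 \<in> U" and c: "curve_at N c 0"
  shows "velocity N k b 0 = velocity N k c 0 \<longleftrightarrow> c 0 \<in> U \<and>
    (\<forall>i<dm. \<forall>\<alpha>\<le>k. (deriv ^^ \<alpha>) (\<lambda>u. \<phi> (b u) i) 0 = (deriv ^^ \<alpha>) (\<lambda>u. \<phi> (c u) i) 0)"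
proof
  assume "velocity N k b 0 = velocity N k c 0"
  then have "c \<in> velocity N k b 0" using velocity_self[OF c] by simp
  then show "c 0 \<in> U \<and> (\<forall>i<dm. \<forall>\<alpha>\<le>k.
      (deriv ^^ \<alpha>) (\<lambda>u. \<phi> (b u) i) 0 = (deriv ^^ \<alpha>) (\<lambda>u. \<phi> (c u) i) 0)"
    using C b(2) unfolding velocity_iff by metis
next
  assume h: "c 0 \<in> U \<and> (\<forall>i<dm. \<forall>\<alpha>\<le>k.
      (deriv ^^ \<alpha>) (\<lambda>u. \<phi> (b u) i) 0 = (deriv ^^ \<alpha>) (\<lambda>u. \<phi> (c u) i) 0)"
  have bc: "c 0 = b 0"
  proof (rule chart_eqI[OF C])
    fix i assume "i < dm"
    then show "\<phi> (c 0) i = \<phi> (b 0) i" using h[THEN conjunct2, rule_format, of i 0] by simp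
  qed (use h b(2) in auto)
  have "(deriv ^^ \<alpha>) (\<lambda>u. \<psi> (c u) i) 0 = (deriv ^^ \<alpha>) (\<lambda>u. \<psi> (b u) i) 0"
    if "(V, \<psi>) \<in> charts N" "b 0 \<in> V" "i < dm" "\<alpha> \<le> k" for V \<psi> i \<alpha>
    using jets_agree_chart[OF C that(1) b that(2) c _ _ that(3,4)] h by auto
  then have "c \<in> velocity N k b 0"
    using c bc by (auto simp: velocity_iff)
  then show "velocity N k b 0 = velocity N k c 0" using velocity_mem by blast
qed

lemma velocity_eq_iff:
  assumes C: "(U, \<phi>) \<in> charts N" and b: "curve_at N b t" "b t \<in> U" and c: "curve_at N c s"
  shows "velocity N k b t = velocity N k c s \<longleftrightarrow> c s \<in> U \<and>
    (\<forall>i<dm. \<forall>\<alpha>\<le>k. (deriv ^^ \<alpha>) (\<lambda>u. \<phi> (b u) i) t = (deriv ^^ \<alpha>) (\<lambda>u. \<phi> (c u) i) s)"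
  using velocity_eq_iff_0[OF C, of "\<lambda>u. b (t + u)" "\<lambda>u. c (s + u)" k] curve_at_shift[of b t 0]
    curve_at_shift[of c s 0] b c higher_deriv_shift[of _ "\<lambda>u. \<phi> (b u) _" t 0]
    higher_deriv_shift[of _ "\<lambda>u. \<phi> (c u) _" s 0]
  unfolding velocity_shift[of N k b t] velocity_shift[of N k c s] by simp

lemma jet_proj_velocity:
  assumes "curve_at N c t" "s \<le> k" shows "jet_proj N s (velocity N k c t) = velocity N s c t"
proof -
  obtain U \<phi> where C: "(U, \<phi>) \<in> charts N" "c t \<in> U"
    using curve_at_in_points[OF assms(1)] by (auto simp: in_points_iff)
  show ?thesis
    unfolding jet_proj_def
    by (subst velocity_eq_iff[OF C(1)]) (use rep_velocity[OF assms(1)] C assms in auto)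
qed

end

section \<open>The bundle of velocities as a smooth atlas\<close>

context
  fixes N :: "'a atlas" and U :: "'a set" and \<phi> :: "'a \<Rightarrow> nat \<Rightarrow> real"
  assumes N: "smooth_atlas N" and C: "(U, \<phi>) \<in> charts N"
begin

text \<open>Families are constructed by prescribing coordinates. Since the image of a chart is open,
  it contains the prescribed values near the origin as soon as it contains the value at the
  origin.\<close>

lemma chart_family:
  assumes F0: "F origin \<in> \<phi> ` U" and Fs: "\<And>i. i < dimension N \<Longrightarrow> smooth_germ p (\<lambda>s. F s i) origin"
    and Fc: "eventually (\<lambda>s. F s \<in> coord_space (dimension N)) (nbhds p origin)"
  shows "smooth_family p N (\<lambda>s. inv_into U \<phi> (F s))" "inv_into U \<phi> (F origin) \<in> U"
    "eventually (\<lambda>s. inv_into U \<phi> (F s) \<in> U \<and> \<phi> (inv_into U \<phi> (F s)) = F s) (nbhds p origin)"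
proof -
  show *: "inv_into U \<phi> (F origin) \<in> U" using F0 by (rule inv_into_into)
  have "filterlim F (nbhds (dimension N) (F origin)) (nbhds p origin)"
    by (rule smooth_germ_filterlim[OF Fs Fc]) auto
  then have "eventually (\<lambda>s. F s \<in> \<phi> ` U) (nbhds p origin)"
    using eventually_nbhds_open[OF chart_open[OF N C] F0] unfolding filterlim_iff by blast
  then show ev: "eventually (\<lambda>s. inv_into U \<phi> (F s) \<in> U \<and> \<phi> (inv_into U \<phi> (F s)) = F s) (nbhds p origin)"
    by (rule eventually_mono) (simp add: inv_into_into f_inv_into_f)
  show "smooth_family p N (\<lambda>s. inv_into U \<phi> (F s))"
    unfolding smooth_family_iff[where f = "\<lambda>s. inv_into U \<phi> (F s)", OF N C *]
  proof (intro conjI allI impI)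
    show "eventually (\<lambda>s. inv_into U \<phi> (F s) \<in> U) (nbhds p origin)"
      using ev by (rule eventually_mono) simp
    fix i assume "i < dimension N"
    from Fs[OF this] show "smooth_germ p (\<lambda>s. \<phi> (inv_into U \<phi> (F s)) i) origin"
      by (rule smooth_germ_cong) (rule eventually_mono[OF ev], simp)
  qed
qed

lemma chart_curve:
  assumes F0: "F t \<in> \<phi> ` U" and Fs: "\<And>i. i < dimension N \<Longrightarrow> smooth1 (\<lambda>s. F s i) t"
    and Fc: "eventually (\<lambda>s. F s \<in> coord_space (dimension N)) (nhds t)"
  shows "curve_at N (\<lambda>s. inv_into U \<phi> (F s)) t" "inv_into U \<phi> (F t) \<in> U"
    "eventually (\<lambda>s. inv_into U \<phi> (F s) \<in> U \<and> \<phi> (inv_into U \<phi> (F s)) = F s) (nhds t)"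
proof -
  show *: "inv_into U \<phi> (F t) \<in> U" using F0 by (rule inv_into_into)
  have "filterlim F (nbhds (dimension N) (F t)) (nhds t)"
  proof (rule filterlim_nbhds[OF Fc])
    show "F t \<in> coord_space (dimension N)" using eventually_nhds_x_imp_x[OF Fc] .
  next
    fix i assume "i < dimension N"
    then have "isCont (\<lambda>u. F u i) t"
      using Fs smooth1_differentiable[of _ t 0] differentiable_imp_continuous_within by force
    then show "((\<lambda>u. F u i) \<longlongrightarrow> F t i) (nhds t)"
      using tendsto_at_iff_tendsto_nhds[of "\<lambda>u. F u i" t] by (simp add: continuous_at)
  qed
  then have "eventually (\<lambda>s. F s \<in> \<phi> ` U) (nhds t)"
    using eventually_nbhds_open[OF chart_open[OF N C] F0] unfolding filterlim_iff by blast
  then show ev: "eventually (\<lambda>s. inv_into U \<phi> (F s) \<in> U \<and> \<phi> (inv_into U \<phi> (F s)) = F s) (nhds t)"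
    by (rule eventually_mono) (simp add: inv_into_into f_inv_into_f)
  show "curve_at N (\<lambda>s. inv_into U \<phi> (F s)) t"
    unfolding curve_at_iff[where c = "\<lambda>s. inv_into U \<phi> (F s)", OF N C *]
  proof (intro conjI allI impI)
    show "eventually (\<lambda>s. inv_into U \<phi> (F s) \<in> U) (nhds t)"
      using ev by (rule eventually_mono) simp
    fix i assume "i < dimension N"
    from Fs[OF this] show "smooth1 (\<lambda>s. \<phi> (inv_into U \<phi> (F s)) i) t"
      by (rule smooth1_cong) (rule eventually_mono[OF ev], simp)
  qed
qed

end

definition jet_dom :: "'a atlas \<Rightarrow> nat \<Rightarrow> 'a set \<Rightarrow> 'a jet set" where
  "jet_dom N k U = {v. \<exists>c. smooth_curve_near_0 N c \<and> c 0 \<in> U \<and> v = velocity N k c 0}"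

definition jet_coord :: "'a atlas \<Rightarrow> nat \<Rightarrow> ('a \<Rightarrow> nat \<Rightarrow> real) \<Rightarrow> 'a jet \<Rightarrow> nat \<Rightarrow> real" where
  "jet_coord N k \<phi> = (\<lambda>v j. if j < (k + 1) * dimension N
     then (deriv ^^ (j div dimension N)) (\<lambda>t. \<phi> (rep v t) (j mod dimension N)) 0 else 0)"

lemma dimension_jet_bundle [simp]: "dimension (jet_bundle k N) = (k + 1) * dimension N"
  by (simp add: jet_bundle_def)

lemma charts_jet_bundle:
  "charts (jet_bundle k N) = (\<lambda>(U, \<phi>). (jet_dom N k U, jet_coord N k \<phi>)) ` charts N"
  unfolding jet_bundle_def jet_dom_def jet_coord_def by simp

lemma jet_chart: "(U, \<phi>) \<in> charts N \<Longrightarrow> (jet_dom N k U, jet_coord N k \<phi>) \<in> charts (jet_bundle k N)"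
  unfolding charts_jet_bundle by force

lemma jet_index:
  fixes j k n :: nat
  assumes "j < (k + 1) * n" obtains \<alpha> i where "\<alpha> \<le> k" "i < n" "j = \<alpha> * n + i"
proof
  have "n > 0" using assms by (cases n) auto
  then show "j mod n < n" by simp
  show "j div n \<le> k" using assms by (metis less_Suc_eq_le Suc_eq_plus1 less_mult_imp_div_less)
  show "j = j div n * n + j mod n" by simp
qed

lemma jet_index_less: "\<alpha> \<le> k \<Longrightarrow> i < n \<Longrightarrow> \<alpha> * n + i < (k + 1) * (n::nat)"
proof -
  assume "\<alpha> \<le> k" "i < n"
  then have "\<alpha> * n + i < \<alpha> * n + n" "\<alpha> * n + n \<le> k * n + n" by auto
  then have "\<alpha> * n + i < k * n + n" by linarith
  then show ?thesis by (simp add: algebra_simps)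
qed

text \<open>Projection from the coordinates of a bundle to those of its base, which form the first
  block in all bundle charts.\<close>

definition coord_restrict :: "nat \<Rightarrow> (nat \<Rightarrow> real) \<Rightarrow> nat \<Rightarrow> real" where
  "coord_restrict n z = (\<lambda>i. if i < n then z i else 0)"

lemma coord_restrict_coord_space [simp]: "coord_restrict n z \<in> coord_space n"
  by (simp add: coord_restrict_def coord_space_def)

lemma openin_coord_restrict:
  assumes "openin (Euclidean_space n) V" "n \<le> m"
  shows "openin (Euclidean_space m) {z \<in> coord_space m. coord_restrict n z \<in> V}"
  unfolding openin_Euclidean_iff
proof (intro conjI ballI)
  fix a assume a: "a \<in> {z \<in> coord_space m. coord_restrict n z \<in> V}"
  obtain e where e: "e > 0" "\<And>x. x \<in> coord_space n \<Longrightarrow> \<forall>i<n. \<bar>x i - coord_restrict n a i\<bar> < e \<Longrightarrow> x \<in> V"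
    using box_in_open[OF assms(1), of "coord_restrict n a"] a by blast
  have "x \<in> {z \<in> coord_space m. coord_restrict n z \<in> V}"
    if "x \<in> coord_space m" "\<forall>i<m. \<bar>x i - a i\<bar> < e" for x
  proof -
    have "coord_restrict n x \<in> V"
      by (rule e(2)) (use that assms(2) in \<open>auto simp: coord_restrict_def coord_space_def\<close>)
    then show ?thesis using that by simp
  qed
  then show "eventually (\<lambda>x. x \<in> {z \<in> coord_space m. coord_restrict n z \<in> V}) (nbhds m a)"
    using e(1) a eventually_nbhds[of a m] by blast
qed auto

section \<open>Taylor polynomials as representatives of jets\<close>

definition taylor_monomial :: "nat \<Rightarrow> real \<Rightarrow> real" where
  "taylor_monomial m t = t ^ m / fact m"

lemma taylor_monomial_simps [simp]:
  "taylor_monomial 0 t = 1" "taylor_monomial m 0 = (if m = 0 then 1 else 0)"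
  by (auto simp: taylor_monomial_def)

lemma deriv_taylor_monomial: "deriv (taylor_monomial (Suc m)) = taylor_monomial m"
proof
  fix t :: real
  have "((\<lambda>t. t ^ Suc m) has_real_derivative real (Suc m) * t ^ m) (at t)"
    by (rule derivative_eq_intros refl)+ simp
  then have "((\<lambda>t. t ^ Suc m / fact (Suc m)) has_real_derivative (real (Suc m) * t ^ m) / fact (Suc m)) (at t)"
    by (rule DERIV_cdivide)
  moreover have "(real (Suc m) * t ^ m) / fact (Suc m) = taylor_monomial m t"
    by (simp add: taylor_monomial_def divide_simps)
  ultimately show "deriv (taylor_monomial (Suc m)) t = taylor_monomial m t"
    unfolding taylor_monomial_def[of "Suc m", abs_def] by (simp only: DERIV_imp_deriv)
qed

lemma higher_deriv_taylor_monomial: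
  "(deriv ^^ \<alpha>) (taylor_monomial \<beta>) = (if \<alpha> \<le> \<beta> then taylor_monomial (\<beta> - \<alpha>) else (\<lambda>_. 0))"
proof (induction \<alpha>)
  case (Suc \<alpha>)
  have *: "deriv (taylor_monomial 0) = (\<lambda>_. 0)"
    unfolding taylor_monomial_simps(1)[abs_def] by (simp add: fun_eq_iff)
  have "deriv (taylor_monomial (\<beta> - \<alpha>)) = taylor_monomial (\<beta> - Suc \<alpha>)" if "\<alpha> < \<beta>"
    using deriv_taylor_monomial[of "\<beta> - Suc \<alpha>"] that by (simp add: Suc_diff_Suc)
  moreover have "deriv (\<lambda>_. 0) = (\<lambda>_::real. 0::real)" by (simp add: fun_eq_iff)
  ultimately show ?case using Suc *
    by (cases \<alpha> \<beta> rule: linorder_cases) simp_all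
qed simp

lemma smooth1_taylor_monomial: "smooth1 (taylor_monomial \<beta>) t"
proof -
  have "smooth1 (\<lambda>t. 1 / fact \<beta> * t ^ \<beta>) t"
    by (rule smooth1_mult[OF smooth1_const smooth1_power[OF smooth1_ident]])
  then show ?thesis by (simp add: taylor_monomial_def[abs_def])
qed

lemma higher_deriv_taylor:
  assumes "\<alpha> \<le> k"
  shows "(deriv ^^ \<alpha>) (\<lambda>t. \<Sum>\<beta>\<le>k. a \<beta> * taylor_monomial \<beta> t) 0 = a \<alpha>"
proof -
  have "(deriv ^^ \<alpha>) (\<lambda>t. \<Sum>\<beta>\<le>k. a \<beta> * taylor_monomial \<beta> t) 0 =
      (\<Sum>\<beta>\<le>k. (deriv ^^ \<alpha>) (\<lambda>t. a \<beta> * taylor_monomial \<beta> t) 0)"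
    by (rule higher_deriv_sum) (auto intro!: smooth1_mult smooth1_const smooth1_taylor_monomial)
  also have "\<dots> = (\<Sum>\<beta>\<le>k. if \<beta> = \<alpha> then a \<beta> else 0)"
    by (intro sum.cong refl)
      (auto simp: higher_deriv_scale[OF smooth1_taylor_monomial] higher_deriv_taylor_monomial)
  also have "\<dots> = a \<alpha>" using assms by simp
  finally show ?thesis .
qed

text \<open>Coordinate \<open>i\<close> is the Taylor polynomial whose derivative of order \<beta>
  at 0 is the entry of index \<open>\<beta> * n + i\<close>; this inverts the lifted coordinates at
  the level of curves in a chart.\<close>

definition jet_poly :: "nat \<Rightarrow> nat \<Rightarrow> (nat \<Rightarrow> real) \<Rightarrow> real \<Rightarrow> nat \<Rightarrow> real" where
  "jet_poly n k z t = (\<lambda>i. if i < n then \<Sum>\<beta>\<le>k. z (\<beta> * n + i) * taylor_monomial \<beta> t else 0)"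

lemma jet_poly_coord_space [simp]: "jet_poly n k z t \<in> coord_space n"
  by (simp add: jet_poly_def coord_space_def)

lemma higher_deriv_jet_poly: "\<alpha> \<le> k \<Longrightarrow> i < n \<Longrightarrow> (deriv ^^ \<alpha>) (\<lambda>t. jet_poly n k z t i) 0 = z (\<alpha> * n + i)"
  using higher_deriv_taylor[of \<alpha> k "\<lambda>\<beta>. z (\<beta> * n + i)"] by (simp add: jet_poly_def)

lemma smooth1_jet_poly: "smooth1 (\<lambda>t. jet_poly n k z t i) t"
  unfolding jet_poly_def
  by (cases "i < n")
    (auto intro!: smooth1_sum smooth1_mult[OF smooth1_const smooth1_taylor_monomial] smooth1_const)

lemma jet_poly_0: "jet_poly n k z 0 = coord_restrict n z"
proof
  fix i
  show "jet_poly n k z 0 i = coord_restrict n z i"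
    using higher_deriv_jet_poly[of 0 k i n z] by (cases "i < n") (auto simp: jet_poly_def coord_restrict_def)
qed

context
  fixes N :: "'a atlas"
  assumes N: "smooth_atlas N"
begin

lemma jet_dom_iff: "curve_at N c t \<Longrightarrow> velocity N k c t \<in> jet_dom N k U \<longleftrightarrow> c t \<in> U"
proof
  assume c: "curve_at N c t"
  { assume "velocity N k c t \<in> jet_dom N k U"
    then obtain b where "curve_at N b 0" "b 0 \<in> U" "velocity N k c t = velocity N k b 0"
      by (auto simp: jet_dom_def smooth_curve_near_0_curve_at)
    then show "c t \<in> U" using base_point_velocity[OF N] c by metis }
  { assume "c t \<in> U"
    then show "velocity N k c t \<in> jet_dom N k U"
      using curve_at_shift[OF N, of c t 0] c velocity_shift[of N k c t]
      unfolding jet_dom_def smooth_curve_near_0_curve_at by force }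
qed

lemma jet_dom_E:
  assumes "v \<in> jet_dom N k U"
  obtains c where "curve_at N c 0" "c 0 \<in> U" "v = velocity N k c 0"
  using assms by (auto simp: jet_dom_def smooth_curve_near_0_curve_at)

lemma points_jet_bundle: "points (jet_bundle k N) = {velocity N k c 0 |c. curve_at N c 0}"
proof -
  have "v \<in> points (jet_bundle k N) \<longleftrightarrow> (\<exists>U \<phi>. (U, \<phi>) \<in> charts N \<and> v \<in> jet_dom N k U)" for v
    by (force simp: in_points_iff charts_jet_bundle)
  moreover have "(\<exists>U \<phi>. (U, \<phi>) \<in> charts N \<and> v \<in> jet_dom N k U) \<longleftrightarrow> (\<exists>c. v = velocity N k c 0 \<and> curve_at N c 0)" for v
  proof
    assume "\<exists>c. v = velocity N k c 0 \<and> curve_at N c 0"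
    then obtain c where c: "v = velocity N k c 0" "curve_at N c 0" by blast
    then show "\<exists>U \<phi>. (U, \<phi>) \<in> charts N \<and> v \<in> jet_dom N k U"
      using curve_at_in_points[OF c(2)] jet_dom_iff[OF c(2)] by (auto simp: in_points_iff)
  qed (metis jet_dom_E)
  ultimately show ?thesis by (intro set_eqI) (simp only: mem_Collect_eq)
qed

lemma velocity_in_points: "curve_at N c t \<Longrightarrow> velocity N k c t \<in> points (jet_bundle k N)"
  using curve_at_shift[OF N, of c t 0] velocity_shift[of N k c t] unfolding points_jet_bundle by auto

lemma jet_coord_velocity:
  assumes "(U, \<phi>) \<in> charts N" "curve_at N c t" "c t \<in> U" "i < dimension N" "\<alpha> \<le> k"
  shows "jet_coord N k \<phi> (velocity N k c t) (\<alpha> * dimension N + i) = (deriv ^^ \<alpha>) (\<lambda>u. \<phi> (c u) i) t"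
  using rep_velocity(4)[OF N assms(2,1,3,4,5)] jet_index_less[OF assms(5,4)] assms(4)
  by (simp add: jet_coord_def)

lemma jet_coord_coord_space: "jet_coord N k \<phi> v \<in> coord_space ((k + 1) * dimension N)"
  by (auto simp: jet_coord_def coord_space_def)

lemma jet_coord_restrict:
  assumes "(U, \<phi>) \<in> charts N" "curve_at N c t" "c t \<in> U"
  shows "coord_restrict (dimension N) (jet_coord N k \<phi> (velocity N k c t)) = \<phi> (c t)"
proof (subst coord_space_eq_iff[of _ "dimension N"])
  show "\<forall>i<dimension N. coord_restrict (dimension N) (jet_coord N k \<phi> (velocity N k c t)) i = \<phi> (c t) i"
    using jet_coord_velocity[OF assms, of _ 0 k] by (simp add: coord_restrict_def)
qed (use chart_coord_space[OF N assms(1,3)] in auto)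

definition jet_curve :: "'a set \<Rightarrow> ('a \<Rightarrow> nat \<Rightarrow> real) \<Rightarrow> nat \<Rightarrow> (nat \<Rightarrow> real) \<Rightarrow> real \<Rightarrow> 'a" where
  "jet_curve U \<phi> k z t = inv_into U \<phi> (jet_poly (dimension N) k z t)"

lemma jet_curve:
  assumes C: "(U, \<phi>) \<in> charts N" and z: "coord_restrict (dimension N) z \<in> \<phi> ` U"
  shows "curve_at N (jet_curve U \<phi> k z) 0" "jet_curve U \<phi> k z 0 \<in> U"
    "eventually (\<lambda>t. jet_curve U \<phi> k z t \<in> U \<and> \<phi> (jet_curve U \<phi> k z t) = jet_poly (dimension N) k z t) (nhds 0)"
  using chart_curve[OF N C, of "jet_poly (dimension N) k z" 0] z
  unfolding jet_curve_def[abs_def] jet_poly_0 by (simp_all add: smooth1_jet_poly)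

lemma higher_deriv_jet_curve:
  assumes C: "(U, \<phi>) \<in> charts N" and z: "coord_restrict (dimension N) z \<in> \<phi> ` U"
    and "i < dimension N" "\<alpha> \<le> k"
  shows "(deriv ^^ \<alpha>) (\<lambda>t. \<phi> (jet_curve U \<phi> k z t) i) 0 = z (\<alpha> * dimension N + i)"
proof -
  have "eventually (\<lambda>t. \<phi> (jet_curve U \<phi> k z t) i = jet_poly (dimension N) k z t i) (nhds 0)"
    using jet_curve(3)[OF C z, of k] by (rule eventually_mono) simp
  then show ?thesis using higher_deriv_cong higher_deriv_jet_poly assms(3,4) by metis
qed

lemma jet_coord_jet_curve:
  assumes C: "(U, \<phi>) \<in> charts N" and z: "coord_restrict (dimension N) z \<in> \<phi> ` U"
    "z \<in> coord_space ((k + 1) * dimension N)"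
  shows "jet_coord N k \<phi> (velocity N k (jet_curve U \<phi> k z) 0) = z"
proof (subst coord_space_eq_iff[OF jet_coord_coord_space z(2)], intro allI impI)
  fix j assume "j < (k + 1) * dimension N"
  then obtain \<alpha> i where "\<alpha> \<le> k" "i < dimension N" "j = \<alpha> * dimension N + i" using jet_index by metis
  then show "jet_coord N k \<phi> (velocity N k (jet_curve U \<phi> k z) 0) j = z j"
    using jet_coord_velocity[OF C jet_curve(1,2)[OF C z(1)]] higher_deriv_jet_curve[OF C z(1)] by simp
qed

lemma jet_coord_inj:
  assumes C: "(U, \<phi>) \<in> charts N" shows "inj_on (jet_coord N k \<phi>) (jet_dom N k U)"
proof (rule inj_onI)
  fix v w assume v: "v \<in> jet_dom N k U" and w: "w \<in> jet_dom N k U" and eq: "jet_coord N k \<phi> v = jet_coord N k \<phi> w"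
  obtain b where b: "curve_at N b 0" "b 0 \<in> U" "v = velocity N k b 0" using v jet_dom_E by metis
  obtain c where c: "curve_at N c 0" "c 0 \<in> U" "w = velocity N k c 0" using w jet_dom_E by metis
  have "(deriv ^^ \<alpha>) (\<lambda>u. \<phi> (b u) i) 0 = (deriv ^^ \<alpha>) (\<lambda>u. \<phi> (c u) i) 0" if "i < dimension N" "\<alpha> \<le> k" for i \<alpha>
    using jet_coord_velocity[OF C b(1,2) that] jet_coord_velocity[OF C c(1,2) that] eq b(3) c(3) by simp
  then show "v = w" using velocity_eq_iff_0[OF N C b(1,2) c(1)] b(3) c(2,3) by simp
qed

text \<open>Only the base point restricts jet coordinates: every choice of higher derivatives is
  realized by the polynomial curve \<open>jet_curve\<close>.\<close>

lemma jet_coord_image: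
  assumes C: "(U, \<phi>) \<in> charts N"
  shows "jet_coord N k \<phi> ` (jet_dom N k U \<inter> jet_dom N k V) =
    {z \<in> coord_space ((k + 1) * dimension N). coord_restrict (dimension N) z \<in> \<phi> ` (U \<inter> V)}" (is "?L = ?R")
proof
  show "?L \<subseteq> ?R"
  proof (intro image_subsetI)
    fix v assume v: "v \<in> jet_dom N k U \<inter> jet_dom N k V"
    then obtain b where b: "curve_at N b 0" "b 0 \<in> U" "v = velocity N k b 0" using jet_dom_E by blast
    then have "b 0 \<in> V" using v jet_dom_iff by auto
    then show "jet_coord N k \<phi> v \<in> ?R"
      using jet_coord_restrict[OF C b(1,2), of k] b jet_coord_coord_space by auto
  qed
  show "?R \<subseteq> ?L"
  proof
    fix z assume z: "z \<in> ?R"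
    then have zU: "coord_restrict (dimension N) z \<in> \<phi> ` U" by auto
    have "\<phi> (jet_curve U \<phi> k z 0) = coord_restrict (dimension N) z"
      using eventually_nhds_x_imp_x[OF jet_curve(3)[OF C zU]] by (simp add: jet_poly_0)
    then have "jet_curve U \<phi> k z 0 \<in> V" using z in_overlap[OF N C jet_curve(2)[OF C zU]] by auto
    then show "z \<in> ?L"
      using jet_coord_jet_curve[OF C zU] z jet_curve(1,2)[OF C zU] jet_dom_iff by (metis (mono_tags, lifting) IntI image_eqI mem_Collect_eq)
  qed
qed

text \<open>Makes time a coordinate of index \<open>d\<close>, so that time derivatives of a curve
  depending on \<open>z\<close> become partial derivatives of one function, to which the rules for
  germs apply.\<close>

lemma partials_last_param:
  "partials (replicate \<alpha> d) F = (\<lambda>z. (deriv ^^ \<alpha>) (\<lambda>t. F (z(d := t))) (z d))"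
proof (induction \<alpha>)
  case (Suc \<alpha>)
  show ?case
    unfolding replicate_Suc foldr.simps o_apply Suc
    unfolding partial_def fun_upd_upd fun_upd_same funpow.simps o_apply by (rule ext) simp
qed (simp only: replicate.simps foldr.simps funpow.simps id_apply fun_upd_triv)

text \<open>In lifted charts the transition map sends \<open>z\<close> to the time derivatives at 0
  of the transition map of \<open>N\<close> applied to the polynomial curve with coefficients
  \<open>z\<close>. With time as coordinate \<open>?d\<close> these are partial derivatives of a
  smooth function of \<open>?d + 1\<close> variables, restricted to the points where the last one
  vanishes.\<close>

lemma smooth_atlas_jet_bundle: "smooth_atlas (jet_bundle k N)"
proof -
  let ?n = "dimension N" and ?d = "(k + 1) * dimension N"
  have "openin (Euclidean_space ?d) (jet_coord N k \<phi> ` (jet_dom N k U \<inter> jet_dom N k V)) \<and>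
     (\<forall>j<?d. smooth_on_Rn ?d (jet_coord N k \<phi> ` (jet_dom N k U \<inter> jet_dom N k V))
        (\<lambda>x. jet_coord N k \<psi> (inv_into (jet_dom N k U) (jet_coord N k \<phi>) x) j))"
    if C: "(U, \<phi>) \<in> charts N" and D: "(V, \<psi>) \<in> charts N" for U \<phi> V \<psi>
  proof
    let ?W = "{z \<in> coord_space ?d. coord_restrict ?n z \<in> \<phi> ` (U \<inter> V)}"
    have W: "openin (Euclidean_space ?d) ?W"
      by (rule openin_coord_restrict[OF overlap_open[OF N C D]]) simp
    then show "openin (Euclidean_space ?d) (jet_coord N k \<phi> ` (jet_dom N k U \<inter> jet_dom N k V))"
      unfolding jet_coord_image[OF C] .
    have eq: "jet_coord N k \<psi> (inv_into (jet_dom N k U) (jet_coord N k \<phi>) z) (\<alpha> * ?n + i) =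
        partials (replicate \<alpha> ?d) (\<lambda>y. \<psi> (inv_into U \<phi> (jet_poly ?n k y (y ?d))) i) z"
      if z: "z \<in> ?W" and i: "i < ?n" and \<alpha>: "\<alpha> \<le> k" for z i \<alpha>
    proof -
      have zU: "coord_restrict ?n z \<in> \<phi> ` U" and zc: "z \<in> coord_space ?d" using z by auto
      have "velocity N k (jet_curve U \<phi> k z) 0 \<in> jet_dom N k U"
        using jet_dom_iff jet_curve(1,2)[OF C zU] by auto
      then have inv: "inv_into (jet_dom N k U) (jet_coord N k \<phi>) z = velocity N k (jet_curve U \<phi> k z) 0"
        using jet_coord_jet_curve[OF C zU zc] inv_into_f_f[OF jet_coord_inj[OF C]] by metis
      have "\<phi> (jet_curve U \<phi> k z 0) = coord_restrict ?n z"
        using eventually_nhds_x_imp_x[OF jet_curve(3)[OF C zU]] by (simp add: jet_poly_0)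
      then have "jet_curve U \<phi> k z 0 \<in> V" using z in_overlap[OF N C jet_curve(2)[OF C zU]] by auto
      then have "jet_coord N k \<psi> (inv_into (jet_dom N k U) (jet_coord N k \<phi>) z) (\<alpha> * ?n + i) =
          (deriv ^^ \<alpha>) (\<lambda>t. \<psi> (inv_into U \<phi> (jet_poly ?n k z t)) i) 0"
        unfolding inv using jet_coord_velocity[OF D jet_curve(1)[OF C zU] _ i \<alpha>] by (simp add: jet_curve_def)
      \<comment> \<open>The coefficients of the polynomial have indices below \<open>?d\<close>, so
        storing the time in coordinate \<open>?d\<close> does not change it.\<close>
      also have "jet_poly ?n k z = jet_poly ?n k (z(?d := t))" for t
      proof -
        have "(z(?d := t)) (\<beta> * ?n + i) = z (\<beta> * ?n + i)" if "\<beta> \<le> k" "i < ?n" for \<beta> i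
          using jet_index_less[OF that] by simp
        then show ?thesis by (auto simp: jet_poly_def fun_eq_iff)
      qed
      then have "(\<lambda>t. \<psi> (inv_into U \<phi> (jet_poly ?n k z t)) i) =
          (\<lambda>t. \<psi> (inv_into U \<phi> (jet_poly ?n k (z(?d := t)) ((z(?d := t)) ?d))) i)" by simp
      finally show ?thesis
        unfolding partials_last_param using zc by (simp add: coord_space_def)
    qed
    have "smooth_germ ?d (\<lambda>x. jet_coord N k \<psi> (inv_into (jet_dom N k U) (jet_coord N k \<phi>) x) j) z"
      if j: "j < ?d" and z: "z \<in> ?W" for j z
    proof -
      obtain \<alpha> i where ai: "\<alpha> \<le> k" "i < ?n" "j = \<alpha> * ?n + i" using jet_index[OF j] by metis
      have zc: "z \<in> coord_space ?d" "z \<in> coord_space (Suc ?d)" and zd: "z ?d = 0" using z by (auto simp: coord_space_def)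
      have sp: "smooth_germ (Suc ?d) (\<lambda>y. jet_poly ?n k y (y ?d) i) z" if "i < ?n" for i
      proof -
        have "smooth_germ (Suc ?d) (\<lambda>y. \<Sum>\<beta>\<le>k. y (\<beta> * ?n + i) * taylor_monomial \<beta> (y ?d)) z"
        proof (rule smooth_germ_sum[OF zc(2)])
          fix \<beta> assume "\<beta> \<in> {..k}"
          then have "\<beta> * ?n + i < Suc ?d" using jet_index_less[of \<beta> k i ?n] that by simp
          then show "smooth_germ (Suc ?d) (\<lambda>y. y (\<beta> * ?n + i) * taylor_monomial \<beta> (y ?d)) z"
            by (intro smooth_germ_mult smooth_germ_coord[OF zc(2)]
                smooth_germ_comp1[where G = "\<lambda>y. y ?d", OF smooth1_taylor_monomial]) auto
        qed
        then show ?thesis using that by (simp add: jet_poly_def)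
      qed
      have zU: "jet_poly ?n k z (z ?d) \<in> \<phi> ` (U \<inter> V)" using z unfolding zd jet_poly_0 by simp
      then obtain x where x: "x \<in> U" "x \<in> V" "jet_poly ?n k z (z ?d) = \<phi> x" by auto
      have "smooth_germ (Suc ?d) (\<lambda>y. \<psi> (inv_into U \<phi> (jet_poly ?n k y (y ?d))) i) z"
        by (rule smooth_germ_comp[where G = "\<lambda>y. jet_poly ?n k y (y ?d)" and n = ?n])
          (use transition_germ[OF N C D x(1,2) ai(2)] x(3) sp zc in auto)
      then have sF: "smooth_germ (Suc ?d) (partials (replicate \<alpha> ?d) (\<lambda>y. \<psi> (inv_into U \<phi> (jet_poly ?n k y (y ?d))) i)) z"
        by (rule smooth_germ_partials) (auto simp: set_replicate_conv_if)
      \<comment> \<open>Restriction to \<open>coord_space ?d\<close>: the added coordinate is the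
        constant 0 there.\<close>
      have coord: "smooth_germ ?d (\<lambda>x. x l) z" if "l < Suc ?d" for l
      proof (cases "l = ?d")
        case True
        have "eventually (\<lambda>x. 0 = x l) (nbhds ?d z)"
          by (rule eventually_mono[OF eventually_coord_space]) (use True in \<open>auto simp: coord_space_def\<close>)
        then show ?thesis by (rule smooth_germ_cong[rotated]) (use zc in auto)
      qed (use that zc smooth_germ_coord in auto)
      have "eventually (\<lambda>x. x \<in> coord_space (Suc ?d)) (nbhds ?d z)"
        by (rule eventually_mono[OF eventually_coord_space]) (auto simp: coord_space_def)
      then have "smooth_germ ?d (\<lambda>x. partials (replicate \<alpha> ?d) (\<lambda>y. \<psi> (inv_into U \<phi> (jet_poly ?n k y (y ?d))) i) x) z"
        by (intro smooth_germ_comp[where G = "\<lambda>x. x", OF sF coord _ zc(1)])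
      then show ?thesis
      proof (rule smooth_germ_cong)
        show "eventually (\<lambda>x. partials (replicate \<alpha> ?d) (\<lambda>y. \<psi> (inv_into U \<phi> (jet_poly ?n k y (y ?d))) i) x =
            jet_coord N k \<psi> (inv_into (jet_dom N k U) (jet_coord N k \<phi>) x) j) (nbhds ?d z)"
          unfolding ai(3) by (rule eventually_mono[OF eventually_nbhds_open[OF W z]]) (rule eq[symmetric, OF _ ai(2,1)])
      qed
    qed
    then show "\<forall>j<?d. smooth_on_Rn ?d (jet_coord N k \<phi> ` (jet_dom N k U \<inter> jet_dom N k V))
        (\<lambda>x. jet_coord N k \<psi> (inv_into (jet_dom N k U) (jet_coord N k \<phi>) x) j)"
      unfolding jet_coord_image[OF C] smooth_on_Rn_germ[OF W] by blast
  qed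
  then show ?thesis
    using jet_coord_inj unfolding smooth_atlas_def charts_jet_bundle by (auto split: prod.splits)
qed

end

section \<open>The tangent and cotangent bundles as smooth atlases\<close>

definition tangent_coord :: "('a \<Rightarrow> nat \<Rightarrow> real) \<Rightarrow> 'a jet \<Rightarrow> nat \<Rightarrow> real" where
  "tangent_coord \<phi> v i = deriv (\<lambda>t. \<phi> (rep v t) i) 0"

definition cotangent_coord :: "'a atlas \<Rightarrow> 'a set \<Rightarrow> ('a \<Rightarrow> nat \<Rightarrow> real) \<Rightarrow> 'a cov \<Rightarrow> nat \<Rightarrow> real" where
  "cotangent_coord M U \<phi> p i = snd p (coord_vector M (U, \<phi>) (fst p) i)"

text \<open>Inverts \<open>cotangent_coord\<close> over a point of the chart; it is extended by 0
  off the tangent space as \<open>covectors\<close> demands.\<close>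

definition covector :: "'a atlas \<Rightarrow> ('a \<Rightarrow> nat \<Rightarrow> real) \<Rightarrow> 'a \<Rightarrow> (nat \<Rightarrow> real) \<Rightarrow> 'a cov" where
  "covector M \<phi> x c =
    (x, \<lambda>v. if v \<in> tangent_space M x then \<Sum>i<dimension M. c i * tangent_coord \<phi> v i else 0)"

definition cot_dom :: "'a atlas \<Rightarrow> 'a set \<Rightarrow> 'a cov set" where
  "cot_dom M U = {p \<in> covectors M. fst p \<in> U}"

definition cot_chart :: "'a atlas \<Rightarrow> 'a set \<Rightarrow> ('a \<Rightarrow> nat \<Rightarrow> real) \<Rightarrow> 'a cov \<Rightarrow> nat \<Rightarrow> real" where
  "cot_chart M U \<phi> = (\<lambda>p j. if j < dimension M then \<phi> (fst p) j
     else if j < 2 * dimension M then cotangent_coord M U \<phi> p (j - dimension M) else 0)"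

lemma dimension_cotangent [simp]: "dimension (cotangent M) = 2 * dimension M"
  by (simp add: cotangent_def)

lemma charts_cotangent: "charts (cotangent M) = (\<lambda>(U, \<phi>). (cot_dom M U, cot_chart M U \<phi>)) ` charts M"
  unfolding cotangent_def cot_dom_def cot_chart_def cotangent_coord_def atlas.simps ..

lemma cotangent_chart: "(U, \<phi>) \<in> charts M \<Longrightarrow> (cot_dom M U, cot_chart M U \<phi>) \<in> charts (cotangent M)"
  unfolding charts_cotangent by force

lemma fst_covector [simp]: "fst (covector M \<phi> x c) = x"
  by (simp add: covector_def)

context
  fixes M :: "'a atlas"
  assumes M: "smooth_atlas M"
begin

section \<open>Tangent vectors in coordinates\<close>

lemma tangent_space_eq: "tangent_space M x = {velocity M 1 c 0 |c. curve_at M c 0 \<and> c 0 = x}"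
  unfolding tangent_space_def points_jet_bundle[OF M] using base_point_velocity[OF M] by fastforce

lemma tangent_space_E:
  assumes "v \<in> tangent_space M x" obtains c where "v = velocity M 1 c 0" "curve_at M c 0" "c 0 = x"
  using assms unfolding tangent_space_eq by blast

lemma velocity_in_tangent_space: "curve_at M c t \<Longrightarrow> velocity M 1 c t \<in> tangent_space M (c t)"
  unfolding tangent_space_def using velocity_in_points[OF M] base_point_velocity[OF M] by auto

lemma tangent_coord_velocity:
  assumes "(U, \<phi>) \<in> charts M" "curve_at M c t" "c t \<in> U" "i < dimension M"
  shows "tangent_coord \<phi> (velocity M 1 c t) i = deriv (\<lambda>u. \<phi> (c u) i) t"
  using rep_velocity(4)[OF M assms(2,1,3,4), of 1 1] by (simp add: tangent_coord_def)

lemma tangent_coord_inj: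
  assumes C: "(U, \<phi>) \<in> charts M" "x \<in> U" and v: "v \<in> tangent_space M x" and w: "w \<in> tangent_space M x"
    and eq: "\<And>i. i < dimension M \<Longrightarrow> tangent_coord \<phi> v i = tangent_coord \<phi> w i"
  shows "v = w"
proof -
  obtain b where b: "v = velocity M 1 b 0" "curve_at M b 0" "b 0 = x" using v tangent_space_E by metis
  obtain c where c: "w = velocity M 1 c 0" "curve_at M c 0" "c 0 = x" using w tangent_space_E by metis
  have "(deriv ^^ \<alpha>) (\<lambda>u. \<phi> (b u) i) 0 = (deriv ^^ \<alpha>) (\<lambda>u. \<phi> (c u) i) 0"
    if "i < dimension M" "\<alpha> \<le> 1" for i \<alpha>
    using eq[OF that(1)] tangent_coord_velocity[OF C(1) b(2) _ that(1)]
      tangent_coord_velocity[OF C(1) c(2) _ that(1)] b c C(2) that(2) by (cases \<alpha>) auto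
  then show ?thesis
    using velocity_eq_iff_0[OF M C(1) b(2) _ c(2)] b c C(2) by simp
qed

lemma tangent_coord_surj:
  assumes C: "(U, \<phi>) \<in> charts M" "x \<in> U"
  obtains v where "v \<in> tangent_space M x" "\<And>i. i < dimension M \<Longrightarrow> tangent_coord \<phi> v i = a i"
proof -
  let ?n = "dimension M"
  \<comment> \<open>Jet coordinates of order one: the base point in the first block, the wanted
    components in the second.\<close>
  define z where "z j = (if j < ?n then \<phi> x j else a (j - ?n))" for j
  have z: "coord_restrict ?n z = \<phi> x"
    using chart_coord_space[OF M C] by (auto simp: coord_restrict_def z_def coord_space_def)
  then have zU: "coord_restrict ?n z \<in> \<phi> ` U" using C by auto
  let ?c = "jet_curve M U \<phi> 1 z"
  have c: "curve_at M ?c 0" "?c 0 \<in> U" "\<phi> (?c 0) = \<phi> x"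
    using jet_curve(1,2)[OF M C(1) zU] eventually_nhds_x_imp_x[OF jet_curve(3)[OF M C(1) zU, of 1]]
    by (auto simp: jet_poly_0 z)
  then have "?c 0 = x" using chart_inj[OF M C(1)] C(2) by (auto dest: inj_onD)
  then have "velocity M 1 ?c 0 \<in> tangent_space M x" using velocity_in_tangent_space[OF c(1)] by simp
  moreover have "tangent_coord \<phi> (velocity M 1 ?c 0) i = a i" if "i < ?n" for i
  proof -
    have "tangent_coord \<phi> (velocity M 1 ?c 0) i = (deriv ^^ 1) (\<lambda>u. \<phi> (?c u) i) 0"
      using tangent_coord_velocity[OF C(1) c(1,2) that] by simp
    also have "\<dots> = z (1 * ?n + i)" by (rule higher_deriv_jet_curve[OF M C(1) zU that]) simp
    finally show ?thesis using that by (simp add: z_def)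
  qed
  ultimately show thesis by (rule that)
qed

lemma coord_vector:
  assumes C: "(U, \<phi>) \<in> charts M" "x \<in> U" and i: "i < dimension M"
  shows "coord_vector M (U, \<phi>) x i \<in> tangent_space M x"
    "j < dimension M \<Longrightarrow> tangent_coord \<phi> (coord_vector M (U, \<phi>) x i) j = (if j = i then 1 else 0)"
proof -
  let ?F = "\<lambda>t. (\<phi> x)(i := \<phi> x i + t)" and ?c = "\<lambda>t. inv_into U \<phi> ((\<phi> x)(i := \<phi> x i + t))"
  have F0: "?F 0 = \<phi> x" by simp
  have s: "smooth1 (\<lambda>t. ?F t j) 0" for j
    by (cases "j = i") (auto intro: smooth1_const smooth1_add[OF smooth1_const smooth1_ident])
  have c: "curve_at M ?c 0" "?c 0 \<in> U" "eventually (\<lambda>t. ?c t \<in> U \<and> \<phi> (?c t) = ?F t) (nhds 0)"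
    using chart_curve[where F = ?F and t = 0, OF M C(1) _ s] C chart_coord_space[OF M C] i
    by (auto simp: coord_space_upd)
  have c0: "?c 0 = x" using chart_inv[OF M C] by simp
  show "coord_vector M (U, \<phi>) x i \<in> tangent_space M x"
    using velocity_in_tangent_space[OF c(1)] c0 by (simp add: coord_vector_def)
  assume j: "j < dimension M"
  have "deriv (\<lambda>u. \<phi> (?c u) j) 0 = deriv (\<lambda>u. ?F u j) 0"
    by (rule deriv_cong_ev[OF eventually_mono[OF c(3)] refl]) simp
  also have "\<dots> = (if j = i then 1 else 0)"
    by (auto intro!: DERIV_imp_deriv derivative_eq_intros)
  finally show "tangent_coord \<phi> (coord_vector M (U, \<phi>) x i) j = (if j = i then 1 else 0)"
    unfolding coord_vector_def split_conv tangent_coord_velocity[OF C(1) c(1,2) j] .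
qed

text \<open>The chain rule for the transition map along a representing curve. Components change
  linearly, which makes the linear structure of a tangent space independent of the chart.\<close>

lemma tangent_coord_change:
  assumes C: "(U, \<phi>) \<in> charts M" "x \<in> U" and D: "(V, \<psi>) \<in> charts M" "x \<in> V"
    and v: "v \<in> tangent_space M x" and j: "j < dimension M"
  shows "tangent_coord \<psi> v j =
    (\<Sum>i<dimension M. partial i (\<lambda>y. \<psi> (inv_into U \<phi> y) j) (\<phi> x) * tangent_coord \<phi> v i)"
proof -
  obtain c where c: "v = velocity M 1 c 0" "curve_at M c 0" "c 0 = x" using v tangent_space_E by metis
  have ev: "eventually (\<lambda>u. c u \<in> U) (nhds 0)" "\<And>i. i < dimension M \<Longrightarrow> smooth1 (\<lambda>u. \<phi> (c u) i) 0"
    using curve_at_coords[OF M C(1) c(2)] c(3) C(2) by auto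
  have tr: "smooth_germ (dimension M) (\<lambda>y. \<psi> (inv_into U \<phi> y) j) (\<phi> (c 0))"
    using transition_germ[OF M C(1) D(1) C(2) D(2) j] c(3) by simp
  have "((\<lambda>u. \<psi> (inv_into U \<phi> (\<phi> (c u))) j) has_real_derivative
      (\<Sum>i<dimension M. partial i (\<lambda>y. \<psi> (inv_into U \<phi> y) j) (\<phi> (c 0)) * tangent_coord \<phi> v i)) (at 0)"
  proof (rule chain_rule[where g = "\<lambda>u. \<phi> (c u)"])
    fix i assume i: "i < dimension M"
    show "((\<lambda>t. \<phi> (c t) i) has_real_derivative tangent_coord \<phi> v i) (at 0)"
      using smooth1_DERIV[OF ev(2)[OF i], of 0] tangent_coord_velocity[OF C(1) c(2) _ i] c C(2) by simp
    show "\<forall>\<^sub>F y in nbhds (dimension M) (\<phi> (c 0)).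
        (\<lambda>h. \<psi> (inv_into U \<phi> (y(i := h))) j) differentiable at (y i)"
      using smooth_germ_eventually[OF tr] by (rule eventually_mono) (use i smooth_germ_differentiable in blast)
    show "contat (dimension M) (partial i (\<lambda>y. \<psi> (inv_into U \<phi> y) j)) (\<phi> (c 0))"
      using smooth_germ_contat[OF smooth_germ_partial[OF tr i]] .
  next
    show "\<forall>\<^sub>F t in nhds 0. \<phi> (c t) \<in> coord_space (dimension M)"
      by (rule eventually_mono[OF ev(1)]) (rule chart_coord_space[OF M C(1)])
  qed
  from DERIV_imp_deriv[OF this]
  have "deriv (\<lambda>u. \<psi> (inv_into U \<phi> (\<phi> (c u))) j) 0 =
      (\<Sum>i<dimension M. partial i (\<lambda>y. \<psi> (inv_into U \<phi> y) j) (\<phi> x) * tangent_coord \<phi> v i)"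
    using c(3) by simp
  moreover have "deriv (\<lambda>u. \<psi> (inv_into U \<phi> (\<phi> (c u))) j) 0 = deriv (\<lambda>u. \<psi> (c u) j) 0"
    by (rule deriv_cong_ev[OF eventually_mono[OF ev(1)] refl]) (simp add: chart_inv[OF M C(1)])
  ultimately show ?thesis
    using tangent_coord_velocity[OF D(1) c(2) _ j] c D(2) by simp
qed

section \<open>Covectors in coordinates\<close>

lemma linear_on_tangent_space_iff:
  "linear_on_tangent_space M x l \<longleftrightarrow> (\<forall>U \<phi>. (U, \<phi>) \<in> charts M \<longrightarrow> x \<in> U \<longrightarrow>
     (\<forall>u\<in>tangent_space M x. \<forall>v\<in>tangent_space M x. \<forall>w\<in>tangent_space M x. \<forall>a b.
       (\<forall>i<dimension M. tangent_coord \<phi> u i = a * tangent_coord \<phi> v i + b * tangent_coord \<phi> w i) \<longrightarrow>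
       l u = a * l v + b * l w))"
  unfolding linear_on_tangent_space_def tangent_coord_def Let_def by auto

text \<open>Linearity is required with respect to components in every chart. A linear relation in
  another chart carries over to \<open>\<phi>\<close> because \<open>tangent_coord_change\<close> is
  linear.\<close>

lemma covector_in_covectors:
  assumes C: "(U, \<phi>) \<in> charts M" "x \<in> U"
  shows "covector M \<phi> x c \<in> covectors M"
proof -
  let ?l = "snd (covector M \<phi> x c)"
  have "?l u = a * ?l v + b * ?l w"
    if D: "(V, \<psi>) \<in> charts M" "x \<in> V" and T: "u \<in> tangent_space M x" "v \<in> tangent_space M x" "w \<in> tangent_space M x"
      and eq: "\<forall>i<dimension M. tangent_coord \<psi> u i = a * tangent_coord \<psi> v i + b * tangent_coord \<psi> w i"
    for V \<psi> u v w a b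
  proof -
    have "tangent_coord \<phi> u i = a * tangent_coord \<phi> v i + b * tangent_coord \<phi> w i" if i: "i < dimension M" for i
      unfolding tangent_coord_change[OF D C T(1) i] tangent_coord_change[OF D C T(2) i] tangent_coord_change[OF D C T(3) i]
      using eq by (simp add: sum_distrib_left sum.distrib[symmetric] algebra_simps)
    then show ?thesis
      using T by (simp add: covector_def sum_distrib_left sum.distrib[symmetric] algebra_simps)
  qed
  then have "linear_on_tangent_space M x ?l" unfolding linear_on_tangent_space_iff by blast
  then show ?thesis
    using C by (auto simp: covectors_def covector_def in_points_iff)
qed

text \<open>Linearity is a statement about three tangent vectors whose components satisfy a linear
  relation, without operations on the tangent space itself. The expansion therefore splits off one
  coordinate vector at a time, by induction on an index from which on the components vanish.\<close>

lemma covectors_expand: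
  assumes C: "(U, \<phi>) \<in> charts M" "fst p \<in> U" and p: "p \<in> covectors M" and v: "v \<in> tangent_space M (fst p)"
  shows "snd p v = (\<Sum>i<dimension M. cotangent_coord M U \<phi> p i * tangent_coord \<phi> v i)"
proof -
  let ?n = "dimension M" and ?x = "fst p"
  have lin: "snd p u = a * snd p v + b * snd p w"
    if "u \<in> tangent_space M ?x" "v \<in> tangent_space M ?x" "w \<in> tangent_space M ?x"
      "\<forall>i<?n. tangent_coord \<phi> u i = a * tangent_coord \<phi> v i + b * tangent_coord \<phi> w i" for u v w a b
    using p C that unfolding covectors_def linear_on_tangent_space_iff by auto
  have "snd p w = (\<Sum>i<m. cotangent_coord M U \<phi> p i * tangent_coord \<phi> w i)"
    if "m \<le> ?n" "w \<in> tangent_space M ?x" "\<And>i. m \<le> i \<Longrightarrow> i < ?n \<Longrightarrow> tangent_coord \<phi> w i = 0" for m w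
    using that
  proof (induction m arbitrary: w)
    case 0
    \<comment> \<open>All components of \<open>w\<close> vanish, so \<open>w\<close> satisfies a
      linear relation with itself in which both factors are 0.\<close>
    then have "snd p w = 0 * snd p w + 0 * snd p w" by (intro lin) auto
    then show ?case by simp
  next
    case (Suc m)
    obtain u where u: "u \<in> tangent_space M ?x"
      "\<And>i. i < ?n \<Longrightarrow> tangent_coord \<phi> u i = (if i = m then 0 else tangent_coord \<phi> w i)"
      using tangent_coord_surj[OF C, of "\<lambda>i. if i = m then 0 else tangent_coord \<phi> w i"] by blast
    have "tangent_coord \<phi> u i = 0" if "m \<le> i" "i < ?n" for i
      using u(2)[OF that(2)] Suc.prems(3)[OF _ that(2)] that(1) by (cases "i = m") auto
    then have "snd p u = (\<Sum>i<m. cotangent_coord M U \<phi> p i * tangent_coord \<phi> u i)"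
      using Suc.IH[OF _ u(1)] Suc.prems(1) by simp
    also have "\<dots> = (\<Sum>i<m. cotangent_coord M U \<phi> p i * tangent_coord \<phi> w i)"
      using u(2) Suc.prems(1) by (intro sum.cong) auto
    finally have su: "snd p u = (\<Sum>i<m. cotangent_coord M U \<phi> p i * tangent_coord \<phi> w i)" .
    have "snd p w = 1 * snd p u + tangent_coord \<phi> w m * snd p (coord_vector M (U, \<phi>) ?x m)"
      using coord_vector[OF C, of m] u Suc.prems by (intro lin) auto
    then show ?case using su by (simp add: cotangent_coord_def)
  qed
  from this[OF le_refl v] show ?thesis by simp
qed

lemma cotangent_coord_covector:
  assumes C: "(U, \<phi>) \<in> charts M" "x \<in> U" and i: "i < dimension M"
  shows "cotangent_coord M U \<phi> (covector M \<phi> x c) i = c i"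
proof -
  have "(\<Sum>j<dimension M. c j * tangent_coord \<phi> (coord_vector M (U, \<phi>) x i) j) =
      (\<Sum>j<dimension M. if j = i then c j else 0)"
    using coord_vector(2)[OF C i] by (intro sum.cong) auto
  then show ?thesis
    using coord_vector(1)[OF C i] i by (simp add: cotangent_coord_def covector_def)
qed

lemma covectors_eqI:
  assumes C: "(U, \<phi>) \<in> charts M" "fst p \<in> U" and p: "p \<in> covectors M" and q: "q \<in> covectors M" "fst q = fst p"
    and eq: "\<And>i. i < dimension M \<Longrightarrow> cotangent_coord M U \<phi> p i = cotangent_coord M U \<phi> q i"
  shows "p = q"
proof -
  have "snd p v = snd q v" for v
  proof (cases "v \<in> tangent_space M (fst p)")
    case True
    then show ?thesis
      using covectors_expand[OF C p True] covectors_expand[OF C(1) _ q(1), of v] C(2) q(2) eq by simp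
  next
    case False
    then show ?thesis using p q by (auto simp: covectors_def)
  qed
  then show ?thesis using q(2) by (auto simp: prod_eq_iff)
qed

section \<open>Charts of the cotangent bundle\<close>

lemma points_cotangent: "points (cotangent M) = covectors M"
  by (auto simp: in_points_iff charts_cotangent cot_dom_def covectors_def) (force simp: in_points_iff)

lemma cot_chart_coord_space: "p \<in> cot_dom M U \<Longrightarrow> (U, \<phi>) \<in> charts M \<Longrightarrow> cot_chart M U \<phi> p \<in> coord_space (2 * dimension M)"
  by (auto simp: cot_chart_def coord_space_def)

lemma cot_chart_restrict:
  assumes "(U, \<phi>) \<in> charts M" "p \<in> cot_dom M U"
  shows "coord_restrict (dimension M) (cot_chart M U \<phi> p) = \<phi> (fst p)"
  using chart_coord_space[OF M assms(1), of "fst p"] assms(2)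
  by (auto simp: coord_restrict_def cot_chart_def cot_dom_def coord_space_def)

lemma cot_chart_inj:
  assumes C: "(U, \<phi>) \<in> charts M" shows "inj_on (cot_chart M U \<phi>) (cot_dom M U)"
proof (rule inj_onI)
  fix p q assume pq: "p \<in> cot_dom M U" "q \<in> cot_dom M U" "cot_chart M U \<phi> p = cot_chart M U \<phi> q"
  then have "\<phi> (fst p) = \<phi> (fst q)" using cot_chart_restrict[OF C] by metis
  then have fst: "fst p = fst q" using chart_inj[OF M C] pq by (auto simp: cot_dom_def dest: inj_onD)
  show "p = q"
  proof (rule covectors_eqI[OF C])
    fix i assume "i < dimension M"
    then show "cotangent_coord M U \<phi> p i = cotangent_coord M U \<phi> q i"
      using fun_cong[OF pq(3), of "dimension M + i"] by (simp add: cot_chart_def)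
  qed (use pq fst in \<open>auto simp: cot_dom_def\<close>)
qed

lemma cot_chart_covector:
  assumes C: "(U, \<phi>) \<in> charts M" and z: "z \<in> coord_space (2 * dimension M)"
    "coord_restrict (dimension M) z \<in> \<phi> ` U"
  defines "p \<equiv> covector M \<phi> (inv_into U \<phi> (coord_restrict (dimension M) z)) (\<lambda>i. z (dimension M + i))"
  shows "p \<in> cot_dom M U" "cot_chart M U \<phi> p = z" "inv_into (cot_dom M U) (cot_chart M U \<phi>) z = p"
proof -
  let ?x = "inv_into U \<phi> (coord_restrict (dimension M) z)"
  have x: "?x \<in> U" "\<phi> ?x = coord_restrict (dimension M) z"
    using z(2) by (auto intro: inv_into_into f_inv_into_f)
  show 1: "p \<in> cot_dom M U"
    using covector_in_covectors[OF C x(1)] x(1) by (simp add: p_def cot_dom_def)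
  show 2: "cot_chart M U \<phi> p = z"
  proof
    fix j
    consider "j < dimension M" | "dimension M \<le> j" "j < 2 * dimension M" | "2 * dimension M \<le> j" by linarith
    then show "cot_chart M U \<phi> p j = z j"
    proof cases
      case 1
      then show ?thesis using x(2) by (simp add: cot_chart_def p_def coord_restrict_def)
    next
      case 2
      then show ?thesis
        using cotangent_coord_covector[OF C x(1), of "j - dimension M"] by (simp add: cot_chart_def p_def)
    next
      case 3
      then show ?thesis using z(1) by (simp add: cot_chart_def coord_space_def)
    qed
  qed
  show "inv_into (cot_dom M U) (cot_chart M U \<phi>) z = p"
    using inv_into_f_f[OF cot_chart_inj[OF C] 1] 2 by simp
qed

lemma cot_chart_image:
  assumes C: "(U, \<phi>) \<in> charts M"
  shows "cot_chart M U \<phi> ` (cot_dom M U \<inter> cot_dom M V) =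
    {z \<in> coord_space (2 * dimension M). coord_restrict (dimension M) z \<in> \<phi> ` (U \<inter> V)}" (is "?L = ?R")
proof
  show "?L \<subseteq> ?R"
  proof (intro image_subsetI)
    fix p assume p: "p \<in> cot_dom M U \<inter> cot_dom M V"
    then have "fst p \<in> U \<inter> V" by (auto simp: cot_dom_def)
    then show "cot_chart M U \<phi> p \<in> ?R"
      using cot_chart_restrict[OF C, of p] cot_chart_coord_space[OF _ C, of p] p by auto
  qed
  show "?R \<subseteq> ?L"
  proof
    fix z assume z: "z \<in> ?R"
    let ?x = "inv_into U \<phi> (coord_restrict (dimension M) z)"
    have zU: "coord_restrict (dimension M) z \<in> \<phi> ` U" "z \<in> coord_space (2 * dimension M)" using z by auto
    have "?x \<in> V" using in_overlap[OF M C, of ?x V] z zU by (simp add: inv_into_into f_inv_into_f)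
    then have "covector M \<phi> ?x (\<lambda>i. z (dimension M + i)) \<in> cot_dom M U \<inter> cot_dom M V"
      using cot_chart_covector(1)[OF C zU(2,1)] by (auto simp: cot_dom_def)
    then show "z \<in> ?L" using cot_chart_covector(2)[OF C zU(2,1)] by (metis image_eqI)
  qed
qed

text \<open>A fibre coordinate in the second chart is the value on a coordinate vector of that
  chart. The components of this vector in the first chart are partial derivatives of the inverse
  transition map, so fibre coordinates change linearly with smooth coefficients.\<close>

lemma smooth_atlas_cotangent: "smooth_atlas (cotangent M)"
proof -
  let ?n = "dimension M"
  have "openin (Euclidean_space (2 * ?n)) (cot_chart M U \<phi> ` (cot_dom M U \<inter> cot_dom M V)) \<and>
     (\<forall>j<2 * ?n. smooth_on_Rn (2 * ?n) (cot_chart M U \<phi> ` (cot_dom M U \<inter> cot_dom M V))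
        (\<lambda>x. cot_chart M V \<psi> (inv_into (cot_dom M U) (cot_chart M U \<phi>) x) j))"
    if C: "(U, \<phi>) \<in> charts M" and D: "(V, \<psi>) \<in> charts M" for U \<phi> V \<psi>
  proof
    let ?W = "{z \<in> coord_space (2 * ?n). coord_restrict ?n z \<in> \<phi> ` (U \<inter> V)}"
    let ?x = "\<lambda>z. inv_into U \<phi> (coord_restrict ?n z)"
    have W: "openin (Euclidean_space (2 * ?n)) ?W"
      by (rule openin_coord_restrict[OF overlap_open[OF M C D]]) simp
    then show "openin (Euclidean_space (2 * ?n)) (cot_chart M U \<phi> ` (cot_dom M U \<inter> cot_dom M V))"
      unfolding cot_chart_image[OF C] .
    have x: "?x z \<in> U" "?x z \<in> V" "\<phi> (?x z) = coord_restrict ?n z" if z: "z \<in> ?W" for z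
      using z in_overlap[OF M C, of "?x z" V] by (auto simp: inv_into_into f_inv_into_f)
    have base: "smooth_germ (2 * ?n) (\<lambda>z. \<psi> (?x z) j) z" if z: "z \<in> ?W" and j: "j < ?n" for z j
    proof (rule smooth_germ_comp[where G = "coord_restrict ?n"])
      show "smooth_germ ?n (\<lambda>y. \<psi> (inv_into U \<phi> y) j) (coord_restrict ?n z)"
        using transition_germ[OF M C D x(1,2)[OF z] j] x(3)[OF z] by simp
      show "smooth_germ (2 * ?n) (\<lambda>x. coord_restrict ?n x i) z" if "i < ?n" for i
        using that z smooth_germ_coord[of z "2 * ?n" i] by (simp add: coord_restrict_def)
    qed (use z in auto)
    have eq: "cot_chart M V \<psi> (inv_into (cot_dom M U) (cot_chart M U \<phi>) z) (?n + j) =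
        (\<Sum>i<?n. z (?n + i) * partial j (\<lambda>y. \<phi> (inv_into V \<psi> y) i) (\<psi> (?x z)))"
      if z: "z \<in> ?W" and j: "j < ?n" for z j
    proof -
      have zU: "z \<in> coord_space (2 * ?n)" "coord_restrict ?n z \<in> \<phi> ` U" using z by auto
      have "tangent_coord \<phi> (coord_vector M (V, \<psi>) (?x z) j) i = partial j (\<lambda>y. \<phi> (inv_into V \<psi> y) i) (\<psi> (?x z))"
        if i: "i < ?n" for i
      proof -
        have "tangent_coord \<phi> (coord_vector M (V, \<psi>) (?x z) j) i =
            (\<Sum>l<?n. if l = j then partial l (\<lambda>y. \<phi> (inv_into V \<psi> y) i) (\<psi> (?x z)) else 0)"
          unfolding tangent_coord_change[OF D x(2)[OF z] C x(1)[OF z] coord_vector(1)[OF D x(2)[OF z] j] i]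
          using coord_vector(2)[OF D x(2)[OF z] j] by (intro sum.cong) auto
        then show ?thesis using j by simp
      qed
      then show ?thesis
        unfolding cot_chart_covector(3)[OF C zU]
        using coord_vector(1)[OF D x(2)[OF z] j] j
        by (simp add: cot_chart_def cotangent_coord_def covector_def)
    qed
    have "smooth_germ (2 * ?n) (\<lambda>x. cot_chart M V \<psi> (inv_into (cot_dom M U) (cot_chart M U \<phi>) x) j) z"
      if j: "j < 2 * ?n" and z: "z \<in> ?W" for j z
    proof (cases "j < ?n")
      case True
      have "cot_chart M V \<psi> (inv_into (cot_dom M U) (cot_chart M U \<phi>) z) j = \<psi> (?x z) j" if "z \<in> ?W" for z
        using cot_chart_covector(3)[OF C, of z] that True by (auto simp: cot_chart_def)
      then show ?thesis
        by (intro smooth_germ_cong[OF base[OF z True]] eventually_mono[OF eventually_nbhds_open[OF W z]]) simp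
    next
      case False
      define l where "l = j - ?n"
      have l: "l < ?n" "j = ?n + l" using j False by (auto simp: l_def)
      have zc: "z \<in> coord_space (2 * ?n)" using z by auto
      have "smooth_germ (2 * ?n) (\<lambda>z. \<Sum>i<?n. z (?n + i) * partial l (\<lambda>y. \<phi> (inv_into V \<psi> y) i) (\<psi> (?x z))) z"
      proof (intro smooth_germ_sum smooth_germ_mult zc)
        fix i assume i: "i \<in> {..<?n}"
        then show "smooth_germ (2 * ?n) (\<lambda>x. x (?n + i)) z" by (intro smooth_germ_coord zc) auto
        show "smooth_germ (2 * ?n) (\<lambda>z. partial l (\<lambda>y. \<phi> (inv_into V \<psi> y) i) (\<psi> (?x z))) z"
        proof (rule smooth_germ_comp[where G = "\<lambda>z. \<psi> (?x z)"])
          show "smooth_germ ?n (partial l (\<lambda>y. \<phi> (inv_into V \<psi> y) i)) (\<psi> (?x z))"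
            using smooth_germ_partial[OF transition_germ[OF M D C x(2,1)[OF z]] l(1)] i by auto
          show "\<forall>\<^sub>F z in nbhds (2 * ?n) z. \<psi> (?x z) \<in> coord_space ?n"
            by (rule eventually_mono[OF eventually_nbhds_open[OF W z]]) (rule chart_coord_space[OF M D x(2)])
        qed (use base[OF z] zc in auto)
      qed
      then show ?thesis
        by (rule smooth_germ_cong) (rule eventually_mono[OF eventually_nbhds_open[OF W z]], simp only: l(2) eq[OF _ l(1)])
    qed
    then show "\<forall>j<2 * ?n. smooth_on_Rn (2 * ?n) (cot_chart M U \<phi> ` (cot_dom M U \<inter> cot_dom M V))
        (\<lambda>x. cot_chart M V \<psi> (inv_into (cot_dom M U) (cot_chart M U \<phi>) x) j)"
      unfolding cot_chart_image[OF C] smooth_on_Rn_germ[OF W] by blast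
  qed
  then show ?thesis
    using cot_chart_inj unfolding smooth_atlas_def charts_cotangent by (auto split: prod.splits)
qed

end

section \<open>Iterated tangent vectors and velocities of velocities\<close>

lemma itangent_iff:
  "g \<in> itangent N k f \<longleftrightarrow> smooth_family k N g \<and> g origin = f origin \<and>
    (\<forall>U \<phi> i is. (U, \<phi>) \<in> charts N \<longrightarrow> f origin \<in> U \<longrightarrow> i < dimension N \<longrightarrow> distinct is \<longrightarrow> set is \<subseteq> {..<k} \<longrightarrow>
      partials is (\<lambda>s. \<phi> (g s) i) origin = partials is (\<lambda>s. \<phi> (f s) i) origin)"
  unfolding itangent_def by auto

lemma itangent_mem: "g \<in> itangent N k f \<Longrightarrow> itangent N k g = itangent N k f"
  by (intro set_eqI) (auto simp: itangent_iff)

lemma itangent_self: "smooth_family k N f \<Longrightarrow> f \<in> itangent N k f"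
  by (simp add: itangent_iff)

lemma rep_itangent:
  assumes "smooth_family k N f"
  shows "rep (itangent N k f) \<in> itangent N k f"
  unfolding rep_def by (rule someI[of "\<lambda>b. b \<in> itangent N k f", OF itangent_self[OF assms]])

lemma itangent_cong:
  assumes "eventually (\<lambda>s. f s = g s) (nbhds k origin)"
  shows "itangent N k f = itangent N k g"
proof -
  have "eventually (\<lambda>s. \<phi> (f s) i = \<phi> (g s) i) (nbhds k origin)" for \<phi> :: "'a \<Rightarrow> nat \<Rightarrow> real" and i
    using assms by (rule eventually_mono) simp
  then have "partials is (\<lambda>s. \<phi> (f s) i) origin = partials is (\<lambda>s. \<phi> (g s) i) origin"
    if "set is \<subseteq> {..<k}" for \<phi> :: "'a \<Rightarrow> nat \<Rightarrow> real" and i "is"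
    by (rule partials_cong[OF _ that origin_coord_space])
  then show ?thesis
    using eventually_nbhds_self[OF assms origin_coord_space] by (intro set_eqI) (simp add: itangent_iff)
qed

lemma smooth_germ_coord_sum:
  assumes "a \<in> coord_space n" "finite A" "A \<subseteq> {..<n}" shows "smooth_germ n (\<lambda>s. \<Sum>i\<in>A. s i) a"
  by (rule smooth_germ_sum[OF assms(1)]) (use assms smooth_germ_coord in auto)

lemma filterlim_two_sums:
  "filterlim (\<lambda>s. point2 (\<Sum>i<m. s i) (\<Sum>i=m..<m + n. s i)) (nbhds 2 origin) (nbhds (m + n) origin)"
  "smooth_germ (m + n) (\<lambda>s. point2 (\<Sum>i<m. s i) (\<Sum>i=m..<m + n. s i) j) origin"
proof -
  have s: "smooth_germ (m + n) (\<lambda>s. point2 (\<Sum>i<m. s i) (\<Sum>i=m..<m + n. s i) j) origin" for j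
  proof -
    have "smooth_germ (m + n) (\<lambda>s. \<Sum>i<m. s i) origin" "smooth_germ (m + n) (\<lambda>s. \<Sum>i=m..<m + n. s i) origin"
      by (intro smooth_germ_coord_sum; auto)+
    then show ?thesis unfolding point2_def by (cases "j = 0"; cases "j = 1") auto
  qed
  then show "smooth_germ (m + n) (\<lambda>s. point2 (\<Sum>i<m. s i) (\<Sum>i=m..<m + n. s i) j) origin" .
  have "filterlim (\<lambda>s. point2 (\<Sum>i<m. s i) (\<Sum>i=m..<m + n. s i))
      (nbhds 2 (point2 (\<Sum>i<m. origin i) (\<Sum>i=m..<m + n. origin i))) (nbhds (m + n) origin)"
    by (rule smooth_germ_filterlim) (use s in auto)
  then show "filterlim (\<lambda>s. point2 (\<Sum>i<m. s i) (\<Sum>i=m..<m + n. s i)) (nbhds 2 origin) (nbhds (m + n) origin)"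
    by simp
qed

lemma smooth1_point2: "smooth1 (\<lambda>t. point2 s t i) u" "smooth1 (\<lambda>s. point2 s t i) u"
  unfolding point2_def by (cases "i = 0"; cases "i = 1"; simp add: smooth1_const smooth1_ident)+

lemma filterlim_point2:
  "filterlim (\<lambda>s. point2 s b) (nbhds 2 (point2 a b)) (nhds a)"
  "filterlim (\<lambda>t. point2 a t) (nbhds 2 (point2 a b)) (nhds b)"
proof -
  have "((\<lambda>s. point2 s b i) \<longlongrightarrow> point2 a b i) (nhds a)" "((\<lambda>t. point2 a t i) \<longlongrightarrow> point2 a b i) (nhds b)" for i
    unfolding point2_def by (cases "i = 0"; cases "i = 1"; simp add: filterlim_ident)+
  then show "filterlim (\<lambda>s. point2 s b) (nbhds 2 (point2 a b)) (nhds a)"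
    "filterlim (\<lambda>t. point2 a t) (nbhds 2 (point2 a b)) (nhds b)"
    by (auto intro!: filterlim_nbhds)
qed

lemma smooth1_slice:
  assumes "smooth_germ 2 F (point2 a b)"
  shows "smooth1 (\<lambda>s. F (point2 s b)) a" "smooth1 (\<lambda>t. F (point2 a t)) b"
  by (rule smooth1_comp[where G = "\<lambda>s. point2 s b" and n = 2], use assms smooth1_point2 in auto)
    (rule smooth1_comp[where G = "\<lambda>t. point2 a t" and n = 2], use assms smooth1_point2 in auto)

lemma subseq_distinct: "subseq js is \<Longrightarrow> distinct is \<Longrightarrow> distinct js"
  using subseq_conv_nths distinct_nthsI by metis

section \<open>Iterated tangent vectors in one chart, and the inclusion of velocities\<close>

context
  fixes N :: "'a atlas"
  assumes N: "smooth_atlas N"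
begin

lemma smooth_family_coords:
  assumes "(U, \<phi>) \<in> charts N" "smooth_family p N f" "f origin \<in> U"
  shows "eventually (\<lambda>s. f s \<in> U) (nbhds p origin)"
    "i < dimension N \<Longrightarrow> smooth_germ p (\<lambda>s. \<phi> (f s) i) origin"
    "eventually (\<lambda>s. \<phi> (f s) \<in> coord_space (dimension N)) (nbhds p origin)"
proof -
  note * = smooth_family_iff[where f = f and p = p, OF N assms(1,3)]
  show 1: "eventually (\<lambda>s. f s \<in> U) (nbhds p origin)" using * assms(2) by blast
  show "i < dimension N \<Longrightarrow> smooth_germ p (\<lambda>s. \<phi> (f s) i) origin" using * assms(2) by blast
  show "eventually (\<lambda>s. \<phi> (f s) \<in> coord_space (dimension N)) (nbhds p origin)"
    by (rule eventually_mono[OF 1]) (rule chart_coord_space[OF N assms(1)])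
qed

lemma smooth_family_chart:
  assumes "smooth_family p N f" obtains U \<phi> where "(U, \<phi>) \<in> charts N" "f origin \<in> U"
  using smooth_family_in_points[OF N assms] by (auto simp: in_points_iff)

text \<open>The counterpart of \<open>velocity_eq_iff_0\<close>: lists without repetition are closed
  under sublists, so \<open>agree_comp\<close> carries derivatives along them to other
  charts.\<close>

lemma itangent_eq_iff:
  assumes C: "(U, \<phi>) \<in> charts N" and f: "smooth_family k N f" "f origin \<in> U" and g: "smooth_family k N g"
  shows "itangent N k f = itangent N k g \<longleftrightarrow> g origin \<in> U \<and>
    (\<forall>i<dimension N. \<forall>is. distinct is \<longrightarrow> set is \<subseteq> {..<k} \<longrightarrow>
      partials is (\<lambda>s. \<phi> (f s) i) origin = partials is (\<lambda>s. \<phi> (g s) i) origin)"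
proof
  assume "itangent N k f = itangent N k g"
  then have "g \<in> itangent N k f" using itangent_self[OF g] by simp
  then show "g origin \<in> U \<and> (\<forall>i<dimension N. \<forall>is. distinct is \<longrightarrow> set is \<subseteq> {..<k} \<longrightarrow>
      partials is (\<lambda>s. \<phi> (f s) i) origin = partials is (\<lambda>s. \<phi> (g s) i) origin)"
    using C f(2) unfolding itangent_iff by metis
next
  assume h: "g origin \<in> U \<and> (\<forall>i<dimension N. \<forall>is. distinct is \<longrightarrow> set is \<subseteq> {..<k} \<longrightarrow>
      partials is (\<lambda>s. \<phi> (f s) i) origin = partials is (\<lambda>s. \<phi> (g s) i) origin)"
  have fg: "g origin = f origin"
  proof (rule chart_eqI[OF N C])
    fix i assume "i < dimension N"
    then show "\<phi> (g origin) i = \<phi> (f origin) i" using h[THEN conjunct2, rule_format, of i "[]"] by simp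
  qed (use h f(2) in auto)
  have "partials is (\<lambda>s. \<psi> (g s) i) origin = partials is (\<lambda>s. \<psi> (f s) i) origin"
    if D: "(V, \<psi>) \<in> charts N" "f origin \<in> V" and i: "i < dimension N" and "is": "distinct is" "set is \<subseteq> {..<k}"
    for V \<psi> i "is"
  proof -
    have gU: "g origin \<in> U" using h by simp
    have "agree origin is (\<lambda>x. \<psi> (inv_into U \<phi> (\<phi> (f x))) i) (\<lambda>x. \<psi> (inv_into U \<phi> (\<phi> (g x))) i)"
    proof (rule agree_comp[of "dimension N" _ "\<lambda>x. \<phi> (f x)" origin k _ "\<lambda>x. \<phi> (g x)"])
      show "smooth_germ (dimension N) (\<lambda>y. \<psi> (inv_into U \<phi> y) i) (\<phi> (f origin))"
        by (rule transition_germ[OF N C D(1) f(2) D(2) i])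
      fix j assume j: "j < dimension N"
      show "agree origin is (\<lambda>x. \<phi> (f x) j) (\<lambda>x. \<phi> (g x) j)"
        unfolding agree_def
      proof (intro allI impI)
        fix js assume js: "subseq js is"
        then have "set js \<subseteq> {..<k}" using list_emb_set[OF js] "is"(2) by auto
        then show "partials js (\<lambda>x. \<phi> (f x) j) origin = partials js (\<lambda>x. \<phi> (g x) j) origin"
          using h j subseq_distinct[OF js "is"(1)] by blast
      qed
    qed (use smooth_family_coords(2,3)[OF C f] smooth_family_coords(2,3)[OF C g gU] "is"(2) in auto)
    then have "agree origin is (\<lambda>x. \<psi> (f x) i) (\<lambda>x. \<psi> (g x) i)"
    proof (rule agree_cong[OF _ "is"(2) origin_coord_space])
      show "eventually (\<lambda>x. \<psi> (inv_into U \<phi> (\<phi> (f x))) i = \<psi> (f x) i) (nbhds k origin)"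
        by (rule eventually_mono[OF smooth_family_coords(1)[OF C f]]) (simp add: chart_inv[OF N C])
      show "eventually (\<lambda>x. \<psi> (inv_into U \<phi> (\<phi> (g x))) i = \<psi> (g x) i) (nbhds k origin)"
        by (rule eventually_mono[OF smooth_family_coords(1)[OF C g gU]]) (simp add: chart_inv[OF N C])
    qed
    from agree_D[OF this] show ?thesis ..
  qed
  then have "g \<in> itangent N k f" using g fg by (simp add: itangent_iff)
  then show "itangent N k f = itangent N k g" using itangent_mem by blast
qed

lemma curve_family:
  assumes c: "curve_at N c (\<sigma> origin)" and \<sigma>: "smooth_germ p \<sigma> origin"
  shows "smooth_family p N (\<lambda>s. c (\<sigma> s))"
proof -
  obtain U \<phi> where C: "(U, \<phi>) \<in> charts N" "c (\<sigma> origin) \<in> U"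
    using curve_at_in_points[OF c] by (auto simp: in_points_iff)
  have "filterlim \<sigma> (nhds (\<sigma> origin)) (nbhds p origin)"
    using smooth_germ_contat[OF \<sigma>] by (simp add: contat_def)
  then have "eventually (\<lambda>s. c (\<sigma> s) \<in> U) (nbhds p origin)"
    using curve_at_coords(1)[OF N C(1) c C(2)] unfolding filterlim_iff by blast
  moreover have "smooth_germ p (\<lambda>s. \<phi> (c (\<sigma> s)) i) origin" if "i < dimension N" for i
    by (rule smooth_germ_comp1[where f = "\<lambda>u. \<phi> (c u) i", OF curve_at_coords(2)[OF N C(1) c C(2) that] \<sigma>])
  ultimately show ?thesis
    using smooth_family_iff[where f = "\<lambda>s. c (\<sigma> s)", OF N C] by blast
qed

lemma curve_sum_family: "curve_at N c 0 \<Longrightarrow> smooth_family k N (\<lambda>s. c (\<Sum>i<k. s i))"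
  by (rule curve_family[where \<sigma> = "\<lambda>s. \<Sum>i<k. s i"]) (auto intro!: smooth_germ_coord_sum)

text \<open>The inclusion is defined by a chosen representative. A list without repetition from
  \<open>{..<k}\<close> has length at most \<open>k\<close>, so only derivatives shared by all
  representatives enter.\<close>

lemma incl_velocity_0:
  assumes c: "curve_at N c 0"
  shows "incl N k (velocity N k c 0) = itangent N k (\<lambda>s. c (\<Sum>i<k. s i))"
proof -
  let ?b = "rep (velocity N k c 0)"
  note b = rep_velocity[OF N c, where k = k]
  obtain U \<phi> where C: "(U, \<phi>) \<in> charts N" "c 0 \<in> U"
    using curve_at_in_points[OF c] by (auto simp: in_points_iff)
  have "partials is (\<lambda>s. \<phi> (?b (\<Sum>i<k. s i)) i) origin = partials is (\<lambda>s. \<phi> (c (\<Sum>i<k. s i)) i) origin"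
    if i: "i < dimension N" and "is": "distinct is" "set is \<subseteq> {..<k}" for i "is"
  proof -
    have "length is \<le> k" using "is" distinct_card[of "is"] card_mono[of "{..<k}" "set is"] by auto
    then show ?thesis
      using b(4)[OF C i] partials_sum_of_coords[OF "is"(2), of "\<lambda>u. \<phi> (?b u) i"]
        partials_sum_of_coords[OF "is"(2), of "\<lambda>u. \<phi> (c u) i"] by simp
  qed
  then have "itangent N k (\<lambda>s. ?b (\<Sum>i<k. s i)) = itangent N k (\<lambda>s. c (\<Sum>i<k. s i))"
    using itangent_eq_iff[OF C(1) curve_sum_family[OF b(2)] _ curve_sum_family[OF c]] C(2) b(3) by simp
  then show ?thesis by (simp add: incl_def)
qed

text \<open>The lists \<open>[0..<\<alpha>]\<close> with \<alpha> \<le> k recover every derivative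
  that the velocity records.\<close>

lemma incl_inj:
  assumes b: "curve_at N b 0" and c: "curve_at N c 0"
    and eq: "itangent N k (\<lambda>s. b (\<Sum>i<k. s i)) = itangent N k (\<lambda>s. c (\<Sum>i<k. s i))"
  shows "velocity N k b 0 = velocity N k c 0"
proof -
  obtain U \<phi> where C: "(U, \<phi>) \<in> charts N" "b 0 \<in> U"
    using curve_at_in_points[OF b] by (auto simp: in_points_iff)
  have 1: "c 0 \<in> U" and 2: "\<And>i is. i < dimension N \<Longrightarrow> distinct is \<Longrightarrow> set is \<subseteq> {..<k} \<Longrightarrow>
      partials is (\<lambda>s. \<phi> (b (\<Sum>i<k. s i)) i) origin = partials is (\<lambda>s. \<phi> (c (\<Sum>i<k. s i)) i) origin"
    using iffD1[OF itangent_eq_iff[OF C(1) curve_sum_family[OF b] _ curve_sum_family[OF c]] eq] C(2) by auto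
  have "(deriv ^^ \<alpha>) (\<lambda>u. \<phi> (b u) i) 0 = (deriv ^^ \<alpha>) (\<lambda>u. \<phi> (c u) i) 0"
    if "i < dimension N" "\<alpha> \<le> k" for i \<alpha>
  proof -
    have "set [0..<\<alpha>] \<subseteq> {..<k}" using that(2) by auto
    then show ?thesis
      using 2[OF that(1), of "[0..<\<alpha>]"] partials_sum_of_coords[of "[0..<\<alpha>]" k "\<lambda>u. \<phi> (b u) i"]
        partials_sum_of_coords[of "[0..<\<alpha>]" k "\<lambda>u. \<phi> (c u) i"] by simp
  qed
  then show ?thesis using velocity_eq_iff_0[OF N C(1) b C(2) c] 1 by simp
qed

section \<open>Two-parameter families and velocities of velocities\<close>

lemma smooth_family2_coords:
  assumes "(U, \<phi>) \<in> charts N" "smooth_family2 N g" "g 0 0 \<in> U"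
  shows "eventually (\<lambda>x. g (x 0) (x (Suc 0)) \<in> U) (nbhds 2 origin)"
    "i < dimension N \<Longrightarrow> smooth_germ 2 (\<lambda>x. \<phi> (g (x 0) (x (Suc 0))) i) origin"
    "eventually (\<lambda>x. \<phi> (g (x 0) (x (Suc 0))) \<in> coord_space (dimension N)) (nbhds 2 origin)"
  using smooth_family_coords[OF assms(1,2)] assms(3) by simp_all

lemma smooth_family2_chart:
  assumes "smooth_family2 N g" obtains U \<phi> where "(U, \<phi>) \<in> charts N" "g 0 0 \<in> U"
  using smooth_family_chart[OF assms] by metis

text \<open>A velocity of velocities uses the curves \<open>g s\<close> for all \<open>s\<close>
  near 0, and smoothness at the origin spreads to the points (s, 0).\<close>

lemma family2_slices:
  assumes C: "(U, \<phi>) \<in> charts N" and g: "smooth_family2 N g" "g 0 0 \<in> U"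
  shows "eventually (\<lambda>s. curve_at N (g s) 0 \<and> g s 0 \<in> U) (nhds 0)"
proof -
  let ?P = "\<lambda>x. g (x 0) (x (Suc 0)) \<in> U \<and> (\<forall>i\<in>{..<dimension N}. smooth_germ 2 (\<lambda>x. \<phi> (g (x 0) (x (Suc 0))) i) x)"
  have "eventually ?P (nbhds 2 (point2 0 0))"
    using smooth_family2_coords[OF C g]
    by (intro eventually_conj eventually_ball_finite) (auto intro: smooth_germ_eventually)
  then have "eventually (\<lambda>x. eventually ?P (nbhds 2 x)) (nbhds 2 (point2 0 0))"
    by (rule eventually_eventually_nbhds)
  then have "eventually (\<lambda>s. eventually ?P (nbhds 2 (point2 s 0))) (nhds 0)"
    using filterlim_point2(1)[of 0 0] unfolding filterlim_iff by blast
  then show ?thesis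
  proof eventually_elim
    case (elim s)
    have P0: "?P (point2 s 0)" using eventually_nbhds_self[OF elim point_coord_space(2)] .
    have "eventually (\<lambda>t. ?P (point2 s t)) (nhds 0)"
      using elim filterlim_point2(2)[of s 0] unfolding filterlim_iff by blast
    then have "eventually (\<lambda>t. g s t \<in> U) (nhds 0)" by (rule eventually_mono) simp
    moreover have "smooth1 (\<lambda>t. \<phi> (g s t) i) 0" if "i < dimension N" for i
      using smooth1_slice(2)[of "\<lambda>x. \<phi> (g (x 0) (x (Suc 0))) i" s 0] P0 that by simp
    ultimately show ?case using curve_at_iff[OF N C, of "g s" 0] P0 by simp
  qed
qed

lemma family2_jet_coord:
  assumes C: "(U, \<phi>) \<in> charts N" and g: "smooth_family2 N g" "g 0 0 \<in> U" and i: "i < dimension N" and \<beta>: "\<beta> \<le> n"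
  shows "eventually (\<lambda>s. jet_coord N n \<phi> (velocity N n (g s) 0) (\<beta> * dimension N + i) =
      partials (replicate \<beta> (Suc 0)) (\<lambda>x. \<phi> (g (x 0) (x (Suc 0))) i) (point2 s 0)) (nhds 0)"
    "(deriv ^^ a) (\<lambda>s. jet_coord N n \<phi> (velocity N n (g s) 0) (\<beta> * dimension N + i)) 0 =
      mixed a \<beta> (\<lambda>x. \<phi> (g (x 0) (x (Suc 0))) i) origin"
    "smooth1 (\<lambda>s. jet_coord N n \<phi> (velocity N n (g s) 0) (\<beta> * dimension N + i)) 0"
proof -
  let ?F = "\<lambda>x. \<phi> (g (x 0) (x (Suc 0))) i"
  have eqF: "partials (replicate \<beta> (Suc 0)) ?F (point2 s 0) = (deriv ^^ \<beta>) (\<lambda>t. \<phi> (g s t) i) 0" for s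
    by (subst partials_replicate_1[of \<beta> "\<lambda>a b. \<phi> (g a b) i"]) simp
  show 1: "eventually (\<lambda>s. jet_coord N n \<phi> (velocity N n (g s) 0) (\<beta> * dimension N + i) =
      partials (replicate \<beta> (Suc 0)) ?F (point2 s 0)) (nhds 0)"
    using family2_slices[OF C g] unfolding eqF
    by (rule eventually_mono) (use jet_coord_velocity[OF N C _ _ i \<beta>] in auto)
  have "smooth_germ 2 (partials (replicate \<beta> (Suc 0)) ?F) (point2 0 0)"
    using smooth_germ_partials[OF smooth_family2_coords(2)[OF C g i], of "replicate \<beta> (Suc 0)"]
    by (auto simp: set_replicate_conv_if)
  from smooth1_slice(1)[OF this]
  show "smooth1 (\<lambda>s. jet_coord N n \<phi> (velocity N n (g s) 0) (\<beta> * dimension N + i)) 0"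
    by (rule smooth1_cong) (rule eventually_eq_sym[OF 1])
  have "(deriv ^^ a) (\<lambda>s. jet_coord N n \<phi> (velocity N n (g s) 0) (\<beta> * dimension N + i)) 0 =
      (deriv ^^ a) (\<lambda>s. (deriv ^^ \<beta>) (\<lambda>t. \<phi> (g s t) i) 0) 0"
    using 1 unfolding eqF by (rule higher_deriv_cong)
  also have "\<dots> = mixed a \<beta> ?F (point2 0 0)" by (rule mixed_eq[symmetric])
  finally show "(deriv ^^ a) (\<lambda>s. jet_coord N n \<phi> (velocity N n (g s) 0) (\<beta> * dimension N + i)) 0 =
      mixed a \<beta> ?F origin" by simp
qed

lemma family2_velocity_curve:
  assumes g: "smooth_family2 N g"
  shows "curve_at (jet_bundle n N) (\<lambda>s. velocity N n (g s) 0) 0"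
proof -
  obtain U \<phi> where C: "(U, \<phi>) \<in> charts N" "g 0 0 \<in> U" using smooth_family2_chart[OF g] by metis
  note ev = family2_slices[OF C(1) g C(2)]
  have "velocity N n (g 0) 0 \<in> jet_dom N n U"
    using eventually_nhds_x_imp_x[OF ev] jet_dom_iff[OF N] by blast
  moreover have "eventually (\<lambda>s. velocity N n (g s) 0 \<in> jet_dom N n U) (nhds 0)"
    using ev by (rule eventually_mono) (use jet_dom_iff[OF N] in blast)
  moreover have "smooth1 (\<lambda>s. jet_coord N n \<phi> (velocity N n (g s) 0) j) 0" if j: "j < (n + 1) * dimension N" for j
  proof -
    obtain \<beta> i where "\<beta> \<le> n" "i < dimension N" "j = \<beta> * dimension N + i" using jet_index[OF j] by metis
    then show ?thesis using family2_jet_coord(3)[OF C(1) g C(2)] by simp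
  qed
  ultimately show ?thesis
    using curve_at_iff[OF smooth_atlas_jet_bundle[OF N] jet_chart[OF C(1)],
        where c = "\<lambda>s. velocity N n (g s) 0" and t = 0] by simp
qed

text \<open>The lifted coordinates of the velocity of \<open>g s\<close> are
  \<open>t\<close>-derivatives up to order \<open>n\<close>; differentiating them in
  \<open>s\<close> up to order \<open>m\<close> gives exactly these mixed derivatives.\<close>

lemma velocity2_eq_iff:
  assumes C: "(U, \<phi>) \<in> charts N" and f: "smooth_family2 N f" "f 0 0 \<in> U" and g: "smooth_family2 N g"
  shows "velocity2 N m n f = velocity2 N m n g \<longleftrightarrow> g 0 0 \<in> U \<and>
    (\<forall>i<dimension N. \<forall>a\<le>m. \<forall>b\<le>n. mixed a b (\<lambda>x. \<phi> (f (x 0) (x (Suc 0))) i) origin =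
      mixed a b (\<lambda>x. \<phi> (g (x 0) (x (Suc 0))) i) origin)"
proof -
  let ?b = "\<lambda>s. velocity N n (f s) 0" and ?c = "\<lambda>s. velocity N n (g s) 0"
  obtain V \<psi> where D: "(V, \<psi>) \<in> charts N" "g 0 0 \<in> V" using smooth_family2_chart[OF g] by metis
  have cf: "curve_at N (f 0) 0" and cg: "curve_at N (g 0) 0"
    using eventually_nhds_x_imp_x[OF family2_slices[OF C f]]
      eventually_nhds_x_imp_x[OF family2_slices[OF D(1) g D(2)]] by auto
  have b0: "?b 0 \<in> jet_dom N n U" using cf f(2) jet_dom_iff[OF N] by blast
  have c0: "?c 0 \<in> jet_dom N n U \<longleftrightarrow> g 0 0 \<in> U" using jet_dom_iff[OF N cg] .
  have "velocity2 N m n f = velocity2 N m n g \<longleftrightarrow> ?c 0 \<in> jet_dom N n U \<and>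
      (\<forall>j<(n + 1) * dimension N. \<forall>a\<le>m. (deriv ^^ a) (\<lambda>s. jet_coord N n \<phi> (?b s) j) 0 =
        (deriv ^^ a) (\<lambda>s. jet_coord N n \<phi> (?c s) j) 0)"
    unfolding velocity2_def
    using velocity_eq_iff_0[OF smooth_atlas_jet_bundle[OF N] jet_chart[OF C] family2_velocity_curve[OF f(1)] b0
        family2_velocity_curve[OF g]] by simp
  also have "\<dots> \<longleftrightarrow> g 0 0 \<in> U \<and> (\<forall>i<dimension N. \<forall>a\<le>m. \<forall>b\<le>n.
      mixed a b (\<lambda>x. \<phi> (f (x 0) (x (Suc 0))) i) origin = mixed a b (\<lambda>x. \<phi> (g (x 0) (x (Suc 0))) i) origin)"
    unfolding c0
  proof (intro conj_cong refl iffI allI impI)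
    assume gU: "g 0 0 \<in> U"
    { fix i a b
      assume h: "\<forall>j<(n + 1) * dimension N. \<forall>a\<le>m. (deriv ^^ a) (\<lambda>s. jet_coord N n \<phi> (?b s) j) 0 =
        (deriv ^^ a) (\<lambda>s. jet_coord N n \<phi> (?c s) j) 0" and *: "i < dimension N" "a \<le> m" "b \<le> n"
      show "mixed a b (\<lambda>x. \<phi> (f (x 0) (x (Suc 0))) i) origin = mixed a b (\<lambda>x. \<phi> (g (x 0) (x (Suc 0))) i) origin"
        using h[rule_format, OF jet_index_less[OF *(3,1)] *(2)]
        unfolding family2_jet_coord(2)[OF C f *(1,3)] family2_jet_coord(2)[OF C g gU *(1,3)] . }
    { fix j a
      assume h: "\<forall>i<dimension N. \<forall>a\<le>m. \<forall>b\<le>n. mixed a b (\<lambda>x. \<phi> (f (x 0) (x (Suc 0))) i) origin =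
          mixed a b (\<lambda>x. \<phi> (g (x 0) (x (Suc 0))) i) origin" and *: "j < (n + 1) * dimension N" "a \<le> m"
      obtain \<beta> i where j: "\<beta> \<le> n" "i < dimension N" "j = \<beta> * dimension N + i" using jet_index[OF *(1)] by metis
      show "(deriv ^^ a) (\<lambda>s. jet_coord N n \<phi> (?b s) j) 0 = (deriv ^^ a) (\<lambda>s. jet_coord N n \<phi> (?c s) j) 0"
        unfolding j(3) family2_jet_coord(2)[OF C f j(2,1)] family2_jet_coord(2)[OF C g gU j(2,1)]
        using h[rule_format, OF j(2) *(2) j(1)] . }
  qed
  finally show ?thesis .
qed

text \<open>In a chart the family is the polynomial in \<open>t\<close> whose coefficients are the
  jet coordinates of \<open>c s\<close>. It allows the flip, which is defined through families, to
  be computed for a curve of tangent vectors.\<close>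

lemma velocity_family_exists:
  assumes c: "curve_at (jet_bundle n N) c 0"
  obtains g where "smooth_family2 N g" "eventually (\<lambda>s. velocity N n (g s) 0 = c s) (nhds 0)"
proof -
  obtain U \<phi> where C: "(U, \<phi>) \<in> charts N" "c 0 \<in> jet_dom N n U"
    using curve_at_in_points[OF c] by (auto simp: in_points_iff charts_jet_bundle)
  let ?z = "\<lambda>s. jet_coord N n \<phi> (c s)"
  let ?F = "\<lambda>x. jet_poly (dimension N) n (?z (x 0)) (x (Suc 0))"
  note J = smooth_atlas_jet_bundle[OF N] jet_chart[OF C(1), of n]
  have ev: "eventually (\<lambda>s. c s \<in> jet_dom N n U) (nhds 0)"
    and sz: "\<And>j. j < (n + 1) * dimension N \<Longrightarrow> smooth1 (\<lambda>s. ?z s j) 0"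
    using curve_at_coords[OF J c C(2)] by auto
  have res: "coord_restrict (dimension N) (jet_coord N n \<phi> v) \<in> \<phi> ` U" if "v \<in> jet_dom N n U" for v
    using jet_coord_image[OF N C(1), of n U] that by blast
  have F: "?F origin \<in> \<phi> ` U" using res[OF C(2)] by (simp add: jet_poly_0)
  have sF: "smooth_germ 2 (\<lambda>x. ?F x i) origin" if i: "i < dimension N" for i
  proof -
    have "smooth_germ 2 (\<lambda>x. \<Sum>\<beta>\<le>n. ?z (x 0) (\<beta> * dimension N + i) * taylor_monomial \<beta> (x (Suc 0))) origin"
    proof (rule smooth_germ_sum[OF origin_coord_space])
      fix \<beta> assume "\<beta> \<in> {..n}"
      then have j: "\<beta> * dimension N + i < (n + 1) * dimension N" using jet_index_less i by simp
      show "smooth_germ 2 (\<lambda>x. ?z (x 0) (\<beta> * dimension N + i) * taylor_monomial \<beta> (x (Suc 0))) origin"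
        by (rule smooth_germ_mult;
            rule smooth_germ_comp1[where G = "\<lambda>x. x 0" and f = "\<lambda>s. ?z s (\<beta> * dimension N + i)"]
              smooth_germ_comp1[where G = "\<lambda>x. x (Suc 0)", OF smooth1_taylor_monomial])
          (use sz[OF j] in \<open>auto intro!: smooth_germ_coord\<close>)
    qed
    then show ?thesis using i by (simp add: jet_poly_def)
  qed
  define g where "g = (\<lambda>s t. inv_into U \<phi> (jet_poly (dimension N) n (?z s) t))"
  have "smooth_family 2 N (\<lambda>x. inv_into U \<phi> (?F x))"
    by (rule chart_family(1)[where F = ?F, OF N C(1) F sF]) auto
  then have "smooth_family2 N g" by (simp add: g_def)
  moreover have "eventually (\<lambda>s. velocity N n (g s) 0 = c s) (nhds 0)"
    using ev
  proof eventually_elim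
    case (elim s)
    have g_eq: "g s = jet_curve N U \<phi> n (?z s)" by (simp add: g_def jet_curve_def[OF N] fun_eq_iff)
    note * = jet_curve[OF N C(1) res[OF elim], of n]
    have "jet_coord N n \<phi> (velocity N n (g s) 0) = ?z s"
      unfolding g_eq by (rule jet_coord_jet_curve[OF N C(1) res[OF elim] jet_coord_coord_space[OF N]])
    moreover have "velocity N n (g s) 0 \<in> jet_dom N n U"
      unfolding g_eq using jet_dom_iff[OF N *(1)] *(2) by blast
    ultimately show ?case using jet_coord_inj[OF N C(1), of n] elim by (auto dest: inj_onD)
  qed
  ultimately show thesis by (rule that)
qed

text \<open>A truncation uses only some of the mixed derivatives that fix the element, so every
  representing family yields the same one.\<close>

lemma truncation_velocity2:
  assumes g: "smooth_family2 N g" and mn: "m \<le> k" "n \<le> k"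
  shows "truncation N k m n (velocity2 N k k g) = velocity2 N m n g"
  unfolding truncation_def
proof (rule the_equality)
  fix Y assume "\<exists>g'. smooth_family2 N g' \<and> velocity2 N k k g = velocity2 N k k g' \<and> Y = velocity2 N m n g'"
  then obtain g' where g': "smooth_family2 N g'" "velocity2 N k k g = velocity2 N k k g'" "Y = velocity2 N m n g'"
    by blast
  obtain U \<phi> where C: "(U, \<phi>) \<in> charts N" "g 0 0 \<in> U" using smooth_family2_chart[OF g] by metis
  show "Y = velocity2 N m n g"
    using g'(2) mn unfolding g'(3) eq_commute[of "velocity2 N m n g'"]
      velocity2_eq_iff[OF C(1) g C(2) g'(1)] by auto
qed (use g in blast)

lemma two_sums_family:
  assumes g: "smooth_family2 N g"
  shows "smooth_family (m + n) N (\<lambda>s. g (\<Sum>i<m. s i) (\<Sum>i=m..<m + n. s i))"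
proof -
  obtain U \<phi> where C: "(U, \<phi>) \<in> charts N" "g 0 0 \<in> U" using smooth_family2_chart[OF g] by metis
  let ?\<sigma> = "\<lambda>s. point2 (\<Sum>i<m. s i) (\<Sum>i=m..<m + n. s i)"
  have "eventually (\<lambda>s. (\<lambda>x. g (x 0) (x (Suc 0)) \<in> U) (?\<sigma> s)) (nbhds (m + n) origin)"
    by (rule eventually_compose_filterlim[OF _ filterlim_two_sums(1)])
      (use smooth_family2_coords(1)[OF C(1) g C(2)] in simp)
  moreover have "smooth_germ (m + n) (\<lambda>s. (\<lambda>x. \<phi> (g (x 0) (x (Suc 0))) i) (?\<sigma> s)) origin" if "i < dimension N" for i
    by (rule smooth_germ_comp[where G = ?\<sigma> and n = 2])
      (use filterlim_two_sums(2) smooth_family2_coords(2)[OF C(1) g C(2) that] in auto)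
  ultimately show ?thesis
    using smooth_family_iff[where f = "\<lambda>s. g (\<Sum>i<m. s i) (\<Sum>i=m..<m + n. s i)", OF N C(1)] C(2) by simp
qed

text \<open>A list without repetition contains at most \<open>m\<close> parameters of the first
  group and at most \<open>n\<close> of the second, so it only calls for mixed derivatives that the
  velocity of velocities determines.\<close>

lemma incl2_velocity2:
  assumes g: "smooth_family2 N g"
  shows "incl2 N m n (velocity2 N m n g) = itangent N (m + n) (\<lambda>s. g (\<Sum>i<m. s i) (\<Sum>i=m..<m + n. s i))"
  unfolding incl2_def
proof (rule the_equality)
  fix Z assume "\<exists>g'. smooth_family2 N g' \<and> velocity2 N m n g = velocity2 N m n g' \<and>
      Z = itangent N (m + n) (\<lambda>s. g' (\<Sum>i<m. s i) (\<Sum>i=m..<m + n. s i))"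
  then obtain g' where g': "smooth_family2 N g'" "velocity2 N m n g = velocity2 N m n g'"
    "Z = itangent N (m + n) (\<lambda>s. g' (\<Sum>i<m. s i) (\<Sum>i=m..<m + n. s i))" by blast
  obtain U \<phi> where C: "(U, \<phi>) \<in> charts N" "g 0 0 \<in> U" using smooth_family2_chart[OF g] by metis
  have g0: "g' 0 0 \<in> U" and eq: "\<And>i a b. i < dimension N \<Longrightarrow> a \<le> m \<Longrightarrow> b \<le> n \<Longrightarrow>
      mixed a b (\<lambda>x. \<phi> (g (x 0) (x (Suc 0))) i) origin = mixed a b (\<lambda>x. \<phi> (g' (x 0) (x (Suc 0))) i) origin"
    using iffD1[OF velocity2_eq_iff[OF C(1) g C(2) g'(1)] g'(2)] by auto
  have "partials is (\<lambda>s. \<phi> (g (\<Sum>i<m. s i) (\<Sum>i=m..<m + n. s i)) i) origin =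
      partials is (\<lambda>s. \<phi> (g' (\<Sum>i<m. s i) (\<Sum>i=m..<m + n. s i)) i) origin"
    if i: "i < dimension N" and "is": "distinct is" "set is \<subseteq> {..<m + n}" for i "is"
  proof -
    let ?js = "map (\<lambda>i. if i < m then 0 else Suc 0) is"
    have js: "set ?js \<subseteq> {..<2}" by auto
    have "count_list ?js 0 = card {i \<in> set is. i < m}" "count_list ?js (Suc 0) = card {i \<in> set is. \<not> i < m}"
      using "is"(1) by (induction "is") (auto simp: card_insert_if conj_disj_distribR Collect_disj_eq insert_compr[symmetric] Collect_conv_if)
    moreover have "card {i \<in> set is. i < m} \<le> card {..<m}" by (rule card_mono) auto
    moreover have "card {i \<in> set is. \<not> i < m} \<le> card {m..<m + n}" by (rule card_mono) (use "is"(2) in auto)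
    ultimately have count: "count_list ?js 0 \<le> m" "count_list ?js (Suc 0) \<le> n" by auto
    have P: "partials is (\<lambda>s. \<phi> (h (\<Sum>i<m. s i) (\<Sum>i=m..<m + n. s i)) i) origin =
        mixed (count_list ?js 0) (count_list ?js (Suc 0)) (\<lambda>x. \<phi> (h (x 0) (x (Suc 0))) i) origin"
      if h: "smooth_family2 N h" "h 0 0 \<in> U" for h
    proof -
      have "partials is (\<lambda>s. \<phi> (h (\<Sum>i<m. s i) (\<Sum>i=m..<m + n. s i)) i) origin =
          partials ?js (\<lambda>x. \<phi> (h (x 0) (x (Suc 0))) i) (point2 0 0)"
        using fun_cong[OF partials_two_sums[OF "is"(2), of "\<lambda>x. \<phi> (h (x 0) (x (Suc 0))) i"], of origin] by simp
      then show ?thesis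
        using partials_mixed[OF smooth_family2_coords(2)[OF C(1) h i] js] by simp
    qed
    show ?thesis unfolding P[OF g C(2)] P[OF g'(1) g0] by (rule eq[OF i count])
  qed
  then have "itangent N (m + n) (\<lambda>s. g (\<Sum>i<m. s i) (\<Sum>i=m..<m + n. s i)) = Z"
    unfolding g'(3)
    using itangent_eq_iff[OF C(1) two_sums_family[OF g] _ two_sums_family[OF g'(1)]] C(2) g0 by simp
  then show "Z = itangent N (m + n) (\<lambda>s. g (\<Sum>i<m. s i) (\<Sum>i=m..<m + n. s i))" by simp
qed (use g in blast)

lemma smooth_family2_swap:
  assumes g: "smooth_family2 N g" shows "smooth_family2 N (\<lambda>s t. g t s)"
proof -
  obtain U \<phi> where C: "(U, \<phi>) \<in> charts N" "g 0 0 \<in> U" using smooth_family2_chart[OF g] by metis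
  let ?\<sigma> = "\<lambda>x::nat \<Rightarrow> real. point2 (x (Suc 0)) (x 0)"
  have s: "smooth_germ 2 (\<lambda>x. ?\<sigma> x i) origin" for i
    unfolding point2_def by (cases "i = 0"; cases "i = 1") (auto intro: smooth_germ_coord)
  have lim: "filterlim ?\<sigma> (nbhds 2 (?\<sigma> origin)) (nbhds 2 origin)"
    by (rule smooth_germ_filterlim) (use s in auto)
  have "eventually (\<lambda>x. (\<lambda>x. g (x 0) (x (Suc 0)) \<in> U) (?\<sigma> x)) (nbhds 2 origin)"
    by (rule eventually_compose_filterlim[OF _ lim])
      (use smooth_family2_coords(1)[OF C(1) g C(2)] in simp)
  moreover have "smooth_germ 2 (\<lambda>s. (\<lambda>x. \<phi> (g (x 0) (x (Suc 0))) i) (?\<sigma> s)) origin" if "i < dimension N" for i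
    by (rule smooth_germ_comp[where G = ?\<sigma> and n = 2])
      (use s smooth_family2_coords(2)[OF C(1) g C(2) that] in auto)
  ultimately show ?thesis
    using smooth_family_iff[where f = "\<lambda>x. g (x (Suc 0)) (x 0)", OF N C(1)] C(2) by simp
qed

lemma mixed_swap:
  assumes "smooth_germ 2 (\<lambda>x. h (x 0) (x (Suc 0))) origin"
  shows "mixed a b (\<lambda>x. h (x (Suc 0)) (x 0)) origin = mixed b a (\<lambda>x. h (x 0) (x (Suc 0))) origin"
proof -
  have "mixed a b (\<lambda>x. h (x (Suc 0)) (x 0)) (point2 0 0) = (deriv ^^ a) (\<lambda>s. (deriv ^^ b) (\<lambda>t. h t s) 0) 0"
    by (rule mixed_eq[of a b "\<lambda>s t. h t s"])
  also have "\<dots> = partials (replicate a (Suc 0) @ replicate b 0) (\<lambda>x. h (x 0) (x (Suc 0))) (point2 0 0)"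
    unfolding foldr_append o_apply partials_replicate_0
    using fun_cong[OF partials_replicate_1[of a "\<lambda>s u. (deriv ^^ b) (\<lambda>t. h t u) s"], of "point2 0 0"] by simp
  also have "\<dots> = mixed b a (\<lambda>x. h (x 0) (x (Suc 0))) (point2 0 0)"
    by (rule partials_permute[where n = 2]) (use assms in \<open>auto simp: set_replicate_conv_if\<close>)
  finally show ?thesis by simp
qed

text \<open>Exchanging the parameters exchanges the two orders of a mixed derivative, by symmetry of
  partial derivatives, so the result does not depend on the family.\<close>

lemma flip_velocity2:
  assumes g: "smooth_family2 N g"
  shows "flip N k (velocity2 N k 1 g) = velocity2 N 1 k (\<lambda>s t. g t s)"
  unfolding flip_def
proof (rule the_equality)
  fix W assume "\<exists>g'. smooth_family2 N g' \<and> velocity2 N k 1 g = velocity2 N k 1 g' \<and> W = velocity2 N 1 k (\<lambda>s t. g' t s)"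
  then obtain g' where g': "smooth_family2 N g'" "velocity2 N k 1 g = velocity2 N k 1 g'"
    "W = velocity2 N 1 k (\<lambda>s t. g' t s)" by blast
  obtain U \<phi> where C: "(U, \<phi>) \<in> charts N" "g 0 0 \<in> U" using smooth_family2_chart[OF g] by metis
  have g0: "g' 0 0 \<in> U" and eq: "\<And>i a b. i < dimension N \<Longrightarrow> a \<le> k \<Longrightarrow> b \<le> 1 \<Longrightarrow>
      mixed a b (\<lambda>x. \<phi> (g (x 0) (x (Suc 0))) i) origin = mixed a b (\<lambda>x. \<phi> (g' (x 0) (x (Suc 0))) i) origin"
    using iffD1[OF velocity2_eq_iff[OF C(1) g C(2) g'(1)] g'(2)] by auto
  have "velocity2 N 1 k (\<lambda>s t. g t s) = velocity2 N 1 k (\<lambda>s t. g' t s)"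
    unfolding velocity2_eq_iff[OF C(1) smooth_family2_swap[OF g] C(2) smooth_family2_swap[OF g'(1)]]
  proof (intro conjI allI impI)
    fix i a b assume *: "i < dimension N" "a \<le> (1::nat)" "b \<le> k"
    show "mixed a b (\<lambda>x. \<phi> (g (x (Suc 0)) (x 0)) i) origin = mixed a b (\<lambda>x. \<phi> (g' (x (Suc 0)) (x 0)) i) origin"
      unfolding mixed_swap[where h = "\<lambda>a b. \<phi> (g a b) i", OF smooth_family2_coords(2)[OF C(1) g C(2) *(1)]]
        mixed_swap[where h = "\<lambda>a b. \<phi> (g' a b) i", OF smooth_family2_coords(2)[OF C(1) g'(1) g0 *(1)]]
      by (rule eq[OF *(1,3,2)])
  qed (rule g0)
  then show "W = velocity2 N 1 k (\<lambda>s t. g t s)" unfolding g'(3) by simp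
qed (use g in blast)

end

section \<open>Pairings in coordinates\<close>

text \<open>Covers the tangent and the cotangent bundle at once: a chart over the whole of a base
  chart, with the base coordinates as first block and fibre coordinates that take all
  values.\<close>

definition bundle_chart ::
  "'a atlas \<Rightarrow> 'b atlas \<Rightarrow> ('b \<Rightarrow> 'a) \<Rightarrow> 'a set \<Rightarrow> ('a \<Rightarrow> nat \<Rightarrow> real) \<Rightarrow> 'b set \<Rightarrow> ('b \<Rightarrow> nat \<Rightarrow> real) \<Rightarrow> bool" where
  "bundle_chart N E pr U \<phi> U' \<phi>' \<longleftrightarrow> (U, \<phi>) \<in> charts N \<and> (U', \<phi>') \<in> charts E \<and>
     dimension E = 2 * dimension N \<and> U' = {e \<in> points E. pr e \<in> U} \<and>
     (\<forall>e\<in>U'. coord_restrict (dimension N) (\<phi>' e) = \<phi> (pr e)) \<and>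
     \<phi>' ` U' = {z \<in> coord_space (2 * dimension N). coord_restrict (dimension N) z \<in> \<phi> ` U}"

lemma bundle_chart_cotangent:
  assumes M: "smooth_atlas M" and C: "(U, \<phi>) \<in> charts M"
  shows "bundle_chart M (cotangent M) fst U \<phi> (cot_dom M U) (cot_chart M U \<phi>)"
  unfolding bundle_chart_def
  using C cotangent_chart[OF C] cot_chart_restrict[OF M C] cot_chart_image[OF M C, of U]
  by (auto simp: points_cotangent[OF M] cot_dom_def)

lemma bundle_chart_tangent:
  assumes M: "smooth_atlas M" and C: "(U, \<phi>) \<in> charts M"
  shows "bundle_chart M (tangent M) base_point U \<phi> (jet_dom M 1 U) (jet_coord M 1 \<phi>)"
proof -
  have "jet_dom M 1 U = {v \<in> points (tangent M). base_point v \<in> U}"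
    unfolding points_jet_bundle[OF M]
    using jet_dom_iff[OF M] base_point_velocity[OF M] by (auto elim!: jet_dom_E[OF M])
  moreover have "coord_restrict (dimension M) (jet_coord M 1 \<phi> v) = \<phi> (base_point v)" if "v \<in> jet_dom M 1 U" for v
    using that jet_coord_restrict[OF M C] base_point_velocity[OF M] by (auto elim!: jet_dom_E[OF M])
  moreover have "(1 + 1) * dimension M = 2 * dimension M" by simp
  ultimately show ?thesis
    unfolding bundle_chart_def dimension_jet_bundle
    using C jet_chart[OF C, of 1] jet_coord_image[OF M C, of 1 U] by (simp add: mult_2)
qed

context
  fixes N :: "'a atlas" and E :: "'b atlas" and pr U \<phi> U' \<phi>'
  assumes N: "smooth_atlas N" and E: "smooth_atlas E" and B: "bundle_chart N E pr U \<phi> U' \<phi>'"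
begin

lemma bundle_charts: "(U, \<phi>) \<in> charts N" "(U', \<phi>') \<in> charts E" "dimension E = 2 * dimension N"
  using B by (auto simp: bundle_chart_def)

lemma bundle_dom_iff: "e \<in> U' \<longleftrightarrow> e \<in> points E \<and> pr e \<in> U"
  using B by (auto simp: bundle_chart_def)

lemma bundle_base_coord: "e \<in> U' \<Longrightarrow> i < dimension N \<Longrightarrow> \<phi>' e i = \<phi> (pr e) i"
  using B unfolding bundle_chart_def by (metis coord_restrict_def)

lemma proj_family:
  assumes y: "smooth_family p E y" "y origin \<in> U'"
  shows "smooth_family p N (\<lambda>s. pr (y s))"
proof -
  note c = smooth_family_coords[OF E bundle_charts(2) y]
  have "eventually (\<lambda>s. pr (y s) \<in> U) (nbhds p origin)"
    using c(1) by (rule eventually_mono) (simp add: bundle_dom_iff)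
  moreover have "smooth_germ p (\<lambda>s. \<phi> (pr (y s)) i) origin" if "i < dimension N" for i
  proof (rule smooth_germ_cong)
    show "smooth_germ p (\<lambda>s. \<phi>' (y s) i) origin" using c(2) that bundle_charts(3) by simp
    show "eventually (\<lambda>s. \<phi>' (y s) i = \<phi> (pr (y s)) i) (nbhds p origin)"
      using c(1) by (rule eventually_mono) (rule bundle_base_coord[OF _ that])
  qed
  ultimately show ?thesis
    using smooth_family_iff[where f = "\<lambda>s. pr (y s)", OF N bundle_charts(1)] y(2) bundle_dom_iff by blast
qed

lemma proj_curve:
  assumes y: "curve_at E y t" "y t \<in> U'"
  shows "curve_at N (\<lambda>u. pr (y u)) t"
    "i < dimension N \<Longrightarrow> (deriv ^^ \<alpha>) (\<lambda>u. \<phi>' (y u) i) t = (deriv ^^ \<alpha>) (\<lambda>u. \<phi> (pr (y u)) i) t"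
proof -
  note c = curve_at_coords[OF E bundle_charts(2) y]
  have ev: "eventually (\<lambda>u. \<phi>' (y u) i = \<phi> (pr (y u)) i) (nhds t)" if "i < dimension N" for i
    using c(1) by (rule eventually_mono) (rule bundle_base_coord[OF _ that])
  then show "i < dimension N \<Longrightarrow> (deriv ^^ \<alpha>) (\<lambda>u. \<phi>' (y u) i) t = (deriv ^^ \<alpha>) (\<lambda>u. \<phi> (pr (y u)) i) t"
    by (rule higher_deriv_cong)
  have "eventually (\<lambda>u. pr (y u) \<in> U) (nhds t)"
    using c(1) by (rule eventually_mono) (simp add: bundle_dom_iff)
  moreover have "smooth1 (\<lambda>u. \<phi> (pr (y u)) i) t" if "i < dimension N" for i
    by (rule smooth1_cong[OF _ ev[OF that]]) (use c(2) that bundle_charts(3) in simp)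
  ultimately show "curve_at N (\<lambda>u. pr (y u)) t"
    using curve_at_iff[where c = "\<lambda>u. pr (y u)", OF N bundle_charts(1)] y(2) bundle_dom_iff by blast
qed

text \<open>Derivatives of base coordinates are among those of bundle coordinates, so the
  representative chosen by \<open>jet_map\<close> does not matter.\<close>

lemma jet_map_proj:
  assumes y: "curve_at E y t" "y t \<in> U'"
  shows "jet_map N k pr (velocity E k y t) = velocity N k (\<lambda>u. pr (y u)) t"
proof -
  let ?b = "rep (velocity E k y t)"
  note r = rep_velocity[OF E y(1), where k = k]
  have b0: "?b 0 \<in> U'" using r(3) y(2) by simp
  have "(deriv ^^ \<alpha>) (\<lambda>u. \<phi> (pr (?b u)) i) 0 = (deriv ^^ \<alpha>) (\<lambda>u. \<phi> (pr (y u)) i) t"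
    if "i < dimension N" "\<alpha> \<le> k" for i \<alpha>
    using r(4)[OF bundle_charts(2) y(2), of i \<alpha>] that bundle_charts(3)
      proj_curve(2)[OF r(2) b0 that(1)] proj_curve(2)[OF y that(1)] by simp
  then show ?thesis
    using velocity_eq_iff[OF N bundle_charts(1) proj_curve(1)[OF r(2) b0] _ proj_curve(1)[OF y]] b0 y(2)
    unfolding bundle_dom_iff jet_map_def o_def by blast
qed

text \<open>\<open>itangent_pairing\<close> accepts only representatives over literally the same
  base family, while elements over one iterated tangent vector of the base merely share derivatives
  there. Replacing the base coordinates of \<open>y\<close> by those of \<open>F\<close> repairs
  this without changing any derivative that the class records.\<close>

lemma change_base_family:
  assumes y: "smooth_family k E y" "y origin \<in> U'" and F: "smooth_family k N F"
    and eq: "itangent N k F = itangent N k (\<lambda>s. pr (y s))"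
  obtains y' where "smooth_family k E y'" "itangent E k y' = itangent E k y"
    "eventually (\<lambda>s. y' s \<in> U' \<and> pr (y' s) = F s \<and>
       (\<forall>i<dimension N. \<phi>' (y' s) (dimension N + i) = \<phi>' (y s) (dimension N + i))) (nbhds k origin)"
proof -
  let ?n = "dimension N"
  have eqs: "F origin \<in> U" "\<And>i is. i < ?n \<Longrightarrow> distinct is \<Longrightarrow> set is \<subseteq> {..<k} \<Longrightarrow>
      partials is (\<lambda>s. \<phi> (F s) i) origin = partials is (\<lambda>s. \<phi> (pr (y s)) i) origin"
    using iffD1[OF itangent_eq_iff[OF N bundle_charts(1) proj_family[OF y] _ F] eq[symmetric]] y(2) bundle_dom_iff
    by auto
  note cF = smooth_family_coords[OF N bundle_charts(1) F eqs(1)]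
  note cy = smooth_family_coords[OF E bundle_charts(2) y]
  \<comment> \<open>Base coordinates from \<open>F\<close>, fibre coordinates from
    \<open>y\<close>.\<close>
  let ?z = "\<lambda>s j. if j < ?n then \<phi> (F s) j else \<phi>' (y s) j"
  have zc: "eventually (\<lambda>s. ?z s \<in> coord_space (2 * ?n) \<and> coord_restrict ?n (?z s) = \<phi> (F s)) (nbhds k origin)"
    using cF(3) cy(3) by eventually_elim (auto simp: coord_space_def coord_restrict_def fun_eq_iff bundle_charts(3))
  have z0: "?z origin \<in> \<phi>' ` U'"
    using eventually_nbhds_self[OF zc origin_coord_space] B eqs(1) unfolding bundle_chart_def by auto
  have sz: "smooth_germ k (\<lambda>s. ?z s j) origin" if "j < dimension E" for j
    using that cF(2) cy(2) by (cases "j < ?n") auto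
  have zcE: "eventually (\<lambda>s. ?z s \<in> coord_space (dimension E)) (nbhds k origin)"
    using zc by (rule eventually_mono) (simp add: bundle_charts(3))
  let ?y = "\<lambda>s. inv_into U' \<phi>' (?z s)"
  note fam' = chart_family[where F = ?z and p = k, OF E bundle_charts(2) z0 _ zcE]
  have fam: "smooth_family k E ?y" "?y origin \<in> U'"
    "eventually (\<lambda>s. ?y s \<in> U' \<and> \<phi>' (?y s) = ?z s) (nbhds k origin)"
    by (rule fam'(1), erule sz, rule fam'(2), erule sz, rule fam'(3), erule sz)
  have ev: "eventually (\<lambda>s. ?y s \<in> U' \<and> pr (?y s) = F s \<and>
       (\<forall>i<?n. \<phi>' (?y s) (?n + i) = \<phi>' (y s) (?n + i))) (nbhds k origin)"
    using fam(3) cF(1)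
  proof eventually_elim
    case (elim s)
    have "pr (?y s) = F s"
    proof (rule chart_eqI[OF N bundle_charts(1)])
      fix i assume "i < ?n"
      then show "\<phi> (pr (?y s)) i = \<phi> (F s) i"
        using bundle_base_coord[of "?y s" i] elim by simp
    qed (use elim bundle_dom_iff in auto)
    then show ?case using elim by simp
  qed
  have "partials is (\<lambda>s. \<phi>' (?y s) j) origin = partials is (\<lambda>s. \<phi>' (y s) j) origin"
    if j: "j < dimension E" and "is": "distinct is" "set is \<subseteq> {..<k}" for j "is"
  proof -
    have "partials is (\<lambda>s. \<phi>' (?y s) j) origin = partials is (\<lambda>s. ?z s j) origin"
      by (rule partials_cong[OF eventually_mono[OF fam(3)] "is"(2) origin_coord_space], elim conjE)
        (erule fun_cong)
    also have "\<dots> = partials is (\<lambda>s. \<phi>' (y s) j) origin"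
    proof (cases "j < ?n")
      case True
      have "partials is (\<lambda>s. \<phi> (pr (y s)) j) origin = partials is (\<lambda>s. \<phi>' (y s) j) origin"
        by (rule partials_cong[OF eventually_mono[OF cy(1)] "is"(2) origin_coord_space])
          (simp add: bundle_base_coord[OF _ True])
      then show ?thesis using eqs(2)[OF True "is"] True by simp
    qed simp
    finally show ?thesis .
  qed
  then have "itangent E k ?y = itangent E k y"
    using itangent_eq_iff[where f = ?y and g = y, OF E bundle_charts(2) fam(1,2) y(1)] y(2) by simp
  with fam(1) show thesis using ev by (rule that)
qed

end

text \<open>Representatives over a common base exist by \<open>change_base_family\<close>. The value
  is unique because the derivative of a product along \<open>[0..<k]\<close> involves only
  derivatives of the factors along sublists, which all members of the classes share. The right side
  makes sense for families whose bases differ.\<close>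

lemma itangent_pairing_coords:
  assumes M: "smooth_atlas M" and C: "(U, \<phi>) \<in> charts M"
    and x: "smooth_family k (cotangent M) x" and y: "smooth_family k (tangent M) y"
    and x0: "fst (x origin) \<in> U"
    and eq: "itangent M k (\<lambda>s. fst (x s)) = itangent M k (\<lambda>s. base_point (y s))"
  shows "itangent_pairing k (itangent (cotangent M) k x) (itangent (tangent M) k y) =
    partials [0..<k] (\<lambda>s. \<Sum>i<dimension M. cotangent_coord M U \<phi> (x s) i * tangent_coord \<phi> (y s) i) origin"
    (is "_ = ?R")
proof -
  let ?n = "dimension M"
  let ?p = "\<lambda>i p. cot_chart M U \<phi> p (?n + i)" and ?v = "\<lambda>i v. jet_coord M 1 \<phi> v (?n + i)"
  have pv: "cotangent_coord M U \<phi> p i = ?p i p" "tangent_coord \<phi> v i = ?v i v" if "i < ?n" for i p v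
    using that by (simp_all add: cot_chart_def jet_coord_def tangent_coord_def)
  note Ec = smooth_atlas_cotangent[OF M] and Et = smooth_atlas_jet_bundle[OF M, of 1]
  note Bc = bundle_chart_cotangent[OF M C] and Bt = bundle_chart_tangent[OF M C]
  have xU: "x origin \<in> cot_dom M U"
    using smooth_family_in_points[OF Ec x] x0 bundle_dom_iff[OF M Ec Bc] by blast
  have fx: "smooth_family k M (\<lambda>s. fst (x s))" by (rule proj_family[OF M Ec Bc x xU])
  have yU: "y origin \<in> jet_dom M 1 U"
  proof -
    obtain c where c: "y origin = velocity M 1 c 0" "curve_at M c 0"
      using smooth_family_in_points[OF Et y] unfolding points_jet_bundle[OF M] by blast
    obtain V \<psi> where D: "(V, \<psi>) \<in> charts M" "base_point (y origin) \<in> V"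
      using curve_at_in_points[OF c(2)] unfolding c(1) base_point_velocity[OF M c(2)] in_points_iff by blast
    have "y origin \<in> jet_dom M 1 V"
      using smooth_family_in_points[OF Et y] D(2) bundle_dom_iff[OF M Et bundle_chart_tangent[OF M D(1)]] by blast
    then have "smooth_family k M (\<lambda>s. base_point (y s))"
      by (rule proj_family[OF M Et bundle_chart_tangent[OF M D(1)] y])
    then have "base_point (y origin) \<in> U"
      using itangent_eq_iff[where g = "\<lambda>s. base_point (y s)", OF M C fx x0] eq by simp
    then show ?thesis using smooth_family_in_points[OF Et y] bundle_dom_iff[OF M Et Bt] by blast
  qed
  have pairing: "eventually (\<lambda>s. pairing (x1 s) (y1 s) = (\<Sum>i<?n. ?p i (x1 s) * ?v i (y1 s))) (nbhds k origin)"
    if x1: "smooth_family k (cotangent M) x1" "x1 origin \<in> cot_dom M U" and y1: "smooth_family k (tangent M) y1" "y1 origin \<in> jet_dom M 1 U"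
      and e: "eventually (\<lambda>s. fst (x1 s) = base_point (y1 s)) (nbhds k origin)" for x1 y1
    using e smooth_family_coords(1)[OF Ec cotangent_chart[OF C] x1] smooth_family_coords(1)[OF Et jet_chart[OF C] y1]
  proof eventually_elim
    case (elim s)
    have "x1 s \<in> covectors M" "fst (x1 s) \<in> U" using elim(2) by (auto simp: cot_dom_def)
    moreover have "y1 s \<in> tangent_space M (fst (x1 s))"
      using elim(1,3) bundle_dom_iff[OF M Et Bt] unfolding tangent_space_def by auto
    ultimately show ?case
      using covectors_expand[OF M C, of "x1 s" "y1 s"] pv unfolding pairing_def by simp
  qed
  have R: "?R = partials [0..<k] (\<lambda>s. \<Sum>i<?n. ?p i (x s) * ?v i (y s)) origin"
    using pv by simp
  have cx: "smooth_germ k (\<lambda>s. ?p i (x1 s)) origin"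
    if "smooth_family k (cotangent M) x1" "x1 origin \<in> cot_dom M U" "i < ?n" for x1 i
    using smooth_family_coords(2)[OF Ec cotangent_chart[OF C] that(1,2)] that(3) by simp
  have cy: "smooth_germ k (\<lambda>s. ?v i (y1 s)) origin"
    if "smooth_family k (tangent M) y1" "y1 origin \<in> jet_dom M 1 U" "i < ?n" for y1 i
    using smooth_family_coords(2)[OF Et jet_chart[OF C] that(1,2)] that(3) by simp
  have set_upt: "set [0..<k] \<subseteq> {..<k}" by auto
  show ?thesis
    unfolding R itangent_pairing_def
  proof (rule the_equality)
    \<comment> \<open>The second argument is moved over the base family of \<open>x\<close>, keeping
      its fibre coordinates.\<close>
    obtain y' where y': "smooth_family k (tangent M) y'" "itangent (tangent M) k y' = itangent (tangent M) k y"
      "eventually (\<lambda>s. y' s \<in> jet_dom M 1 U \<and> base_point (y' s) = fst (x s) \<and>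
        (\<forall>i<?n. ?v i (y' s) = ?v i (y s))) (nbhds k origin)"
      by (rule change_base_family[OF M Et Bt y yU fx eq])
    have y'0: "y' origin \<in> jet_dom M 1 U" using eventually_nbhds_self[OF y'(3)] by simp
    have e: "eventually (\<lambda>s. fst (x s) = base_point (y' s)) (nbhds k origin)"
      by (rule eventually_mono[OF y'(3)]) simp
    have "eventually (\<lambda>s. (\<Sum>i<?n. ?p i (x s) * ?v i (y s)) = pairing (x s) (y' s)) (nbhds k origin)"
      using pairing[OF x xU y'(1) y'0 e] y'(3) by eventually_elim simp
    then have "partials [0..<k] (\<lambda>s. \<Sum>i<?n. ?p i (x s) * ?v i (y s)) origin = partials [0..<k] (\<lambda>s. pairing (x s) (y' s)) origin"
      by (rule partials_cong[OF _ set_upt origin_coord_space])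
    then show "\<exists>x2\<in>itangent (cotangent M) k x. \<exists>y2\<in>itangent (tangent M) k y.
        eventually (\<lambda>s. fst (x2 s) = base_point (y2 s)) (nbhds k origin) \<and>
        partials [0..<k] (\<lambda>s. \<Sum>i<?n. ?p i (x s) * ?v i (y s)) origin =
          partials [0..<k] (\<lambda>s. pairing (x2 s) (y2 s)) origin"
      using itangent_self[OF x] itangent_self[OF y'(1)] y'(2) e by blast
  next
    fix r assume "\<exists>x\<in>itangent (cotangent M) k x. \<exists>y\<in>itangent (tangent M) k y.
        eventually (\<lambda>s. fst (x s) = base_point (y s)) (nbhds k origin) \<and>
        r = partials [0..<k] (\<lambda>s. pairing (x s) (y s)) origin"
    then obtain x1 y1 where x1: "x1 \<in> itangent (cotangent M) k x" and y1: "y1 \<in> itangent (tangent M) k y"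
      and e: "eventually (\<lambda>s. fst (x1 s) = base_point (y1 s)) (nbhds k origin)"
      and r: "r = partials [0..<k] (\<lambda>s. pairing (x1 s) (y1 s)) origin" by blast
    have x1s: "smooth_family k (cotangent M) x1" "x1 origin \<in> cot_dom M U"
      and y1s: "smooth_family k (tangent M) y1" "y1 origin \<in> jet_dom M 1 U"
      using x1 y1 xU yU unfolding itangent_iff by auto
    have ag: "agree origin [0..<k] u v" if "\<And>is. distinct is \<Longrightarrow> set is \<subseteq> {..<k} \<Longrightarrow> partials is u origin = partials is v origin" for u v
      unfolding agree_def
    proof (intro allI impI)
      fix js assume js: "subseq js [0..<k]"
      then have "set js \<subseteq> {..<k}" using list_emb_set[OF js] by auto
      then show "partials js u origin = partials js v origin" using that subseq_distinct[OF js] by simp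
    qed
    have "agree origin [0..<k] (\<lambda>s. \<Sum>i<?n. ?p i (x1 s) * ?v i (y1 s)) (\<lambda>s. \<Sum>i<?n. ?p i (x s) * ?v i (y s))"
    proof (rule agree_sum[OF origin_coord_space set_upt])
      fix i assume "i \<in> {..<?n}"
      then have i: "i < ?n" by simp
      note s = cx[OF x1s i] cy[OF y1s i] cx[OF x xU i] cy[OF y yU i]
      show "smooth_germ k (\<lambda>s. ?p i (x1 s) * ?v i (y1 s)) origin" by (rule smooth_germ_mult[OF s(1,2)])
      show "smooth_germ k (\<lambda>s. ?p i (x s) * ?v i (y s)) origin" by (rule smooth_germ_mult[OF s(3,4)])
      show "agree origin [0..<k] (\<lambda>s. ?p i (x1 s) * ?v i (y1 s)) (\<lambda>s. ?p i (x s) * ?v i (y s))"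
      proof (rule agree_mult[OF s set_upt])
        show "agree origin [0..<k] (\<lambda>s. ?p i (x1 s)) (\<lambda>s. ?p i (x s))"
        proof (rule ag)
          fix "is" assume "distinct is" "set is \<subseteq> {..<k}"
          moreover have "?n + i < dimension (cotangent M)" using i by simp
          ultimately show "partials is (\<lambda>s. ?p i (x1 s)) origin = partials is (\<lambda>s. ?p i (x s)) origin"
            using x1 cotangent_chart[OF C] xU unfolding itangent_iff by blast
        qed
        show "agree origin [0..<k] (\<lambda>s. ?v i (y1 s)) (\<lambda>s. ?v i (y s))"
        proof (rule ag)
          fix "is" assume "distinct is" "set is \<subseteq> {..<k}"
          moreover have "?n + i < dimension (tangent M)" using i by simp
          ultimately show "partials is (\<lambda>s. ?v i (y1 s)) origin = partials is (\<lambda>s. ?v i (y s)) origin"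
            using y1 jet_chart[OF C] yU unfolding itangent_iff by blast
        qed
      qed
    qed
    moreover have "r = partials [0..<k] (\<lambda>s. \<Sum>i<?n. ?p i (x1 s) * ?v i (y1 s)) origin"
      unfolding r by (rule partials_cong[OF pairing[OF x1s y1s e] set_upt origin_coord_space])
    ultimately show "r = partials [0..<k] (\<lambda>s. \<Sum>i<?n. ?p i (x s) * ?v i (y s)) origin"
      using agree_D by simp
  qed
qed

section \<open>Nondegeneracy of the pairing of velocities\<close>

context
  fixes M :: "'a atlas" and U :: "'a set" and \<phi> :: "'a \<Rightarrow> nat \<Rightarrow> real"
  assumes M: "smooth_atlas M" and C: "(U, \<phi>) \<in> charts M"
begin

abbreviation (input) "pcoord i p \<equiv> cotangent_coord M U \<phi> p i"
abbreviation (input) "vcoord i v \<equiv> tangent_coord \<phi> v i"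

lemma cot_chart_fibre: "i < dimension M \<Longrightarrow> cot_chart M U \<phi> p (dimension M + i) = pcoord i p"
  by (simp add: cot_chart_def)

lemma tangent_chart_fibre: "i < dimension M \<Longrightarrow> jet_coord M 1 \<phi> v (dimension M + i) = vcoord i v"
  by (simp add: jet_coord_def tangent_coord_def)

lemma fibre_index:
  assumes "j < 2 * dimension M" obtains "j < dimension M" | i where "i < dimension M" "j = dimension M + i"
proof (cases "j < dimension M")
  case False
  then have "j - dimension M < dimension M" "j = dimension M + (j - dimension M)" using assms by auto
  then show thesis using that(2) by blast
qed (use that(1) in blast)

lemma covector_chart:
  assumes "x \<in> U"
  shows "covector M \<phi> x c \<in> cot_dom M U" "j < dimension M \<Longrightarrow> cot_chart M U \<phi> (covector M \<phi> x c) j = \<phi> x j"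
    "i < dimension M \<Longrightarrow> cot_chart M U \<phi> (covector M \<phi> x c) (dimension M + i) = c i"
  using assms covector_in_covectors[OF M C assms] cotangent_coord_covector[OF M C assms]
  by (auto simp: cot_dom_def cot_chart_def)

lemma covector_family:
  assumes F: "smooth_family p M F" "F origin \<in> U"
    and c: "\<And>i. i < dimension M \<Longrightarrow> smooth_germ p (\<lambda>s. c s i) origin"
  shows "smooth_family p (cotangent M) (\<lambda>s. covector M \<phi> (F s) (c s))"
proof -
  note cF = smooth_family_coords[OF M C F]
  have "eventually (\<lambda>s. covector M \<phi> (F s) (c s) \<in> cot_dom M U) (nbhds p origin)"
    using cF(1) by (rule eventually_mono) (rule covector_chart(1))
  moreover have "smooth_germ p (\<lambda>s. cot_chart M U \<phi> (covector M \<phi> (F s) (c s)) j) origin"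
    if "j < dimension (cotangent M)" for j
  proof (rule fibre_index[of j])
    show "j < 2 * dimension M" using that by simp
    assume j: "j < dimension M"
    from cF(2)[OF j] show ?thesis
      by (rule smooth_germ_cong) (rule eventually_mono[OF cF(1)], simp add: covector_chart(2) j)
  next
    fix i assume i: "i < dimension M" "j = dimension M + i"
    from c[OF i(1)] show ?thesis unfolding i(2)
      by (rule smooth_germ_cong) (rule eventually_mono[OF cF(1)], simp add: covector_chart(3) i(1))
  qed
  ultimately show ?thesis
    using smooth_family_iff[where f = "\<lambda>s. covector M \<phi> (F s) (c s)", OF smooth_atlas_cotangent[OF M] cotangent_chart[OF C]]
      covector_chart(1)[OF F(2)] by blast
qed

lemma covector_curve:
  assumes b: "curve_at M b t" "b t \<in> U" and c: "\<And>i. i < dimension M \<Longrightarrow> smooth1 (\<lambda>s. c s i) t"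
  shows "curve_at (cotangent M) (\<lambda>s. covector M \<phi> (b s) (c s)) t"
proof -
  note cb = curve_at_coords[OF M C b]
  have "eventually (\<lambda>s. covector M \<phi> (b s) (c s) \<in> cot_dom M U) (nhds t)"
    using cb(1) by (rule eventually_mono) (rule covector_chart(1))
  moreover have "smooth1 (\<lambda>s. cot_chart M U \<phi> (covector M \<phi> (b s) (c s)) j) t"
    if "j < dimension (cotangent M)" for j
  proof (rule fibre_index[of j])
    show "j < 2 * dimension M" using that by simp
    assume j: "j < dimension M"
    from cb(2)[OF j] show ?thesis
      by (rule smooth1_cong) (rule eventually_mono[OF cb(1)], simp add: covector_chart(2) j)
  next
    fix i assume i: "i < dimension M" "j = dimension M + i"
    from c[OF i(1)] show ?thesis unfolding i(2)
      by (rule smooth1_cong) (rule eventually_mono[OF cb(1)], simp add: covector_chart(3) i(1))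
  qed
  ultimately show ?thesis
    using curve_at_iff[where c = "\<lambda>s. covector M \<phi> (b s) (c s)", OF smooth_atlas_cotangent[OF M] cotangent_chart[OF C]]
      covector_chart(1)[OF b(2)] by blast
qed

text \<open>The supply of test vectors: fibre components over a given curve can be prescribed
  freely.\<close>

lemma vector_curve_exists:
  assumes b: "curve_at M b 0" "b 0 \<in> U" and w: "\<And>i. i < dimension M \<Longrightarrow> smooth1 (w i) 0"
  obtains y where "curve_at (tangent M) y 0"
    "eventually (\<lambda>t. base_point (y t) = b t \<and> (\<forall>i<dimension M. vcoord i (y t) = w i t)) (nhds 0)"
proof -
  let ?n = "dimension M"
  note B = bundle_chart_tangent[OF M C] and Et = smooth_atlas_jet_bundle[OF M, of 1]
  note cb = curve_at_coords[OF M C b]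
  let ?z = "\<lambda>t j. if j < ?n then \<phi> (b t) j else if j < 2 * ?n then w (j - ?n) t else 0"
  have zc: "eventually (\<lambda>t. ?z t \<in> coord_space (2 * ?n) \<and> coord_restrict ?n (?z t) = \<phi> (b t)) (nhds 0)"
    using cb(1)
  proof (rule eventually_mono)
    fix t assume "b t \<in> U"
    then show "?z t \<in> coord_space (2 * ?n) \<and> coord_restrict ?n (?z t) = \<phi> (b t)"
      using chart_coord_space[OF M C] by (auto simp: coord_space_def coord_restrict_def fun_eq_iff)
  qed
  have z0: "?z 0 \<in> jet_coord M 1 \<phi> ` jet_dom M 1 U"
    using eventually_nhds_x_imp_x[OF zc] B b(2) unfolding bundle_chart_def by auto
  have sz: "smooth1 (\<lambda>t. ?z t j) 0" for j
    using cb(2)[of j] w[of "j - ?n"] smooth1_const[of 0]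
    by (cases "j < ?n"; cases "j < 2 * ?n") auto
  have zcE: "eventually (\<lambda>t. ?z t \<in> coord_space (dimension (tangent M))) (nhds 0)"
    using zc by (rule eventually_mono) (simp add: mult_2)
  let ?y = "\<lambda>t. inv_into (jet_dom M 1 U) (jet_coord M 1 \<phi>) (?z t)"
  note cur = chart_curve[where F = ?z and t = 0, OF Et jet_chart[OF C] z0 sz zcE]
  have "eventually (\<lambda>t. base_point (?y t) = b t \<and> (\<forall>i<?n. vcoord i (?y t) = w i t)) (nhds 0)"
    using cur(3) cb(1)
  proof eventually_elim
    case (elim t)
    have yt: "?y t \<in> jet_dom M 1 U" "\<And>j. jet_coord M 1 \<phi> (?y t) j = ?z t j"
      using elim(1) by auto
    have "base_point (?y t) = b t"
    proof (rule chart_eqI[OF M C])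
      fix i assume "i < ?n"
      then show "\<phi> (base_point (?y t)) i = \<phi> (b t) i"
        using bundle_base_coord[OF M Et B yt(1)] yt(2)[of i] by simp
    qed (use elim(2) yt(1) bundle_dom_iff[OF M Et B] in auto)
    moreover have "vcoord i (?y t) = w i t" if "i < ?n" for i
      using yt(2)[of "?n + i"] tangent_chart_fibre[OF that] that by simp
    ultimately show ?case by blast
  qed
  with cur(1) show thesis by (rule that)
qed

end

context
  fixes M :: "'a atlas"
  assumes M: "smooth_atlas M"
begin

lemma fst_curve: "curve_at (cotangent M) x t \<Longrightarrow> curve_at M (\<lambda>u. fst (x u)) t"
  and fst_curve_jet: "curve_at (cotangent M) x t \<Longrightarrow> jet_map M k fst (velocity (cotangent M) k x t) = velocity M k (\<lambda>u. fst (x u)) t"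
proof -
  assume x: "curve_at (cotangent M) x t"
  obtain U \<phi> where C: "(U, \<phi>) \<in> charts M" "x t \<in> cot_dom M U"
    using curve_at_in_points[OF x] by (auto simp: in_points_iff charts_cotangent)
  note * = M smooth_atlas_cotangent[OF M] bundle_chart_cotangent[OF M C(1)] x C(2)
  show "curve_at M (\<lambda>u. fst (x u)) t" by (rule proj_curve(1)[OF *])
  show "jet_map M k fst (velocity (cotangent M) k x t) = velocity M k (\<lambda>u. fst (x u)) t"
    by (rule jet_map_proj[OF *])
qed

lemma base_point_curve: "curve_at (tangent M) y t \<Longrightarrow> curve_at M (\<lambda>u. base_point (y u)) t"
  and base_point_curve_jet: "curve_at (tangent M) y t \<Longrightarrow> jet_map M k base_point (velocity (tangent M) k y t) = velocity M k (\<lambda>u. base_point (y u)) t"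
proof -
  assume y: "curve_at (tangent M) y t"
  obtain U \<phi> where C: "(U, \<phi>) \<in> charts M" "y t \<in> jet_dom M 1 U"
    using curve_at_in_points[OF y] by (auto simp: in_points_iff charts_jet_bundle)
  note * = M smooth_atlas_jet_bundle[OF M] bundle_chart_tangent[OF M C(1)] y C(2)
  show "curve_at M (\<lambda>u. base_point (y u)) t" by (rule proj_curve(1)[OF *])
  show "jet_map M k base_point (velocity (tangent M) k y t) = velocity M k (\<lambda>u. base_point (y u)) t"
    by (rule jet_map_proj[OF *])
qed

section \<open>The pairing of velocities in a chart\<close>

context
  fixes U :: "'a set" and \<phi> :: "'a \<Rightarrow> nat \<Rightarrow> real"
  assumes C: "(U, \<phi>) \<in> charts M"
begin

lemma curve_dom:
  "curve_at (cotangent M) x t \<Longrightarrow> x t \<in> cot_dom M U \<longleftrightarrow> fst (x t) \<in> U"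
  "curve_at (tangent M) y t \<Longrightarrow> y t \<in> jet_dom M 1 U \<longleftrightarrow> base_point (y t) \<in> U"
  using bundle_dom_iff[OF M smooth_atlas_cotangent[OF M] bundle_chart_cotangent[OF M C]] curve_at_in_points
    bundle_dom_iff[OF M smooth_atlas_jet_bundle[OF M] bundle_chart_tangent[OF M C]] by blast+

lemma smooth1_cotangent_coord:
  assumes "curve_at (cotangent M) x t" "fst (x t) \<in> U" "i < dimension M"
  shows "smooth1 (\<lambda>u. cotangent_coord M U \<phi> (x u) i) t"
  using curve_at_coords(2)[OF smooth_atlas_cotangent[OF M] cotangent_chart[OF C] assms(1), of "dimension M + i"]
    curve_dom(1)[OF assms(1)] assms(2,3) cot_chart_fibre[OF M C assms(3)] by simp

lemma smooth1_tangent_coord: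
  assumes "curve_at (tangent M) y t" "base_point (y t) \<in> U" "i < dimension M"
  shows "smooth1 (\<lambda>u. tangent_coord \<phi> (y u) i) t"
  using curve_at_coords(2)[OF smooth_atlas_jet_bundle[OF M] jet_chart[OF C] assms(1), of "dimension M + i"]
    curve_dom(2)[OF assms(1)] assms(2,3) tangent_chart_fibre[OF M C assms(3)] by simp

text \<open>Included velocities are represented by families depending only on the sum of the
  parameters, so one derivative in each of the \<open>k\<close> parameters amounts to the
  \<open>k\<close>-th derivative.\<close>

lemma jet_pairing_coords:
  assumes x: "curve_at (cotangent M) x 0" and y: "curve_at (tangent M) y 0" and x0: "fst (x 0) \<in> U"
    and eq: "velocity M k (\<lambda>u. fst (x u)) 0 = velocity M k (\<lambda>u. base_point (y u)) 0"
  shows "jet_pairing M k (velocity (cotangent M) k x 0) (velocity (tangent M) k y 0) =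
    (deriv ^^ k) (\<lambda>t. \<Sum>i<dimension M. cotangent_coord M U \<phi> (x t) i * tangent_coord \<phi> (y t) i) 0"
proof -
  note Ec = smooth_atlas_cotangent[OF M] and Et = smooth_atlas_jet_bundle[OF M, of 1]
  have "itangent M k (\<lambda>s. fst (x (\<Sum>i<k. s i))) = itangent M k (\<lambda>s. base_point (y (\<Sum>i<k. s i)))"
    using incl_velocity_0[OF M fst_curve[OF x], of k] incl_velocity_0[OF M base_point_curve[OF y], of k] eq by simp
  then have "jet_pairing M k (velocity (cotangent M) k x 0) (velocity (tangent M) k y 0) =
      partials [0..<k] (\<lambda>s. (\<lambda>t. \<Sum>i<dimension M. cotangent_coord M U \<phi> (x t) i * tangent_coord \<phi> (y t) i) (\<Sum>i<k. s i)) origin"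
    unfolding jet_pairing_def incl_velocity_0[OF Ec x] incl_velocity_0[OF Et y]
    by (intro itangent_pairing_coords[OF M C])
      (use curve_sum_family[OF Ec x] curve_sum_family[OF Et y] x0 in auto)
  also have "\<dots> = (deriv ^^ k) (\<lambda>t. \<Sum>i<dimension M. cotangent_coord M U \<phi> (x t) i * tangent_coord \<phi> (y t) i) 0"
    by (subst partials_sum_of_coords) auto
  finally show ?thesis .
qed

lemma velocity_base_point_eq:
  assumes "curve_at M b 0" "curve_at M c 0" "velocity M k b 0 = velocity M k c 0" shows "b 0 = c 0"
  using base_point_velocity[OF M assms(1), of k] base_point_velocity[OF M assms(2), of k] assms(3) by simp

lemma jet_pairing_leibniz:
  assumes x: "curve_at (cotangent M) x 0" and y: "curve_at (tangent M) y 0" and x0: "fst (x 0) \<in> U"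
    and eq: "velocity M k (\<lambda>u. fst (x u)) 0 = velocity M k (\<lambda>u. base_point (y u)) 0"
  shows "jet_pairing M k (velocity (cotangent M) k x 0) (velocity (tangent M) k y 0) =
    (\<Sum>i<dimension M. \<Sum>\<alpha>\<le>k. real (k choose \<alpha>) * ((deriv ^^ (k - \<alpha>)) (\<lambda>t. cotangent_coord M U \<phi> (x t) i) 0 *
      (deriv ^^ \<alpha>) (\<lambda>t. tangent_coord \<phi> (y t) i) 0))"
proof -
  have y0: "base_point (y 0) \<in> U"
    using velocity_base_point_eq[OF fst_curve[OF x] base_point_curve[OF y] eq] x0 by simp
  note s = smooth1_cotangent_coord[OF x x0] smooth1_tangent_coord[OF y y0]
  show ?thesis
    unfolding jet_pairing_coords[OF assms]
    by (subst higher_deriv_sum) (auto intro!: sum.cong higher_deriv_mult smooth1_mult s)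
qed

text \<open>Nondegeneracy. A test vector whose component \<open>i\<close> is the Taylor monomial of
  degree \<alpha>, the others being 0, leaves a single term of the Leibniz sum: the derivative of
  order k - \<alpha> of fibre coordinate \<open>i\<close>, times the nonzero factor (k choose
  \<alpha>).\<close>

lemma velocity_eq_of_jet_pairing:
  assumes x: "curve_at (cotangent M) x 0" and z: "curve_at (cotangent M) z 0" and x0: "fst (x 0) \<in> U"
    and eq: "velocity M k (\<lambda>u. fst (x u)) 0 = velocity M k (\<lambda>u. fst (z u)) 0"
    and pair: "\<And>y. curve_at (tangent M) y 0 \<Longrightarrow> velocity M k (\<lambda>u. fst (x u)) 0 = velocity M k (\<lambda>u. base_point (y u)) 0 \<Longrightarrow>
      jet_pairing M k (velocity (cotangent M) k x 0) (velocity (tangent M) k y 0) =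
      jet_pairing M k (velocity (cotangent M) k z 0) (velocity (tangent M) k y 0)"
  shows "velocity (cotangent M) k x 0 = velocity (cotangent M) k z 0"
proof -
  let ?n = "dimension M"
  note Ec = smooth_atlas_cotangent[OF M] and Bc = bundle_chart_cotangent[OF M C]
  have z0: "fst (z 0) \<in> U"
    using velocity_base_point_eq[OF fst_curve[OF x] fst_curve[OF z] eq] x0 by simp
  have xU: "x 0 \<in> cot_dom M U" and zU: "z 0 \<in> cot_dom M U" using curve_dom x z x0 z0 by auto
  have fib: "(deriv ^^ (k - \<alpha>)) (\<lambda>t. cotangent_coord M U \<phi> (x t) i) 0 = (deriv ^^ (k - \<alpha>)) (\<lambda>t. cotangent_coord M U \<phi> (z t) i) 0"
    if i: "i < ?n" and \<alpha>: "\<alpha> \<le> k" for i \<alpha>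
  proof -
    let ?w = "\<lambda>j. if j = i then taylor_monomial \<alpha> else (\<lambda>_. 0)"
    obtain y where y: "curve_at (tangent M) y 0"
      "eventually (\<lambda>t. base_point (y t) = fst (x t) \<and> (\<forall>j<?n. tangent_coord \<phi> (y t) j = ?w j t)) (nhds 0)"
      by (rule vector_curve_exists[OF M C fst_curve[OF x] x0, where w = ?w])
        (auto simp: smooth1_taylor_monomial smooth1_const)
    have eqy: "velocity M k (\<lambda>u. fst (x u)) 0 = velocity M k (\<lambda>u. base_point (y u)) 0"
      by (rule velocity_cong[OF eventually_mono[OF y(2)]]) simp
    have w: "(deriv ^^ \<beta>) (\<lambda>t. tangent_coord \<phi> (y t) j) 0 = (if j = i \<and> \<beta> = \<alpha> then 1 else 0)" if j: "j < ?n" for j \<beta>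
    proof -
      have "(deriv ^^ \<beta>) (\<lambda>t. tangent_coord \<phi> (y t) j) 0 = (deriv ^^ \<beta>) (?w j) 0"
        by (rule higher_deriv_cong[OF eventually_mono[OF y(2)]]) (use j in simp)
      also have "\<dots> = (if j = i \<and> \<beta> = \<alpha> then 1 else 0)"
      proof (cases "j = i")
        case False
        have "(deriv ^^ \<beta>) (\<lambda>_::real. 0::real) = (\<lambda>_. 0)" by (induction \<beta>) simp_all
        then show ?thesis using False by simp
      qed (auto simp: higher_deriv_taylor_monomial)
      finally show ?thesis .
    qed
    have "jet_pairing M k (velocity (cotangent M) k q 0) (velocity (tangent M) k y 0) =
        real (k choose \<alpha>) * (deriv ^^ (k - \<alpha>)) (\<lambda>t. cotangent_coord M U \<phi> (q t) i) 0"
      if q: "curve_at (cotangent M) q 0" "fst (q 0) \<in> U"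
        "velocity M k (\<lambda>u. fst (q u)) 0 = velocity M k (\<lambda>u. base_point (y u)) 0" for q
    proof -
      have "jet_pairing M k (velocity (cotangent M) k q 0) (velocity (tangent M) k y 0) =
          (\<Sum>j<?n. \<Sum>\<beta>\<le>k. if j = i \<and> \<beta> = \<alpha> then real (k choose \<beta>) * (deriv ^^ (k - \<beta>)) (\<lambda>t. cotangent_coord M U \<phi> (q t) j) 0 else 0)"
        unfolding jet_pairing_leibniz[OF q(1) y(1) q(2,3)] using w by (intro sum.cong refl) auto
      also have "\<dots> = (\<Sum>j<?n. if j = i then real (k choose \<alpha>) * (deriv ^^ (k - \<alpha>)) (\<lambda>t. cotangent_coord M U \<phi> (q t) j) 0 else 0)"
        using \<alpha> by (intro sum.cong refl) auto
      finally show ?thesis using i by simp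
    qed
    from this[OF x x0 eqy] this[OF z z0] eq eqy pair[OF y(1) eqy] \<alpha> show ?thesis by simp
  qed
  have "(deriv ^^ \<alpha>) (\<lambda>u. cot_chart M U \<phi> (x u) j) 0 = (deriv ^^ \<alpha>) (\<lambda>u. cot_chart M U \<phi> (z u) j) 0"
    if "j < dimension (cotangent M)" "\<alpha> \<le> k" for j \<alpha>
  proof (rule fibre_index[OF M C, of j])
    show "j < 2 * ?n" using that by simp
    assume j: "j < ?n"
    show ?thesis
      unfolding proj_curve(2)[OF M Ec Bc x xU j] proj_curve(2)[OF M Ec Bc z zU j]
      using iffD1[OF velocity_eq_iff_0[OF M C fst_curve[OF x] x0 fst_curve[OF z]] eq] j that(2) by simp
  next
    fix i assume i: "i < ?n" "j = ?n + i"
    show ?thesis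
      unfolding i(2) cot_chart_fibre[OF M C i(1)] using fib[OF i(1), of "k - \<alpha>"] that(2) by simp
  qed
  then show ?thesis
    using velocity_eq_iff_0[OF Ec cotangent_chart[OF C] x xU z] zU by simp
qed

text \<open>A functional that is linear in the derivatives of the fibre coordinates is represented
  by exactly one velocity of covectors. Comparison with the Leibniz sum shows that the coefficient
  of order k - \<beta>, divided by (k choose \<beta>), must be the derivative of order \<beta>;
  \<open>x\<close> is the Taylor polynomial with these derivatives. Both \<open>dual_flip\<close>
  and \<open>P_map\<close> are instances.\<close>

lemma jet_dual:
  assumes b: "curve_at M b 0" "b 0 \<in> U"
    and Q: "\<And>y. curve_at (tangent M) y 0 \<Longrightarrow> velocity M k b 0 = velocity M k (\<lambda>u. base_point (y u)) 0 \<Longrightarrow>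
      Q (velocity (tangent M) k y 0) = (\<Sum>i<dimension M. \<Sum>\<alpha>\<le>k. a i \<alpha> * (deriv ^^ \<alpha>) (\<lambda>t. tangent_coord \<phi> (y t) i) 0)"
  defines "x \<equiv> \<lambda>t. covector M \<phi> (b t) (\<lambda>i. \<Sum>\<beta>\<le>k. a i (k - \<beta>) / real (k choose \<beta>) * taylor_monomial \<beta> t)"
  shows "curve_at (cotangent M) x 0"
    "(THE Y. Y \<in> points (jet_bundle k (cotangent M)) \<and> jet_map M k fst Y = velocity M k b 0 \<and>
      (\<forall>V\<in>points (jet_bundle k (tangent M)). jet_map M k base_point V = velocity M k b 0 \<longrightarrow>
        Q V = jet_pairing M k Y V)) = velocity (cotangent M) k x 0"
    "\<And>y. curve_at (tangent M) y 0 \<Longrightarrow> velocity M k b 0 = velocity M k (\<lambda>u. base_point (y u)) 0 \<Longrightarrow>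
      jet_pairing M k (velocity (cotangent M) k x 0) (velocity (tangent M) k y 0) = Q (velocity (tangent M) k y 0)"
proof -
  let ?n = "dimension M"
  note Ec = smooth_atlas_cotangent[OF M] and Et = smooth_atlas_jet_bundle[OF M, of 1]
  have fx: "fst (x t) = b t" for t by (simp add: x_def)
  show x: "curve_at (cotangent M) x 0"
    unfolding x_def
    by (rule covector_curve[OF M C b])
      (intro smooth1_sum smooth1_mult smooth1_const smooth1_taylor_monomial)
  have px: "(deriv ^^ \<beta>) (\<lambda>t. cotangent_coord M U \<phi> (x t) i) 0 = a i (k - \<beta>) / real (k choose \<beta>)"
    if i: "i < ?n" and "\<beta> \<le> k" for i \<beta>
  proof -
    have "eventually (\<lambda>t. cotangent_coord M U \<phi> (x t) i = (\<Sum>\<beta>\<le>k. a i (k - \<beta>) / real (k choose \<beta>) * taylor_monomial \<beta> t)) (nhds 0)"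
      using curve_at_coords(1)[OF M C b]
      by (rule eventually_mono) (simp add: x_def cotangent_coord_covector[OF M C _ i])
    then have "(deriv ^^ \<beta>) (\<lambda>t. cotangent_coord M U \<phi> (x t) i) 0 =
        (deriv ^^ \<beta>) (\<lambda>t. \<Sum>\<beta>\<le>k. a i (k - \<beta>) / real (k choose \<beta>) * taylor_monomial \<beta> t) 0"
      by (rule higher_deriv_cong)
    then show ?thesis
      unfolding higher_deriv_taylor[OF that(2), of "\<lambda>\<beta>. a i (k - \<beta>) / real (k choose \<beta>)"] .
  qed
  show pair: "jet_pairing M k (velocity (cotangent M) k x 0) (velocity (tangent M) k y 0) = Q (velocity (tangent M) k y 0)"
    if y: "curve_at (tangent M) y 0" "velocity M k b 0 = velocity M k (\<lambda>u. base_point (y u)) 0" for y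
  proof -
    have "jet_pairing M k (velocity (cotangent M) k x 0) (velocity (tangent M) k y 0) =
        (\<Sum>i<?n. \<Sum>\<alpha>\<le>k. a i \<alpha> * (deriv ^^ \<alpha>) (\<lambda>t. tangent_coord \<phi> (y t) i) 0)"
      by (subst jet_pairing_leibniz[OF x y(1)])
        (use b y(2) px in \<open>auto simp: fx binomial_symmetric[symmetric] intro!: sum.cong\<close>)
    then show ?thesis using Q[OF y] by simp
  qed
  show "(THE Y. Y \<in> points (jet_bundle k (cotangent M)) \<and> jet_map M k fst Y = velocity M k b 0 \<and>
      (\<forall>V\<in>points (jet_bundle k (tangent M)). jet_map M k base_point V = velocity M k b 0 \<longrightarrow>
        Q V = jet_pairing M k Y V)) = velocity (cotangent M) k x 0"
  proof (rule the_equality)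
    show "velocity (cotangent M) k x 0 \<in> points (jet_bundle k (cotangent M)) \<and>
        jet_map M k fst (velocity (cotangent M) k x 0) = velocity M k b 0 \<and>
        (\<forall>V\<in>points (jet_bundle k (tangent M)). jet_map M k base_point V = velocity M k b 0 \<longrightarrow>
          Q V = jet_pairing M k (velocity (cotangent M) k x 0) V)"
      using velocity_in_points[OF Ec x] fst_curve_jet[OF x, of k] pair base_point_curve_jet
      unfolding points_jet_bundle[OF Et] fx by auto
  next
    fix Y assume Y: "Y \<in> points (jet_bundle k (cotangent M)) \<and> jet_map M k fst Y = velocity M k b 0 \<and>
      (\<forall>V\<in>points (jet_bundle k (tangent M)). jet_map M k base_point V = velocity M k b 0 \<longrightarrow> Q V = jet_pairing M k Y V)"
    then obtain z where z: "Y = velocity (cotangent M) k z 0" "curve_at (cotangent M) z 0"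
      unfolding points_jet_bundle[OF Ec] by blast
    have eq: "velocity M k (\<lambda>u. fst (x u)) 0 = velocity M k (\<lambda>u. fst (z u)) 0"
      using Y fst_curve_jet[OF z(2), of k] by (simp add: z(1) fx)
    have "velocity (cotangent M) k x 0 = velocity (cotangent M) k z 0"
    proof (rule velocity_eq_of_jet_pairing[OF x z(2) _ eq])
      show "fst (x 0) \<in> U" using b(2) fx by simp
      fix y assume y: "curve_at (tangent M) y 0" "velocity M k (\<lambda>u. fst (x u)) 0 = velocity M k (\<lambda>u. base_point (y u)) 0"
      have "Q (velocity (tangent M) k y 0) = jet_pairing M k Y (velocity (tangent M) k y 0)"
        using Y velocity_in_points[OF Et y(1), of k] base_point_curve_jet[OF y(1), of k] y(2) by (simp add: fx)
      then show "jet_pairing M k (velocity (cotangent M) k x 0) (velocity (tangent M) k y 0) =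
          jet_pairing M k (velocity (cotangent M) k z 0) (velocity (tangent M) k y 0)"
        using pair[OF y(1)] y(2) by (simp add: fx z(1))
    qed
    then show "Y = velocity (cotangent M) k x 0" by (simp add: z(1))
  qed
qed

end

end

section \<open>The differential of a Lagrangian and its image under the dual of the flip\<close>

text \<open>\<open>differential\<close> evaluates on a chosen representative of \<open>w\<close>; by
  the chain rule only its tangent coordinates enter.\<close>

lemma differential_coords:
  assumes N: "smooth_atlas N" and f: "smooth_function N f" and C: "(U, \<phi>) \<in> charts N" "x \<in> U"
    and w: "w \<in> tangent_space N x"
  shows "pairing (differential N f x) w =
    (\<Sum>j<dimension N. partial j (\<lambda>y. f (inv_into U \<phi> y)) (\<phi> x) * tangent_coord \<phi> w j)"
proof -
  obtain c where c: "w = velocity N 1 c 0" "curve_at N c 0" "c 0 = x" using w tangent_space_E[OF N] by metis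
  let ?r = "rep w"
  have r: "curve_at N ?r 0" "?r 0 = x" using rep_velocity(2,3)[OF N c(2), of 1] c(1,3) by auto
  have rU: "?r 0 \<in> U" using r(2) C(2) by simp
  note cr = curve_at_coords[OF N C(1) r(1) rU]
  have sf: "smooth_germ (dimension N) (\<lambda>y. f (inv_into U \<phi> y)) (\<phi> (?r 0))"
    using f C rU smooth_on_Rn_germ[OF chart_open[OF N C(1)]] unfolding smooth_function_def by fastforce
  have "((\<lambda>t. f (inv_into U \<phi> (\<phi> (?r t)))) has_real_derivative
      (\<Sum>j<dimension N. partial j (\<lambda>y. f (inv_into U \<phi> y)) (\<phi> (?r 0)) * tangent_coord \<phi> w j)) (at 0)"
  proof (rule chain_rule[where g = "\<lambda>t. \<phi> (?r t)"])
    fix i assume i: "i < dimension N"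
    show "((\<lambda>t. \<phi> (?r t) i) has_real_derivative tangent_coord \<phi> w i) (at 0)"
      using smooth1_DERIV[OF cr(2)[OF i], of 0] by (simp add: tangent_coord_def)
    show "\<forall>\<^sub>F y in nbhds (dimension N) (\<phi> (?r 0)). (\<lambda>h. f (inv_into U \<phi> (y(i := h)))) differentiable at (y i)"
      using smooth_germ_eventually[OF sf] by (rule eventually_mono) (use i smooth_germ_differentiable in blast)
    show "contat (dimension N) (partial i (\<lambda>y. f (inv_into U \<phi> y))) (\<phi> (?r 0))"
      using smooth_germ_contat[OF smooth_germ_partial[OF sf i]] .
  next
    show "\<forall>\<^sub>F t in nhds 0. \<phi> (?r t) \<in> coord_space (dimension N)"
      by (rule eventually_mono[OF cr(1)]) (rule chart_coord_space[OF N C(1)])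
  qed
  from DERIV_imp_deriv[OF this]
  have "deriv (\<lambda>t. f (inv_into U \<phi> (\<phi> (?r t)))) 0 =
      (\<Sum>j<dimension N. partial j (\<lambda>y. f (inv_into U \<phi> y)) (\<phi> x) * tangent_coord \<phi> w j)"
    using r(2) by simp
  moreover have "deriv (\<lambda>t. f (inv_into U \<phi> (\<phi> (?r t)))) 0 = deriv (\<lambda>t. f (?r t)) 0"
    by (rule deriv_cong_ev[OF eventually_mono[OF cr(1)] refl]) (simp add: chart_inv[OF N C(1)])
  ultimately show ?thesis using w by (simp add: pairing_def differential_def)
qed

lemma sum_jet_index:
  "(\<Sum>j<(k + 1) * n. f j) = (\<Sum>i<n. \<Sum>\<alpha>\<le>k. f (\<alpha> * n + i))" for f :: "nat \<Rightarrow> real"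
proof -
  have "(\<Sum>j<(k + 1) * n. f j) = (\<Sum>\<alpha><k + 1. sum f {\<alpha> * n..<\<alpha> * n + n})"
    by (rule sum.nat_group[symmetric])
  also have "\<dots> = (\<Sum>\<alpha><k + 1. \<Sum>i<n. f (\<alpha> * n + i))"
    by (rule sum.cong[OF refl], subst sum.atLeastLessThan_shift_0) (simp add: atLeast0LessThan)
  also have "\<dots> = (\<Sum>i<n. \<Sum>\<alpha>\<le>k. f (\<alpha> * n + i))"
    by (subst sum.swap) (simp add: lessThan_Suc_atMost)
  finally show ?thesis .
qed

text \<open>The derivative of \<open>L\<close> by the jet coordinate usually written as the
  \<alpha>-th time derivative of the \<open>i\<close>-th position coordinate.\<close>

definition lagrangian_partial ::
  "'a atlas \<Rightarrow> nat \<Rightarrow> ('a jet \<Rightarrow> real) \<Rightarrow> 'a set \<Rightarrow> ('a \<Rightarrow> nat \<Rightarrow> real) \<Rightarrow> nat \<Rightarrow> nat \<Rightarrow> (nat \<Rightarrow> real) \<Rightarrow> real" where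
  "lagrangian_partial M k L U \<phi> i \<alpha> =
    partial (\<alpha> * dimension M + i) (\<lambda>z. L (inv_into (jet_dom M k U) (jet_coord M k \<phi>) z))"

context
  fixes M :: "'a atlas" and U :: "'a set" and \<phi> :: "'a \<Rightarrow> nat \<Rightarrow> real"
  assumes M: "smooth_atlas M" and C: "(U, \<phi>) \<in> charts M"
begin

text \<open>By symmetry of mixed derivatives, the component of index
  \<open>\<alpha> * dimension M + i\<close> of the flipped vector is the \<alpha>-th derivative of
  component \<open>i\<close> of \<open>y\<close>. Pairing with the differential of \<open>L\<close>
  then gives the first variation of \<open>L\<close> in its classical coordinate form, which is what
  \<open>jet_dual\<close> takes as input.\<close>

lemma pairing_differential_flip:
  assumes L: "smooth_function (jet_bundle k M) L" and b: "curve_at M b 0" "b 0 \<in> U"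
    and y: "curve_at (tangent M) y 0" and eq: "velocity M k b 0 = velocity M k (\<lambda>u. base_point (y u)) 0"
  shows "pairing (differential (jet_bundle k M) L (velocity M k b 0)) (flip M k (velocity (tangent M) k y 0)) =
    (\<Sum>i<dimension M. \<Sum>\<alpha>\<le>k. lagrangian_partial M k L U \<phi> i \<alpha> (jet_coord M k \<phi> (velocity M k b 0)) *
      (deriv ^^ \<alpha>) (\<lambda>t. tangent_coord \<phi> (y t) i) 0)"
proof -
  let ?n = "dimension M" and ?v = "velocity M k b 0"
  note Et = smooth_atlas_jet_bundle[OF M, of 1] and J = smooth_atlas_jet_bundle[OF M, of k]
  have vU: "?v \<in> jet_dom M k U" using jet_dom_iff[OF M b(1)] b(2) by blast
  \<comment> \<open>The flip is evaluated on families, so the curve of tangent vectors is first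
    written as the 1-velocities of one.\<close>
  obtain g where g: "smooth_family2 M g" "eventually (\<lambda>s. velocity M 1 (g s) 0 = y s) (nhds 0)"
    by (rule velocity_family_exists[OF M y])
  have V: "velocity (tangent M) k y 0 = velocity2 M k 1 g"
    unfolding velocity2_def by (rule velocity_cong[OF eventually_eq_sym[OF g(2)]])
  have y0: "base_point (y 0) \<in> U"
    using velocity_base_point_eq[OF M C b(1) base_point_curve[OF M y] eq] b(2) by simp
  obtain V' \<psi> where D: "(V', \<psi>) \<in> charts M" "g 0 0 \<in> V'" using smooth_family2_chart[OF M g(1)] by metis
  have bs: "eventually (\<lambda>s. base_point (y s) = g s 0) (nhds 0)"
    using g(2) family2_slices[OF M D(1) g(1) D(2)]
    by eventually_elim (metis base_point_velocity[OF M])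
  have g0: "g 0 0 \<in> U" using eventually_nhds_x_imp_x[OF bs] y0 by simp
  let ?h = "\<lambda>s t. g t s"
  have h: "smooth_family2 M ?h" by (rule smooth_family2_swap[OF M g(1)])
  let ?c = "\<lambda>s. velocity M k (?h s) 0"
  have c: "curve_at (jet_bundle k M) ?c 0" by (rule family2_velocity_curve[OF M h])
  have c0: "?c 0 = ?v" unfolding eq by (rule velocity_cong[OF eventually_eq_sym[OF bs]])
  let ?w = "velocity (jet_bundle k M) 1 ?c 0"
  have fl: "flip M k (velocity (tangent M) k y 0) = ?w"
    using flip_velocity2[OF M g(1), of k] unfolding V by (simp only: velocity2_def)
  have w: "?w \<in> tangent_space (jet_bundle k M) ?v"
    using velocity_in_tangent_space[OF J c] c0 by simp
  have co: "tangent_coord (jet_coord M k \<phi>) ?w (\<alpha> * ?n + i) = (deriv ^^ \<alpha>) (\<lambda>t. tangent_coord \<phi> (y t) i) 0"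
    if i: "i < ?n" and \<alpha>: "\<alpha> \<le> k" for i \<alpha>
  proof -
    let ?F = "\<lambda>x. \<phi> (g (x 0) (x (Suc 0))) i"
    have "tangent_coord (jet_coord M k \<phi>) ?w (\<alpha> * ?n + i) = deriv (\<lambda>s. jet_coord M k \<phi> (?c s) (\<alpha> * ?n + i)) 0"
      by (rule tangent_coord_velocity[OF J jet_chart[OF C] c])
        (use c0 vU jet_index_less[OF \<alpha> i] in auto)
    also have "\<dots> = (deriv ^^ 1) (\<lambda>s. jet_coord M k \<phi> (?c s) (\<alpha> * ?n + i)) 0" by simp
    also have "\<dots> = mixed 1 \<alpha> (\<lambda>x. \<phi> (g (x (Suc 0)) (x 0)) i) origin"
      by (rule family2_jet_coord(2)[OF M C h g0 i \<alpha>])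
    also have "\<dots> = mixed \<alpha> 1 ?F origin"
      by (rule mixed_swap[OF M, where h = "\<lambda>a b. \<phi> (g a b) i", OF smooth_family2_coords(2)[OF M C g(1) g0 i]])
    also have "\<dots> = (deriv ^^ \<alpha>) (\<lambda>s. jet_coord M 1 \<phi> (velocity M 1 (g s) 0) (1 * ?n + i)) 0"
      by (rule family2_jet_coord(2)[OF M C g(1) g0 i, symmetric]) simp
    also have "\<dots> = (deriv ^^ \<alpha>) (\<lambda>t. tangent_coord \<phi> (y t) i) 0"
      by (rule higher_deriv_cong[OF eventually_mono[OF g(2)]])
        (use tangent_chart_fibre[OF M C i] in simp)
    finally show ?thesis .
  qed
  have "pairing (differential (jet_bundle k M) L ?v) ?w =
      (\<Sum>j<(k + 1) * ?n. partial j (\<lambda>z. L (inv_into (jet_dom M k U) (jet_coord M k \<phi>) z)) (jet_coord M k \<phi> ?v) *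
        tangent_coord (jet_coord M k \<phi>) ?w j)"
    using differential_coords[OF J L jet_chart[OF C] vU w] by simp
  also have "\<dots> = (\<Sum>i<?n. \<Sum>\<alpha>\<le>k. lagrangian_partial M k L U \<phi> i \<alpha> (jet_coord M k \<phi> ?v) *
      (deriv ^^ \<alpha>) (\<lambda>t. tangent_coord \<phi> (y t) i) 0)"
    unfolding sum_jet_index lagrangian_partial_def using co by (intro sum.cong refl) auto
  finally show ?thesis unfolding fl .
qed

text \<open>The derivative of order \<beta> of fibre coordinate \<open>i\<close> of
  \<open>Lambda_map\<close>. The binomial coefficient undoes the one in the Leibniz rule, which also
  pairs order \<beta> with order k - \<beta>.\<close>

definition momentum_coeff :: "nat \<Rightarrow> ('a jet \<Rightarrow> real) \<Rightarrow> nat \<Rightarrow> nat \<Rightarrow> (nat \<Rightarrow> real) \<Rightarrow> real" where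
  "momentum_coeff k L i \<beta> z = lagrangian_partial M k L U \<phi> i (k - \<beta>) z / real (k choose \<beta>)"

text \<open>\<open>dual_flip\<close> asks for the velocity that represents the pairing of the
  differential with flipped vectors; \<open>pairing_differential_flip\<close> puts this functional
  into the form treated by \<open>jet_dual\<close>.\<close>

lemma Lambda_map_velocity:
  assumes L: "smooth_function (jet_bundle k M) L" and b: "curve_at M b 0" "b 0 \<in> U"
  defines "x \<equiv> \<lambda>t. covector M \<phi> (b t) (\<lambda>i. \<Sum>\<beta>\<le>k. momentum_coeff k L i \<beta> (jet_coord M k \<phi> (velocity M k b 0)) * taylor_monomial \<beta> t)"
  shows "curve_at (cotangent M) x 0" "Lambda_map M k L (velocity M k b 0) = velocity (cotangent M) k x 0"
    "\<And>y. curve_at (tangent M) y 0 \<Longrightarrow> velocity M k b 0 = velocity M k (\<lambda>u. base_point (y u)) 0 \<Longrightarrow>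
      pairing (differential (jet_bundle k M) L (velocity M k b 0)) (flip M k (velocity (tangent M) k y 0)) =
      jet_pairing M k (velocity (cotangent M) k x 0) (velocity (tangent M) k y 0)"
proof -
  let ?\<Psi> = "differential (jet_bundle k M) L (velocity M k b 0)"
  have fst: "fst ?\<Psi> = velocity M k b 0" by (simp add: differential_def)
  note * = jet_dual[OF M C b, where k = k and Q = "\<lambda>V. pairing ?\<Psi> (flip M k V)"
      and a = "\<lambda>i \<alpha>. lagrangian_partial M k L U \<phi> i \<alpha> (jet_coord M k \<phi> (velocity M k b 0))"]
  note ** = *[folded momentum_coeff_def, folded x_def]
  show "curve_at (cotangent M) x 0"
    by (rule **(1)) (rule pairing_differential_flip[OF L b])
  show "Lambda_map M k L (velocity M k b 0) = velocity (cotangent M) k x 0"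
    unfolding Lambda_map_def o_apply dual_flip_def fst
    by (rule **(2)) (rule pairing_differential_flip[OF L b])
  show "pairing ?\<Psi> (flip M k (velocity (tangent M) k y 0)) =
      jet_pairing M k (velocity (cotangent M) k x 0) (velocity (tangent M) k y 0)"
    if "curve_at (tangent M) y 0" "velocity M k b 0 = velocity M k (\<lambda>u. base_point (y u)) 0" for y
    by (rule **(3)[OF _ that, symmetric]) (rule pairing_differential_flip[OF L b])
qed

end

section \<open>Linear combinations of truncations\<close>

lemma sum_split_at: "j \<le> k \<Longrightarrow> (\<Sum>i<j. s i) + (\<Sum>i=j..<k. s i) = (\<Sum>i<k. s i)" for s :: "nat \<Rightarrow> real"
  by (simp add: lessThan_atLeast0 sum.atLeastLessThan_concat)

context
  fixes M :: "'a atlas" and U :: "'a set" and \<phi> :: "'a \<Rightarrow> nat \<Rightarrow> real"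
  assumes M: "smooth_atlas M" and C: "(U, \<phi>) \<in> charts M"
begin

text \<open>The sum in \<open>itangent_lincomb\<close> acts on functionals; by components it becomes
  a \<open>covector\<close>, for which smoothness and coordinates are known.\<close>

lemma lincomb_eq_covector:
  assumes "\<And>j. j \<le> k \<Longrightarrow> p j \<in> covectors M" "\<And>j. j \<le> k \<Longrightarrow> fst (p j) = x" "x \<in> U"
  shows "(x, \<lambda>v. \<Sum>j\<le>k. a j * snd (p j) v) = covector M \<phi> x (\<lambda>i. \<Sum>j\<le>(k::nat). a j * cotangent_coord M U \<phi> (p j) i)"
proof -
  have "(\<Sum>j\<le>k. a j * snd (p j) v) = snd (covector M \<phi> x (\<lambda>i. \<Sum>j\<le>k. a j * cotangent_coord M U \<phi> (p j) i)) v" for v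
  proof (cases "v \<in> tangent_space M x")
    case True
    have "(\<Sum>j\<le>k. a j * snd (p j) v) = (\<Sum>j\<le>k. \<Sum>i<dimension M. a j * cotangent_coord M U \<phi> (p j) i * tangent_coord \<phi> v i)"
      using covectors_expand[OF M C, of "p _" v] assms True
      by (intro sum.cong refl) (simp add: sum_distrib_left mult.assoc)
    also have "\<dots> = (\<Sum>i<dimension M. (\<Sum>j\<le>k. a j * cotangent_coord M U \<phi> (p j) i) * tangent_coord \<phi> v i)"
      by (subst sum.swap) (simp add: sum_distrib_right)
    finally show ?thesis using True by (simp add: covector_def)
  next
    case False
    then have "snd (p j) v = 0" if "j \<le> k" for j
      using assms(1,2)[OF that] by (auto simp: covectors_def)
    then show ?thesis using False by (simp add: covector_def)
  qed
  then show ?thesis by (simp add: prod_eq_iff fun_eq_iff)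
qed

text \<open>Partial derivatives are linear, so those of the sum are determined by those of the
  summands, and any choice of families over a common base gives the same class.\<close>

lemma itangent_lincomb_covector:
  fixes a :: "nat \<Rightarrow> real"
  assumes y: "\<And>j. j \<le> k \<Longrightarrow> smooth_family k (cotangent M) (y j)"
    and base: "\<And>j. j \<le> k \<Longrightarrow> eventually (\<lambda>s. fst (y j s) = F s) (nbhds k origin)" and F0: "F origin \<in> U"
    and Y: "\<And>j. j \<le> k \<Longrightarrow> Y j = itangent (cotangent M) k (y j)"
  defines "x \<equiv> \<lambda>s. covector M \<phi> (F s) (\<lambda>i. \<Sum>j\<le>k. a j * cotangent_coord M U \<phi> (y j s) i)"
  shows "smooth_family k (cotangent M) x" "itangent_lincomb M k a Y = itangent (cotangent M) k x"
proof -
  let ?n = "dimension M"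
  note Ec = smooth_atlas_cotangent[OF M] and CC = cotangent_chart[OF C] and Bc = bundle_chart_cotangent[OF M C]
  let ?x = "\<lambda>y' F' s. covector M \<phi> (F' s) (\<lambda>i. \<Sum>j\<le>k. a j * cotangent_coord M U \<phi> (y' j s) i)"
  \<comment> \<open>Stated for arbitrary families, since it is applied both to the given ones and,
    for uniqueness, to a competing choice.\<close>
  have fam: "smooth_family k (cotangent M) (?x y' F') \<and> smooth_family k M F' \<and>
      (\<forall>j\<le>k. y' j origin \<in> cot_dom M U) \<and>
      eventually (\<lambda>s. (fst (y' 0 s), \<lambda>v. \<Sum>j\<le>k. a j * snd (y' j s) v) = ?x y' F' s) (nbhds k origin)"
    if y': "\<And>j. j \<le> k \<Longrightarrow> smooth_family k (cotangent M) (y' j)"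
      and b': "\<And>j. j \<le> k \<Longrightarrow> eventually (\<lambda>s. fst (y' j s) = F' s) (nbhds k origin)" and F': "F' origin \<in> U" for y' F'
  proof -
    have y0: "y' j origin \<in> cot_dom M U" if "j \<le> k" for j
      using bundle_dom_iff[OF M Ec Bc] smooth_family_in_points[OF Ec y'[OF that]]
        eventually_nbhds_self[OF b'[OF that] origin_coord_space] F' by simp
    have FF: "smooth_family k M F'"
      by (rule smooth_family_cong[OF M proj_family[OF M Ec Bc y'[of 0] y0[of 0]] b'[of 0]]) auto
    have ev: "eventually (\<lambda>s. \<forall>j\<in>{..k}. y' j s \<in> cot_dom M U \<and> fst (y' j s) = F' s) (nbhds k origin)"
      by (rule eventually_ball_finite)
        (use smooth_family_coords(1)[OF Ec CC y' y0] b' in \<open>auto intro: eventually_conj\<close>)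
    have "smooth_family k (cotangent M) (?x y' F')"
    proof (rule covector_family[OF M C FF F'])
      fix i assume i: "i < ?n"
      have "smooth_germ k (\<lambda>s. cotangent_coord M U \<phi> (y' j s) i) origin" if "j \<le> k" for j
        using smooth_family_coords(2)[OF Ec CC y'[OF that] y0[OF that], of "?n + i"] i cot_chart_fibre[OF M C i] by simp
      then show "smooth_germ k (\<lambda>s. \<Sum>j\<le>k. a j * cotangent_coord M U \<phi> (y' j s) i) origin"
        by (auto intro!: smooth_germ_sum smooth_germ_mult)
    qed
    moreover have "eventually (\<lambda>s. (fst (y' 0 s), \<lambda>v. \<Sum>j\<le>k. a j * snd (y' j s) v) = ?x y' F' s) (nbhds k origin)"
      using ev
    proof eventually_elim
      case (elim s)
      have "fst (y' 0 s) = F' s" "F' s \<in> U" using bspec[OF elim, of 0] by (auto simp: cot_dom_def)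
      then show ?case
        using lincomb_eq_covector[of k "\<lambda>j. y' j s" "F' s" a] elim by (auto simp: cot_dom_def)
    qed
    ultimately show ?thesis using FF y0 by blast
  qed
  note fx = fam[of y F, OF y base F0]
  show sx: "smooth_family k (cotangent M) x" using fx by (simp add: x_def)
  show "itangent_lincomb M k a Y = itangent (cotangent M) k x"
    unfolding itangent_lincomb_def
  proof (rule the_equality)
    have "eventually (\<lambda>s. fst (y j s) = fst (y 0 s)) (nbhds k origin)" if "j \<le> k" for j
      using base[OF that] base[of 0] by (auto elim: eventually_elim2)
    moreover have "itangent (cotangent M) k x = itangent (cotangent M) k (\<lambda>s. (fst (y 0 s), \<lambda>v. \<Sum>j\<le>k. a j * snd (y j s) v))"
      unfolding x_def by (rule itangent_cong[OF eventually_eq_sym]) (use fx in blast)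
    ultimately show "\<exists>y. (\<forall>j\<le>k. y j \<in> Y j \<and> eventually (\<lambda>s. fst (y j s) = fst (y 0 s)) (nbhds k origin)) \<and>
        itangent (cotangent M) k x = itangent (cotangent M) k (\<lambda>s. (fst (y 0 s), \<lambda>v. \<Sum>j\<le>k. a j * snd (y j s) v))"
      using Y itangent_self[OF y] by (intro exI[of _ y]) auto
  next
    fix Z assume "\<exists>y. (\<forall>j\<le>k. y j \<in> Y j \<and> eventually (\<lambda>s. fst (y j s) = fst (y 0 s)) (nbhds k origin)) \<and>
        Z = itangent (cotangent M) k (\<lambda>s. (fst (y 0 s), \<lambda>v. \<Sum>j\<le>k. a j * snd (y j s) v))"
    then obtain y' where y': "\<And>j. j \<le> k \<Longrightarrow> y' j \<in> itangent (cotangent M) k (y j)"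
      and b': "\<And>j. j \<le> k \<Longrightarrow> eventually (\<lambda>s. fst (y' j s) = fst (y' 0 s)) (nbhds k origin)"
      and Z: "Z = itangent (cotangent M) k (\<lambda>s. (fst (y' 0 s), \<lambda>v. \<Sum>j\<le>k. a j * snd (y' j s) v))"
      using Y by auto
    have y's: "smooth_family k (cotangent M) (y' j)" "y' j origin = y j origin" if "j \<le> k" for j
      using y'[OF that] unfolding itangent_iff by auto
    have y00: "fst (y 0 origin) = F origin" using eventually_nbhds_self[OF base[of 0]] by simp
    let ?F = "\<lambda>s. fst (y' 0 s)"
    have F'0: "?F origin \<in> U" using y's(2)[of 0] y00 F0 by simp
    note fx' = fam[of y' ?F, OF y's(1) b' F'0]
    have "Z = itangent (cotangent M) k (?x y' ?F)"
      unfolding Z by (rule itangent_cong) (use fx' in blast)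
    also have "\<dots> = itangent (cotangent M) k x"
    proof -
      have xo: "?x y' ?F origin \<in> cot_dom M U" "x origin \<in> cot_dom M U"
        unfolding x_def using covector_chart(1)[OF M C] F'0 F0 by auto
      have evU: "eventually (\<lambda>s. ?F s \<in> U) (nbhds k origin)" "eventually (\<lambda>s. F s \<in> U) (nbhds k origin)"
        using smooth_family_coords(1)[OF M C, where f = ?F] smooth_family_coords(1)[OF M C, where f = F] fx fx' F'0 F0 by auto
      have dom: "y j origin \<in> cot_dom M U" "y' j origin \<in> cot_dom M U" if "j \<le> k" for j using fx fx' that by auto
      have eqj: "partials is (\<lambda>s. cot_chart M U \<phi> (y' j s) l) origin = partials is (\<lambda>s. cot_chart M U \<phi> (y j s) l) origin"
        if "j \<le> k" "l < 2 * ?n" "distinct is" "set is \<subseteq> {..<k}" for j l "is"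
        using y'[OF that(1)] dom(1)[OF that(1)] CC that(2-4) unfolding itangent_iff by simp
      have "partials is (\<lambda>s. cot_chart M U \<phi> (?x y' ?F s) l) origin = partials is (\<lambda>s. cot_chart M U \<phi> (x s) l) origin"
        if l: "l < 2 * ?n" and "is": "distinct is" "set is \<subseteq> {..<k}" for l "is"
        using l
      proof (cases rule: fibre_index[OF M C, consumes 1])
        case 1
        have "partials is (\<lambda>s. cot_chart M U \<phi> (?x y' ?F s) l) origin = partials is (\<lambda>s. cot_chart M U \<phi> (y' 0 s) l) origin"
          by (rule partials_cong[OF eventually_mono[OF evU(1)] "is"(2) origin_coord_space])
            (simp add: covector_chart(2)[OF M C _ 1], simp add: cot_chart_def 1)
        also have "\<dots> = partials is (\<lambda>s. cot_chart M U \<phi> (y 0 s) l) origin" by (rule eqj[OF _ l "is"]) simp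
        also have "\<dots> = partials is (\<lambda>s. cot_chart M U \<phi> (x s) l) origin"
          by (rule partials_cong[OF eventually_mono[OF eventually_conj[OF evU(2) base[of 0]]] "is"(2) origin_coord_space])
            (simp_all add: x_def covector_chart(2)[OF M C _ 1], simp add: cot_chart_def 1)
        finally show ?thesis .
      next
        case (2 i)
        have s: "smooth_germ k (\<lambda>s. cotangent_coord M U \<phi> (q s) i) origin"
          if "smooth_family k (cotangent M) q" "q origin \<in> cot_dom M U" for q
          using smooth_family_coords(2)[OF Ec CC that, of "?n + i"] 2(1) cot_chart_fibre[OF M C 2(1)] by simp
        have lin: "partials is (\<lambda>s. \<Sum>j\<le>k. a j * cotangent_coord M U \<phi> (q j s) i) origin =
            (\<Sum>j\<le>k. a j * partials is (\<lambda>s. cotangent_coord M U \<phi> (q j s) i) origin)"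
          if q: "\<And>j. j \<le> k \<Longrightarrow> smooth_family k (cotangent M) (q j)" "\<And>j. j \<le> k \<Longrightarrow> q j origin \<in> cot_dom M U" for q
        proof -
          have "partials is (\<lambda>s. \<Sum>j\<in>{..k}. a j * cotangent_coord M U \<phi> (q j s) i) origin =
              (\<Sum>j\<in>{..k}. partials is (\<lambda>s. a j * cotangent_coord M U \<phi> (q j s) i) origin)"
            by (rule partials_sum[OF _ "is"(2)]) (use s q in \<open>auto intro!: smooth_germ_mult\<close>)
          also have "\<dots> = (\<Sum>j\<in>{..k}. a j * partials is (\<lambda>s. cotangent_coord M U \<phi> (q j s) i) origin)"
            by (intro sum.cong refl partials_scale[OF s[OF q] "is"(2)]) auto
          finally show ?thesis .
        qed
        have "partials is (\<lambda>s. cot_chart M U \<phi> (?x y' ?F s) l) origin =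
            partials is (\<lambda>s. \<Sum>j\<le>k. a j * cotangent_coord M U \<phi> (y' j s) i) origin"
          unfolding 2(2)
          by (rule partials_cong[OF eventually_mono[OF evU(1)] "is"(2) origin_coord_space])
            (simp add: covector_chart(3)[OF M C _ 2(1)])
        also have "\<dots> = (\<Sum>j\<le>k. a j * partials is (\<lambda>s. cotangent_coord M U \<phi> (y' j s) i) origin)"
          by (rule lin[OF y's(1) dom(2)])
        also have "\<dots> = (\<Sum>j\<le>k. a j * partials is (\<lambda>s. cotangent_coord M U \<phi> (y j s) i) origin)"
          using eqj[OF _ l "is"] unfolding 2(2) cot_chart_fibre[OF M C 2(1)] by simp
        also have "\<dots> = partials is (\<lambda>s. \<Sum>j\<le>k. a j * cotangent_coord M U \<phi> (y j s) i) origin"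
          by (rule lin[OF y dom(1), symmetric])
        also have "\<dots> = partials is (\<lambda>s. cot_chart M U \<phi> (x s) l) origin"
          unfolding 2(2) x_def
          by (rule partials_cong[OF eventually_mono[OF evU(2)] "is"(2) origin_coord_space])
            (simp add: covector_chart(3)[OF M C _ 2(1)])
        finally show ?thesis .
      qed
      then show ?thesis
        using itangent_eq_iff[where f = "?x y' ?F" and g = x, OF Ec CC _ xo(1) sx] fx' xo(2) by simp
    qed
    finally show "Z = itangent (cotangent M) k x" .
  qed
qed

end

section \<open>Force and momentum\<close>

lemma proj_itangent:
  assumes N: "smooth_atlas N" and E: "smooth_atlas E" and B: "bundle_chart N E pr U \<phi> U' \<phi>'"
    and x: "smooth_family k E x" "x origin \<in> U'" and f: "f \<in> itangent E k x"
  shows "itangent N k (\<lambda>s. pr (f s)) = itangent N k (\<lambda>s. pr (x s))"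
proof -
  have fs: "smooth_family k E f" "f origin \<in> U'" using f x(2) unfolding itangent_iff by auto
  note pf = proj_family[OF N E B fs] and px = proj_family[OF N E B x] and C = bundle_charts[OF N E B]
  have "partials is (\<lambda>s. \<phi> (pr (f s)) i) origin = partials is (\<lambda>s. \<phi> (pr (x s)) i) origin"
    if i: "i < dimension N" and "is": "distinct is" "set is \<subseteq> {..<k}" for i "is"
  proof -
    have *: "partials is (\<lambda>s. \<phi>' (q s) i) origin = partials is (\<lambda>s. \<phi> (pr (q s)) i) origin"
      if "smooth_family k E q" "q origin \<in> U'" for q
      by (rule partials_cong[OF eventually_mono[OF smooth_family_coords(1)[OF E C(2) that]] "is"(2) origin_coord_space])
        (rule bundle_base_coord[OF N E B _ i])
    have "partials is (\<lambda>s. \<phi>' (f s) i) origin = partials is (\<lambda>s. \<phi>' (x s) i) origin"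
      using f C(2,3) x(2) i "is" unfolding itangent_iff by auto
    then show ?thesis using *[OF fs] *[OF x] by simp
  qed
  then show ?thesis
    using itangent_eq_iff[where f = "\<lambda>s. pr (f s)" and g = "\<lambda>s. pr (x s)", OF N C(1) pf _ px]
      fs(2) x(2) bundle_dom_iff[OF N E B] by auto
qed

section \<open>Sums of truncations of a semi-holonomic element represented by a family over
  \<open>c (s + t)\<close>\<close>

context
  fixes M :: "'a atlas" and U :: "'a set" and \<phi> :: "'a \<Rightarrow> nat \<Rightarrow> real"
    and g :: "real \<Rightarrow> real \<Rightarrow> 'a cov" and c :: "real \<Rightarrow> 'a" and k :: nat
  assumes M: "smooth_atlas M" and C: "(U, \<phi>) \<in> charts M"
    and g: "smooth_family2 (cotangent M) g"
    and gc: "eventually (\<lambda>x. fst (g (x 0) (x (Suc 0))) = c (x 0 + x (Suc 0))) (nbhds 2 origin)"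
    and c: "curve_at M c 0" "c 0 \<in> U"
begin

abbreviation (input) "pairing_function y \<equiv>
  (\<lambda>z. \<Sum>i<dimension M. cotangent_coord M U \<phi> (g (z 0) (z (Suc 0))) i * tangent_coord \<phi> (y (z 0 + z (Suc 0))) i)"

text \<open>In truncation \<open>j\<close> the first \<open>j\<close> parameters are summed into
  \<open>s\<close> and the others into \<open>t\<close>. All truncations then lie over
  \<open>c\<close> at the sum of all parameters, so their fibre coordinates can be added; this is
  where semi-holonomy enters.\<close>

definition lincomb_family :: "(nat \<Rightarrow> real) \<Rightarrow> (nat \<Rightarrow> real) \<Rightarrow> 'a cov" where
  "lincomb_family a s = covector M \<phi> (c (\<Sum>i<k. s i))
     (\<lambda>i. \<Sum>j\<le>k. a j * cotangent_coord M U \<phi> (g (\<Sum>l<j. s l) (\<Sum>l=j..<k. s l)) i)"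

lemma truncations_lincomb_family:
  "smooth_family k (cotangent M) (lincomb_family a)"
  "truncations_lincomb M k a (velocity2 (cotangent M) k k g) = itangent (cotangent M) k (lincomb_family a)"
proof -
  note Ec = smooth_atlas_cotangent[OF M]
  let ?y = "\<lambda>j s. g (\<Sum>l<j. s l) (\<Sum>l=j..<k. s l)"
  have 1: "smooth_family k (cotangent M) (?y j)" if "j \<le> k" for j
    using two_sums_family[OF Ec g, of j "k - j"] that by simp
  have 2: "eventually (\<lambda>s. fst (?y j s) = c (\<Sum>i<k. s i)) (nbhds k origin)" if "j \<le> k" for j
    using eventually_compose_filterlim[OF gc filterlim_two_sums(1)[of j "k - j"]] that
    by (simp add: sum_split_at)
  have 3: "incl2 (cotangent M) j (k - j) (truncation (cotangent M) k j (k - j) (velocity2 (cotangent M) k k g)) =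
      itangent (cotangent M) k (?y j)" if "j \<le> k" for j
    using incl2_velocity2[OF Ec g, of j "k - j"] truncation_velocity2[OF Ec g that, of "k - j"] that by simp
  note * = itangent_lincomb_covector[OF M C, where k = k and y = ?y and F = "\<lambda>s. c (\<Sum>i<k. s i)"
      and Y = "\<lambda>j. incl2 (cotangent M) j (k - j) (truncation (cotangent M) k j (k - j) (velocity2 (cotangent M) k k g))"
      and a = a, OF 1 2 _ 3, folded lincomb_family_def]
  show "smooth_family k (cotangent M) (lincomb_family a)"
    "truncations_lincomb M k a (velocity2 (cotangent M) k k g) = itangent (cotangent M) k (lincomb_family a)"
    unfolding truncations_lincomb_def using * c(2) by (simp_all add: lincomb_family_def[abs_def])
qed

lemma fst_lincomb_family: "fst (lincomb_family a s) = c (\<Sum>i<k. s i)"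
  by (simp add: lincomb_family_def)

lemma smooth_germ_cotangent_coord:
  assumes "i < dimension M" shows "smooth_germ 2 (\<lambda>z. cotangent_coord M U \<phi> (g (z 0) (z (Suc 0))) i) origin"
proof -
  note Ec = smooth_atlas_cotangent[OF M]
  have "fst (g 0 0) = c 0" using eventually_nbhds_self[OF gc origin_coord_space] by simp
  then have "g 0 0 \<in> cot_dom M U"
    using smooth_family_in_points[OF Ec g] c(2) points_cotangent[OF M] by (simp add: cot_dom_def)
  then show ?thesis
    using smooth_family2_coords(2)[OF Ec cotangent_chart[OF C] g, of "dimension M + i"] assms
      cot_chart_fibre[OF M C assms] by simp
qed

lemma same_base:
  assumes y: "curve_at (tangent M) y 0" "velocity M k c 0 = velocity M k (\<lambda>u. base_point (y u)) 0"
  shows "base_point (y 0) = c 0"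
  using velocity_base_point_eq[OF M C c(1) base_point_curve[OF M y(1)] y(2)] by simp

lemma smooth_germ_translate:
  assumes "smooth1 w 0" shows "smooth_germ 2 (\<lambda>z. w (z 0 + z (Suc 0))) origin"
  by (rule smooth_germ_comp1[where G = "\<lambda>z. z 0 + z (Suc 0)"])
    (use assms in \<open>auto intro!: smooth_germ_add smooth_germ_coord\<close>)

lemma smooth_germ_pairing_function:
  assumes y: "curve_at (tangent M) y 0" "velocity M k c 0 = velocity M k (\<lambda>u. base_point (y u)) 0"
  shows "smooth_germ 2 (pairing_function y) origin"
  using smooth_germ_cotangent_coord smooth_germ_translate[OF smooth1_tangent_coord[OF M C y(1)]] same_base[OF y] c(2)
  by (auto intro!: smooth_germ_sum smooth_germ_mult)

text \<open>The fibre coordinates of \<open>y\<close> at the sum of all parameters are also a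
  function of the two partial sums. For truncation \<open>j\<close>, one derivative in each
  parameter therefore amounts to \<open>j\<close> derivatives in the first argument and
  \<open>k - j\<close> in the second.\<close>

lemma itangent_pairing_lincomb:
  assumes y: "curve_at (tangent M) y 0" "velocity M k c 0 = velocity M k (\<lambda>u. base_point (y u)) 0"
  shows "itangent_pairing k (truncations_lincomb M k a (velocity2 (cotangent M) k k g)) (incl (tangent M) k (velocity (tangent M) k y 0)) =
    (\<Sum>j\<le>k. a j * mixed j (k - j) (pairing_function y) origin)"
proof -
  let ?n = "dimension M" and ?H = "pairing_function y"
  let ?h = "\<lambda>j s. ?H (point2 (\<Sum>l<j. s l) (\<Sum>l=j..<k. s l))"
  note Et = smooth_atlas_jet_bundle[OF M, of 1]
  have set_upt: "set [0..<k] \<subseteq> {..<k}" by auto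
  have "itangent M k (\<lambda>s. fst (lincomb_family a s)) = itangent M k (\<lambda>s. base_point (y (\<Sum>i<k. s i)))"
    using incl_velocity_0[OF M c(1), of k] incl_velocity_0[OF M base_point_curve[OF M y(1)], of k] y(2)
    by (simp add: fst_lincomb_family)
  then have "itangent_pairing k (truncations_lincomb M k a (velocity2 (cotangent M) k k g)) (incl (tangent M) k (velocity (tangent M) k y 0)) =
      partials [0..<k] (\<lambda>s. \<Sum>i<?n. cotangent_coord M U \<phi> (lincomb_family a s) i * tangent_coord \<phi> (y (\<Sum>i<k. s i)) i) origin"
    unfolding truncations_lincomb_family(2) incl_velocity_0[OF Et y(1)]
    by (intro itangent_pairing_coords[OF M C])
      (use truncations_lincomb_family(1) curve_sum_family[OF Et y(1)] c(2) in \<open>auto simp: fst_lincomb_family\<close>)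
  also have "\<dots> = partials [0..<k] (\<lambda>s. \<Sum>j\<le>k. a j * ?h j s) origin"
  proof (rule partials_cong[OF _ set_upt origin_coord_space])
    have "smooth_family k M (\<lambda>s. c (\<Sum>i<k. s i))" by (rule curve_sum_family[OF M c(1)])
    then have "eventually (\<lambda>s. c (\<Sum>i<k. s i) \<in> U) (nbhds k origin)"
      using smooth_family_coords(1)[OF M C, where f = "\<lambda>s. c (\<Sum>i<k. s i)"] c(2) by simp
    then show "eventually (\<lambda>s. (\<Sum>i<?n. cotangent_coord M U \<phi> (lincomb_family a s) i * tangent_coord \<phi> (y (\<Sum>i<k. s i)) i) =
        (\<Sum>j\<le>k. a j * ?h j s)) (nbhds k origin)"
    proof (rule eventually_mono)
      fix s :: "nat \<Rightarrow> real" assume cU: "c (\<Sum>i<k. s i) \<in> U"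
      have "(\<Sum>i<?n. cotangent_coord M U \<phi> (lincomb_family a s) i * tangent_coord \<phi> (y (\<Sum>i<k. s i)) i) =
          (\<Sum>i<?n. \<Sum>j\<le>k. a j * (cotangent_coord M U \<phi> (g (\<Sum>l<j. s l) (\<Sum>l=j..<k. s l)) i * tangent_coord \<phi> (y (\<Sum>i<k. s i)) i))"
        unfolding lincomb_family_def
        by (intro sum.cong refl) (simp add: cotangent_coord_covector[OF M C cU] sum_distrib_right mult.assoc)
      also have "\<dots> = (\<Sum>j\<le>k. a j * ?h j s)"
        by (subst sum.swap) (simp add: sum_distrib_left sum_split_at)
      finally show "(\<Sum>i<?n. cotangent_coord M U \<phi> (lincomb_family a s) i * tangent_coord \<phi> (y (\<Sum>i<k. s i)) i) =
          (\<Sum>j\<le>k. a j * ?h j s)" .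
    qed
  qed
  also have "\<dots> = (\<Sum>j\<le>k. a j * mixed j (k - j) ?H origin)"
  proof -
    have s: "smooth_germ k (?h j) origin" if "j \<le> k" for j
    proof -
      have "smooth_germ (j + (k - j)) (\<lambda>s. ?H (point2 (\<Sum>l<j. s l) (\<Sum>l=j..<j + (k - j). s l))) origin"
      proof (rule smooth_germ_comp[where n = 2 and f = ?H and G = "\<lambda>s. point2 (\<Sum>l<j. s l) (\<Sum>l=j..<j + (k - j). s l)"])
        show "smooth_germ 2 ?H (point2 (\<Sum>l<j. origin l) (\<Sum>l=j..<j + (k - j). origin l))"
          using smooth_germ_pairing_function[OF y] by simp
      qed (use filterlim_two_sums(2) in auto)
      then show ?thesis using that by simp
    qed
    have m: "partials [0..<k] (?h j) origin = mixed j (k - j) ?H origin" if "j \<le> k" for j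
      using partials_two_sums_upt[of j "k - j" ?H] that by simp
    have "partials [0..<k] (\<lambda>s. \<Sum>j\<in>{..k}. a j * ?h j s) origin = (\<Sum>j\<in>{..k}. partials [0..<k] (\<lambda>s. a j * ?h j s) origin)"
      by (rule partials_sum[OF _ set_upt]) (use s in \<open>auto intro!: smooth_germ_mult\<close>)
    also have "\<dots> = (\<Sum>j\<in>{..k}. a j * partials [0..<k] (?h j) origin)"
      by (intro sum.cong refl partials_scale[OF s set_upt]) simp
    finally show ?thesis using m by simp
  qed
  finally show ?thesis .
qed

lemma lincomb_base:
  shows "fst (rep (itangent (cotangent M) k (lincomb_family a)) origin) = c 0"
    "itangent_map M k fst (itangent (cotangent M) k (lincomb_family a)) = incl M k (velocity M k c 0)"
proof -
  note Ec = smooth_atlas_cotangent[OF M] and Bc = bundle_chart_cotangent[OF M C]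
  let ?S = "itangent (cotangent M) k (lincomb_family a)"
  note x = truncations_lincomb_family(1)[of a]
  have r: "rep ?S \<in> ?S" by (rule rep_itangent[OF x])
  then show "fst (rep ?S origin) = c 0" unfolding itangent_iff by (simp add: fst_lincomb_family)
  have "lincomb_family a origin \<in> cot_dom M U"
    using bundle_dom_iff[OF M Ec Bc] smooth_family_in_points[OF Ec x] c(2) by (simp add: fst_lincomb_family)
  from proj_itangent[OF M Ec Bc x this r]
  show "itangent_map M k fst ?S = incl M k (velocity M k c 0)"
    unfolding itangent_map_def o_def incl_velocity_0[OF M c(1)] fst_lincomb_family .
qed

text \<open>The definitions of \<open>Upsilon\<close> and \<open>P_map\<close> compare base points
  in the iterated tangent bundle; injectivity of the inclusion turns this into a comparison of
  velocities.\<close>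

lemma incl_velocity_eq_iff:
  "curve_at M b 0 \<Longrightarrow> incl M k (velocity M k b 0) = incl M k (velocity M k c 0) \<longleftrightarrow> velocity M k b 0 = velocity M k c 0"
  by (metis incl_inj[OF M _ c(1)] incl_velocity_0[OF M] c(1))

text \<open>By \<open>partials_mult_translate\<close> the pairing with the sum of truncations is
  linear in the derivatives of order at most \<open>k\<close> of the fibre coordinates of
  \<open>y\<close>, with coefficients independent of \<open>y\<close>. Such a functional is
  represented through \<open>jet_dual\<close>, and the representing velocity is the value of
  \<open>P_map\<close>.\<close>

lemma P_map_pairing:
  assumes y: "curve_at (tangent M) y 0" "velocity M k c 0 = velocity M k (\<lambda>u. base_point (y u)) 0"
  shows "jet_pairing M k (P_map M k (truncations_lincomb M k a (velocity2 (cotangent M) k k g))) (velocity (tangent M) k y 0) =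
    (\<Sum>j\<le>k. a j * mixed j (k - j) (pairing_function y) origin)"
proof -
  let ?n = "dimension M" and ?S = "truncations_lincomb M k a (velocity2 (cotangent M) k k g)"
  note Ec = smooth_atlas_cotangent[OF M] and Et = smooth_atlas_jet_bundle[OF M, of 1]
  define p where "p i = (\<lambda>z::nat \<Rightarrow> real. cotangent_coord M U \<phi> (g (z 0) (z (Suc 0))) i)" for i
  have sp: "smooth_germ 2 (p i) origin" if "i < ?n" for i
    unfolding p_def by (rule smooth_germ_cotangent_coord[OF that])
  \<comment> \<open>Naming the relation lets the coefficients be chosen for all \<open>i\<close> and
    \<open>j\<close> at once, before any \<open>w\<close> is given.\<close>
  define R where "R i j d \<longleftrightarrow> (\<forall>w. smooth1 w 0 \<longrightarrow> mixed j (k - j) (\<lambda>z. p i z * w (z 0 + z (Suc 0))) origin =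
      (\<Sum>\<alpha>\<le>k. d \<alpha> * (deriv ^^ \<alpha>) w 0))" for i j d
  have "\<exists>d. R i j d" if i: "i < ?n" and j: "j \<le> k" for i j
  proof -
    obtain d where d: "\<And>w. smooth1 w (origin 0 + origin (Suc 0)) \<Longrightarrow>
        eventually (\<lambda>x. mixed j (k - j) (\<lambda>z. p i z * w (z 0 + z (Suc 0))) x =
          (\<Sum>\<alpha>\<le>length (replicate j 0 @ replicate (k - j) (Suc 0)). d \<alpha> x * (deriv ^^ \<alpha>) w (x 0 + x (Suc 0)))) (nbhds 2 origin)"
      using partials_mult_translate[OF sp[OF i] set_mixed[of j "k - j"]] by blast
    have "mixed j (k - j) (\<lambda>z. p i z * w (z 0 + z (Suc 0))) origin = (\<Sum>\<alpha>\<le>k. d \<alpha> origin * (deriv ^^ \<alpha>) w 0)"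
      if "smooth1 w 0" for w
      using eventually_nbhds_self[OF d[of w] origin_coord_space] that j by (simp del: foldr_append)
    then have "R i j (\<lambda>\<alpha>. d \<alpha> origin)" unfolding R_def by blast
    then show ?thesis by (rule exI[of "R i j"])
  qed
  then have "\<forall>i j. \<exists>d. i < ?n \<longrightarrow> j \<le> k \<longrightarrow> R i j d" by blast
  then obtain d where "\<And>i j. i < ?n \<Longrightarrow> j \<le> k \<Longrightarrow> R i j (d i j)" by metis
  then have d: "\<And>i j w. i < ?n \<Longrightarrow> j \<le> k \<Longrightarrow> smooth1 w 0 \<Longrightarrow>
      mixed j (k - j) (\<lambda>z. p i z * w (z 0 + z (Suc 0))) origin = (\<Sum>\<alpha>\<le>k. d i j \<alpha> * (deriv ^^ \<alpha>) w 0)"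
    unfolding R_def by blast
  have Q: "itangent_pairing k ?S (incl (tangent M) k (velocity (tangent M) k y 0)) =
      (\<Sum>i<?n. \<Sum>\<alpha>\<le>k. (\<Sum>j\<le>k. a j * d i j \<alpha>) * (deriv ^^ \<alpha>) (\<lambda>t. tangent_coord \<phi> (y t) i) 0)"
    if y: "curve_at (tangent M) y 0" "velocity M k c 0 = velocity M k (\<lambda>u. base_point (y u)) 0" for y
  proof -
    have w: "smooth1 (\<lambda>t. tangent_coord \<phi> (y t) i) 0" if "i < ?n" for i
      using smooth1_tangent_coord[OF M C y(1)] same_base[OF y] c(2) that by simp
    have "mixed j (k - j) (pairing_function y) origin =
        (\<Sum>i<?n. \<Sum>\<alpha>\<le>k. d i j \<alpha> * (deriv ^^ \<alpha>) (\<lambda>t. tangent_coord \<phi> (y t) i) 0)" if j: "j \<le> k" for j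
    proof -
      have "mixed j (k - j) (pairing_function y) origin =
          (\<Sum>i\<in>{..<?n}. mixed j (k - j) (\<lambda>z. p i z * tangent_coord \<phi> (y (z 0 + z (Suc 0))) i) origin)"
        unfolding p_def
        by (rule partials_sum[OF _ set_mixed])
          (use smooth_germ_cotangent_coord smooth_germ_translate[OF w] in \<open>auto intro!: smooth_germ_mult\<close>)
      then show ?thesis using d[OF _ j w] by simp
    qed
    then have "itangent_pairing k ?S (incl (tangent M) k (velocity (tangent M) k y 0)) =
        (\<Sum>j\<le>k. \<Sum>i<?n. \<Sum>\<alpha>\<le>k. a j * d i j \<alpha> * (deriv ^^ \<alpha>) (\<lambda>t. tangent_coord \<phi> (y t) i) 0)"
      unfolding itangent_pairing_lincomb[OF y] by (simp add: sum_distrib_left mult.assoc)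
    also have "\<dots> = (\<Sum>i<?n. \<Sum>\<alpha>\<le>k. \<Sum>j\<le>k. a j * d i j \<alpha> * (deriv ^^ \<alpha>) (\<lambda>t. tangent_coord \<phi> (y t) i) 0)"
      by (subst sum.swap, rule sum.cong[OF refl], rule sum.swap)
    finally show ?thesis by (simp add: sum_distrib_right)
  qed
  note dual = jet_dual[OF M C c, where k = k and Q = "\<lambda>V. itangent_pairing k ?S (incl (tangent M) k V)"
      and a = "\<lambda>i \<alpha>. \<Sum>j\<le>k. a j * d i j \<alpha>"]
  have S: "itangent_map M k fst ?S = incl M k (velocity M k c 0)"
    unfolding truncations_lincomb_family(2) by (rule lincomb_base(2))
  have "(Y \<in> points (jet_bundle k (cotangent M)) \<and> incl M k (jet_map M k fst Y) = itangent_map M k fst ?S \<and>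
        (\<forall>\<Psi>\<in>points (jet_bundle k (tangent M)). incl M k (jet_map M k base_point \<Psi>) = itangent_map M k fst ?S \<longrightarrow>
           jet_pairing M k Y \<Psi> = itangent_pairing k ?S (incl (tangent M) k \<Psi>))) \<longleftrightarrow>
     (Y \<in> points (jet_bundle k (cotangent M)) \<and> jet_map M k fst Y = velocity M k c 0 \<and>
      (\<forall>V\<in>points (jet_bundle k (tangent M)). jet_map M k base_point V = velocity M k c 0 \<longrightarrow>
        itangent_pairing k ?S (incl (tangent M) k V) = jet_pairing M k Y V))" for Y
  proof -
    have 1: "incl M k (jet_map M k fst Y) = incl M k (velocity M k c 0) \<longleftrightarrow> jet_map M k fst Y = velocity M k c 0"
      if "Y \<in> points (jet_bundle k (cotangent M))"
      using that fst_curve_jet[OF M] incl_velocity_eq_iff[OF fst_curve[OF M]] unfolding points_jet_bundle[OF Ec] by auto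
    have 2: "incl M k (jet_map M k base_point V) = incl M k (velocity M k c 0) \<longleftrightarrow> jet_map M k base_point V = velocity M k c 0"
      if "V \<in> points (jet_bundle k (tangent M))" for V
      using that base_point_curve_jet[OF M] incl_velocity_eq_iff[OF base_point_curve[OF M]] unfolding points_jet_bundle[OF Et] by auto
    show ?thesis unfolding S using 1 2 by (auto simp: eq_commute)
  qed
  note eqv = this
  have "P_map M k ?S = (THE Y. Y \<in> points (jet_bundle k (cotangent M)) \<and> jet_map M k fst Y = velocity M k c 0 \<and>
      (\<forall>V\<in>points (jet_bundle k (tangent M)). jet_map M k base_point V = velocity M k c 0 \<longrightarrow>
        itangent_pairing k ?S (incl (tangent M) k V) = jet_pairing M k Y V))"
    unfolding P_map_def by (rule arg_cong[where f = The]) (rule ext, rule eqv)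
  moreover define x where "x = (\<lambda>t. covector M \<phi> (c t)
    (\<lambda>i. \<Sum>\<beta>\<le>k. (\<Sum>j\<le>k. a j * d i j (k - \<beta>)) / real (k choose \<beta>) * taylor_monomial \<beta> t))"
  have "(THE Y. Y \<in> points (jet_bundle k (cotangent M)) \<and> jet_map M k fst Y = velocity M k c 0 \<and>
      (\<forall>V\<in>points (jet_bundle k (tangent M)). jet_map M k base_point V = velocity M k c 0 \<longrightarrow>
        itangent_pairing k ?S (incl (tangent M) k V) = jet_pairing M k Y V)) = velocity (cotangent M) k x 0"
    unfolding x_def by (rule dual(2)) (rule Q)
  moreover have "jet_pairing M k (velocity (cotangent M) k x 0) (velocity (tangent M) k y 0) =
      itangent_pairing k ?S (incl (tangent M) k (velocity (tangent M) k y 0))"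
    unfolding x_def by (rule dual(3)[OF _ y]) (rule Q)
  ultimately show ?thesis
    unfolding itangent_pairing_lincomb[OF y] by (simp only:)
qed

text \<open>The alternating sum is the \<open>k\<close>-th derivative along (-r, r). There the
  argument of \<open>y\<close> is constantly 0, so the components of \<open>y 0\<close> leave the
  derivative as constant factors and nothing else of \<open>y\<close> contributes.\<close>

lemma alternating_pairing:
  assumes y: "curve_at (tangent M) y 0" "velocity M k c 0 = velocity M k (\<lambda>u. base_point (y u)) 0"
  shows "(\<Sum>j\<le>k. (- 1) ^ j * real (k choose j) * mixed j (k - j) (pairing_function y) origin) =
    (\<Sum>i<dimension M. (\<Sum>j\<le>k. (- 1) ^ j * real (k choose j) *
      mixed j (k - j) (\<lambda>z. cotangent_coord M U \<phi> (g (z 0) (z (Suc 0))) i) origin) * tangent_coord \<phi> (y 0) i)"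
proof -
  let ?n = "dimension M" and ?p = "\<lambda>i z. cotangent_coord M U \<phi> (g (z 0) (z (Suc 0))) i"
  have anti: "(\<Sum>j\<le>k. (- 1) ^ j * real (k choose j) * mixed j (k - j) F origin) = (deriv ^^ k) (\<lambda>r. F (point2 (- r) r)) 0"
    if "smooth_germ 2 F origin" for F
    using higher_deriv_antidiagonal[of F 0 0 k] that by simp
  have s: "smooth1 (\<lambda>r. ?p i (point2 (- r) r)) 0" if "i < ?n" for i
  proof (rule smooth1_comp[where G = "\<lambda>r. point2 (- r) r" and n = 2])
    show "smooth_germ 2 (?p i) (point2 (- 0) 0)" using smooth_germ_cotangent_coord[OF that] by simp
    have "smooth1 (\<lambda>r. - 1 * r) 0" by (rule smooth1_mult[OF smooth1_const smooth1_ident])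
    then show "smooth1 (\<lambda>u. point2 (- u) u j) 0" for j
      unfolding point2_def by (cases "j = 0"; cases "j = 1") (simp_all add: smooth1_ident smooth1_const)
  qed simp
  have "(deriv ^^ k) (\<lambda>r. pairing_function y (point2 (- r) r)) 0 =
      (deriv ^^ k) (\<lambda>r. \<Sum>i<?n. tangent_coord \<phi> (y 0) i * ?p i (point2 (- r) r)) 0"
    by (simp add: mult.commute)
  also have "\<dots> = (\<Sum>i<?n. tangent_coord \<phi> (y 0) i * (deriv ^^ k) (\<lambda>r. ?p i (point2 (- r) r)) 0)"
    by (subst higher_deriv_sum) (use s in \<open>auto intro!: smooth1_mult smooth1_const sum.cong higher_deriv_scale\<close>)
  also have "\<dots> = (\<Sum>i<?n. (\<Sum>j\<le>k. (- 1) ^ j * real (k choose j) * mixed j (k - j) (?p i) origin) * tangent_coord \<phi> (y 0) i)"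
  proof (rule sum.cong[OF refl])
    fix i assume "i \<in> {..<?n}"
    then show "tangent_coord \<phi> (y 0) i * (deriv ^^ k) (\<lambda>r. ?p i (point2 (- r) r)) 0 =
        (\<Sum>j\<le>k. (- 1) ^ j * real (k choose j) * mixed j (k - j) (?p i) origin) * tangent_coord \<phi> (y 0) i"
      by (subst anti[OF smooth_germ_cotangent_coord]) (simp_all add: mult.commute)
  qed
  finally show ?thesis
    unfolding anti[OF smooth_germ_pairing_function[OF y]] .
qed

text \<open>Ensures that every tangent vector is tested by some velocity over the right base,
  without which the condition in \<open>Upsilon\<close> would not determine a covector. Constant
  components in the chart suffice.\<close>

lemma constant_vector_curve:
  assumes \<xi>: "\<xi> \<in> tangent_space M (c 0)"
  obtains y where "curve_at (tangent M) y 0" "velocity M k c 0 = velocity M k (\<lambda>u. base_point (y u)) 0" "y 0 = \<xi>"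
proof -
  obtain y where y: "curve_at (tangent M) y 0"
    "eventually (\<lambda>t. base_point (y t) = c t \<and> (\<forall>i<dimension M. tangent_coord \<phi> (y t) i = tangent_coord \<phi> \<xi> i)) (nhds 0)"
    by (rule vector_curve_exists[OF M C c, where w = "\<lambda>i _. tangent_coord \<phi> \<xi> i"]) (rule smooth1_const)
  have v: "velocity M k c 0 = velocity M k (\<lambda>u. base_point (y u)) 0"
    by (rule velocity_cong[OF eventually_mono[OF y(2)]]) simp
  have "y 0 \<in> tangent_space M (c 0)"
    using curve_at_in_points[OF y(1)] eventually_nhds_x_imp_x[OF y(2)] by (simp add: tangent_space_def)
  then have "y 0 = \<xi>"
    using tangent_coord_inj[OF M C c(2) _ \<xi>] eventually_nhds_x_imp_x[OF y(2)] by blast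
  with y(1) v show thesis by (rule that)
qed

text \<open>The covector \<open>e\<close> has the components found in
  \<open>alternating_pairing\<close>, so it satisfies the defining condition for every admissible
  velocity. By \<open>constant_vector_curve\<close> the condition fixes its value on each tangent
  vector.\<close>

lemma Upsilon_pairing:
  assumes y: "curve_at (tangent M) y 0" "velocity M k c 0 = velocity M k (\<lambda>u. base_point (y u)) 0"
  shows "pairing (Upsilon M k (velocity2 (cotangent M) k k g)) (y 0) =
    (\<Sum>j\<le>k. (- 1) ^ j * real (k choose j) * mixed j (k - j) (pairing_function y) origin)"
proof -
  let ?n = "dimension M"
  let ?a = "\<lambda>j. (- 1) ^ j * real (k choose j)"
  let ?S = "truncations_lincomb M k ?a (velocity2 (cotangent M) k k g)"
  note Et = smooth_atlas_jet_bundle[OF M, of 1]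
  define e where "e = covector M \<phi> (c 0) (\<lambda>i. \<Sum>j\<le>k. ?a j *
      mixed j (k - j) (\<lambda>z. cotangent_coord M U \<phi> (g (z 0) (z (Suc 0))) i) origin)"
  have e: "e \<in> covectors M" "fst e = c 0"
    unfolding e_def using covector_in_covectors[OF M C c(2)] by auto
  have yT: "y 0 \<in> tangent_space M (c 0)"
    if "curve_at (tangent M) y 0" "velocity M k c 0 = velocity M k (\<lambda>u. base_point (y u)) 0" for y
    using curve_at_in_points[OF that(1)] same_base[OF that] by (simp add: tangent_space_def)
  have ey: "pairing e (y 0) = (\<Sum>j\<le>k. ?a j * mixed j (k - j) (pairing_function y) origin)"
    if y: "curve_at (tangent M) y 0" "velocity M k c 0 = velocity M k (\<lambda>u. base_point (y u)) 0" for y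
    unfolding alternating_pairing[OF y] using yT[OF y] by (simp add: pairing_def e_def covector_def)
  have S: "itangent_map M k fst ?S = incl M k (velocity M k c 0)" "fst (rep ?S origin) = c 0"
    unfolding truncations_lincomb_family(2) by (rule lincomb_base(2), rule lincomb_base(1))
  have cond: "incl M k (jet_map M k base_point (velocity (tangent M) k y 0)) = incl M k (velocity M k c 0) \<longleftrightarrow>
      velocity M k c 0 = velocity M k (\<lambda>u. base_point (y u)) 0" if "curve_at (tangent M) y 0" for y
    using base_point_curve_jet[OF M that, of k] incl_velocity_eq_iff[OF base_point_curve[OF M that]] by auto
  have "Upsilon M k (velocity2 (cotangent M) k k g) = e"
    unfolding Upsilon_def Let_def S
  proof (rule the_equality)
    show "e \<in> covectors M \<and> fst e = c 0 \<and> (\<forall>\<xi>\<in>tangent_space M (fst e). \<forall>\<Xi>\<in>points (jet_bundle k (tangent M)).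
        base_point \<Xi> = \<xi> \<and> incl M k (jet_map M k base_point \<Xi>) = incl M k (velocity M k c 0) \<longrightarrow>
        pairing e \<xi> = itangent_pairing k ?S (incl (tangent M) k \<Xi>))"
    proof (intro conjI ballI impI e)
      fix \<xi> \<Xi> assume "\<Xi> \<in> points (jet_bundle k (tangent M))"
        and h: "base_point \<Xi> = \<xi> \<and> incl M k (jet_map M k base_point \<Xi>) = incl M k (velocity M k c 0)"
      then obtain y where y: "\<Xi> = velocity (tangent M) k y 0" "curve_at (tangent M) y 0"
        unfolding points_jet_bundle[OF Et] by blast
      have "\<xi> = y 0" using h base_point_velocity[OF Et y(2)] y(1) by simp
      moreover have "velocity M k c 0 = velocity M k (\<lambda>u. base_point (y u)) 0" using h cond[OF y(2)] y(1) by simp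
      ultimately show "pairing e \<xi> = itangent_pairing k ?S (incl (tangent M) k \<Xi>)"
        unfolding y(1) using itangent_pairing_lincomb[OF y(2)] ey[OF y(2)] by simp
    qed
  next
    fix e' assume h: "e' \<in> covectors M \<and> fst e' = c 0 \<and> (\<forall>\<xi>\<in>tangent_space M (fst e'). \<forall>\<Xi>\<in>points (jet_bundle k (tangent M)).
        base_point \<Xi> = \<xi> \<and> incl M k (jet_map M k base_point \<Xi>) = incl M k (velocity M k c 0) \<longrightarrow>
        pairing e' \<xi> = itangent_pairing k ?S (incl (tangent M) k \<Xi>))"
    have "snd e' \<xi> = snd e \<xi>" for \<xi>
    proof (cases "\<xi> \<in> tangent_space M (c 0)")
      case True
      obtain y where y: "curve_at (tangent M) y 0" "velocity M k c 0 = velocity M k (\<lambda>u. base_point (y u)) 0" "y 0 = \<xi>"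
        by (rule constant_vector_curve[OF True])
      have "pairing e' \<xi> = itangent_pairing k ?S (incl (tangent M) k (velocity (tangent M) k y 0))"
        using h True velocity_in_points[OF Et y(1), of k] base_point_velocity[OF Et y(1), of k] cond[OF y(1)] y(2,3) by simp
      then show ?thesis
        using itangent_pairing_lincomb[OF y(1,2)] ey[OF y(1,2)] y(3) by (simp add: pairing_def)
    next
      case False
      then show ?thesis using h e by (auto simp: covectors_def)
    qed
    then show "e' = e" using h e by (auto simp: prod_eq_iff)
  qed
  then show ?thesis using ey[OF y] by simp
qed

end

section \<open>The first variation\<close>

lemma smooth_curve_curve_at: "smooth_curve N I c \<Longrightarrow> open I \<Longrightarrow> t \<in> I \<Longrightarrow> curve_at N c t"
  by (auto simp: curve_at_def)

lemma velocity_curve: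
  assumes N: "smooth_atlas N" and c: "curve_at N c t"
  shows "curve_at (jet_bundle k N) (\<lambda>u. velocity N k c u) t"
proof -
  obtain U \<phi> where C: "(U, \<phi>) \<in> charts N" "c t \<in> U"
    using curve_at_in_points[OF c] by (auto simp: in_points_iff)
  note cc = curve_at_coords[OF N C(1) c C(2)]
  have ev: "eventually (\<lambda>u. curve_at N c u \<and> c u \<in> U) (nhds t)"
    using curve_at_eventually[OF c] cc(1) by (rule eventually_conj)
  have "eventually (\<lambda>u. velocity N k c u \<in> jet_dom N k U) (nhds t)"
    using ev by (rule eventually_mono) (use jet_dom_iff[OF N] in blast)
  moreover have "smooth1 (\<lambda>u. jet_coord N k \<phi> (velocity N k c u) j) t" if j: "j < (k + 1) * dimension N" for j
  proof -
    obtain \<alpha> i where ai: "\<alpha> \<le> k" "i < dimension N" "j = \<alpha> * dimension N + i" using jet_index[OF j] by metis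
    show ?thesis
      unfolding ai(3)
      by (rule smooth1_cong[OF smooth1_higher_deriv[OF cc(2)[OF ai(2)], of \<alpha>] eventually_mono[OF ev]])
        (use jet_coord_velocity[OF N C(1) _ _ ai(2,1)] in auto)
  qed
  ultimately show ?thesis
    using curve_at_iff[OF smooth_atlas_jet_bundle[OF N] jet_chart[OF C(1)], where c = "\<lambda>u. velocity N k c u" and t = t]
      eventually_nhds_x_imp_x[of "\<lambda>u. velocity N k c u \<in> jet_dom N k U" t] by simp
qed

lemma smooth_germ_taylor:
  assumes "\<And>\<beta>. \<beta> \<le> k \<Longrightarrow> smooth1 (P \<beta>) (s + a 0)" "a \<in> coord_space 2"
  shows "smooth_germ 2 (\<lambda>x. \<Sum>\<beta>\<le>k. P \<beta> (s + x 0) * taylor_monomial \<beta> (x (Suc 0))) a"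
proof (rule smooth_germ_sum[OF assms(2)])
  fix \<beta> assume "\<beta> \<in> {..k}"
  have "smooth_germ 2 (\<lambda>x. P \<beta> (s + x 0)) a"
    by (rule smooth_germ_comp1[where G = "\<lambda>x. s + x 0"])
      (use assms \<open>\<beta> \<in> {..k}\<close> in \<open>auto intro!: smooth_germ_add smooth_germ_coord\<close>)
  moreover have "smooth_germ 2 (\<lambda>x. taylor_monomial \<beta> (x (Suc 0))) a"
    by (rule smooth_germ_comp1[where G = "\<lambda>x. x (Suc 0)", OF smooth1_taylor_monomial])
      (use assms in \<open>auto intro!: smooth_germ_coord\<close>)
  ultimately show "smooth_germ 2 (\<lambda>x. P \<beta> (s + x 0) * taylor_monomial \<beta> (x (Suc 0))) a"
    by (rule smooth_germ_mult)
qed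

section \<open>A Lagrangian, a curve and a variation over an open set of times\<close>

context
  fixes M :: "'a atlas" and k :: nat and L :: "'a jet \<Rightarrow> real" and \<gamma> :: "real \<Rightarrow> 'a" and \<delta> :: "real \<Rightarrow> 'a jet"
    and I :: "real set"
  assumes M: "smooth_atlas M" and L: "smooth_function (jet_bundle k M) L"
    and I: "open I" and \<gamma>: "smooth_curve M I \<gamma>" and \<delta>: "smooth_curve (tangent M) I \<delta>"
    and T: "\<And>t. t \<in> I \<Longrightarrow> \<delta> t \<in> tangent_space M (\<gamma> t)"
begin

lemma curves_at: "s \<in> I \<Longrightarrow> curve_at M \<gamma> s" "s \<in> I \<Longrightarrow> curve_at (tangent M) \<delta> s"
  using smooth_curve_curve_at I \<gamma> \<delta> by blast+

lemma base_point_variation: "s \<in> I \<Longrightarrow> base_point (\<delta> s) = \<gamma> s"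
  using T by (simp add: tangent_space_def)

context
  fixes U :: "'a set" and \<phi> :: "'a \<Rightarrow> nat \<Rightarrow> real"
  assumes C: "(U, \<phi>) \<in> charts M"
begin

definition momentum_coord :: "nat \<Rightarrow> nat \<Rightarrow> real \<Rightarrow> real" where
  "momentum_coord i \<beta> s = momentum_coeff M U \<phi> k L i \<beta> (jet_coord M k \<phi> (velocity M k \<gamma> s))"

text \<open>Here \<open>s\<close> is a fixed time, \<sigma> the offset from it along \<gamma>, and
  \<open>t\<close> the parameter of the velocity that \<open>Lambda_map\<close> assigns to the time
  s + \<sigma>. The base point depends on \<sigma> + t only, which is the semi-holonomy of the
  element represented.\<close>

definition Lambda_family :: "real \<Rightarrow> real \<Rightarrow> real \<Rightarrow> 'a cov" where
  "Lambda_family s \<sigma> t = covector M \<phi> (\<gamma> (s + \<sigma> + t)) (\<lambda>i. \<Sum>\<beta>\<le>k. momentum_coord i \<beta> (s + \<sigma>) * taylor_monomial \<beta> t)"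

text \<open>Every term of the formula is a combination of derivatives of this function of \<open>s = x 0\<close>
  and \<open>t = x 1\<close> at \<open>t = 0\<close>.\<close>

definition pairing_germ :: "(nat \<Rightarrow> real) \<Rightarrow> real" where
  "pairing_germ x = (\<Sum>i<dimension M. (\<Sum>\<beta>\<le>k. momentum_coord i \<beta> (x 0) * taylor_monomial \<beta> (x (Suc 0))) *
     tangent_coord \<phi> (\<delta> (x 0 + x (Suc 0))) i)"

lemma smooth1_momentum_coord:
  assumes s: "s \<in> I" "\<gamma> s \<in> U" and i: "i < dimension M" and \<beta>: "\<beta> \<le> k"
  shows "smooth1 (momentum_coord i \<beta>) s"
proof -
  note J = smooth_atlas_jet_bundle[OF M, of k] and JC = jet_chart[OF C, of k]
  let ?z = "\<lambda>u. jet_coord M k \<phi> (velocity M k \<gamma> u)"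
  let ?f = "\<lambda>z. L (inv_into (jet_dom M k U) (jet_coord M k \<phi>) z)"
  have v: "velocity M k \<gamma> s \<in> jet_dom M k U" using jet_dom_iff[OF M curves_at(1)[OF s(1)]] s(2) by blast
  note cv = curve_at_coords[OF J JC velocity_curve[OF M curves_at(1)[OF s(1)]] v]
  have "smooth_germ (dimension (jet_bundle k M)) ?f (?z s)"
    using L JC v smooth_on_Rn_germ[OF chart_open[OF J JC]] unfolding smooth_function_def by fastforce
  moreover have "(k - \<beta>) * dimension M + i < dimension (jet_bundle k M)"
    using jet_index_less[of "k - \<beta>" k i "dimension M"] i by simp
  ultimately have "smooth_germ (dimension (jet_bundle k M)) (lagrangian_partial M k L U \<phi> i (k - \<beta>)) (?z s)"
    unfolding lagrangian_partial_def by (rule smooth_germ_partial)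
  then have "smooth1 (\<lambda>u. lagrangian_partial M k L U \<phi> i (k - \<beta>) (?z u)) s"
    by (rule smooth1_comp[where G = ?z])
      (use cv(2) jet_coord_coord_space[OF M] in auto)
  then have "smooth1 (\<lambda>u. 1 / real (k choose \<beta>) * lagrangian_partial M k L U \<phi> i (k - \<beta>) (?z u)) s"
    by (rule smooth1_mult[OF smooth1_const])
  then show ?thesis by (simp add: momentum_coord_def[abs_def] momentum_coeff_def[OF M C])
qed

lemma smooth_germ_pairing_germ:
  assumes s: "s \<in> I" "\<gamma> s \<in> U"
  shows "smooth_germ 2 pairing_germ (point2 s 0)"
proof -
  have "smooth_germ 2 (\<lambda>x. (\<Sum>\<beta>\<le>k. momentum_coord i \<beta> (x 0) * taylor_monomial \<beta> (x (Suc 0))) *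
     tangent_coord \<phi> (\<delta> (x 0 + x (Suc 0))) i) (point2 s 0)" if i: "i < dimension M" for i
  proof (rule smooth_germ_mult)
    show "smooth_germ 2 (\<lambda>x. \<Sum>\<beta>\<le>k. momentum_coord i \<beta> (x 0) * taylor_monomial \<beta> (x (Suc 0))) (point2 s 0)"
      using smooth_germ_taylor[where P = "momentum_coord i" and s = 0 and a = "point2 s 0"]
        smooth1_momentum_coord[OF s i] by simp
    show "smooth_germ 2 (\<lambda>x. tangent_coord \<phi> (\<delta> (x 0 + x (Suc 0))) i) (point2 s 0)"
      by (rule smooth_germ_comp1[where f = "\<lambda>u. tangent_coord \<phi> (\<delta> u) i" and G = "\<lambda>x. x 0 + x (Suc 0)"])
        (use smooth1_tangent_coord[OF M C curves_at(2)[OF s(1)] _ i] base_point_variation[OF s(1)] s(2)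
          in \<open>auto intro!: smooth_germ_add smooth_germ_coord\<close>)
  qed
  then show ?thesis unfolding pairing_germ_def[abs_def] by (auto intro!: smooth_germ_sum)
qed

context
  fixes s assumes s: "s \<in> I" "\<gamma> s \<in> U"
begin

abbreviation (input) "\<gamma>\<^sub>s u \<equiv> \<gamma> (s + u)"
abbreviation (input) "\<delta>\<^sub>s u \<equiv> \<delta> (s + u)"

lemma shifted_curves:
  "curve_at M \<gamma>\<^sub>s 0" "curve_at (tangent M) \<delta>\<^sub>s 0"
  "velocity M m \<gamma>\<^sub>s 0 = velocity M m (\<lambda>u. base_point (\<delta>\<^sub>s u)) 0"
  "velocity M m \<gamma> s = velocity M m \<gamma>\<^sub>s 0" "velocity (tangent M) m \<delta> s = velocity (tangent M) m \<delta>\<^sub>s 0"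
proof -
  show "curve_at M \<gamma>\<^sub>s 0" using curve_at_shift[OF M, of \<gamma> s 0] curves_at(1)[OF s(1)] by simp
  show "curve_at (tangent M) \<delta>\<^sub>s 0"
    using curve_at_shift[OF smooth_atlas_jet_bundle[OF M], of 1 \<delta> s 0] curves_at(2)[OF s(1)] by simp
  have "eventually (\<lambda>u. u \<in> I) (nhds (s + 0))" using I s(1) by (simp add: eventually_nhds_in_open)
  moreover have "filterlim (\<lambda>u. s + u) (nhds (s + 0)) (nhds 0)" by (intro tendsto_intros filterlim_ident)
  ultimately have "eventually (\<lambda>u. s + u \<in> I) (nhds 0)" by (rule eventually_compose_filterlim)
  then show "velocity M m \<gamma>\<^sub>s 0 = velocity M m (\<lambda>u. base_point (\<delta>\<^sub>s u)) 0"
    by (intro velocity_cong, elim eventually_mono) (simp add: base_point_variation)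
  show "velocity M m \<gamma> s = velocity M m \<gamma>\<^sub>s 0" by (rule velocity_shift)
  show "velocity (tangent M) m \<delta> s = velocity (tangent M) m \<delta>\<^sub>s 0" by (rule velocity_shift)
qed

lemma Lambda_family:
  "smooth_family2 (cotangent M) (Lambda_family s)"
  "fst (Lambda_family s \<sigma> t) = \<gamma>\<^sub>s (\<sigma> + t)"
proof -
  have "smooth_family 2 (cotangent M) (\<lambda>x. covector M \<phi> (\<gamma>\<^sub>s (x 0 + x (Suc 0)))
      (\<lambda>i. \<Sum>\<beta>\<le>k. momentum_coord i \<beta> (s + x 0) * taylor_monomial \<beta> (x (Suc 0))))"
  proof (rule covector_family[OF M C, where F = "\<lambda>x. \<gamma>\<^sub>s (x 0 + x (Suc 0))"])
    show "smooth_family 2 M (\<lambda>x. \<gamma>\<^sub>s (x 0 + x (Suc 0)))"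
      by (rule curve_family[OF M, where c = \<gamma>\<^sub>s and \<sigma> = "\<lambda>x. x 0 + x (Suc 0)"])
        (use shifted_curves(1) in \<open>auto intro!: smooth_germ_add smooth_germ_coord\<close>)
    show "smooth_germ 2 (\<lambda>x. \<Sum>\<beta>\<le>k. momentum_coord i \<beta> (s + x 0) * taylor_monomial \<beta> (x (Suc 0))) origin"
      if "i < dimension M" for i
      by (rule smooth_germ_taylor) (use smooth1_momentum_coord[OF s that] in auto)
  qed (use s(2) in simp)
  then show "smooth_family2 (cotangent M) (Lambda_family s)"
    by (simp add: Lambda_family_def add.assoc)
  show "fst (Lambda_family s \<sigma> t) = \<gamma>\<^sub>s (\<sigma> + t)" by (simp add: Lambda_family_def add.assoc)
qed

lemma eventually_domain: "eventually (\<lambda>u. s + u \<in> I \<and> \<gamma>\<^sub>s u \<in> U) (nhds 0)"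
proof -
  have "eventually (\<lambda>u. u \<in> I \<and> \<gamma> u \<in> U) (nhds (s + 0))"
    using I s curve_at_coords(1)[OF M C curves_at(1)[OF s(1)] s(2)]
    by (simp add: eventually_nhds_in_open eventually_conj)
  moreover have "filterlim (\<lambda>u. s + u) (nhds (s + 0)) (nhds 0)" by (intro tendsto_intros filterlim_ident)
  ultimately show ?thesis by (rule eventually_compose_filterlim)
qed

text \<open>Holds near the origin, where the base point stays in \<open>U\<close> and the fibre
  coordinates of a \<open>covector\<close> are its coefficients.\<close>

lemma pairing_function_germ:
  "eventually (\<lambda>z. (\<Sum>i<dimension M. cotangent_coord M U \<phi> (Lambda_family s (z 0) (z (Suc 0))) i *
      tangent_coord \<phi> (\<delta>\<^sub>s (z 0 + z (Suc 0))) i) = pairing_germ (point2 (s + z 0) (z (Suc 0)))) (nbhds 2 origin)"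
proof -
  have "((\<lambda>z. z 0 + z (Suc 0)) \<longlongrightarrow> 0) (nbhds 2 origin)"
    using smooth_germ_contat[OF smooth_germ_add[OF smooth_germ_coord smooth_germ_coord], of origin 2 0 "Suc 0"]
    by (simp add: contat_def)
  then have "eventually (\<lambda>z. (\<lambda>u. s + u \<in> I \<and> \<gamma>\<^sub>s u \<in> U) (z 0 + z (Suc 0))) (nbhds 2 origin)"
    by (rule eventually_compose_filterlim[OF eventually_domain])
  then show ?thesis
  proof (rule eventually_mono)
    fix z :: "nat \<Rightarrow> real" assume "s + (z 0 + z (Suc 0)) \<in> I \<and> \<gamma>\<^sub>s (z 0 + z (Suc 0)) \<in> U"
    then have "\<gamma> (s + z 0 + z (Suc 0)) \<in> U" by (simp add: add.assoc)
    then show "(\<Sum>i<dimension M. cotangent_coord M U \<phi> (Lambda_family s (z 0) (z (Suc 0))) i *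
        tangent_coord \<phi> (\<delta>\<^sub>s (z 0 + z (Suc 0))) i) = pairing_germ (point2 (s + z 0) (z (Suc 0)))"
      unfolding pairing_germ_def Lambda_family_def
      by (intro sum.cong refl) (simp add: cotangent_coord_covector[OF M C] add.assoc)
  qed
qed

lemma mixed_pairing_function:
  "mixed a b (\<lambda>z. \<Sum>i<dimension M. cotangent_coord M U \<phi> (Lambda_family s (z 0) (z (Suc 0))) i *
      tangent_coord \<phi> (\<delta>\<^sub>s (z 0 + z (Suc 0))) i) origin = mixed a b pairing_germ (point2 s 0)"
proof -
  have "mixed a b (\<lambda>z. \<Sum>i<dimension M. cotangent_coord M U \<phi> (Lambda_family s (z 0) (z (Suc 0))) i *
      tangent_coord \<phi> (\<delta>\<^sub>s (z 0 + z (Suc 0))) i) origin =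
      mixed a b (\<lambda>z. pairing_germ (point2 (s + z 0) (z (Suc 0)))) (point2 0 0)"
    unfolding point2_simps(3) by (rule partials_cong[OF pairing_function_germ set_mixed origin_coord_space])
  then show ?thesis unfolding mixed_shift by simp
qed

text \<open>\<open>Lambda_map_velocity\<close> applies at each time near \<open>s\<close>, as long
  as \<gamma> stays in the chart. The family therefore represents \<open>Lambda_map\<close> along
  \<gamma> as a velocity of velocities.\<close>

lemma Lambda_along:
  "eventually (\<lambda>\<sigma>. curve_at (cotangent M) (Lambda_family s \<sigma>) 0 \<and>
     Lambda_map M k L (velocity M k \<gamma> (s + \<sigma>)) = velocity (cotangent M) k (Lambda_family s \<sigma>) 0) (nhds 0)"
  using eventually_domain
proof (rule eventually_mono)
  fix \<sigma> assume h: "s + \<sigma> \<in> I \<and> \<gamma>\<^sub>s \<sigma> \<in> U"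
  have b: "curve_at M (\<lambda>u. \<gamma> (s + \<sigma> + u)) 0" "\<gamma> (s + \<sigma> + 0) \<in> U"
    using curve_at_shift[OF M, of \<gamma> "s + \<sigma>" 0] curves_at(1) h by auto
  have v: "velocity M k \<gamma> (s + \<sigma>) = velocity M k (\<lambda>u. \<gamma> (s + \<sigma> + u)) 0" by (rule velocity_shift)
  have f: "Lambda_family s \<sigma> = (\<lambda>t. covector M \<phi> (\<gamma> (s + \<sigma> + t))
      (\<lambda>i. \<Sum>\<beta>\<le>k. momentum_coeff M U \<phi> k L i \<beta> (jet_coord M k \<phi> (velocity M k (\<lambda>u. \<gamma> (s + \<sigma> + u)) 0)) * taylor_monomial \<beta> t))"
    unfolding v[symmetric] by (simp add: Lambda_family_def[abs_def] momentum_coord_def)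
  show "curve_at (cotangent M) (Lambda_family s \<sigma>) 0 \<and>
     Lambda_map M k L (velocity M k \<gamma> (s + \<sigma>)) = velocity (cotangent M) k (Lambda_family s \<sigma>) 0"
    unfolding f v using Lambda_map_velocity(1,2)[OF M C L b] by blast
qed

text \<open>The dual of the flip moves the flip of the admissible variation over to the
  differential; what remains is the pairing of two velocities at time \<open>s\<close>, a pure
  derivative in \<open>t\<close>.\<close>

lemma action_integrand:
  "pairing (differential (jet_bundle k M) L (velocity M k \<gamma> s)) (admissible_variation M k \<delta> s) =
    mixed 0 k pairing_germ (point2 s 0)"
proof -
  have Lf: "Lambda_family s 0 = (\<lambda>t. covector M \<phi> (\<gamma>\<^sub>s t)
      (\<lambda>i. \<Sum>\<beta>\<le>k. momentum_coeff M U \<phi> k L i \<beta> (jet_coord M k \<phi> (velocity M k \<gamma>\<^sub>s 0)) * taylor_monomial \<beta> t))"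
    unfolding shifted_curves(4)[symmetric] by (simp add: Lambda_family_def[abs_def] momentum_coord_def)
  have bU: "\<gamma>\<^sub>s 0 \<in> U" using s(2) by simp
  have "pairing (differential (jet_bundle k M) L (velocity M k \<gamma> s)) (admissible_variation M k \<delta> s) =
      jet_pairing M k (velocity (cotangent M) k (Lambda_family s 0) 0) (velocity (tangent M) k \<delta>\<^sub>s 0)"
    unfolding admissible_variation_def shifted_curves(4) shifted_curves(5) Lf
    by (rule Lambda_map_velocity(3)[OF M C L shifted_curves(1) bU shifted_curves(2,3)])
  also have "\<dots> = (deriv ^^ k) (\<lambda>t. \<Sum>i<dimension M. cotangent_coord M U \<phi> (Lambda_family s 0 t) i * tangent_coord \<phi> (\<delta>\<^sub>s t) i) 0"
    by (rule jet_pairing_coords[OF M C])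
      (use eventually_nhds_x_imp_x[OF Lambda_along] shifted_curves s(2) in \<open>auto simp: Lambda_family(2)\<close>)
  also have "\<dots> = mixed 0 k (\<lambda>z. \<Sum>i<dimension M. cotangent_coord M U \<phi> (Lambda_family s (z 0) (z (Suc 0))) i *
      tangent_coord \<phi> (\<delta>\<^sub>s (z 0 + z (Suc 0))) i) (point2 0 0)"
    by (subst mixed_eq[of 0 k "\<lambda>a b. \<Sum>i<dimension M. cotangent_coord M U \<phi> (Lambda_family s a b) i *
      tangent_coord \<phi> (\<delta>\<^sub>s (a + b)) i"]) simp
  finally show ?thesis using mixed_pairing_function[of 0 k] by simp
qed

lemma Lambda_base:
  "eventually (\<lambda>x. fst (Lambda_family s (x 0) (x (Suc 0))) = \<gamma>\<^sub>s (x 0 + x (Suc 0))) (nbhds 2 origin)"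
  by (simp add: Lambda_family(2))

lemma force_pairing:
  "pairing (force_along M k L \<gamma> s) (\<delta> s) =
    (\<Sum>j\<le>k. (- 1) ^ j * real (k choose j) * mixed j (k - j) pairing_germ (point2 s 0))"
proof -
  have bU: "\<gamma>\<^sub>s 0 \<in> U" using s(2) by simp
  have "velocity (jet_bundle k (cotangent M)) k (\<lambda>t. Lambda_map M k L (velocity M k \<gamma> t)) s =
      velocity2 (cotangent M) k k (Lambda_family s)"
    unfolding velocity_shift[of "jet_bundle k (cotangent M)" k _ s] velocity2_def
    by (rule velocity_cong[OF eventually_mono[OF Lambda_along]]) simp
  then show ?thesis
    using Upsilon_pairing[OF M C Lambda_family(1) Lambda_base shifted_curves(1) bU shifted_curves(2,3)]
    unfolding force_along_def mixed_pairing_function by simp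
qed

text \<open>Projection to velocities of order \<open>m\<close> keeps the representing curves, so
  \<open>Lambda_family\<close> also serves for \<open>lambda_map\<close>. The coefficients of
  \<open>upsilon\<close> at order \<open>m\<close> are (m + 1 choose j + 1), and m + 1 is
  \<open>k\<close>.\<close>

lemma momentum_pairing:
  assumes k: "k = Suc m"
  shows "jet_pairing M m (momentum_along M k L \<gamma> s) (velocity (tangent M) m \<delta> s) =
    (\<Sum>j\<le>m. (- 1) ^ j * real (k choose Suc j) * mixed j (m - j) pairing_germ (point2 s 0))"
proof -
  have bU: "\<gamma>\<^sub>s 0 \<in> U" and km: "k - 1 = m" "m + 1 = k" using s(2) k by simp_all
  have "velocity (jet_bundle m (cotangent M)) m (\<lambda>t. lambda_map M k L (velocity M k \<gamma> t)) s =
      velocity2 (cotangent M) m m (Lambda_family s)"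
    unfolding velocity_shift[of "jet_bundle m (cotangent M)" m _ s] velocity2_def
  proof (rule velocity_cong[OF eventually_mono[OF Lambda_along]])
    fix \<sigma> assume "curve_at (cotangent M) (Lambda_family s \<sigma>) 0 \<and>
      Lambda_map M k L (velocity M k \<gamma> (s + \<sigma>)) = velocity (cotangent M) k (Lambda_family s \<sigma>) 0"
    then show "lambda_map M k L (velocity M k \<gamma> (s + \<sigma>)) = velocity (cotangent M) m (Lambda_family s \<sigma>) 0"
      using jet_proj_velocity[OF smooth_atlas_cotangent[OF M], of "Lambda_family s \<sigma>" 0 m k]
      by (simp add: lambda_map_def k)
  qed
  then show ?thesis
    using P_map_pairing[OF M C Lambda_family(1) Lambda_base shifted_curves(1) bU shifted_curves(2,3),
        of m "\<lambda>j. (- 1) ^ j * real (k choose (j + 1))"]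
    unfolding momentum_along_def km(1) upsilon_def km(2) mixed_pairing_function shifted_curves(5) by simp
qed

end

end

text \<open>In a chart around the point all three terms are combinations of derivatives of the one
  germ \<open>pairing_germ\<close>, which gives both the derivative and the continuity with which
  the integral is split later. The conclusion itself mentions no chart.\<close>

lemma momentum_derivative:
  assumes k: "k = Suc m" and t: "t \<in> I"
  shows "((\<lambda>s. jet_pairing M m (momentum_along M k L \<gamma> s) (velocity (tangent M) m \<delta> s)) has_real_derivative
      pairing (differential (jet_bundle k M) L (velocity M k \<gamma> t)) (admissible_variation M k \<delta> t) -
      pairing (force_along M k L \<gamma> t) (\<delta> t)) (at t)"
    "isCont (\<lambda>s. pairing (differential (jet_bundle k M) L (velocity M k \<gamma> s)) (admissible_variation M k \<delta> s)) t"
    "isCont (\<lambda>s. pairing (force_along M k L \<gamma> s) (\<delta> s)) t"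
proof -
  obtain U \<phi> where C: "(U, \<phi>) \<in> charts M" and tU: "\<gamma> t \<in> U"
    using curve_at_in_points[OF curves_at(1)[OF t]] by (auto simp: in_points_iff)
  let ?H = "pairing_germ U \<phi>"
  have ev: "eventually (\<lambda>s. s \<in> I \<and> \<gamma> s \<in> U) (nhds t)"
    using eventually_conj[OF eventually_nhds_in_open[OF I t] curve_at_coords(1)[OF M C curves_at(1)[OF t] tU]] .
  note H = smooth_germ_pairing_germ[OF C t tU]
  have mH: "smooth_germ 2 (mixed a b ?H) (point2 t 0)" for a b
    by (rule smooth_germ_partials[OF H set_mixed])
  have cont: "isCont (\<lambda>s. mixed a b ?H (point2 s 0)) t" for a b
    using smooth1_differentiable[OF smooth1_slice(1)[OF mH], of 0] differentiable_imp_continuous_within by force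
  have D: "((\<lambda>s. mixed a b ?H (point2 s 0)) has_real_derivative mixed (Suc a) b ?H (point2 t 0)) (at t)" for a b
    using smooth_germ_partial_deriv[OF mH, of 0] by simp
  have "((\<lambda>s. \<Sum>j\<le>m. (- 1) ^ j * real (k choose Suc j) * mixed j (m - j) ?H (point2 s 0)) has_real_derivative
      (\<Sum>j\<le>m. (- 1) ^ j * real (k choose Suc j) * mixed (Suc j) (m - j) ?H (point2 t 0))) (at t)"
    by (rule DERIV_sum) (rule DERIV_cmult[OF D])
  \<comment> \<open>Differentiation moves \<open>j\<close> to \<open>j + 1\<close>, so the sum
    becomes minus the force sum without its term \<open>j = 0\<close>; that term is the integrand of
    the action differential.\<close>
  moreover have "(\<Sum>j\<le>m. (- 1) ^ j * real (k choose Suc j) * mixed (Suc j) (m - j) ?H (point2 t 0)) =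
      mixed 0 k ?H (point2 t 0) - (\<Sum>j\<le>k. (- 1) ^ j * real (k choose j) * mixed j (k - j) ?H (point2 t 0))"
    unfolding k by (subst sum.atMost_Suc_shift) (simp add: sum_negf)
  moreover have "eventually (\<lambda>s. (\<Sum>j\<le>m. (- 1) ^ j * real (k choose Suc j) * mixed j (m - j) ?H (point2 s 0)) =
      jet_pairing M m (momentum_along M k L \<gamma> s) (velocity (tangent M) m \<delta> s)) (nhds t)"
    using ev by (rule eventually_mono) (use momentum_pairing[OF C _ _ k] in auto)
  ultimately show "((\<lambda>s. jet_pairing M m (momentum_along M k L \<gamma> s) (velocity (tangent M) m \<delta> s)) has_real_derivative
      pairing (differential (jet_bundle k M) L (velocity M k \<gamma> t)) (admissible_variation M k \<delta> t) -
      pairing (force_along M k L \<gamma> t) (\<delta> t)) (at t)"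
    unfolding action_integrand[OF C t tU] force_pairing[OF C t tU]
    by (subst DERIV_cong_ev[OF refl _ refl, symmetric]) auto
  have "eventually (\<lambda>s. pairing (differential (jet_bundle k M) L (velocity M k \<gamma> s)) (admissible_variation M k \<delta> s) =
      mixed 0 k ?H (point2 s 0)) (nhds t)"
    using ev by (rule eventually_mono) (use action_integrand[OF C] in blast)
  then show "isCont (\<lambda>s. pairing (differential (jet_bundle k M) L (velocity M k \<gamma> s)) (admissible_variation M k \<delta> s)) t"
    by (rule iffD2[OF isCont_cong]) (rule cont)
  have "eventually (\<lambda>s. pairing (force_along M k L \<gamma> s) (\<delta> s) =
      (\<Sum>j\<le>k. (- 1) ^ j * real (k choose j) * mixed j (k - j) ?H (point2 s 0))) (nhds t)"
    using ev by (rule eventually_mono) (use force_pairing[OF C] in blast)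
  then show "isCont (\<lambda>s. pairing (force_along M k L \<gamma> s) (\<delta> s)) t"
    by (rule iffD2[OF isCont_cong]) (intro continuous_sum continuous_mult continuous_const cont)
qed

end

theorem theorem4p2:
  fixes X :: "'a topology" and M :: "'a atlas" and k :: nat
    and L :: "'a jet \<Rightarrow> real" and \<gamma> :: "real \<Rightarrow> 'a" and \<delta>\<gamma> :: "real \<Rightarrow> 'a jet"
    and t\<^sub>0 t\<^sub>1 :: real and I :: "real set"
  assumes "1 \<le> k"
    and "smooth_manifold X M"
    and "smooth_function (jet_bundle k M) L"
    and "t\<^sub>0 \<le> t\<^sub>1" and "open I" and "{t\<^sub>0..t\<^sub>1} \<subseteq> I"
    and "smooth_curve M I \<gamma>"
    and "smooth_curve (tangent M) I \<delta>\<gamma>"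
    and "\<And>t. t \<in> I \<Longrightarrow> \<delta>\<gamma> t \<in> tangent_space M (\<gamma> t)"
  shows "action_differential M k L t\<^sub>0 t\<^sub>1 \<gamma> (admissible_variation M k \<delta>\<gamma>) =
    integral {t\<^sub>0..t\<^sub>1} (\<lambda>t. pairing (force_along M k L \<gamma> t) (\<delta>\<gamma> t)) +
    (jet_pairing M (k - 1) (momentum_along M k L \<gamma> t\<^sub>1) (velocity (tangent M) (k - 1) \<delta>\<gamma> t\<^sub>1) -
     jet_pairing M (k - 1) (momentum_along M k L \<gamma> t\<^sub>0) (velocity (tangent M) (k - 1) \<delta>\<gamma> t\<^sub>0))"
proof -
  obtain m where k: "k = Suc m" using assms(1) by (cases k) auto
  let ?A = "\<lambda>t. pairing (differential (jet_bundle k M) L (velocity M k \<gamma> t)) (admissible_variation M k \<delta>\<gamma> t)"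
  let ?F = "\<lambda>t. pairing (force_along M k L \<gamma> t) (\<delta>\<gamma> t)"
  let ?G = "\<lambda>s. jet_pairing M m (momentum_along M k L \<gamma> s) (velocity (tangent M) m \<delta>\<gamma> s)"
  note D = momentum_derivative[OF smooth_manifold_atlas[OF assms(2)] assms(3,5,7,8,9) k]
  have cA: "continuous_on {t\<^sub>0..t\<^sub>1} ?A" and cF: "continuous_on {t\<^sub>0..t\<^sub>1} ?F"
    by (rule continuous_at_imp_continuous_on; use D(2,3) assms(6) in blast)+
  \<comment> \<open>The charts vary with \<open>t\<close>, but the derivative formula is free of
    them, so the fundamental theorem applies on the whole interval at once.\<close>
  have "((\<lambda>t. ?A t - ?F t) has_integral (?G t\<^sub>1 - ?G t\<^sub>0)) {t\<^sub>0..t\<^sub>1}"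
    by (rule fundamental_theorem_of_calculus[OF assms(4)])
      (use D(1) assms(6) in \<open>blast intro: has_field_derivative_at_within
        has_real_derivative_iff_has_vector_derivative[THEN iffD1]\<close>)
  then have "integral {t\<^sub>0..t\<^sub>1} (\<lambda>t. ?A t - ?F t) = ?G t\<^sub>1 - ?G t\<^sub>0"
    by (rule integral_unique)
  then have "integral {t\<^sub>0..t\<^sub>1} ?A - integral {t\<^sub>0..t\<^sub>1} ?F = ?G t\<^sub>1 - ?G t\<^sub>0"
    unfolding integral_diff[OF integrable_continuous_interval[OF cA] integrable_continuous_interval[OF cF]] .
  then show ?thesis unfolding action_differential_def k by simp
qed

end
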